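(* Let $\mathcal O$ be an $\mathcal{A}ssoc_{>0}$-bimodule with $\mathcal O(0)\simeq*$, endowed with a map of $\mathcal{A}ssoc_{>0}$-bimodules $\eta\colon\mathcal{A}ssoc\to\mathcal O$. Then the map $$\xi_\infty\colon\Omega\,\mathrm{Bimod}_{\mathcal Assoc_{>0}}(\square,\mathcal O)\to\mathrm{Wbimod}_{\mathcal Assoc_{>0}}(Wb\square,\mathcal O),\qquad g\mapsto\xi^g,$$ is a homotopy equivalence.
   Context: $\mathcal Assoc(n)=\{a_n\}$ ($n\ge0$), $\mathcal Assoc_{>0}$ the suboperad without arity $0$. Bimodules over an operad: sequences $M(n)$ with left action $\mathcal P(k)\times M(n_1)\times\dots\times M(n_k)\to M(\sum n_i)$ and right action $M(n)\times\prod\mathcal P(k_i)\to M(\sum k_i)$ with unit/associativity; weak bimodules: partial compositions $\mathcal P(n)\times M(k)\to M(n+k-1)$, $M(k)\times\mathcal P(n)\to M(k+n-1)$ with the natural axioms. Via $\eta$, $\mathcal O$ is a weak $\mathcal Assoc_{>0}$-bimodule: $a_k\circ_i m=a_k(\eta(a_1),\dots,m,\dots,\eta(a_1))$, right action with identities elsewhere. $\square(0)=\emptyset$, $\square(n)=[0,1]^{n-1}$, with left action $a_k(x_1,\dots,x_k)$ = concatenation of coordinates with $1$ inserted between blocks and right action of $a_k$ inserting $k-1$ zeros. The loop space is based at $\eta\circ p$, $p\colon\square\to\mathcal Assoc$ the unique map; a loop is $g=(g_i\colon\square(i)\times[0,1]\to\mathcal O(i))_{i\ge1}$ with each $g(-,t)$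 a bimodule map and $g_i(x,0)=g_i(x,1)=\eta(a_i)$. $Wb\square(0)$ is a point; for $n\ge1$, $Wb\square(n)$ is the quotient of $\coprod_{k\ge1}\coprod_{n_1+\dots+n_k=n,\,n_i\ge1}\prod_i\square(n_i)\times\{0\le t_1\le\dots\le t_k\le1\}$ by: (a) if $t_i=t_{i+1}$, $(x;t)\sim(x_1,\dots,a_2(x_i,x_{i+1}),\dots,x_k;t_1,\dots,\widehat{t_{i+1}},\dots,t_k)$; (b) if $t_i\in\{0,1\}$, points differing only in $x_i$ are identified. Weak bimodule structure: $a_k\circ_j[x;t]$ adds $j-1$ factors $*\in\square(1)$ with parameter $0$ on the left and $k-j$ with parameter $1$ on the right; $[x;t]\circ_ja_k$ applies the right action to the relevant factor. $\xi^g[x;t]=a_k(g_{n_1}(x_1,t_1),\dots,g_{n_k}(x_k,t_k))$, and $\xi^g$ sends the point of $Wb\square(0)$ to $\eta(a_0)$. (The paper identifies $Wb\square$ with the weak bimodule of simplices $\triangle$ via a homeomorphism of weak bimodules, so the target is the semicosimplicial totalization $\mathrm{Wbimod}_{\mathcal Assoc_{>0}}(\triangle,\mathcal O)$.) *)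

theory Defs
  imports "HOL-Analysis.Analysis"
begin

definition cmaps :: "'a topology \<Rightarrow> 'b topology \<Rightarrow> ('a \<Rightarrow> 'b) set" where
  "cmaps X Y = {f. continuous_map X Y f \<and> (\<forall>x. x \<notin> topspace X \<longrightarrow> f x = undefined)}"

definition compact_open :: "'a topology \<Rightarrow> 'b topology \<Rightarrow> ('a \<Rightarrow> 'b) topology" where
  "compact_open X Y = topology_generated_by
     {{f \<in> cmaps X Y. f ` K \<subseteq> U} | K U. compactin X K \<and> openin Y U}"

definition quotient_top :: "'a topology \<Rightarrow> ('a \<times> 'a) set \<Rightarrow> 'a set topology" where
  "quotient_top X r = topology (\<lambda>U. U \<subseteq> topspace X // r \<and> openin X (\<Union>U))"

definition homotopy_equivalence_map :: "'a topology \<Rightarrow> 'b topology \<Rightarrow> ('a \<Rightarrow> 'b) \<Rightarrow> bool" where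
  "homotopy_equivalence_map X Y f \<longleftrightarrow> continuous_map X Y f \<and>
     (\<exists>g. continuous_map Y X g \<and>
          homotopic_with (\<lambda>_. True) X X (g \<circ> f) id \<and>
          homotopic_with (\<lambda>_. True) Y Y (f \<circ> g) id)"

fun chunks :: "nat list \<Rightarrow> 'b list \<Rightarrow> 'b list list" where
  "chunks [] ls = []"
| "chunks (k # ks) ls = take k ls # chunks ks (drop k ls)"

fun glue_sep :: "real list \<Rightarrow> real list list \<Rightarrow> real list" where
  "glue_sep ss [] = []"
| "glue_sep ss [b] = b"
| "glue_sep (s # ss) (b # c # bs) = b @ [s] @ glue_sep ss (c # bs)"
| "glue_sep [] (b # c # bs) = []"

text \<open>Since Assoc(k) is a point, the left action is
  lact [n_1,...,n_k] [x_1,...,x_k] (k >= 1, n_i >= 0, x_i in Op(n_i)) and the right action is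
  ract [k_1,...,k_n] x (k_i >= 1, x in Op(n)).\<close>
definition assoc_bimodule ::
  "(nat \<Rightarrow> 'a topology) \<Rightarrow> (nat list \<Rightarrow> 'a list \<Rightarrow> 'a) \<Rightarrow> (nat list \<Rightarrow> 'a \<Rightarrow> 'a) \<Rightarrow> bool" where
  "assoc_bimodule Op lact ract \<longleftrightarrow>
    (\<forall>ns xs. ns \<noteq> [] \<and> length xs = length ns \<and> (\<forall>i<length ns. xs ! i \<in> topspace (Op (ns ! i)))
        \<longrightarrow> lact ns xs \<in> topspace (Op (sum_list ns))) \<and>
    (\<forall>ns. ns \<noteq> [] \<longrightarrow>
        continuous_map (product_topology (\<lambda>i. Op (ns ! i)) {..<length ns}) (Op (sum_list ns))
          (\<lambda>z. lact ns (map z [0..<length ns]))) \<and>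
    (\<forall>ks x. (\<forall>k\<in>set ks. 1 \<le> k) \<and> x \<in> topspace (Op (length ks))
        \<longrightarrow> ract ks x \<in> topspace (Op (sum_list ks))) \<and>
    (\<forall>ks. (\<forall>k\<in>set ks. 1 \<le> k) \<longrightarrow> continuous_map (Op (length ks)) (Op (sum_list ks)) (ract ks)) \<and>
    (\<forall>n x. x \<in> topspace (Op n) \<longrightarrow> lact [n] [x] = x) \<and>
    (\<forall>n x. x \<in> topspace (Op n) \<longrightarrow> ract (replicate n 1) x = x) \<and>
    (\<forall>nss xss. nss \<noteq> [] \<and> (\<forall>ns\<in>set nss. ns \<noteq> []) \<and> length xss = length nss \<and>
        (\<forall>i<length nss. length (xss ! i) = length (nss ! i) \<and>
            (\<forall>j<length (nss ! i). xss ! i ! j \<in> topspace (Op (nss ! i ! j))))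
        \<longrightarrow> lact (map sum_list nss) (map2 lact nss xss) = lact (concat nss) (concat xss)) \<and>
    (\<forall>ks ls x. (\<forall>k\<in>set ks. 1 \<le> k) \<and> length ls = sum_list ks \<and> (\<forall>l\<in>set ls. 1 \<le> l) \<and>
        x \<in> topspace (Op (length ks))
        \<longrightarrow> ract ls (ract ks x) = ract (map sum_list (chunks ks ls)) x) \<and>
    (\<forall>ns xs ks. ns \<noteq> [] \<and> length xs = length ns \<and> (\<forall>i<length ns. xs ! i \<in> topspace (Op (ns ! i))) \<and>
        length ks = sum_list ns \<and> (\<forall>k\<in>set ks. 1 \<le> k)
        \<longrightarrow> ract ks (lact ns xs) = lact (map sum_list (chunks ns ks)) (map2 ract (chunks ns ks) xs))"

text \<open>A map of Assoc_{>0}-bimodules eta : Assoc -> Op; eta n = eta(a_n).\<close>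
definition assoc_bimodule_map_from_Assoc ::
  "(nat \<Rightarrow> 'a topology) \<Rightarrow> (nat list \<Rightarrow> 'a list \<Rightarrow> 'a) \<Rightarrow> (nat list \<Rightarrow> 'a \<Rightarrow> 'a) \<Rightarrow> (nat \<Rightarrow> 'a) \<Rightarrow> bool" where
  "assoc_bimodule_map_from_Assoc Op lact ract eta \<longleftrightarrow>
    (\<forall>n. eta n \<in> topspace (Op n)) \<and>
    (\<forall>ns. ns \<noteq> [] \<longrightarrow> lact ns (map eta ns) = eta (sum_list ns)) \<and>
    (\<forall>ks. (\<forall>k\<in>set ks. 1 \<le> k) \<longrightarrow> ract ks (eta (length ks)) = eta (sum_list ks))"

definition cube :: "nat \<Rightarrow> (nat \<Rightarrow> real) set" where
  "cube n = (if n = 0 then {} else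
     {x. (\<forall>i<n - 1. 0 \<le> x i \<and> x i \<le> 1) \<and> (\<forall>i\<ge>n - 1. x i = 0)})"

definition CubeTop :: "nat \<Rightarrow> (nat \<Rightarrow> real) topology" where
  "CubeTop n = subtopology (powertop_real UNIV) (cube n)"

definition tolist :: "nat \<Rightarrow> (nat \<Rightarrow> real) \<Rightarrow> real list" where
  "tolist n x = map x [0..<n - 1]"

definition fromlist :: "real list \<Rightarrow> (nat \<Rightarrow> real)" where
  "fromlist l = (\<lambda>i. if i < length l then l ! i else 0)"

definition cube_lact :: "nat list \<Rightarrow> (nat \<Rightarrow> real) list \<Rightarrow> (nat \<Rightarrow> real)" where
  "cube_lact ns xs = fromlist (glue_sep (replicate (length ns - 1) 1) (map2 tolist ns xs))"

definition cube_ract :: "nat list \<Rightarrow> (nat \<Rightarrow> real) \<Rightarrow> (nat \<Rightarrow> real)" where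
  "cube_ract ks x = fromlist (glue_sep (tolist (length ks) x) (map (\<lambda>k. replicate (k - 1) 0) ks))"

definition bimod_map ::
  "(nat \<Rightarrow> 'a topology) \<Rightarrow> (nat list \<Rightarrow> 'a list \<Rightarrow> 'a) \<Rightarrow> (nat list \<Rightarrow> 'a \<Rightarrow> 'a)
   \<Rightarrow> (nat \<Rightarrow> (nat \<Rightarrow> real) \<Rightarrow> 'a) \<Rightarrow> bool" where
  "bimod_map Op lact ract f \<longleftrightarrow>
    (\<forall>n. f n \<in> cmaps (CubeTop n) (Op n)) \<and>
    (\<forall>ns xs. ns \<noteq> [] \<and> length xs = length ns \<and> (\<forall>i<length ns. 1 \<le> ns ! i \<and> xs ! i \<in> cube (ns ! i))
        \<longrightarrow> f (sum_list ns) (cube_lact ns xs) = lact ns (map2 f ns xs)) \<and>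
    (\<forall>ks x. ks \<noteq> [] \<and> (\<forall>k\<in>set ks. 1 \<le> k) \<and> x \<in> cube (length ks)
        \<longrightarrow> f (sum_list ks) (cube_ract ks x) = ract ks (f (length ks) x))"

definition BimodSp ::
  "(nat \<Rightarrow> 'a topology) \<Rightarrow> (nat list \<Rightarrow> 'a list \<Rightarrow> 'a) \<Rightarrow> (nat list \<Rightarrow> 'a \<Rightarrow> 'a)
   \<Rightarrow> (nat \<Rightarrow> (nat \<Rightarrow> real) \<Rightarrow> 'a) topology" where
  "BimodSp Op lact ract = subtopology (product_topology (\<lambda>n. compact_open (CubeTop n) (Op n)) UNIV)
     {f. bimod_map Op lact ract f}"

definition base_map :: "(nat \<Rightarrow> 'a) \<Rightarrow> nat \<Rightarrow> (nat \<Rightarrow> real) \<Rightarrow> 'a" where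
  "base_map eta = (\<lambda>n x. if x \<in> cube n then eta n else undefined)"

definition LoopSp ::
  "(nat \<Rightarrow> 'a topology) \<Rightarrow> (nat list \<Rightarrow> 'a list \<Rightarrow> 'a) \<Rightarrow> (nat list \<Rightarrow> 'a \<Rightarrow> 'a) \<Rightarrow> (nat \<Rightarrow> 'a)
   \<Rightarrow> (real \<Rightarrow> nat \<Rightarrow> (nat \<Rightarrow> real) \<Rightarrow> 'a) topology" where
  "LoopSp Op lact ract eta =
     subtopology (compact_open (top_of_set {0..1}) (BimodSp Op lact ract))
       {\<gamma>. \<gamma> 0 = base_map eta \<and> \<gamma> 1 = base_map eta}"

text \<open>A point (ns, X, T) of the coproduct: ns = [n_1..n_k], X i = x_i in cube(n_i),
  T i = t_i with 0 <= t_1 <= ... <= t_k <= 1; padded by 0 beyond k.  ns = [] encodes the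
  point of Wb(cube)(0).\<close>
type_synonym wbpt = "nat list \<times> (nat \<Rightarrow> nat \<Rightarrow> real) \<times> (nat \<Rightarrow> real)"

definition wb_valid :: "nat \<Rightarrow> wbpt \<Rightarrow> bool" where
  "wb_valid n p = (case p of (ns, X, T) \<Rightarrow>
     (\<forall>m\<in>set ns. 1 \<le> m) \<and> sum_list ns = n \<and>
     (\<forall>i<length ns. X i \<in> cube (ns ! i) \<and> 0 \<le> T i \<and> T i \<le> 1) \<and>
     (\<forall>i. Suc i < length ns \<longrightarrow> T i \<le> T (Suc i)) \<and>
     (\<forall>i\<ge>length ns. X i = (\<lambda>_. 0) \<and> T i = 0))"

definition WbPiece :: "nat list \<Rightarrow> ((nat \<Rightarrow> nat \<Rightarrow> real) \<times> (nat \<Rightarrow> real)) topology" where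
  "WbPiece ns = subtopology
     (prod_topology (product_topology (\<lambda>_. powertop_real UNIV) UNIV) (powertop_real UNIV))
     {(X, T). wb_valid (sum_list ns) (ns, X, T)}"

definition WbCoprod :: "nat \<Rightarrow> wbpt topology" where
  "WbCoprod n = sum_topology WbPiece {ns. (\<forall>m\<in>set ns. 1 \<le> m) \<and> sum_list ns = n}"

definition wb_merge :: "nat \<Rightarrow> wbpt \<Rightarrow> wbpt" where
  "wb_merge i p = (case p of (ns, X, T) \<Rightarrow>
     (take i ns @ [ns ! i + ns ! Suc i] @ drop (Suc (Suc i)) ns,
      \<lambda>j. if j < i then X j else if j = i then cube_lact [ns ! i, ns ! Suc i] [X i, X (Suc i)]
           else X (Suc j),
      \<lambda>j. if j \<le> i then T j else T (Suc j)))"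

inductive_set wb_step :: "(wbpt \<times> wbpt) set" where
  merge: "\<lbrakk>wb_valid n (ns, X, T); Suc i < length ns; T i = T (Suc i)\<rbrakk>
          \<Longrightarrow> ((ns, X, T), wb_merge i (ns, X, T)) \<in> wb_step"
| collapse: "\<lbrakk>wb_valid n (ns, X, T); i < length ns; T i = 0 \<or> T i = 1; y \<in> cube (ns ! i)\<rbrakk>
          \<Longrightarrow> ((ns, X, T), (ns, X(i := y), T)) \<in> wb_step"

definition wbR :: "(wbpt \<times> wbpt) set" where
  "wbR = (wb_step \<union> wb_step\<inverse>)\<^sup>*"

definition WbQ :: "nat \<Rightarrow> wbpt set topology" where
  "WbQ n = quotient_top (WbCoprod n) wbR"

text \<open>a_k o_j [x;t]: j-1 factors * with parameter 0 on the left, k-j with parameter 1 on the right.\<close>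
definition wb_lcomp_pt :: "nat \<Rightarrow> nat \<Rightarrow> wbpt \<Rightarrow> wbpt" where
  "wb_lcomp_pt k j p = (case p of (ns, X, T) \<Rightarrow>
     (replicate (j - 1) 1 @ ns @ replicate (k - j) 1,
      \<lambda>i. if j - 1 \<le> i \<and> i < j - 1 + length ns then X (i - (j - 1)) else (\<lambda>_. 0),
      \<lambda>i. if i < j - 1 then 0 else if i < j - 1 + length ns then T (i - (j - 1))
          else if i < k - 1 + length ns then 1 else 0))"

definition cube_rcomp :: "nat \<Rightarrow> (nat \<Rightarrow> real) \<Rightarrow> nat \<Rightarrow> nat \<Rightarrow> (nat \<Rightarrow> real)" where
  "cube_rcomp n x l k = cube_ract ((replicate n 1)[l - 1 := k]) x"

text \<open>[x;t] o_j a_k: right action applied to the factor containing input j.\<close>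
definition wb_rcomp_pt :: "nat \<Rightarrow> nat \<Rightarrow> wbpt \<Rightarrow> wbpt" where
  "wb_rcomp_pt j k p = (case p of (ns, X, T) \<Rightarrow>
     (let i = (LEAST i. j \<le> sum_list (take (Suc i) ns));
          l = j - sum_list (take i ns)
      in (ns[i := ns ! i + k - 1], X(i := cube_rcomp (ns ! i) (X i) l k), T)))"

definition wb_lcomp :: "nat \<Rightarrow> nat \<Rightarrow> wbpt set \<Rightarrow> wbpt set" where
  "wb_lcomp k j c = wbR `` {wb_lcomp_pt k j (SOME p. p \<in> c)}"

definition wb_rcomp :: "nat \<Rightarrow> nat \<Rightarrow> wbpt set \<Rightarrow> wbpt set" where
  "wb_rcomp j k c = wbR `` {wb_rcomp_pt j k (SOME p. p \<in> c)}"

definition O_lcomp :: "(nat list \<Rightarrow> 'a list \<Rightarrow> 'a) \<Rightarrow> (nat \<Rightarrow> 'a) \<Rightarrow> nat \<Rightarrow> nat \<Rightarrow> nat \<Rightarrow> 'a \<Rightarrow> 'a" where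
  "O_lcomp lact eta k j n m =
     lact (replicate (j - 1) 1 @ [n] @ replicate (k - j) 1)
          (replicate (j - 1) (eta 1) @ [m] @ replicate (k - j) (eta 1))"

definition O_rcomp :: "(nat list \<Rightarrow> 'a \<Rightarrow> 'a) \<Rightarrow> nat \<Rightarrow> nat \<Rightarrow> nat \<Rightarrow> 'a \<Rightarrow> 'a" where
  "O_rcomp ract n j k m = ract ((replicate n 1)[j - 1 := k]) m"

definition wbimod_map ::
  "(nat \<Rightarrow> 'a topology) \<Rightarrow> (nat list \<Rightarrow> 'a list \<Rightarrow> 'a) \<Rightarrow> (nat list \<Rightarrow> 'a \<Rightarrow> 'a) \<Rightarrow> (nat \<Rightarrow> 'a)
   \<Rightarrow> (nat \<Rightarrow> wbpt set \<Rightarrow> 'a) \<Rightarrow> bool" where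
  "wbimod_map Op lact ract eta h \<longleftrightarrow>
    (\<forall>n. h n \<in> cmaps (WbQ n) (Op n)) \<and>
    (\<forall>n c k j. c \<in> topspace (WbQ n) \<and> 1 \<le> k \<and> 1 \<le> j \<and> j \<le> k
        \<longrightarrow> h (n + k - 1) (wb_lcomp k j c) = O_lcomp lact eta k j n (h n c)) \<and>
    (\<forall>n c j k. c \<in> topspace (WbQ n) \<and> 1 \<le> j \<and> j \<le> n \<and> 1 \<le> k
        \<longrightarrow> h (n + k - 1) (wb_rcomp j k c) = O_rcomp ract n j k (h n c))"

definition WbimodSp ::
  "(nat \<Rightarrow> 'a topology) \<Rightarrow> (nat list \<Rightarrow> 'a list \<Rightarrow> 'a) \<Rightarrow> (nat list \<Rightarrow> 'a \<Rightarrow> 'a) \<Rightarrow> (nat \<Rightarrow> 'a)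
   \<Rightarrow> (nat \<Rightarrow> wbpt set \<Rightarrow> 'a) topology" where
  "WbimodSp Op lact ract eta = subtopology (product_topology (\<lambda>n. compact_open (WbQ n) (Op n)) UNIV)
     {h. wbimod_map Op lact ract eta h}"

text \<open>xi^g [x;t] = a_k(g_{n_1}(x_1,t_1), ..., g_{n_k}(x_k,t_k)); the point goes to eta(a_0).
  A loop is given as gamma : [0,1] -> Bimod(cube,Op), so g_i(x,t) = gamma t i x.\<close>
definition xi_map :: "(nat list \<Rightarrow> 'a list \<Rightarrow> 'a) \<Rightarrow> (nat \<Rightarrow> 'a)
   \<Rightarrow> (real \<Rightarrow> nat \<Rightarrow> (nat \<Rightarrow> real) \<Rightarrow> 'a) \<Rightarrow> nat \<Rightarrow> wbpt set \<Rightarrow> 'a" where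
  "xi_map lact eta \<gamma> = (\<lambda>n c. if c \<in> topspace (WbQ n) then
      (case (SOME p. p \<in> c) of (ns, X, T) \<Rightarrow>
         if ns = [] then eta 0 else lact ns (map (\<lambda>i. \<gamma> (T i) (ns ! i) (X i)) [0..<length ns]))
      else undefined)"

end

(* A point of Wb(n) is flattened to n points on a line with consecutive gaps y_i in [0,1] and times
t_0 <= ... <= t_(n-1) in [0,1] that agree across every gap smaller than 1. A weak bimodule map is then
a coherent family H n y t (a weave), and xi identifies the loops of bimodule maps with those weaves
that satisfy H 0 = eta 0 (normal) and are multiplicative at every gap equal to 1 (strict).

To deform an arbitrary weave into a normal strict one, first squeeze the times towards 0 and 1 and
insert a contraction path of O(0) where all times are 0 or 1 (renorm). Then rescale the gaps and,
travelling from right to left, pull a point back in time when the gap on its right opens. At the moment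
this gap is wide enough, either all points of the block on its left have reached time 0, or all those
on its right have a late time, which is rescaled to 1. In both cases one of the two factors consists of
units, so the weave is already multiplicative there; it may be cut into the product of its blocks, and
the times may be released as the gap opens further (pushed). All these deformations are explicit and
continuous in the weave, and those from a strict weave can be carried out through strict ones. *)
theory Submission
  imports Defs
begin

section \<open>Compact-open and quotient topologies\<close>

text \<open>The obstacle: a weak bimodule map is compatible only with units, placed left of points
  at time 0 or right of points at time 1. Nothing relates its values on two blocks at interior times
  to a product, whereas a loop of bimodule maps is multiplicative at every gap 1. Hence times must
  move before a cut. Across a cut they need not stay ordered, so a family may be evaluated only on
  blocks without a cut inside.

  The stretching factor 3 makes room for three regimes. A stretched gap up to 1 must not disturb
  times that are forced to agree; cuts start at 2; at 3, where a gap of original width 1 ends up,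
  the two sides must be independent, which is strictness. At 2 the bound
  \<open>max 0 (2 * T - 1)\<close> vanishes for \<open>T \<le> 1 / 2\<close> and
  \<open>min 1 (2 * T)\<close> is 1 for \<open>T \<ge> 1 / 2\<close>; this is the origin of the
  rescaling by 2.

  Contractibility of O(0) enters because a weave whose times are all 0 or 1 is its value in O(0)
  padded by units, while a loop must start and end at the units. Normality is thus what makes the
  restriction of a weave to constant times a based loop.\<close>

lemma topspace_compact_open [simp]: "topspace (compact_open X Y) = cmaps X Y"
proof -
  have "cmaps X Y \<in> {{f \<in> cmaps X Y. f ` K \<subseteq> U} | K U. compactin X K \<and> openin Y U}"
    by (rule CollectI, rule exI[of _ "{}"], rule exI[of _ "topspace Y"]) auto
  then show ?thesis
    unfolding compact_open_def topology_generated_by_topspace by blast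
qed

lemma openin_compact_open_subbase:
  assumes "compactin X K" "openin Y U"
  shows "openin (compact_open X Y) {f \<in> cmaps X Y. f ` K \<subseteq> U}"
  unfolding compact_open_def
  by (rule topology_generated_by_Basis) (use assms in blast)

text \<open>Compact neighbourhoods are found in \<open>X\<close> and carried to \<open>Y\<close> by
  \<open>q\<close>, where their images are compact. In this form the lemma evaluates maps on the
  quotient \<open>WbQ n\<close> through its compact Hausdorff space of coordinates.\<close>

lemma compact_open_eval_continuous:
  assumes X: "compact_space X" "Hausdorff_space X" and q: "continuous_map X Y q"
  shows "continuous_map (prod_topology (compact_open Y Z) X) Z (\<lambda>(f, x). f (q x))"
  unfolding continuous_map_def
proof (intro conjI allI impI)
  show "(\<lambda>(f, x). f (q x)) \<in> topspace (prod_topology (compact_open Y Z) X) \<rightarrow> topspace Z"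
    using q by (auto simp: cmaps_def continuous_map_def Pi_iff)
next
  fix U assume U: "openin Z U"
  let ?S = "{p \<in> topspace (prod_topology (compact_open Y Z) X). (case p of (f, x) \<Rightarrow> f (q x)) \<in> U}"
  show "openin (prod_topology (compact_open Y Z) X) ?S"
  proof (subst openin_subopen, intro ballI)
    fix p assume p: "p \<in> ?S"
    obtain f x where px: "p = (f, x)" by (cases p)
    with p have f: "f \<in> cmaps Y Z" and x: "x \<in> topspace X" and fx: "f (q x) \<in> U" by auto
    let ?V = "{x \<in> topspace X. f (q x) \<in> U}"
    have "continuous_map X Z (f \<circ> q)"
      using f q by (auto simp: cmaps_def intro: continuous_map_compose)
    then have V: "openin X ?V" using U by (auto simp: continuous_map_def o_def)
    have "neighbourhood_base_of (compactin X) X"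
      using X compact_imp_locally_compact_space[of X] locally_compact_space_neighbourhood_base[of X] by simp
    then have "\<forall>W x. openin X W \<and> x \<in> W \<longrightarrow> (\<exists>U V. openin X U \<and> compactin X V \<and> x \<in> U \<and> U \<subseteq> V \<and> V \<subseteq> W)"
      unfolding neighbourhood_base_of .
    from this[rule_format, of ?V x] V x fx
    obtain W K where WK: "openin X W" "compactin X K" "x \<in> W" "W \<subseteq> K" "K \<subseteq> ?V"
      by auto
    let ?N = "{f \<in> cmaps Y Z. f ` (q ` K) \<subseteq> U}"
    have "compactin Y (q ` K)" using WK q by (meson image_compactin)
    then have "openin (compact_open Y Z) ?N" using U openin_compact_open_subbase by blast
    then have "openin (prod_topology (compact_open Y Z) X) (?N \<times> W)"
      using WK by (simp add: openin_prod_Times_iff)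
    moreover have "p \<in> ?N \<times> W" using f WK px by auto
    moreover have "?N \<times> W \<subseteq> ?S"
    proof
      fix z assume z: "z \<in> ?N \<times> W"
      obtain g y where gy: "z = (g, y)" by (cases z)
      then have "y \<in> K" "y \<in> topspace X" "g \<in> cmaps Y Z" "g ` q ` K \<subseteq> U" using z WK openin_subset[OF WK(1)] by auto
      then show "z \<in> ?S" unfolding gy by auto
    qed
    ultimately show "\<exists>T. openin (prod_topology (compact_open Y Z) X) T \<and> p \<in> T \<and> T \<subseteq> ?S" by blast
  qed
qed

text \<open>One half of the exponential law, read through a proper surjection \<open>q\<close>: the
  preimage \<open>L\<close> of a compact \<open>K\<close> is compact, so the tube lemma along
  \<open>{a} \<times> L\<close> turns joint continuity over \<open>X\<close> into a neighbourhood of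
  \<open>a\<close>.\<close>

lemma continuous_map_into_compact_open:
  assumes q: "proper_map X Y q" "continuous_map X Y q" "q ` topspace X = topspace Y"
    and F: "continuous_map (prod_topology A X) Z (\<lambda>(a, x). F a (q x))"
    and cm: "\<And>a. a \<in> topspace A \<Longrightarrow> F a \<in> cmaps Y Z"
  shows "continuous_map A (compact_open Y Z) F"
  unfolding compact_open_def
proof (rule continuous_on_generated_topo)
  show "F ` topspace A \<subseteq> \<Union> {{f \<in> cmaps Y Z. f ` K \<subseteq> U} |K U. compactin Y K \<and> openin Z U}"
    using cm topspace_compact_open[of Y Z] unfolding compact_open_def topology_generated_by_topspace by blast
next
  fix V assume "V \<in> {{f \<in> cmaps Y Z. f ` K \<subseteq> U} |K U. compactin Y K \<and> openin Z U}"
  then obtain K U where V: "V = {f \<in> cmaps Y Z. f ` K \<subseteq> U}" and K: "compactin Y K" and U: "openin Z U" by blast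
  define L where "L = {x \<in> topspace X. q x \<in> K}"
  have L: "compactin X L" unfolding L_def using q K compactin_proper_map_preimage by blast
  have LK: "q ` L = K" unfolding L_def using q(3) compactin_subset_topspace[OF K] by force
  define W where "W = {p \<in> topspace (prod_topology A X). (case p of (a, x) \<Rightarrow> F a (q x)) \<in> U}"
  have W: "openin (prod_topology A X) W" unfolding W_def using F U by (auto simp: continuous_map_def)
  show "openin A (F -` V \<inter> topspace A)"
  proof (subst openin_subopen, intro ballI)
    fix a assume a: "a \<in> F -` V \<inter> topspace A"
    have "{a} \<times> L \<subseteq> W"
      using a V LK compactin_subset_topspace[OF L] unfolding W_def by auto
    then obtain P Q where PQ: "openin A P" "openin X Q" "{a} \<subseteq> P" "L \<subseteq> Q" "P \<times> Q \<subseteq> W"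
      using Wallace_theorem_prod_topology[OF _ L W] a by (metis compactin_sing IntD2)
    have "P \<subseteq> F -` V \<inter> topspace A"
    proof
      fix b assume b: "b \<in> P"
      then have bA: "b \<in> topspace A" using PQ(1) openin_subset by blast
      have "F b z \<in> U" if "z \<in> K" for z
      proof -
        have "z \<in> q ` L" using that LK by simp
        then obtain x where "x \<in> L" "z = q x" by auto
        then have "(b, x) \<in> W" using PQ b by blast
        then show ?thesis unfolding W_def \<open>z = q x\<close> by simp
      qed
      then show "b \<in> F -` V \<inter> topspace A" using V bA cm by auto
    qed
    then show "\<exists>T. openin A T \<and> a \<in> T \<and> T \<subseteq> F -` V \<inter> topspace A" using PQ by blast
  qed
qed

lemma continuous_map_into_compact_open_id:
  assumes F: "continuous_map (prod_topology A X) Z (\<lambda>(a, x). F a x)"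
    and cm: "\<And>a. a \<in> topspace A \<Longrightarrow> F a \<in> cmaps X Z"
  shows "continuous_map A (compact_open X Z) F"
  using continuous_map_into_compact_open[of X X id A Z F] assms by simp

lemma homotopic_withI_True:
  assumes h: "continuous_map (prod_topology (top_of_set {0..1::real}) X) Y (\<lambda>(s, x). h s x)"
    and "\<And>x. x \<in> topspace X \<Longrightarrow> h 0 x = f x" "\<And>x. x \<in> topspace X \<Longrightarrow> h 1 x = g x"
  shows "homotopic_with (\<lambda>_. True) X Y f g"
  by (subst homotopic_with) (use assms in auto)

text \<open>The description of the open sets holds once they are shown to form a topology. Closure
  under intersection is where \<open>r\<close> must be an equivalence: two classes sharing a point
  coincide.\<close>

lemma openin_quotient_top:
  assumes "equiv UNIV r" "r `` topspace X \<subseteq> topspace X"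
  shows "openin (quotient_top X r) U \<longleftrightarrow> U \<subseteq> topspace X // r \<and> openin X (\<Union>U)"
proof -
  have "istopology (\<lambda>U. U \<subseteq> topspace X // r \<and> openin X (\<Union>U))"
    unfolding istopology_def
  proof (intro conjI allI impI)
    fix S T assume S: "S \<subseteq> topspace X // r \<and> openin X (\<Union> S)" and T: "T \<subseteq> topspace X // r \<and> openin X (\<Union> T)"
    have "\<Union>(S \<inter> T) = \<Union>S \<inter> \<Union>T"
    proof
      show "\<Union>S \<inter> \<Union>T \<subseteq> \<Union>(S \<inter> T)"
      proof
        fix x assume "x \<in> \<Union>S \<inter> \<Union>T"
        then obtain s t where st: "s \<in> S" "x \<in> s" "t \<in> T" "x \<in> t" by blast
        then have "s \<in> UNIV // r" "t \<in> UNIV // r" using S T unfolding quotient_def by blast+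
        then have "s = t" using st quotient_disj[OF assms(1), of s t] by blast
        then show "x \<in> \<Union>(S \<inter> T)" using st by blast
      qed
    qed blast
    moreover have "openin X (\<Union>S \<inter> \<Union>T)" using S T by (intro openin_Int) blast+
    ultimately show "openin X (\<Union> (S \<inter> T))" by (simp only:)
    show "S \<inter> T \<subseteq> topspace X // r" using S by blast
  next
    fix K assume K: "\<forall>S\<in>K. S \<subseteq> topspace X // r \<and> openin X (\<Union> S)"
    then show "\<Union> K \<subseteq> topspace X // r" by blast
    have "\<Union>(\<Union>K) = \<Union>(Union ` K)" by blast
    then show "openin X (\<Union> (\<Union> K))" by (simp only:) (rule openin_Union, use K in auto)
  qed
  then show ?thesis unfolding quotient_top_def by (simp add: topology_inverse')
qed

lemma topspace_quotient_top:
  assumes "equiv UNIV r" "r `` topspace X \<subseteq> topspace X"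
  shows "topspace (quotient_top X r) = topspace X // r"
proof
  show "topspace (quotient_top X r) \<subseteq> topspace X // r"
    using openin_quotient_top[OF assms, of "topspace (quotient_top X r)"] by simp
  have "\<Union>(topspace X // r) = topspace X"
    proof
    show "\<Union>(topspace X // r) \<subseteq> topspace X"
    proof
      fix x assume "x \<in> \<Union>(topspace X // r)"
      then obtain z where "z \<in> topspace X" "x \<in> r `` {z}" by (auto elim!: quotientE)
      then have "x \<in> r `` topspace X" by blast
      then show "x \<in> topspace X" using assms(2) by blast
    qed
    show "topspace X \<subseteq> \<Union>(topspace X // r)"
    proof
      fix x assume "x \<in> topspace X"
      then have "r `` {x} \<in> topspace X // r" by (rule quotientI)
      then show "x \<in> \<Union>(topspace X // r)"
        by (rule UnionI) (rule equiv_class_self[OF assms(1)], simp)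
    qed
  qed
  then have "openin (quotient_top X r) (topspace X // r)"
    using openin_quotient_top[OF assms] by simp
  then show "topspace X // r \<subseteq> topspace (quotient_top X r)" by (rule openin_subset)
qed

lemma quotient_map_quotient_top:
  assumes "equiv UNIV r" "r `` topspace X \<subseteq> topspace X"
  shows "quotient_map X (quotient_top X r) (\<lambda>x. r `` {x})"
  unfolding quotient_map_def topspace_quotient_top[OF assms]
proof (intro conjI allI impI)
  show "(\<lambda>x. r `` {x}) ` topspace X = topspace X // r"
    by (auto simp: quotient_def)
  fix U assume U: "U \<subseteq> topspace X // r"
  have "{x \<in> topspace X. r `` {x} \<in> U} = \<Union>U"
  proof (intro set_eqI iffI)
    fix x assume "x \<in> {x \<in> topspace X. r `` {x} \<in> U}"
    then show "x \<in> \<Union>U" using equiv_class_self[OF assms(1)] by blast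
  next
    fix x assume "x \<in> \<Union>U"
    then obtain u where u: "u \<in> U" "x \<in> u" by blast
    then obtain z where z: "z \<in> topspace X" "u = r `` {z}" using U by (auto simp: quotient_def)
    then have zx: "(z, x) \<in> r" using u by simp
    then have "r `` {x} = u" "x \<in> topspace X" using z equiv_class_eq[OF assms(1) zx] assms(2) by blast+
    then show "x \<in> {x \<in> topspace X. r `` {x} \<in> U}" using u by simp
  qed
  then show "openin X {x \<in> topspace X. r `` {x} \<in> U} = openin (quotient_top X r) U"
    using openin_quotient_top[OF assms] U by simp
qed

lemma chunks_append:
  "length ls1 = sum_list ks1 \<Longrightarrow> chunks (ks1 @ ks2) (ls1 @ ls2) = chunks ks1 ls1 @ chunks ks2 ls2"
  by (induction ks1 arbitrary: ls1) auto

lemma sum_list_chunks_replicate: "map sum_list (chunks ks (replicate (sum_list ks) 1)) = ks"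
  by (induction ks) (auto simp: sum_list_replicate)

section \<open>The bimodule operations\<close>

text \<open>Arities of the right action that doubles input \<open>m\<close> out of \<open>n\<close>
  and keeps the others. These doublings generate the right action, so families are tested on them
  only.\<close>

definition dup :: "nat \<Rightarrow> nat \<Rightarrow> nat list" where
  "dup n m = replicate m 1 @ 2 # replicate (n - Suc m) 1"

lemma dup_props [simp]:
  "m < n \<Longrightarrow> length (dup n m) = n"
  "m < n \<Longrightarrow> sum_list (dup n m) = Suc n"
  "k \<in> set (dup n m) \<Longrightarrow> Suc 0 \<le> k"
  by (auto simp: dup_def sum_list_replicate)

lemma dup_eq_update: "m < n \<Longrightarrow> dup n m = (replicate n 1)[m := 2]"
  by (rule nth_equalityI) (auto simp: dup_def nth_append nth_list_update nth_Cons')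

lemma take_dup: "m < a \<Longrightarrow> take a (dup (a + b) m) = dup a m"
  and drop_dup: "m < a \<Longrightarrow> drop a (dup (a + b) m) = replicate b 1"
  and take_dup': "a \<le> m \<Longrightarrow> take a (dup (a + b) m) = replicate a 1"
  and drop_dup': "a \<le> m \<Longrightarrow> drop a (dup (a + b) m) = dup b (m - a)"
  by (auto simp: dup_def take_Cons' drop_Cons' min_def)

locale assoc_bimod =
  fixes Op :: "nat \<Rightarrow> 'a topology" and lact :: "nat list \<Rightarrow> 'a list \<Rightarrow> 'a"
    and ract :: "nat list \<Rightarrow> 'a \<Rightarrow> 'a" and eta :: "nat \<Rightarrow> 'a"
  assumes bim: "assoc_bimodule Op lact ract"
    and eta: "assoc_bimodule_map_from_Assoc Op lact ract eta"
begin

lemma lact_closed: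
  "ns \<noteq> [] \<Longrightarrow> length xs = length ns \<Longrightarrow> (\<And>i. i < length ns \<Longrightarrow> xs ! i \<in> topspace (Op (ns ! i)))
    \<Longrightarrow> lact ns xs \<in> topspace (Op (sum_list ns))"
  using bim[unfolded assoc_bimodule_def, THEN conjunct1, rule_format] by simp

lemma lact_continuous:
  "ns \<noteq> [] \<Longrightarrow> continuous_map (product_topology (\<lambda>i. Op (ns ! i)) {..<length ns}) (Op (sum_list ns))
          (\<lambda>z. lact ns (map z [0..<length ns]))"
  using bim[unfolded assoc_bimodule_def, THEN conjunct2, THEN conjunct1, rule_format] by simp

lemma ract_closed:
  "(\<And>k. k \<in> set ks \<Longrightarrow> 1 \<le> k) \<Longrightarrow> x \<in> topspace (Op (length ks)) \<Longrightarrow> ract ks x \<in> topspace (Op (sum_list ks))"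
  using bim[unfolded assoc_bimodule_def, THEN conjunct2, THEN conjunct2, THEN conjunct1, rule_format] by simp

lemma lact_single: "x \<in> topspace (Op n) \<Longrightarrow> lact [n] [x] = x"
  using bim[unfolded assoc_bimodule_def, THEN conjunct2, THEN conjunct2, THEN conjunct2, THEN conjunct2, THEN conjunct1, rule_format] by simp

lemma ract_ones: "x \<in> topspace (Op n) \<Longrightarrow> ract (replicate n 1) x = x"
  using bim[unfolded assoc_bimodule_def, THEN conjunct2, THEN conjunct2, THEN conjunct2, THEN conjunct2, THEN conjunct2, THEN conjunct1, rule_format] by simp

lemma lact_lact:
  assumes "nss \<noteq> []" "\<And>ns. ns \<in> set nss \<Longrightarrow> ns \<noteq> []" "length xss = length nss"
    "\<And>i. i < length nss \<Longrightarrow> length (xss ! i) = length (nss ! i)"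
    "\<And>i j. i < length nss \<Longrightarrow> j < length (nss ! i) \<Longrightarrow> xss ! i ! j \<in> topspace (Op (nss ! i ! j))"
  shows "lact (map sum_list nss) (map2 lact nss xss) = lact (concat nss) (concat xss)"
  by (rule bim[unfolded assoc_bimodule_def, THEN conjunct2, THEN conjunct2, THEN conjunct2, THEN conjunct2, THEN conjunct2, THEN conjunct2, THEN conjunct1, rule_format]) (use assms in auto)

lemma ract_ract:
  assumes "\<And>k. k \<in> set ks \<Longrightarrow> 1 \<le> k" "length ls = sum_list ks" "\<And>l. l \<in> set ls \<Longrightarrow> 1 \<le> l"
    "x \<in> topspace (Op (length ks))"
  shows "ract ls (ract ks x) = ract (map sum_list (chunks ks ls)) x"
  by (rule bim[unfolded assoc_bimodule_def, THEN conjunct2, THEN conjunct2, THEN conjunct2, THEN conjunct2, THEN conjunct2, THEN conjunct2, THEN conjunct2, THEN conjunct1, rule_format]) (use assms in auto)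

lemma ract_lact:
  assumes "ns \<noteq> []" "length xs = length ns" "\<And>i. i < length ns \<Longrightarrow> xs ! i \<in> topspace (Op (ns ! i))"
    "length ks = sum_list ns" "\<And>k. k \<in> set ks \<Longrightarrow> 1 \<le> k"
  shows "ract ks (lact ns xs) = lact (map sum_list (chunks ns ks)) (map2 ract (chunks ns ks) xs)"
  by (rule bim[unfolded assoc_bimodule_def, THEN conjunct2, THEN conjunct2, THEN conjunct2, THEN conjunct2, THEN conjunct2, THEN conjunct2, THEN conjunct2, THEN conjunct2, rule_format]) (use assms in auto)

lemma eta_closed [simp]: "eta n \<in> topspace (Op n)"
  and eta_lact: "ns \<noteq> [] \<Longrightarrow> lact ns (map eta ns) = eta (sum_list ns)"
  and eta_ract: "(\<And>k. k \<in> set ks \<Longrightarrow> 1 \<le> k) \<Longrightarrow> ract ks (eta (length ks)) = eta (sum_list ks)"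
  using eta unfolding assoc_bimodule_map_from_Assoc_def by blast+

definition a2 :: "nat \<Rightarrow> nat \<Rightarrow> 'a \<Rightarrow> 'a \<Rightarrow> 'a" where
  "a2 m n x y = lact [m, n] [x, y]"

lemma a2_closed:
  assumes "x \<in> topspace (Op m)" "y \<in> topspace (Op n)"
  shows "a2 m n x y \<in> topspace (Op (m + n))"
proof -
  have "lact [m, n] [x, y] \<in> topspace (Op (sum_list [m, n]))"
    by (rule lact_closed) (use assms in \<open>auto simp: less_Suc_eq\<close>)
  then show ?thesis by (simp add: a2_def)
qed

lemma a2_continuous:
  assumes f: "continuous_map Y (Op m) f" and g: "continuous_map Y (Op n) g"
  shows "continuous_map Y (Op (m + n)) (\<lambda>a. a2 m n (f a) (g a))"
proof -
  have "continuous_map Y (product_topology (\<lambda>i. Op ([m, n] ! i)) {..<length [m, n]})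
      (\<lambda>a. \<lambda>i\<in>{..<2}. if i = 0 then f a else g a)"
    unfolding continuous_map_componentwise using f g
    by (auto simp: less_Suc_eq numeral_2_eq_2 cong: if_cong)
  from continuous_map_compose[OF this lact_continuous]
  have "continuous_map Y (Op (sum_list [m, n]))
     ((\<lambda>z. lact [m, n] (map z [0..<length [m, n]])) \<circ> (\<lambda>a. \<lambda>i\<in>{..<2}. if i = 0 then f a else g a))" by simp
  then show ?thesis by (simp add: a2_def o_def upt_rec)
qed

text \<open>Associativity for the nesting \<open>[[n], ns]\<close> with the unit law on the first
  entry; it reduces left actions to iterated binary products \<open>a2\<close>.\<close>

lemma lact_Cons:
  assumes "ns \<noteq> []" "length xs = length ns" "x \<in> topspace (Op n)"
    "\<And>i. i < length ns \<Longrightarrow> xs ! i \<in> topspace (Op (ns ! i))"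
  shows "lact (n # ns) (x # xs) = a2 n (sum_list ns) x (lact ns xs)"
proof -
  have "lact (map sum_list [[n], ns]) (map2 lact [[n], ns] [[x], xs]) = lact (concat [[n], ns]) (concat [[x], xs])"
    by (rule lact_lact) (use assms in \<open>auto simp: less_Suc_eq\<close>)
  then show ?thesis using assms lact_single by (simp add: a2_def)
qed

lemma lact_snoc:
  assumes "ns \<noteq> []" "length xs = length ns" "x \<in> topspace (Op n)"
    "\<And>i. i < length ns \<Longrightarrow> xs ! i \<in> topspace (Op (ns ! i))"
  shows "lact (ns @ [n]) (xs @ [x]) = a2 (sum_list ns) n (lact ns xs) x"
proof -
  have "lact (map sum_list [ns, [n]]) (map2 lact [ns, [n]] [xs, [x]]) = lact (concat [ns, [n]]) (concat [xs, [x]])"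
    by (rule lact_lact) (use assms in \<open>auto simp: less_Suc_eq\<close>)
  then show ?thesis using assms lact_single by (simp add: a2_def)
qed

lemma a2_assoc:
  assumes "x \<in> topspace (Op a)" "y \<in> topspace (Op b)" "z \<in> topspace (Op c)"
  shows "a2 (a + b) c (a2 a b x y) z = a2 a (b + c) x (a2 b c y z)"
proof -
  have "lact ([a] @ [b, c]) ([x] @ [y, z]) = a2 a (sum_list [b, c]) x (lact [b, c] [y, z])"
    unfolding append_Cons append_Nil by (rule lact_Cons) (use assms in \<open>auto simp: less_Suc_eq\<close>)
  moreover have "lact ([a, b] @ [c]) ([x, y] @ [z]) = a2 (sum_list [a, b]) c (lact [a, b] [x, y]) z"
    by (rule lact_snoc) (use assms in \<open>auto simp: less_Suc_eq\<close>)
  ultimately show ?thesis by (simp add: a2_def)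
qed

lemma a2_eta: "a2 m n (eta m) (eta n) = eta (m + n)"
  using eta_lact[of "[m, n]"] by (simp add: a2_def)

lemma ract_dup_eta: "m < n \<Longrightarrow> ract (dup n m) (eta n) = eta (Suc n)"
  using eta_ract[of "dup n m"] by simp

lemma ract_dup_a2_left:
  assumes "x \<in> topspace (Op a)" "y \<in> topspace (Op b)" "m < a"
  shows "ract (dup (a + b) m) (a2 a b x y) = a2 (Suc a) b (ract (dup a m) x) y"
proof -
  have "ract (dup (a + b) m) (lact [a, b] [x, y]) = lact (map sum_list (chunks [a, b] (dup (a + b) m))) (map2 ract (chunks [a, b] (dup (a + b) m)) [x, y])"
    by (rule ract_lact) (use assms in \<open>auto simp: less_Suc_eq\<close>)
  then show ?thesis
    using ract_ones[of y b] assms take_dup[of m a b] drop_dup[of m a b] dup_props(1)[of m a] by (simp add: a2_def sum_list_replicate)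
qed

lemma ract_dup_a2_right:
  assumes "x \<in> topspace (Op a)" "y \<in> topspace (Op b)" "a \<le> m" "m < a + b"
  shows "ract (dup (a + b) m) (a2 a b x y) = a2 a (Suc b) x (ract (dup b (m - a)) y)"
proof -
  have "ract (dup (a + b) m) (lact [a, b] [x, y]) = lact (map sum_list (chunks [a, b] (dup (a + b) m))) (map2 ract (chunks [a, b] (dup (a + b) m)) [x, y])"
    by (rule ract_lact) (use assms in \<open>auto simp: less_Suc_eq\<close>)
  then show ?thesis
    using ract_ones[of x a] assms take_dup'[of a m b] drop_dup'[of a m b] dup_props[of "m - a" b] by (simp add: a2_def sum_list_replicate)
qed

text \<open>The only 2 of the doubling falls on the first strand of the block of size
  \<open>k\<close>, so regrouping along the blocks raises that size alone. Repeating this step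
  builds every right action out of doublings.\<close>

lemma ract_dup_ract:
  assumes ks: "\<And>i. i \<in> set (ks1 @ k # ks2) \<Longrightarrow> 1 \<le> i" and x: "x \<in> topspace (Op (length (ks1 @ k # ks2)))"
  shows "ract (dup (sum_list (ks1 @ k # ks2)) (sum_list ks1)) (ract (ks1 @ k # ks2) x) = ract (ks1 @ Suc k # ks2) x"
proof -
  have k: "1 \<le> k" using ks by simp
  define ls where "ls = dup (sum_list (ks1 @ k # ks2)) (sum_list ks1)"
  have ls: "ls = replicate (sum_list ks1) 1 @ (2 # replicate (k - 1) 1) @ replicate (sum_list ks2) 1"
    using k by (auto simp: ls_def dup_def simp flip: replicate_add)
  have c1: "chunks ks1 (replicate (sum_list ks1) 1) @ chunks (k # ks2) ((2 # replicate (k - 1) 1) @ replicate (sum_list ks2) 1)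
     = chunks (ks1 @ k # ks2) ls"
    unfolding ls by (rule chunks_append[symmetric]) simp
  have "chunks (k # ks2) ((2 # replicate (k - 1) (1::nat)) @ replicate (sum_list ks2) 1) = (2 # replicate (k - 1) 1) # chunks ks2 (replicate (sum_list ks2) 1)"
    using k by (cases k) auto
  then have "map sum_list (chunks (ks1 @ k # ks2) ls) = ks1 @ Suc k # ks2"
    using k unfolding c1[symmetric] by (simp add: sum_list_chunks_replicate[simplified] sum_list_replicate)
  moreover have "ract ls (ract (ks1 @ k # ks2) x) = ract (map sum_list (chunks (ks1 @ k # ks2) ls)) x"
  proof (rule ract_ract)
    show "length ls = sum_list (ks1 @ k # ks2)" unfolding ls_def by (rule dup_props(1)) (use k in simp)
    show "\<And>l. l \<in> set ls \<Longrightarrow> 1 \<le> l" unfolding ls_def using dup_props(3) by simp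
  qed (use ks x in auto)
  ultimately show ?thesis by (simp add: ls_def)
qed

text \<open>For \<open>n = 0\<close> these are the values that a weave can take when all times are 0
  or 1, with \<open>p\<close> points at 0 and \<open>q\<close> at 1; only the entry in
  \<open>Op 0\<close> is free. For general \<open>n\<close> it is the left weak bimodule
  composition.\<close>

definition pad :: "nat \<Rightarrow> nat \<Rightarrow> nat \<Rightarrow> 'a \<Rightarrow> 'a" where
  "pad p q n x = lact (replicate p 1 @ n # replicate q 1) (replicate p (eta 1) @ x # replicate q (eta 1))"

lemma pad_0: "x \<in> topspace (Op n) \<Longrightarrow> pad 0 0 n x = x"
  by (simp add: pad_def lact_single)

lemma pad_nth:
  assumes "x \<in> topspace (Op n)" "i < Suc (p + q)"
  shows "(replicate p (eta 1) @ x # replicate q (eta 1)) ! i \<in> topspace (Op ((replicate p 1 @ n # replicate q 1) ! i))"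
  using assms by (auto simp: nth_append nth_Cons')

lemma pad_left:
  assumes "x \<in> topspace (Op n)"
  shows "pad (Suc p) q n x = a2 1 (p + n + q) (eta 1) (pad p q n x)"
  unfolding pad_def replicate.simps append_Cons
  by (subst lact_Cons) (use pad_nth[OF assms] in \<open>auto simp: sum_list_replicate add.assoc\<close>)

lemma pad_right:
  assumes "x \<in> topspace (Op n)"
  shows "pad p (Suc q) n x = a2 (p + n + q) 1 (pad p q n x) (eta 1)"
proof -
  have "pad p (Suc q) n x = lact ((replicate p 1 @ n # replicate q 1) @ [1]) ((replicate p (eta 1) @ x # replicate q (eta 1)) @ [eta 1])"
    unfolding pad_def by (simp flip: replicate_append_same)
  also have "\<dots> = a2 (p + n + q) 1 (pad p q n x) (eta 1)"
    by (subst lact_snoc) (use pad_nth[OF assms] in \<open>auto simp: sum_list_replicate add.assoc pad_def\<close>)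
  finally show ?thesis .
qed

lemma pad_closed: "x \<in> topspace (Op n) \<Longrightarrow> pad p q n x \<in> topspace (Op (p + n + q))"
proof -
  assume x: "x \<in> topspace (Op n)"
  have "pad p q n x \<in> topspace (Op (sum_list (replicate p 1 @ n # replicate q 1)))"
    unfolding pad_def by (rule lact_closed) (use pad_nth[OF x] in auto)
  then show ?thesis by (simp add: sum_list_replicate add.assoc)
qed

lemma pad_continuous:
  assumes "continuous_map Y (Op n) f"
  shows "continuous_map Y (Op (p + n + q)) (\<lambda>a. pad p q n (f a))"
proof -
  have fO: "f a \<in> topspace (Op n)" if "a \<in> topspace Y" for a
    using assms that by (auto simp: continuous_map_def)
  have base: "continuous_map Y (Op (n + q)) (\<lambda>a. pad 0 q n (f a))"
  proof (induction q)
    case 0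
    then show ?case using continuous_map_eq[OF assms] pad_0 fO by simp
  next
    case (Suc q)
    have "continuous_map Y (Op (n + q + 1)) (\<lambda>a. a2 (n + q) 1 (pad 0 q n (f a)) (eta 1))"
      by (rule a2_continuous[OF Suc]) simp
    from continuous_map_eq[OF this, of "\<lambda>a. pad 0 (Suc q) n (f a)"]
    show ?case using pad_right[of _ n 0 q] fO by simp
  qed
  show ?thesis
  proof (induction p)
    case 0
    then show ?case using base by simp
  next
    case (Suc p)
    have "continuous_map Y (Op (1 + (p + n + q))) (\<lambda>a. a2 1 (p + n + q) (eta 1) (pad p q n (f a)))"
      by (rule a2_continuous[OF _ Suc]) simp
    from continuous_map_eq[OF this, of "\<lambda>a. pad (Suc p) q n (f a)"]
    show ?case using pad_left[of _ n p q] fO by simp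
  qed
qed

text \<open>Doubling a unit gives \<open>eta 2\<close>, which is the product of two copies of
  \<open>eta 1\<close>; so the padding merely grows by one unit on that side.\<close>

lemma pad_dup_right:
  assumes c: "c \<in> topspace (Op 0)"
  shows "i < q \<Longrightarrow> ract (dup q i) (pad 0 q 0 c) = pad 0 (Suc q) 0 c"
proof (induction q)
  case (Suc q)
  note P = pad_closed[OF c, of 0, simplified]
  have r: "pad 0 (Suc q) 0 c = a2 q 1 (pad 0 q 0 c) (eta 1)" for q using pad_right[OF c, of 0 q] by simp
  show ?case
  proof (cases "i < q")
    case True
    then show ?thesis
      using ract_dup_a2_left[OF P[of q] eta_closed[of 1] True] Suc.IH r by simp
  next
    case False
    then have i: "i = q" using Suc by simp
    have "ract (dup (Suc q) i) (pad 0 (Suc q) 0 c) = a2 q 2 (pad 0 q 0 c) (eta 2)"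
      using ract_dup_a2_right[OF P[of q] eta_closed[of 1], of q] i r ract_dup_eta[of 0 1] by (simp add: numeral_2_eq_2)
    also have "\<dots> = a2 (q + 1) 1 (a2 q 1 (pad 0 q 0 c) (eta 1)) (eta 1)"
      using a2_assoc[OF P[of q] eta_closed[of 1] eta_closed[of 1]] a2_eta[of 1 1] by (simp add: numeral_2_eq_2)
    finally show ?thesis using r by simp
  qed
qed simp

lemma pad_dup:
  assumes c: "c \<in> topspace (Op 0)"
  shows "i < p + q \<Longrightarrow> ract (dup (p + q) i) (pad p q 0 c) = (if i < p then pad (Suc p) q 0 c else pad p (Suc q) 0 c)"
proof (induction p arbitrary: i)
  case 0
  then show ?case using pad_dup_right[OF c] by simp
next
  case (Suc p)
  note P = pad_closed[OF c, of _ _, simplified]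
  have r: "pad (Suc p) q 0 c = a2 1 (p + q) (eta 1) (pad p q 0 c)" for p q using pad_left[OF c, of p q] by simp
  show ?case
  proof (cases i)
    case 0
    have "ract (dup (Suc p + q) i) (pad (Suc p) q 0 c) = a2 2 (p + q) (eta 2) (pad p q 0 c)"
      using ract_dup_a2_left[OF eta_closed[of 1] P[of p q], of 0] 0 r ract_dup_eta[of 0 1] by (simp add: numeral_2_eq_2)
    also have "\<dots> = a2 1 (Suc (p + q)) (eta 1) (a2 1 (p + q) (eta 1) (pad p q 0 c))"
      using a2_assoc[OF eta_closed[of 1] eta_closed[of 1] P[of p q]] a2_eta[of 1 1] by (simp add: numeral_2_eq_2)
    finally show ?thesis using r 0 by simp
  next
    case (Suc j)
    have "ract (dup (Suc p + q) i) (pad (Suc p) q 0 c) = a2 1 (Suc (p + q)) (eta 1) (ract (dup (p + q) j) (pad p q 0 c))"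
      using ract_dup_a2_right[OF eta_closed[of 1] P[of p q], of i] Suc r Suc.prems by simp
    then show ?thesis using Suc.IH[of j] Suc Suc.prems r by simp
  qed
qed

section \<open>Products of blocks along a set of cuts\<close>

text \<open>Points \<open>s, \<dots>, s + l + n\<close>; the current block is \<open>s, \<dots>, s + l\<close>, gap \<open>i\<close> separates the points
  \<open>i\<close> and \<open>i + 1\<close>, and the product is cut at the gaps satisfying \<open>S\<close>.\<close>
primrec bprod :: "(nat \<Rightarrow> nat \<Rightarrow> 'a) \<Rightarrow> (nat \<Rightarrow> bool) \<Rightarrow> nat \<Rightarrow> nat \<Rightarrow> nat \<Rightarrow> 'a" where
  "bprod b S s l 0 = b s (Suc l)"
| "bprod b S s l (Suc n) = (if S (s + l) then a2 (Suc l) (Suc n) (b s (Suc l)) (bprod b S (Suc (s + l)) 0 n)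
     else bprod b S s (Suc l) n)"

definition uncut :: "(nat \<Rightarrow> bool) \<Rightarrow> nat \<Rightarrow> nat \<Rightarrow> bool" where
  "uncut S s l \<longleftrightarrow> (\<forall>i. s \<le> i \<longrightarrow> i < s + l \<longrightarrow> \<not> S i)"

lemma uncut_0 [simp]: "uncut S s 0"
  by (simp add: uncut_def)

lemma uncut_Suc: "uncut S s (Suc l) \<longleftrightarrow> uncut S s l \<and> \<not> S (s + l)"
  unfolding uncut_def by (metis add_Suc_right le_add1 less_Suc_eq)

text \<open>Restricted to blocks without a cut inside: the times of a pushed family may decrease
  across a cut, and a block reaching over one would not be a legal argument.\<close>

definition block_closed :: "(nat \<Rightarrow> nat \<Rightarrow> 'a) \<Rightarrow> (nat \<Rightarrow> bool) \<Rightarrow> nat \<Rightarrow> bool" where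
  "block_closed b S M \<longleftrightarrow> (\<forall>s l. s + l \<le> M \<longrightarrow> uncut S s l \<longrightarrow> b s (Suc l) \<in> topspace (Op (Suc l)))"

definition block_cut :: "(nat \<Rightarrow> nat \<Rightarrow> 'a) \<Rightarrow> (nat \<Rightarrow> bool) \<Rightarrow> nat \<Rightarrow> nat \<Rightarrow> bool" where
  "block_cut b S M m \<longleftrightarrow> (\<forall>s l l'. s + l = m \<longrightarrow> Suc (m + l') \<le> M \<longrightarrow> uncut S s (Suc (l + l')) \<longrightarrow>
     b s (Suc (Suc (l + l'))) = a2 (Suc l) (Suc l') (b s (Suc l)) (b (Suc m) (Suc l')))"

lemma uncut_right: "uncut S s (Suc (l + l')) \<Longrightarrow> uncut S (Suc (s + l)) l'"
  by (auto simp: uncut_def)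

lemma uncut_left: "uncut S s (l + l') \<Longrightarrow> uncut S s l"
  by (auto simp: uncut_def)

lemma bprod_closed:
  assumes "block_closed b S M"
  shows "s + l + n \<le> M \<Longrightarrow> uncut S s l \<Longrightarrow> bprod b S s l n \<in> topspace (Op (Suc (l + n)))"
proof (induction n arbitrary: s l)
  case 0
  then show ?case using assms by (auto simp: block_closed_def)
next
  case (Suc n)
  show ?case
  proof (cases "S (s + l)")
    case True
    have "b s (Suc l) \<in> topspace (Op (Suc l))"
      using assms Suc.prems by (auto simp: block_closed_def)
    moreover have "bprod b S (Suc (s + l)) 0 n \<in> topspace (Op (Suc n))"
      using Suc.IH[of "Suc (s + l)" 0] Suc.prems by simp
    ultimately show ?thesis using a2_closed True by fastforce
  next
    case False
    then show ?thesis using Suc.IH[of s "Suc l"] Suc.prems by (simp add: uncut_Suc)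
  qed
qed

lemma bprod_split:
  assumes "block_closed b S M" "S (s + l + n1)" "s + l + n1 + Suc n2 \<le> M" "uncut S s l"
  shows "bprod b S s l (n1 + Suc n2) =
    a2 (Suc (l + n1)) (Suc n2) (bprod b S s l n1) (bprod b S (Suc (s + l + n1)) 0 n2)"
  using assms(2-)
proof (induction n1 arbitrary: s l)
  case 0
  then show ?case by simp
next
  case (Suc n1)
  show ?case
  proof (cases "S (s + l)")
    case True
    have "b s (Suc l) \<in> topspace (Op (Suc l))"
      using assms(1) Suc.prems by (auto simp: block_closed_def)
    moreover have "bprod b S (Suc (s + l)) 0 n1 \<in> topspace (Op (Suc n1))"
      using bprod_closed[OF assms(1), of "Suc (s + l)" 0 n1] Suc.prems by simp
    moreover have "bprod b S (Suc (s + l + Suc n1)) 0 n2 \<in> topspace (Op (Suc n2))"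
      using bprod_closed[OF assms(1), of "Suc (s + l + Suc n1)" 0 n2] Suc.prems by simp
    ultimately show ?thesis
      using True Suc.IH[of "Suc (s + l)" 0] Suc.prems
        a2_assoc[of "b s (Suc l)" "Suc l" "bprod b S (Suc (s + l)) 0 n1" "Suc n1" "bprod b S (Suc (s + l + Suc n1)) 0 n2" "Suc n2"]
      by (simp add: add.assoc)
  next
    case False
    then show ?thesis using Suc.IH[of s "Suc l"] Suc.prems by (simp add: uncut_Suc add.assoc)
  qed
qed

text \<open>The recursion keeps extending the current block, so the factorisation at
  \<open>m\<close> has to be followed while the part to the right of \<open>m\<close> grows;
  \<open>l'\<close> is the number of points gathered there after the first.\<close>

lemma bprod_cut:
  assumes "block_closed b S M" "block_cut b S M m"
  shows "s + l = m \<Longrightarrow> Suc (m + l' + n) \<le> M \<Longrightarrow> uncut S s (Suc (l + l')) \<Longrightarrow>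
    bprod b S s (Suc (l + l')) n = a2 (Suc l) (Suc (l' + n)) (b s (Suc l)) (bprod b S (Suc m) l' n)"
proof (induction n arbitrary: l')
  case 0
  then show ?case using assms(2) by (simp add: block_cut_def)
next
  case (Suc n)
  show ?case
  proof (cases "S (Suc (s + (l + l')))")
    case True
    have "b s (Suc (Suc (l + l'))) = a2 (Suc l) (Suc l') (b s (Suc l)) (b (Suc m) (Suc l'))"
      using assms(2) Suc.prems by (simp add: block_cut_def)
    moreover have "b s (Suc l) \<in> topspace (Op (Suc l))"
      using assms(1) Suc.prems uncut_left[of S s l "Suc l'"] by (simp add: block_closed_def)
    moreover have "b (Suc m) (Suc l') \<in> topspace (Op (Suc l'))"
      using assms(1) Suc.prems uncut_right[of S s l l'] by (simp add: block_closed_def)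
    moreover have "bprod b S (Suc (Suc (m + l'))) 0 n \<in> topspace (Op (Suc n))"
      using bprod_closed[OF assms(1), of "Suc (Suc (m + l'))" 0 n] Suc.prems by simp
    ultimately show ?thesis
      using True Suc.prems
        a2_assoc[of "b s (Suc l)" "Suc l" "b (Suc m) (Suc l')" "Suc l'" "bprod b S (Suc (Suc (m + l'))) 0 n" "Suc n"]
      by (auto simp: add.assoc)
  next
    case False
    then show ?thesis using Suc.IH[of "Suc l'"] Suc.prems by (auto simp: uncut_Suc add.assoc)
  qed
qed

text \<open>A cut at a gap where the blocks factor anyway may be made or omitted. Products with
  different cut sets therefore agree on the common boundary of the regions where they are used, and
  cuts can be inserted or removed to reach a convenient form.\<close>

lemma bprod_refine:
  assumes "block_closed b S M"
    and sub: "\<And>m. S m \<Longrightarrow> m < M \<Longrightarrow> S' m"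
    and cut: "\<And>m. S' m \<Longrightarrow> \<not> S m \<Longrightarrow> m < M \<Longrightarrow> block_cut b S M m"
  shows "s + l + n \<le> M \<Longrightarrow> uncut S s l \<Longrightarrow> bprod b S s l n = bprod b S' s l n"
proof (induction n arbitrary: s l)
  case 0
  then show ?case by simp
next
  case (Suc n)
  consider "S (s + l)" "S' (s + l)" | "\<not> S (s + l)" "S' (s + l)" | "\<not> S (s + l)" "\<not> S' (s + l)"
    using sub[of "s + l"] Suc.prems by auto
  then show ?case
  proof cases
    case 1
    then show ?thesis using Suc.IH[of "Suc (s + l)" 0] Suc.prems by simp
  next
    case 2
    then show ?thesis
      using Suc.IH[of "Suc (s + l)" 0] Suc.prems bprod_cut[OF assms(1) cut[of "s + l"], of s l 0 n]
      by (simp add: uncut_Suc)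
  next
    case 3
    then show ?thesis using Suc.IH[of s "Suc l"] Suc.prems by (simp add: uncut_Suc)
  qed
qed

lemma bprod_cong:
  assumes "\<And>s l. s + l \<le> M \<Longrightarrow> uncut S s l \<Longrightarrow> b s (Suc l) = b' s (Suc l)"
    and "\<And>i. i < M \<Longrightarrow> S i = S' i"
  shows "s + l + n \<le> M \<Longrightarrow> uncut S s l \<Longrightarrow> bprod b S s l n = bprod b' S' s l n"
proof (induction n arbitrary: s l)
  case 0
  then show ?case using assms by simp
next
  case (Suc n)
  then show ?case
    using assms(2)[of "s + l"] assms(1)[of s l] Suc.IH[of s "Suc l"] Suc.IH[of "Suc (s + l)" 0] by (auto simp: uncut_Suc)
qed

lemma bprod_shift:
  "bprod (\<lambda>s. b (k + s)) (\<lambda>i. S (k + i)) s l n = bprod b S (k + s) l n"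
  by (induction n arbitrary: s l) (simp_all add: add.assoc)

lemma bprod_uncut: "uncut S s (l + n) \<Longrightarrow> bprod b S s l n = b s (Suc (l + n))"
  by (induction n arbitrary: l) (auto simp: uncut_def)

lemma bprod_continuous:
  assumes "\<And>s l. s + l \<le> M \<Longrightarrow> uncut S s l \<Longrightarrow> continuous_map Y (Op (Suc l)) (\<lambda>z. b z s (Suc l))"
  shows "s + l + n \<le> M \<Longrightarrow> uncut S s l \<Longrightarrow> continuous_map Y (Op (Suc (l + n))) (\<lambda>z. bprod (b z) S s l n)"
proof (induction n arbitrary: s l)
  case 0
  then show ?case using assms by simp
next
  case (Suc n)
  show ?case
  proof (cases "S (s + l)")
    case True
    have "continuous_map Y (Op (Suc l + Suc n)) (\<lambda>z. a2 (Suc l) (Suc n) (b z s (Suc l)) (bprod (b z) S (Suc (s + l)) 0 n))"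
      by (rule a2_continuous) (use assms[of s l] Suc.IH[of "Suc (s + l)" 0] Suc.prems in auto)
    then show ?thesis using True by simp
  next
    case False
    then show ?thesis using Suc.IH[of s "Suc l"] Suc.prems by (simp add: uncut_Suc)
  qed
qed

text \<open>Doubling point \<open>m\<close> creates a gap \<open>m\<close> that is never cut and
  moves the later gaps by one. The right action passes through the product to the single block
  containing \<open>m\<close>; blocks before it stay and blocks after it are shifted.\<close>

lemma bprod_dup:
  assumes closed: "block_closed b S M"
    and S: "\<not> S' m" "\<And>i. i < m \<Longrightarrow> S i = S' i" "\<And>i. m \<le> i \<Longrightarrow> S i = S' (Suc i)"
    and before: "\<And>s l. s + l < m \<Longrightarrow> s + l \<le> M \<Longrightarrow> uncut S s l \<Longrightarrow> b s (Suc l) = b' s (Suc l)"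
    and after: "\<And>s l. m < s \<Longrightarrow> s + l \<le> M \<Longrightarrow> uncut S s l \<Longrightarrow> b s (Suc l) = b' (Suc s) (Suc l)"
    and at: "\<And>s l. s \<le> m \<Longrightarrow> m \<le> s + l \<Longrightarrow> s + l \<le> M \<Longrightarrow> uncut S s l \<Longrightarrow>
         ract (dup (Suc l) (m - s)) (b s (Suc l)) = b' s (Suc (Suc l))"
    and M: "m \<le> M"
  shows "ract (dup (Suc M) m) (bprod b S 0 0 M) = bprod b' S' 0 0 (Suc M)"
proof -
  \<comment> \<open>Three positions of the current block: in \<open>G1\<close> it starts after
    \<open>m\<close>, in \<open>G2\<close> it contains \<open>m\<close>, in \<open>G3\<close> it has
    not passed \<open>m\<close> yet, which is the initial situation.\<close>
  have G1: "m < s \<Longrightarrow> s + l + n \<le> M \<Longrightarrow> uncut S s l \<Longrightarrow> bprod b S s l n = bprod b' S' (Suc s) l n" for s l n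
  proof (induction n arbitrary: s l)
    case 0
    then show ?case using after by simp
  next
    case (Suc n)
    then show ?case
      using S(3)[of "s + l"] after[of s l] Suc.IH[of s "Suc l"] Suc.IH[of "Suc (s + l)" 0] by (auto simp: uncut_Suc)
  qed
  have G2: "s \<le> m \<Longrightarrow> m \<le> s + l \<Longrightarrow> s + l + n \<le> M \<Longrightarrow> uncut S s l \<Longrightarrow>
      ract (dup (Suc (l + n)) (m - s)) (bprod b S s l n) = bprod b' S' s (Suc l) n" for s l n
  proof (induction n arbitrary: s l)
    case 0
    then show ?case using at by simp
  next
    case (Suc n)
    show ?case
    proof (cases "S (s + l)")
      case True
      have c: "b s (Suc l) \<in> topspace (Op (Suc l))" "bprod b S (Suc (s + l)) 0 n \<in> topspace (Op (Suc n))"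
        using closed bprod_closed[OF closed, of "Suc (s + l)" 0 n] Suc.prems by (auto simp: block_closed_def)
      have "ract (dup (Suc l + Suc n) (m - s)) (a2 (Suc l) (Suc n) (b s (Suc l)) (bprod b S (Suc (s + l)) 0 n))
        = a2 (Suc (Suc l)) (Suc n) (ract (dup (Suc l) (m - s)) (b s (Suc l))) (bprod b S (Suc (s + l)) 0 n)"
        by (rule ract_dup_a2_left[OF c]) (use Suc.prems in auto)
      then show ?thesis
        using True S(3)[of "s + l"] Suc.prems at[of s l] G1[of "Suc (s + l)" 0 n] by simp
    next
      case False
      then show ?thesis using Suc.IH[of s "Suc l"] Suc.prems S(3)[of "s + l"] by (simp add: uncut_Suc)
    qed
  qed
  have G3: "s + l \<le> m \<Longrightarrow> m \<le> s + l + n \<Longrightarrow> s + l + n \<le> M \<Longrightarrow> uncut S s l \<Longrightarrow>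
      ract (dup (Suc (l + n)) (m - s)) (bprod b S s l n) = bprod b' S' s l (Suc n)" for s l n
  proof (induction n arbitrary: s l)
    case 0
    then show ?case using G2[of s l 0] S(1) by simp
  next
    case (Suc n)
    show ?case
    proof (cases "s + l = m")
      case True
      then show ?thesis using G2[of s l "Suc n"] S(1) Suc.prems by simp
    next
      case False
      then have lt: "s + l < m" using Suc.prems by simp
      show ?thesis
      proof (cases "S (s + l)")
        case True
        have c: "b s (Suc l) \<in> topspace (Op (Suc l))" "bprod b S (Suc (s + l)) 0 n \<in> topspace (Op (Suc n))"
          using closed bprod_closed[OF closed, of "Suc (s + l)" 0 n] Suc.prems by (auto simp: block_closed_def)
        have "ract (dup (Suc l + Suc n) (m - s)) (a2 (Suc l) (Suc n) (b s (Suc l)) (bprod b S (Suc (s + l)) 0 n))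
          = a2 (Suc l) (Suc (Suc n)) (b s (Suc l)) (ract (dup (Suc n) (m - s - Suc l)) (bprod b S (Suc (s + l)) 0 n))"
          by (rule ract_dup_a2_right[OF c]) (use Suc.prems lt in auto)
        moreover have "m - s - Suc l = m - Suc (s + l)" by simp
        ultimately show ?thesis
          using True S(2)[OF lt] Suc.prems before[OF lt] Suc.IH[of "Suc (s + l)" 0] lt by simp
      next
        case False
        then show ?thesis using Suc.IH[of s "Suc l"] Suc.prems S(2)[OF lt] lt by (simp add: uncut_Suc)
      qed
    qed
  qed
  show ?thesis using G3[of 0 0 M] M by simp
qed

end

section \<open>Families of functions of gaps and times\<close>

definition sh :: "nat \<Rightarrow> (nat \<Rightarrow> real) \<Rightarrow> nat \<Rightarrow> real" where
  "sh k f = (\<lambda>i. f (k + i))"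

definition del :: "nat \<Rightarrow> (nat \<Rightarrow> real) \<Rightarrow> nat \<Rightarrow> real" where
  "del m f = (\<lambda>i. if i < m then f i else f (Suc i))"

text \<open>Times agree across a gap below 1 because such a gap is a coordinate inside one cube
  factor, and a factor carries a single time. A gap equal to 1 may lie inside a factor or between
  two factors.\<close>

definition inZ :: "nat \<Rightarrow> (nat \<Rightarrow> real) \<Rightarrow> (nat \<Rightarrow> real) \<Rightarrow> bool" where
  "inZ n y t \<longleftrightarrow> (\<forall>i. Suc i < n \<longrightarrow> 0 \<le> y i \<and> y i \<le> 1 \<and> t i \<le> t (Suc i) \<and> (y i < 1 \<longrightarrow> t i = t (Suc i)))
     \<and> (\<forall>i<n. 0 \<le> t i \<and> t i \<le> 1)"

lemma inZ_sh: "inZ (k + n) y t \<Longrightarrow> inZ n (sh k y) (sh k t)"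
  by (auto simp: inZ_def sh_def)

lemma inZ_take: "inZ n y t \<Longrightarrow> m \<le> n \<Longrightarrow> inZ m y t"
  by (auto simp: inZ_def)

text \<open>A gap of width 0 forces its two end points to share their time, so forgetting either of
  them gives the same configuration.\<close>

lemma inZ_del:
  assumes "inZ (Suc n) y t" "m < n" "y m = 0"
  shows "inZ n (del m y) (del m t)"
proof -
  have "t m = t (Suc m)" using assms by (auto simp: inZ_def)
  show ?thesis
    unfolding inZ_def
  proof (intro conjI allI impI)
    fix i assume i: "Suc i < n"
    then have "Suc i < Suc n" "Suc (Suc i) < Suc n" by auto
    with assms(1) have "0 \<le> y i \<and> y i \<le> 1 \<and> t i \<le> t (Suc i) \<and> (y i < 1 \<longrightarrow> t i = t (Suc i))"
      "0 \<le> y (Suc i) \<and> y (Suc i) \<le> 1 \<and> t (Suc i) \<le> t (Suc (Suc i)) \<and> (y (Suc i) < 1 \<longrightarrow> t (Suc i) = t (Suc (Suc i)))"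
      unfolding inZ_def by blast+
    note zi = this
    consider "Suc i < m" | "Suc i = m" | "m \<le> i" by linarith
    then have "0 \<le> del m y i \<and> del m y i \<le> 1 \<and> del m t i \<le> del m t (Suc i) \<and> (del m y i < 1 \<longrightarrow> del m t i = del m t (Suc i))"
      using \<open>t m = t (Suc m)\<close> zi by cases (auto simp: del_def)
    then show "0 \<le> del m y i" "del m y i \<le> 1" "del m t i \<le> del m t (Suc i)" "del m y i < 1 \<Longrightarrow> del m t i = del m t (Suc i)"
      by blast+
  next
    fix i assume "i < n"
    then show "0 \<le> del m t i" "del m t i \<le> 1" using assms(1) by (auto simp: del_def inZ_def)
  qed
qed

lemma inZ_mono: "inZ n y t \<Longrightarrow> i \<le> j \<Longrightarrow> j < n \<Longrightarrow> t i \<le> t j"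
proof (induction j)
  case (Suc j)
  then show ?case by (cases "i = Suc j") (auto simp: inZ_def intro: order_trans)
qed simp

context assoc_bimod begin

text \<open>The structure is imposed on generators: one unit on the left, one on the right, one
  doubling. The two unit clauses discard the gap next to the unit, so a gap between points that are
  both at time 0, or both at time 1, is irrelevant, as in the quotient.\<close>

definition weave :: "(nat \<Rightarrow> (nat \<Rightarrow> real) \<Rightarrow> (nat \<Rightarrow> real) \<Rightarrow> 'a) \<Rightarrow> bool" where
  "weave H \<longleftrightarrow>
    (\<forall>n y t. inZ n y t \<longrightarrow> H n y t \<in> topspace (Op n)) \<and>
    (\<forall>n y t y' t'. (\<forall>i. Suc i < n \<longrightarrow> y i = y' i) \<longrightarrow> (\<forall>i<n. t i = t' i) \<longrightarrow> H n y t = H n y' t') \<and>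
    (\<forall>n y t. inZ (Suc n) y t \<longrightarrow> t 0 = 0 \<longrightarrow> H (Suc n) y t = a2 1 n (eta 1) (H n (sh 1 y) (sh 1 t))) \<and>
    (\<forall>n y t. inZ (Suc n) y t \<longrightarrow> t n = 1 \<longrightarrow> H (Suc n) y t = a2 n 1 (H n y t) (eta 1)) \<and>
    (\<forall>n y t m. inZ (Suc n) y t \<longrightarrow> m < n \<longrightarrow> y m = 0 \<longrightarrow> H (Suc n) y t = ract (dup n m) (H n (del m y) (del m t)))"

definition normal :: "(nat \<Rightarrow> (nat \<Rightarrow> real) \<Rightarrow> (nat \<Rightarrow> real) \<Rightarrow> 'a) \<Rightarrow> bool" where
  "normal H \<longleftrightarrow> (\<forall>y t. H 0 y t = eta 0)"

definition strict :: "(nat \<Rightarrow> (nat \<Rightarrow> real) \<Rightarrow> (nat \<Rightarrow> real) \<Rightarrow> 'a) \<Rightarrow> bool" where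
  "strict H \<longleftrightarrow> (\<forall>m n y t. inZ (Suc m + Suc n) y t \<longrightarrow> y m = 1 \<longrightarrow>
     H (Suc m + Suc n) y t = a2 (Suc m) (Suc n) (H (Suc m) y t) (H (Suc n) (sh (Suc m) y) (sh (Suc m) t)))"

lemma weaveD:
  assumes "weave H"
  shows weave_closed: "inZ n y t \<Longrightarrow> H n y t \<in> topspace (Op n)"
    and weave_cong: "(\<And>i. Suc i < n \<Longrightarrow> y i = y' i) \<Longrightarrow> (\<And>i. i < n \<Longrightarrow> t i = t' i) \<Longrightarrow> H n y t = H n y' t'"
    and weave_left: "inZ (Suc n) y t \<Longrightarrow> t 0 = 0 \<Longrightarrow> H (Suc n) y t = a2 1 n (eta 1) (H n (sh 1 y) (sh 1 t))"
    and weave_right: "inZ (Suc n) y t \<Longrightarrow> t n = 1 \<Longrightarrow> H (Suc n) y t = a2 n 1 (H n y t) (eta 1)"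
    and weave_dup: "inZ (Suc n) y t \<Longrightarrow> m < n \<Longrightarrow> y m = 0 \<Longrightarrow> H (Suc n) y t = ract (dup n m) (H n (del m y) (del m t))"
      apply (use assms[unfolded weave_def, THEN conjunct1] in simp)
     apply (rule assms[unfolded weave_def, THEN conjunct2, THEN conjunct1, rule_format]; simp)
    apply (use assms[unfolded weave_def, THEN conjunct2, THEN conjunct2, THEN conjunct1] in simp)
   apply (use assms[unfolded weave_def, THEN conjunct2, THEN conjunct2, THEN conjunct2, THEN conjunct1] in simp)
  apply (use assms[unfolded weave_def, THEN conjunct2, THEN conjunct2, THEN conjunct2, THEN conjunct2] in simp)
  done

lemma weave_zero_left:
  assumes H: "weave H" "normal H"
  shows "inZ (Suc l + n) y t \<Longrightarrow> (\<And>i. i \<le> l \<Longrightarrow> t i = 0) \<Longrightarrow>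
    H (Suc l + n) y t = a2 (Suc l) n (eta (Suc l)) (H n (sh (Suc l) y) (sh (Suc l) t))"
proof (induction l arbitrary: y t)
  case 0
  then show ?case using weave_left[OF H(1)] by simp
next
  case (Suc l)
  have z: "inZ (Suc l + n) (sh 1 y) (sh 1 t)" using inZ_sh[of 1 "Suc l + n"] Suc.prems by simp
  have zn: "inZ n (sh (Suc (Suc l)) y) (sh (Suc (Suc l)) t)" using inZ_sh[of "Suc (Suc l)" n] Suc.prems by simp
  have "H (Suc (Suc l + n)) y t = a2 1 (Suc l + n) (eta 1) (H (Suc l + n) (sh 1 y) (sh 1 t))"
    by (rule weave_left[OF H(1)]) (use Suc.prems in auto)
  also have "H (Suc l + n) (sh 1 y) (sh 1 t) = a2 (Suc l) n (eta (Suc l)) (H n (sh (Suc l) (sh 1 y)) (sh (Suc l) (sh 1 t)))"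
    by (rule Suc.IH[OF z]) (use Suc.prems in \<open>auto simp: sh_def\<close>)
  also have "sh (Suc l) (sh 1 y) = sh (Suc (Suc l)) y" by (simp add: sh_def)
  also have "sh (Suc l) (sh 1 t) = sh (Suc (Suc l)) t" by (simp add: sh_def)
  finally show ?case
    using a2_assoc[OF eta_closed[of 1] eta_closed[of "Suc l"] weave_closed[OF H(1) zn]] a2_eta[of 1 "Suc l"] by simp
qed

lemma weave_zeros:
  assumes H: "weave H" "normal H" "inZ (Suc l) y t" "\<And>i. i \<le> l \<Longrightarrow> t i = 0"
  shows "H (Suc l) y t = eta (Suc l)"
  using weave_zero_left[OF H(1,2), of l 0 y t] H a2_eta[of "Suc l" 0] by (simp add: normal_def)

lemma weave_one_right:
  assumes H: "weave H" "normal H"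
  shows "inZ (m + Suc l) y t \<Longrightarrow> (\<And>i. m \<le> i \<Longrightarrow> i \<le> m + l \<Longrightarrow> t i = 1) \<Longrightarrow>
    H (m + Suc l) y t = a2 m (Suc l) (H m y t) (eta (Suc l))"
proof (induction l)
  case 0
  then show ?case using weave_right[OF H(1)] by simp
next
  case (Suc l)
  have z: "inZ (m + Suc l) y t" "inZ m y t" using inZ_take Suc.prems by force+
  have "H (Suc (m + Suc l)) y t = a2 (m + Suc l) 1 (H (m + Suc l) y t) (eta 1)"
    by (rule weave_right[OF H(1)]) (use Suc.prems in auto)
  also have "H (m + Suc l) y t = a2 m (Suc l) (H m y t) (eta (Suc l))"
    by (rule Suc.IH[OF z(1)]) (use Suc.prems in auto)
  finally show ?case
    using a2_assoc[OF weave_closed[OF H(1) z(2)] eta_closed[of "Suc l"] eta_closed[of 1]] a2_eta[of "Suc l" 1] by simp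
qed

lemma weave_ones:
  assumes H: "weave H" "normal H" "inZ (Suc l) y t" "\<And>i. i \<le> l \<Longrightarrow> t i = 1"
  shows "H (Suc l) y t = eta (Suc l)"
  using weave_one_right[OF H(1,2), of 0 l y t] H a2_eta[of 0 "Suc l"] by (simp add: normal_def)

text \<open>The factorisation available without strictness: units split off at the extreme times,
  and by normality a block lying entirely at time 0 or at time 1 has a unit as its value.\<close>

lemma normal_cut:
  assumes H: "weave H" "normal H" and z: "inZ (Suc l + Suc l') y t"
    and "(\<forall>i\<le>l. t i = 0) \<or> (\<forall>i. l < i \<longrightarrow> i \<le> Suc (l + l') \<longrightarrow> t i = 1)"
  shows "H (Suc l + Suc l') y t = a2 (Suc l) (Suc l') (H (Suc l) y t) (H (Suc l') (sh (Suc l) y) (sh (Suc l) t))"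
  using assms(4)
proof
  assume "\<forall>i\<le>l. t i = 0"
  then show ?thesis using weave_zero_left[OF H z] weave_zeros[OF H, of l y t] inZ_take[OF z] by simp
next
  assume one: "\<forall>i. l < i \<longrightarrow> i \<le> Suc (l + l') \<longrightarrow> t i = 1"
  then have "H (Suc l') (sh (Suc l) y) (sh (Suc l) t) = eta (Suc l')"
    by (intro weave_ones[OF H] inZ_sh[OF z]) (auto simp: sh_def)
  then show ?thesis using weave_one_right[OF H z] one by simp
qed

end

section \<open>Moving times across a wide gap\<close>

text \<open>\<open>push s e\<close> is the largest time allowed to a point whose right neighbour, at distance \<open>e\<close>, has time \<open>s\<close>:
  \<open>s\<close> itself for \<open>e \<le> 1\<close>, decreasing to \<open>max 0 (2 * s - 1)\<close> at \<open>e = 2\<close>, and \<open>1\<close>, that is no restriction, at \<open>e = 3\<close>.\<close>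
definition push :: "real \<Rightarrow> real \<Rightarrow> real" where
  "push s e = max (min 1 (max 0 (2 - e)) * s) (max (min 1 (max 0 (e - 2))) (2 * s - 1))"

lemma push_le: "0 \<le> s \<Longrightarrow> s \<le> 1 \<Longrightarrow> e \<le> 2 \<Longrightarrow> push s e \<le> s"
  by (auto simp: push_def mult_left_le_one_le)

lemma push_id: "0 \<le> s \<Longrightarrow> s \<le> 1 \<Longrightarrow> e \<le> 1 \<Longrightarrow> push s e = s"
  by (auto simp: push_def)

lemma push_1: "push 1 e = 1"
  by (auto simp: push_def)

lemma push_3: "0 \<le> s \<Longrightarrow> s \<le> 1 \<Longrightarrow> push s 3 = 1"
  by (auto simp: push_def)

lemma push_2: "push s 2 = max 0 (2 * s - 1)"
  by (auto simp: push_def)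

lemma push_bounds: "0 \<le> s \<Longrightarrow> s \<le> 1 \<Longrightarrow> 0 \<le> push s e \<and> push s e \<le> 1"
  by (auto simp: push_def le_max_iff_disj intro!: mult_le_one)

text \<open>Computed from the right end, \<open>r\<close> being the number of points from
  \<open>i\<close> on. The value 1 beyond the last point leaves that point unconstrained, because
  \<open>push 1 e = 1\<close>.\<close>

primrec tq :: "(nat \<Rightarrow> real) \<Rightarrow> (nat \<Rightarrow> real) \<Rightarrow> nat \<Rightarrow> nat \<Rightarrow> real" where
  "tq e t i 0 = 1"
| "tq e t i (Suc r) = min (t i) (push (tq e t (Suc i) r) (e i))"

definition tm :: "nat \<Rightarrow> (nat \<Rightarrow> real) \<Rightarrow> (nat \<Rightarrow> real) \<Rightarrow> nat \<Rightarrow> real" where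
  "tm n e t i = tq e t i (n - i)"

lemma tm_rec: "i < n \<Longrightarrow> tm n e t i = min (t i) (push (tm n e t (Suc i)) (e i))"
  by (cases "n - i") (auto simp: tm_def simp del: diff_Suc dest: Suc_diff_Suc)

lemma tm_end: "n \<le> i \<Longrightarrow> tm n e t i = 1"
  by (simp add: tm_def)

lemma tm_sh: "tm n (sh k e) (sh k t) i = tm (k + n) e t (k + i)"
proof -
  have "tq (sh k e) (sh k t) i r = tq e t (k + i) r" for r
    by (induction r arbitrary: i) (auto simp: sh_def)
  then show ?thesis by (simp add: tm_def)
qed

lemma tm_bounds:
  assumes "\<And>i. i < n \<Longrightarrow> 0 \<le> t i"
  shows "0 \<le> tm n e t i \<and> tm n e t i \<le> 1"
proof (cases "i \<le> n")
  case True
  then show ?thesis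
  proof (induction i rule: inc_induct)
    case base
    then show ?case by (simp add: tm_end)
  next
    case (step i)
    then show ?case using assms[of i] push_bounds[of "tm n e t (Suc i)" "e i"] by (auto simp: tm_rec)
  qed
qed (simp add: tm_end)

lemma tm_le: "i < n \<Longrightarrow> tm n e t i \<le> t i"
  by (simp add: tm_rec)

lemma tm_mono:
  assumes "\<And>i. i < n \<Longrightarrow> 0 \<le> t i" "i < n" "e i \<le> 2"
  shows "tm n e t i \<le> tm n e t (Suc i)"
  using push_le[of "tm n e t (Suc i)" "e i"] tm_bounds[OF assms(1), where e=e and i="Suc i"] assms by (simp add: tm_rec)

text \<open>For \<open>e i \<le> 1\<close> \<open>push\<close> is the identity, and the right
  neighbour already stays below the common value of \<open>t\<close>; the new minimum is then
  attained by the neighbour's time.\<close>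

lemma tm_eq:
  assumes "\<And>i. i < n \<Longrightarrow> 0 \<le> t i" "Suc i < n" "e i \<le> 1" "t i = t (Suc i)"
  shows "tm n e t i = tm n e t (Suc i)"
proof -
  have "0 \<le> tm n e t (Suc i) \<and> tm n e t (Suc i) \<le> 1" by (rule tm_bounds) (use assms in auto)
  then have "push (tm n e t (Suc i)) (e i) = tm n e t (Suc i)" using push_id assms by simp
  then show ?thesis using tm_rec[of i n e t] tm_le[of "Suc i" n e t] assms by simp
qed

lemma tm_last: "t i \<le> 1 \<Longrightarrow> n = Suc i \<Longrightarrow> tm n e t i = t i"
  by (simp add: tm_rec tm_end push_1)

lemma tm_3:
  assumes "\<And>i. i < n \<Longrightarrow> 0 \<le> t i" "i < n" "e i = 3" "t i \<le> 1"
  shows "tm n e t i = t i"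
  using push_3 tm_bounds[OF assms(1), where e=e and i="Suc i"] assms by (simp add: tm_rec)

lemma tm_id:
  assumes z: "inZ n x t" and e: "\<And>i. Suc i < n \<Longrightarrow> e i \<le> 1"
  shows "i < n \<Longrightarrow> tm n e t i = t i"
proof -
  have "i \<le> n \<Longrightarrow> i < n \<longrightarrow> tm n e t i = t i"
  proof (induction i rule: inc_induct)
    case (step i)
    show ?case
    proof (cases "Suc i < n")
      case True
      then show ?thesis using step z e[OF True] push_id[of "t (Suc i)" "e i"] by (auto simp: tm_rec inZ_def)
    next
      case False
      then show ?thesis using tm_last[of t i n e] z step by (auto simp: inZ_def)
    qed
  qed simp
  then show "i < n \<Longrightarrow> tm n e t i = t i" by simp
qed

text \<open>Points beyond \<open>m\<close> act on those before it only through the value at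
  \<open>m\<close>. If that value is still \<open>t m\<close>, the left part is computed as if
  \<open>m\<close> were the last point.\<close>

lemma tm_cut_off:
  assumes "m < n" "tm n e t m = t m" "t m \<le> 1" "i \<le> m"
  shows "tm n e t i = tm (Suc m) e t i"
  using assms(4)
proof (induction i rule: inc_induct)
  case base
  then show ?case using assms tm_last[of t m "Suc m" e] by simp
next
  case (step i)
  then show ?case using assms(1) by (simp add: tm_rec)
qed

lemma tm_cong:
  assumes "\<And>i. Suc i < n \<Longrightarrow> e i = e' i" "\<And>i. i < n \<Longrightarrow> t i = t' i"
  shows "tm n e t i = tm n e' t' i"
proof (cases "i \<le> n")
  case True
  then show ?thesis
  proof (induction i rule: inc_induct)
    case (step i)
    then show ?case using assms by (cases "Suc i < n") (simp_all add: tm_rec tm_end push_1)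
  qed (simp add: tm_end)
qed (simp add: tm_end)

text \<open>The two points at distance 0 get equal pushed times, so every remaining point reads the
  same bound from its right neighbour in both recursions.\<close>

lemma tm_del:
  assumes t: "\<And>i. i < Suc n \<Longrightarrow> 0 \<le> t i" and m: "m < n" "e m = 0" "t m = t (Suc m)"
  shows "tm n (del m e) (del m t) i = del m (tm (Suc n) e t) i"
proof -
  have eq: "tm (Suc n) e t m = tm (Suc n) e t (Suc m)"
    by (rule tm_eq) (use assms in auto)
  show ?thesis
  proof (cases "i \<le> n")
    case True
    then show ?thesis
    proof (induction i rule: inc_induct)
      case base
      then show ?case using m by (simp add: tm_end del_def)
    next
      case (step i)
      consider "Suc i < m" | "Suc i = m" | "m \<le> i" by linarith
      then show ?case
      proof cases
        case 1
        then show ?thesis using step by (simp add: tm_rec[of i] del_def)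
      next
        case 2
        then show ?thesis using step eq tm_rec[of i "Suc n" e t] by (simp add: tm_rec[of i n] del_def)
      next
        case 3
        then show ?thesis using step tm_rec[of "Suc i" "Suc n" e t] by (simp add: tm_rec[of i n] del_def)
      qed
    qed
  qed (use m in \<open>simp add: tm_end del_def\<close>)
qed

section \<open>Stretched gaps, pushed and rescaled times\<close>

definition gp :: "real \<Rightarrow> (nat \<Rightarrow> real) \<Rightarrow> nat \<Rightarrow> real" where
  "gp \<alpha> x i = min 1 (\<alpha> * x i)"

text \<open>\<open>\<beta>\<close> rescales the pushed times so that late ones reach 1, and
  \<open>a\<close> interpolates back to the given times. The pushing sees the stretched gap
  \<open>\<alpha> * x i\<close> itself, whereas a weave is evaluated at its truncation
  \<open>gp\<close>.\<close>

definition sg :: "real \<Rightarrow> real \<Rightarrow> real \<Rightarrow> nat \<Rightarrow> (nat \<Rightarrow> real) \<Rightarrow> (nat \<Rightarrow> real) \<Rightarrow> nat \<Rightarrow> real" where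
  "sg \<alpha> \<beta> a n x t i = (1 - a) * min 1 (\<beta> * tm n (\<lambda>i. \<alpha> * x i) t i) + a * t i"

lemma gp_sh: "sh k (gp \<alpha> x) = gp \<alpha> (sh k x)"
  by (simp add: sh_def gp_def fun_eq_iff)

lemma sg_sh: "sg \<alpha> \<beta> a n (sh k x) (sh k t) i = sg \<alpha> \<beta> a (k + n) x t (k + i)"
  using tm_sh[of n k "\<lambda>i. \<alpha> * x i" t i] by (simp add: sg_def sh_def)

lemma gp_del: "del m (gp \<alpha> x) = gp \<alpha> (del m x)"
  by (simp add: del_def gp_def fun_eq_iff)

lemma sg_del:
  assumes "inZ (Suc n) x t" "m < n" "x m = 0"
  shows "sg \<alpha> \<beta> a n (del m x) (del m t) = del m (sg \<alpha> \<beta> a (Suc n) x t)"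
proof
  fix i
  have e: "(\<lambda>i. \<alpha> * del m x i) = del m (\<lambda>i. \<alpha> * x i)" by (simp add: del_def fun_eq_iff)
  have "tm n (del m (\<lambda>i. \<alpha> * x i)) (del m t) i = del m (tm (Suc n) (\<lambda>i. \<alpha> * x i) t) i"
    by (rule tm_del) (use assms in \<open>auto simp: inZ_def\<close>)
  then show "sg \<alpha> \<beta> a n (del m x) (del m t) i = del m (sg \<alpha> \<beta> a (Suc n) x t) i"
    unfolding sg_def e by (simp add: del_def)
qed

locale push_params =
  fixes \<alpha> \<beta> a :: real and n :: nat and x t :: "nat \<Rightarrow> real"
  assumes params: "1 \<le> \<alpha>" "\<alpha> \<le> 3" "1 \<le> \<beta>" "\<beta> \<le> 2" "0 \<le> a" "a \<le> 1"
    and z: "inZ n x t"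
begin

lemma t_bounds: "i < n \<Longrightarrow> 0 \<le> t i" "i < n \<Longrightarrow> t i \<le> 1"
  using z by (auto simp: inZ_def)

lemma tm_b: "0 \<le> tm n e t i" "tm n e t i \<le> 1"
  using tm_bounds[of n t e i] t_bounds by auto

lemma sg_bounds: "i < n \<Longrightarrow> 0 \<le> sg \<alpha> \<beta> a n x t i \<and> sg \<alpha> \<beta> a n x t i \<le> 1"
  unfolding sg_def using params t_bounds[of i] tm_b(1)[of "\<lambda>i. \<alpha> * x i" i]
  by (intro conjI add_nonneg_nonneg mult_nonneg_nonneg convex_bound_le) auto

lemma sg_mono:
  assumes "Suc i < n" "\<alpha> * x i \<le> 2"
  shows "sg \<alpha> \<beta> a n x t i \<le> sg \<alpha> \<beta> a n x t (Suc i)"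
proof -
  have "tm n (\<lambda>i. \<alpha> * x i) t i \<le> tm n (\<lambda>i. \<alpha> * x i) t (Suc i)"
    by (rule tm_mono) (use assms t_bounds in auto)
  then have "\<beta> * tm n (\<lambda>i. \<alpha> * x i) t i \<le> \<beta> * tm n (\<lambda>i. \<alpha> * x i) t (Suc i)"
    using params by (intro mult_left_mono) auto
  moreover have "t i \<le> t (Suc i)" using z assms by (auto simp: inZ_def)
  ultimately show ?thesis unfolding sg_def using params
    by (intro add_mono mult_left_mono min.mono) auto
qed

lemma sg_eq:
  assumes "Suc i < n" "\<alpha> * x i < 1"
  shows "sg \<alpha> \<beta> a n x t i = sg \<alpha> \<beta> a n x t (Suc i)"
proof -
  have "0 \<le> x i" using z assms by (auto simp: inZ_def)
  then have "1 * x i \<le> \<alpha> * x i" using params by (intro mult_right_mono) auto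
  then have "t i = t (Suc i)" using z assms by (auto simp: inZ_def)
  moreover then have "tm n (\<lambda>i. \<alpha> * x i) t i = tm n (\<lambda>i. \<alpha> * x i) t (Suc i)"
    by (intro tm_eq) (use assms t_bounds in auto)
  ultimately show ?thesis by (simp add: sg_def)
qed

lemma x_bounds: "Suc i < n \<Longrightarrow> 0 \<le> x i \<and> x i \<le> 1"
  using z by (auto simp: inZ_def)

text \<open>Up to stretched width 2 \<open>push\<close> only lowers times, which keeps them ordered
  inside a block; for \<open>a = 1\<close> the times are the given ones, which are ordered
  already.\<close>

lemma block_inZ:
  assumes "s + l < n" "a = 1 \<or> (\<forall>i. s \<le> i \<longrightarrow> i < s + l \<longrightarrow> \<alpha> * x i \<le> 2)"
  shows "inZ (Suc l) (sh s (gp \<alpha> x)) (sh s (sg \<alpha> \<beta> a n x t))"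
  unfolding inZ_def
proof (intro conjI allI impI)
  fix i assume i: "Suc i < Suc l"
  then have si: "Suc (s + i) < n" using assms by simp
  show "0 \<le> sh s (gp \<alpha> x) i" using x_bounds[OF si] params by (simp add: sh_def gp_def)
  show "sh s (gp \<alpha> x) i \<le> 1" by (simp add: sh_def gp_def)
  have "sg \<alpha> \<beta> a n x t (s + i) \<le> sg \<alpha> \<beta> a n x t (Suc (s + i))"
    using assms(2)
  proof
    assume "a = 1"
    then show ?thesis using z si by (simp add: sg_def inZ_def)
  next
    assume "\<forall>i. s \<le> i \<longrightarrow> i < s + l \<longrightarrow> \<alpha> * x i \<le> 2"
    then show ?thesis using sg_mono[OF si] i by simp
  qed
  then show "sh s (sg \<alpha> \<beta> a n x t) i \<le> sh s (sg \<alpha> \<beta> a n x t) (Suc i)"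
    by (simp add: sh_def)
  assume "sh s (gp \<alpha> x) i < 1"
  then have "\<alpha> * x (s + i) < 1" by (auto simp: sh_def gp_def)
  then show "sh s (sg \<alpha> \<beta> a n x t) i = sh s (sg \<alpha> \<beta> a n x t) (Suc i)"
    using sg_eq[OF si] by (simp add: sh_def)
next
  fix i assume "i < Suc l"
  then have "s + i < n" using assms by simp
  then show "0 \<le> sh s (sg \<alpha> \<beta> a n x t) i" "sh s (sg \<alpha> \<beta> a n x t) i \<le> 1"
    using sg_bounds by (simp_all add: sh_def)
qed

lemma sg_zero: "i < n \<Longrightarrow> t i = 0 \<Longrightarrow> sg \<alpha> \<beta> a n x t i = 0"
  using tm_le[of i n "\<lambda>i. \<alpha> * x i" t] tm_b(1)[of "\<lambda>i. \<alpha> * x i" i] by (simp add: sg_def)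

lemma sg_last_one: "n = Suc i \<Longrightarrow> t i = 1 \<Longrightarrow> sg \<alpha> \<beta> a n x t i = 1"
  using tm_last[of t i n "\<lambda>i. \<alpha> * x i"] params by (simp add: sg_def)

lemma tm_mono_block:
  assumes "\<And>i. s \<le> i \<Longrightarrow> i < s + l \<Longrightarrow> \<alpha> * x i \<le> 2" "s + l < n" "s \<le> i" "i \<le> j" "j \<le> s + l"
  shows "tm n (\<lambda>i. \<alpha> * x i) t i \<le> tm n (\<lambda>i. \<alpha> * x i) t j"
  using assms(4,5)
proof (induction j)
  case (Suc j)
  show ?case
  proof (cases "i = Suc j")
    case False
    have "tm n (\<lambda>i. \<alpha> * x i) t j \<le> tm n (\<lambda>i. \<alpha> * x i) t (Suc j)"
      by (rule tm_mono) (use assms Suc False t_bounds in auto)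
    then show ?thesis using Suc False by simp
  qed simp
qed simp

end

section \<open>The pushed family of a weave\<close>

context assoc_bimod begin

definition blk :: "(nat \<Rightarrow> (nat \<Rightarrow> real) \<Rightarrow> (nat \<Rightarrow> real) \<Rightarrow> 'a) \<Rightarrow> (nat \<Rightarrow> real) \<Rightarrow> (nat \<Rightarrow> real) \<Rightarrow> nat \<Rightarrow> nat \<Rightarrow> 'a" where
  "blk H y t s l = H l (sh s y) (sh s t)"

lemma blk_sh: "blk H (sh k y) (sh k t) s l = blk H y t (k + s) l"
  by (simp add: blk_def sh_def add.assoc)

definition pushed ::
  "real \<Rightarrow> real \<Rightarrow> real \<Rightarrow> (nat \<Rightarrow> (nat \<Rightarrow> real) \<Rightarrow> (nat \<Rightarrow> real) \<Rightarrow> 'a) \<Rightarrow> nat \<Rightarrow> (nat \<Rightarrow> real) \<Rightarrow> (nat \<Rightarrow> real) \<Rightarrow> 'a" where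
  "pushed \<alpha> \<beta> a H n x t = (case n of 0 \<Rightarrow> eta 0 | Suc m \<Rightarrow>
     bprod (blk H (gp \<alpha> x) (sg \<alpha> \<beta> a n x t)) (\<lambda>i. 2 \<le> \<alpha> * x i) 0 0 m)"

text \<open>The last clause lists the two situations in which a cut at stretched width 2 is
  legitimate: the weave is strict and factors at every gap of width 1, or the times are the pushed
  ones, doubled as soon as a stretched gap can reach 2.\<close>

definition push_ok :: "real \<Rightarrow> real \<Rightarrow> real \<Rightarrow> (nat \<Rightarrow> (nat \<Rightarrow> real) \<Rightarrow> (nat \<Rightarrow> real) \<Rightarrow> 'a) \<Rightarrow> bool" where
  "push_ok \<alpha> \<beta> a H \<longleftrightarrow> weave H \<and> normal H \<and> 1 \<le> \<alpha> \<and> \<alpha> \<le> 3 \<and> 1 \<le> \<beta> \<and> \<beta> \<le> 2 \<and> 0 \<le> a \<and> a \<le> 1 \<and>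
     (strict H \<or> a = 0 \<and> (2 \<le> \<alpha> \<longrightarrow> \<beta> = 2))"

lemma push_ok_params: "push_ok \<alpha> \<beta> a H \<Longrightarrow> inZ n x t \<Longrightarrow> push_params \<alpha> \<beta> a n x t"
  by (simp add: push_ok_def push_params_def)

lemma blk_closed:
  assumes ok: "push_ok \<alpha> \<beta> a H" and z: "inZ (Suc M) x t"
    and S: "a = 1 \<or> (\<forall>i<M. \<not> S i \<longrightarrow> \<alpha> * x i \<le> 2)"
  shows "block_closed (blk H (gp \<alpha> x) (sg \<alpha> \<beta> a (Suc M) x t)) S M"
  unfolding block_closed_def blk_def
proof (intro allI impI)
  fix s l assume sl: "s + l \<le> M" "uncut S s l"
  interpret push_params \<alpha> \<beta> a "Suc M" x t using push_ok_params[OF ok z] .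
  show "H (Suc l) (sh s (gp \<alpha> x)) (sh s (sg \<alpha> \<beta> a (Suc M) x t)) \<in> topspace (Op (Suc l))"
    by (rule weave_closed[OF _ block_inZ]) (use ok sl S in \<open>auto simp: push_ok_def uncut_def\<close>)
qed

text \<open>Both reasons for a block to factor in one statement: strictness at a stretched gap of at
  least 1, which \<open>gp\<close> truncates to 1, or the extreme times that
  \<open>normal_cut\<close> asks for.\<close>

lemma blk_cut_gen:
  assumes ok: "push_ok \<alpha> \<beta> a H" and z: "inZ (Suc M) x t"
    and S: "a = 1 \<or> (\<forall>i<M. \<not> S i \<longrightarrow> \<alpha> * x i \<le> 2)"
    and cut: "strict H \<and> 1 \<le> \<alpha> * x m \<or> (\<forall>s l. s \<le> m \<longrightarrow> m < s + l \<longrightarrow> s + l \<le> M \<longrightarrow> uncut S s l \<longrightarrow>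
       (\<forall>i. s \<le> i \<longrightarrow> i \<le> m \<longrightarrow> sg \<alpha> \<beta> a (Suc M) x t i = 0) \<or> (\<forall>i. m < i \<longrightarrow> i \<le> s + l \<longrightarrow> sg \<alpha> \<beta> a (Suc M) x t i = 1))"
  shows "block_cut (blk H (gp \<alpha> x) (sg \<alpha> \<beta> a (Suc M) x t)) S M m"
  unfolding block_cut_def
proof (intro allI impI)
  fix s l l' assume sl: "s + l = m" "Suc (m + l') \<le> M" "uncut S s (Suc (l + l'))"
  interpret push_params \<alpha> \<beta> a "Suc M" x t using push_ok_params[OF ok z] .
  let ?y = "sh s (gp \<alpha> x)" and ?t = "sh s (sg \<alpha> \<beta> a (Suc M) x t)"
  have "inZ (Suc (Suc (l + l'))) ?y ?t"
    by (rule block_inZ) (use sl S in \<open>auto simp: uncut_def\<close>)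
  then have zz: "inZ (Suc l + Suc l') ?y ?t" by simp
  have sh2: "sh (Suc l) (sh s f) = sh (Suc m) f" for f using sl by (simp add: sh_def add.assoc[symmetric])
  have "H (Suc l + Suc l') ?y ?t = a2 (Suc l) (Suc l') (H (Suc l) ?y ?t) (H (Suc l') (sh (Suc l) ?y) (sh (Suc l) ?t))"
  proof (cases "strict H \<and> 1 \<le> \<alpha> * x m")
    case True
    then have "?y l = 1" using sl by (simp add: sh_def gp_def)
    then show ?thesis using True zz unfolding strict_def by blast
  next
    case False
    then have "(\<forall>i. s \<le> i \<longrightarrow> i \<le> m \<longrightarrow> sg \<alpha> \<beta> a (Suc M) x t i = 0) \<or>
        (\<forall>i. m < i \<longrightarrow> i \<le> s + Suc (l + l') \<longrightarrow> sg \<alpha> \<beta> a (Suc M) x t i = 1)"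
    proof -
      have "\<forall>s l. s \<le> m \<longrightarrow> m < s + l \<longrightarrow> s + l \<le> M \<longrightarrow> uncut S s l \<longrightarrow>
         (\<forall>i. s \<le> i \<longrightarrow> i \<le> m \<longrightarrow> sg \<alpha> \<beta> a (Suc M) x t i = 0) \<or> (\<forall>i. m < i \<longrightarrow> i \<le> s + l \<longrightarrow> sg \<alpha> \<beta> a (Suc M) x t i = 1)"
        using False cut by blast
      from this[THEN spec, THEN spec, of s "Suc (l + l')"] show ?thesis using sl by simp
    qed
    then have "(\<forall>i\<le>l. ?t i = 0) \<or> (\<forall>i. l < i \<longrightarrow> i \<le> Suc (l + l') \<longrightarrow> ?t i = 1)"
      using sl by (auto simp: sh_def)
    then show ?thesis by (intro normal_cut zz) (use ok in \<open>auto simp: push_ok_def\<close>)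
  qed
  then show "blk H (gp \<alpha> x) (sg \<alpha> \<beta> a (Suc M) x t) s (Suc (Suc (l + l'))) =
      a2 (Suc l) (Suc l') (blk H (gp \<alpha> x) (sg \<alpha> \<beta> a (Suc M) x t) s (Suc l)) (blk H (gp \<alpha> x) (sg \<alpha> \<beta> a (Suc M) x t) (Suc m) (Suc l'))"
    by (simp add: blk_def sh2)
qed

text \<open>At a gap with \<open>\<alpha> * x m = 2\<close> the point \<open>m\<close> has time \<open>max 0 (2 * T - 1)\<close> at most, \<open>T\<close> being the time of its
  right neighbour: either everything to the left in its block sits at \<open>0\<close>, or \<open>T\<close> is at least \<open>1 / 2\<close> and
  is rescaled to \<open>1\<close>.\<close>
lemma blk_cut_2:
  assumes ok: "push_ok \<alpha> \<beta> a H" and z: "inZ (Suc M) x t"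
    and S: "\<forall>i<M. \<not> S i \<longrightarrow> \<alpha> * x i \<le> 2" and m: "m < M" "2 \<le> \<alpha> * x m" "\<not> S m"
  shows "block_cut (blk H (gp \<alpha> x) (sg \<alpha> \<beta> a (Suc M) x t)) S M m"
proof (cases "strict H")
  case True
  then show ?thesis by (intro blk_cut_gen[OF ok z]) (use S m in auto)
next
  case False
  interpret push_params \<alpha> \<beta> a "Suc M" x t using push_ok_params[OF ok z] .
  \<comment> \<open>An uncut gap has stretched width at most 2, so it is exactly 2 here. As gaps are
    at most 1, this gives \<open>2 \<le> \<alpha>\<close>, and \<open>push_ok\<close> then provides
    \<open>\<beta> = 2\<close>.\<close>
  have am: "\<alpha> * x m = 2" using S m by force
  have "x m \<le> 1" "0 \<le> x m" using x_bounds[of m] m by auto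
  then have "\<alpha> * x m \<le> \<alpha>" using params by (simp add: mult_left_le)
  then have ab: "a = 0" "\<beta> = 2" using ok False am by (auto simp: push_ok_def)
  let ?tm = "tm (Suc M) (\<lambda>i. \<alpha> * x i) t"
  have tmm: "?tm m = min (t m) (max 0 (2 * ?tm (Suc m) - 1))"
    using m am by (simp add: tm_rec[of m] push_2)
  have cut: "(\<forall>i. s \<le> i \<longrightarrow> i \<le> m \<longrightarrow> sg \<alpha> \<beta> a (Suc M) x t i = 0) \<or> (\<forall>i. m < i \<longrightarrow> i \<le> s + l \<longrightarrow> sg \<alpha> \<beta> a (Suc M) x t i = 1)"
    if sl: "s \<le> m" "m < s + l" "s + l \<le> M" "uncut S s l" for s l
  proof -
    have le2: "\<alpha> * x i \<le> 2" if "s \<le> i" "i < s + l" for i using that sl S by (auto simp: uncut_def)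
    have mono: "?tm i \<le> ?tm j" if "s \<le> i" "i \<le> j" "j \<le> s + l" for i j
      by (rule tm_mono_block[of s l]) (use le2 that sl in auto)
    show ?thesis
    proof (cases "?tm (Suc m) \<le> 1 / 2")
      case True
      then have "?tm m \<le> 0" using tmm by auto
      then have "?tm i = 0" if "s \<le> i" "i \<le> m" for i
        using mono[OF that(1,2)] sl tm_b(1)[of "\<lambda>i. \<alpha> * x i" i] by simp
      then show ?thesis using ab by (simp add: sg_def)
    next
      case False
      then have "1 / 2 \<le> ?tm i" if "m < i" "i \<le> s + l" for i
        using mono[of "Suc m" i] that sl by simp
      then have "sg \<alpha> \<beta> a (Suc M) x t i = 1" if "m < i" "i \<le> s + l" for i
        using that ab by (fastforce simp: sg_def min_def)
      then show ?thesis by blast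
    qed
  qed
  show ?thesis by (rule blk_cut_gen[OF ok z]) (use S cut in auto)
qed

text \<open>By \<open>blk_cut_2\<close> a gap of stretched width exactly 2 may count as cut or as
  uncut. The cut set can therefore be held constant on closed pieces of the configuration
  space.\<close>

lemma pushed_refine:
  assumes ok: "push_ok \<alpha> \<beta> a H" and z: "inZ (Suc M) x t"
    and S: "\<And>i. i < M \<Longrightarrow> S i \<Longrightarrow> 2 \<le> \<alpha> * x i" "\<And>i. i < M \<Longrightarrow> \<not> S i \<Longrightarrow> \<alpha> * x i \<le> 2"
  shows "pushed \<alpha> \<beta> a H (Suc M) x t = bprod (blk H (gp \<alpha> x) (sg \<alpha> \<beta> a (Suc M) x t)) S 0 0 M"
proof -
  have "bprod (blk H (gp \<alpha> x) (sg \<alpha> \<beta> a (Suc M) x t)) S 0 0 M =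
      bprod (blk H (gp \<alpha> x) (sg \<alpha> \<beta> a (Suc M) x t)) (\<lambda>i. 2 \<le> \<alpha> * x i) 0 0 M"
    by (rule bprod_refine[OF blk_closed[OF ok z]]) (use S blk_cut_2[OF ok z] in auto)
  then show ?thesis by (simp add: pushed_def)
qed

lemma pushed_insert:
  assumes ok: "push_ok \<alpha> \<beta> a H" and z: "inZ (Suc M) x t" and m: "m < M"
    and cut: "(\<forall>i\<le>m. sg \<alpha> \<beta> a (Suc M) x t i = 0) \<or> (\<forall>i. m < i \<longrightarrow> i \<le> M \<longrightarrow> sg \<alpha> \<beta> a (Suc M) x t i = 1)"
  shows "pushed \<alpha> \<beta> a H (Suc M) x t = bprod (blk H (gp \<alpha> x) (sg \<alpha> \<beta> a (Suc M) x t)) (\<lambda>i. 2 \<le> \<alpha> * x i \<or> i = m) 0 0 M"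
proof -
  have "bprod (blk H (gp \<alpha> x) (sg \<alpha> \<beta> a (Suc M) x t)) (\<lambda>i. 2 \<le> \<alpha> * x i) 0 0 M =
      bprod (blk H (gp \<alpha> x) (sg \<alpha> \<beta> a (Suc M) x t)) (\<lambda>i. 2 \<le> \<alpha> * x i \<or> i = m) 0 0 M"
  proof (rule bprod_refine[OF blk_closed[OF ok z]])
    fix k assume "2 \<le> \<alpha> * x k \<or> k = m" "\<not> 2 \<le> \<alpha> * x k" "k < M"
    then have "k = m" by simp
    show "block_cut (blk H (gp \<alpha> x) (sg \<alpha> \<beta> a (Suc M) x t)) (\<lambda>i. 2 \<le> \<alpha> * x i) M k"
      unfolding \<open>k = m\<close> by (rule blk_cut_gen[OF ok z]) (use cut in auto)
  qed auto
  then show ?thesis by (simp add: pushed_def)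
qed

text \<open>\<open>eq\<close> grants the cut at \<open>m\<close>, and \<open>left\<close> says that
  the points up to \<open>m\<close> do not feel those beyond it. The right part never feels the left
  one, since times are computed from the right.\<close>

lemma pushed_split:
  assumes ok: "push_ok \<alpha> \<beta> a H" and z: "inZ (Suc M) x t"
    and S: "\<And>i. S i \<longleftrightarrow> 2 \<le> \<alpha> * x i \<or> i = m" and M: "M = m + Suc k"
    and eq: "pushed \<alpha> \<beta> a H (Suc M) x t = bprod (blk H (gp \<alpha> x) (sg \<alpha> \<beta> a (Suc M) x t)) S 0 0 M"
    and left: "\<And>i. i \<le> m \<Longrightarrow> sg \<alpha> \<beta> a (Suc M) x t i = sg \<alpha> \<beta> a (Suc m) x t i"
  shows "pushed \<alpha> \<beta> a H (Suc M) x t =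
    a2 (Suc m) (Suc k) (pushed \<alpha> \<beta> a H (Suc m) x t) (pushed \<alpha> \<beta> a H (Suc k) (sh (Suc m) x) (sh (Suc m) t))"
proof -
  let ?b = "blk H (gp \<alpha> x) (sg \<alpha> \<beta> a (Suc M) x t)"
  have "bprod ?b S 0 0 (m + Suc k) = a2 (Suc (0 + m)) (Suc k) (bprod ?b S 0 0 m) (bprod ?b S (Suc (0 + 0 + m)) 0 k)"
    by (rule bprod_split[OF blk_closed[OF ok z]]) (use S M in auto)
  moreover have "bprod ?b S 0 0 m = pushed \<alpha> \<beta> a H (Suc m) x t"
  proof -
    have "bprod ?b S 0 0 m = bprod (blk H (gp \<alpha> x) (sg \<alpha> \<beta> a (Suc m) x t)) (\<lambda>i. 2 \<le> \<alpha> * x i) 0 0 m"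
    proof (rule bprod_cong[where M = m])
      fix s l assume sl: "s + l \<le> m" "uncut S s l"
      show "?b s (Suc l) = blk H (gp \<alpha> x) (sg \<alpha> \<beta> a (Suc m) x t) s (Suc l)"
        unfolding blk_def by (rule weave_cong) (use ok left sl in \<open>auto simp: push_ok_def sh_def\<close>)
    qed (use S in auto)
    then show ?thesis by (simp add: pushed_def)
  qed
  moreover have "bprod ?b S (Suc m) 0 k = pushed \<alpha> \<beta> a H (Suc k) (sh (Suc m) x) (sh (Suc m) t)"
  proof -
    have sgsh: "sg \<alpha> \<beta> a (Suc k) (sh (Suc m) x) (sh (Suc m) t) = sh (Suc m) (sg \<alpha> \<beta> a (Suc M) x t)"
      using M by (simp add: sg_sh fun_eq_iff) (simp add: sh_def)
    have "bprod ?b S (Suc m) 0 k = bprod (\<lambda>s. ?b (Suc m + s)) (\<lambda>i. S (Suc m + i)) 0 0 k"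
      using bprod_shift[of ?b "Suc m" S 0 0 k] by simp
    also have "\<dots> = bprod (blk H (gp \<alpha> (sh (Suc m) x)) (sg \<alpha> \<beta> a (Suc k) (sh (Suc m) x) (sh (Suc m) t)))
        (\<lambda>i. 2 \<le> \<alpha> * sh (Suc m) x i) 0 0 k"
    proof (rule bprod_cong[where M = k])
      fix s l show "?b (Suc m + s) (Suc l) = blk H (gp \<alpha> (sh (Suc m) x)) (sg \<alpha> \<beta> a (Suc k) (sh (Suc m) x) (sh (Suc m) t)) s (Suc l)"
        by (simp only: sgsh gp_sh[symmetric] blk_sh)
    qed (use S in \<open>auto simp: sh_def\<close>)
    finally show ?thesis by (simp add: pushed_def)
  qed
  ultimately show ?thesis using eq M by simp
qed

lemma normal_pushed: "normal (pushed \<alpha> \<beta> a H)"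
  by (simp add: normal_def pushed_def)

lemma pushed_cong:
  assumes H: "weave H" and "\<And>i. Suc i < n \<Longrightarrow> x i = x' i" "\<And>i. i < n \<Longrightarrow> t i = t' i"
  shows "pushed \<alpha> \<beta> a H n x t = pushed \<alpha> \<beta> a H n x' t'"
proof (cases n)
  case (Suc M)
  have tm: "tm n (\<lambda>i. \<alpha> * x i) t i = tm n (\<lambda>i. \<alpha> * x' i) t' i" for i by (rule tm_cong) (use assms in auto)
  have "bprod (blk H (gp \<alpha> x) (sg \<alpha> \<beta> a n x t)) (\<lambda>i. 2 \<le> \<alpha> * x i) 0 0 M =
      bprod (blk H (gp \<alpha> x') (sg \<alpha> \<beta> a n x' t')) (\<lambda>i. 2 \<le> \<alpha> * x' i) 0 0 M"
  proof (rule bprod_cong[where M = M])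
    fix s l assume sl: "s + l \<le> M"
    show "blk H (gp \<alpha> x) (sg \<alpha> \<beta> a n x t) s (Suc l) = blk H (gp \<alpha> x') (sg \<alpha> \<beta> a n x' t') s (Suc l)"
      unfolding blk_def by (rule weave_cong[OF H]) (use assms sl Suc in \<open>auto simp: sh_def gp_def sg_def tm[unfolded Suc]\<close>)
  qed (use assms Suc in auto)
  then show ?thesis using Suc by (simp add: pushed_def)
qed (simp add: pushed_def)

lemma pushed_one: "pushed \<alpha> \<beta> a H (Suc 0) x t = H (Suc 0) (gp \<alpha> x) (sg \<alpha> \<beta> a (Suc 0) x t)"
  by (simp add: pushed_def blk_def sh_def)

text \<open>The unit clauses follow from an extra cut, after a first point at time 0 or before a
  last point at time 1. A doubled point lies inside one block, where the clause for \<open>H\<close>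
  applies.\<close>

lemma weave_pushed:
  assumes ok: "push_ok \<alpha> \<beta> a H"
  shows "weave (pushed \<alpha> \<beta> a H)"
  unfolding weave_def
proof (intro conjI allI impI)
  note H = ok[unfolded push_ok_def, THEN conjunct1] ok[unfolded push_ok_def, THEN conjunct2, THEN conjunct1]
  fix n y t y' t'
  show "inZ n y t \<Longrightarrow> pushed \<alpha> \<beta> a H n y t \<in> topspace (Op n)"
  proof (cases n)
    case (Suc M)
    assume z: "inZ n y t"
    show ?thesis
      using bprod_closed[OF blk_closed[OF ok z[unfolded Suc]], of "\<lambda>i. 2 \<le> \<alpha> * y i" 0 0 M] Suc by (simp add: pushed_def)
  qed (simp add: pushed_def)
  show "\<forall>i. Suc i < n \<longrightarrow> y i = y' i \<Longrightarrow> \<forall>i<n. t i = t' i \<Longrightarrow> pushed \<alpha> \<beta> a H n y t = pushed \<alpha> \<beta> a H n y' t'"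
    by (rule pushed_cong[OF H(1)]) auto
next
  note H = ok[unfolded push_ok_def, THEN conjunct1] ok[unfolded push_ok_def, THEN conjunct2, THEN conjunct1]
  fix n y t assume z: "inZ (Suc n) y t"
  interpret push_params \<alpha> \<beta> a "Suc n" y t using push_ok_params[OF ok z] .
  have one: "pushed \<alpha> \<beta> a H (Suc 0) y t = eta (Suc 0)" if "t 0 = 0 \<or> n = 0 \<and> t 0 = 1" "inZ (Suc 0) y t" for y t
  proof -
    interpret p: push_params \<alpha> \<beta> a "Suc 0" y t using push_ok_params[OF ok that(2)] .
    have zz: "inZ (Suc 0) (gp \<alpha> y) (sg \<alpha> \<beta> a (Suc 0) y t)" using p.block_inZ[of 0 0] by (simp add: sh_def)
    from that show ?thesis unfolding pushed_one
      using weave_zeros[OF H zz] weave_ones[OF H zz] p.sg_zero[of 0] p.sg_last_one[of 0] by auto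
  qed
  show "pushed \<alpha> \<beta> a H (Suc n) y t = a2 1 n (eta 1) (pushed \<alpha> \<beta> a H n (sh 1 y) (sh 1 t))" if t0: "t 0 = 0"
  proof (cases n)
    case 0
    then show ?thesis using one[of t y] z t0 a2_eta[of 1 0] by (simp add: pushed_def[of _ _ _ _ 0])
  next
    case (Suc k)
    have sg0: "sg \<alpha> \<beta> a (Suc n) y t 0 = 0" using sg_zero t0 by simp
    have z1: "inZ (Suc 0) y t" using inZ_take[OF z] by simp
    interpret p: push_params \<alpha> \<beta> a "Suc 0" y t using push_ok_params[OF ok z1] .
    have "pushed \<alpha> \<beta> a H (Suc n) y t = bprod (blk H (gp \<alpha> y) (sg \<alpha> \<beta> a (Suc n) y t)) (\<lambda>i. 2 \<le> \<alpha> * y i \<or> i = 0) 0 0 n"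
      by (rule pushed_insert[OF ok z]) (use sg0 Suc in auto)
    from pushed_split[OF ok z _ _ this, of 0 k] show ?thesis
      using one[of t y] z1 t0 Suc sg0 p.sg_zero by simp
  qed
  show "pushed \<alpha> \<beta> a H (Suc n) y t = a2 n 1 (pushed \<alpha> \<beta> a H n y t) (eta 1)" if tn: "t n = 1"
  proof (cases n)
    case 0
    then show ?thesis using one[of t y] z tn a2_eta[of 0 1] by (simp add: pushed_def[of _ _ _ _ 0])
  next
    case (Suc k)
    have sg0: "sg \<alpha> \<beta> a (Suc n) y t n = 1" using sg_last_one tn by simp
    have z1: "inZ (Suc 0) (sh n y) (sh n t)" using inZ_sh[of n 1] z by simp
    interpret p: push_params \<alpha> \<beta> a "Suc 0" "sh n y" "sh n t" using push_ok_params[OF ok z1] .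
    have tn': "tm (Suc n) (\<lambda>i. \<alpha> * y i) t n = 1" using tn tm_last[of t n "Suc n"] by simp
    \<comment> \<open>A last point at time 1 imposes no bound, so the others are pushed as if it
      were absent.\<close>
    have tms: "tm (Suc n) (\<lambda>i. \<alpha> * y i) t i = tm n (\<lambda>i. \<alpha> * y i) t i" if "i \<le> n" for i
      using that by (induction i rule: inc_induct) (simp_all add: tn' tm_end tm_rec)
    have "pushed \<alpha> \<beta> a H (Suc n) y t = bprod (blk H (gp \<alpha> y) (sg \<alpha> \<beta> a (Suc n) y t)) (\<lambda>i. 2 \<le> \<alpha> * y i \<or> i = k) 0 0 n"
    proof (rule pushed_insert[OF ok z])
      show "(\<forall>i\<le>k. sg \<alpha> \<beta> a (Suc n) y t i = 0) \<or> (\<forall>i>k. i \<le> n \<longrightarrow> sg \<alpha> \<beta> a (Suc n) y t i = 1)"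
        using sg0 Suc by (metis le_antisym Suc_leI)
    qed (use Suc in simp)
    then have "pushed \<alpha> \<beta> a H (Suc n) y t = a2 (Suc k) (Suc 0) (pushed \<alpha> \<beta> a H (Suc k) y t)
        (pushed \<alpha> \<beta> a H (Suc 0) (sh (Suc k) y) (sh (Suc k) t))"
      by (intro pushed_split[OF ok z]) (use Suc tms in \<open>auto simp: sg_def\<close>)
    moreover have "pushed \<alpha> \<beta> a H (Suc 0) (sh (Suc k) y) (sh (Suc k) t) = eta (Suc 0)"
      unfolding pushed_one
      by (rule weave_ones[OF H]) (use p.block_inZ[of 0 0] p.sg_last_one[of 0] tn Suc in \<open>auto simp: sh_def\<close>)
    ultimately show ?thesis using Suc by simp
  qed
next
  note H = ok[unfolded push_ok_def, THEN conjunct1] ok[unfolded push_ok_def, THEN conjunct2, THEN conjunct1]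
  fix n y t m assume z: "inZ (Suc n) y t" and m: "m < n" "y m = 0"
  obtain M where n: "n = Suc M" using m by (cases n) auto
  let ?y = "del m y" and ?t = "del m t"
  have z': "inZ (Suc M) ?y ?t" using inZ_del[OF z m] n by simp
  let ?b = "blk H (gp \<alpha> ?y) (sg \<alpha> \<beta> a (Suc M) ?y ?t)" and ?b' = "blk H (gp \<alpha> y) (sg \<alpha> \<beta> a (Suc n) y t)"
  let ?S = "\<lambda>i. 2 \<le> \<alpha> * ?y i" and ?S' = "\<lambda>i. 2 \<le> \<alpha> * y i"
  interpret p: push_params \<alpha> \<beta> a "Suc n" y t using push_ok_params[OF ok z] .
  have sgd: "sg \<alpha> \<beta> a (Suc M) ?y ?t = del m (sg \<alpha> \<beta> a (Suc n) y t)" using sg_del[OF z m] n by simp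
  have "ract (dup (Suc M) m) (bprod ?b ?S 0 0 M) = bprod ?b' ?S' 0 0 (Suc M)"
  proof (rule bprod_dup[OF blk_closed[OF ok z']])
    show "\<not> 2 \<le> \<alpha> * y m" using m by simp
    fix i show "i < m \<Longrightarrow> ?S i = ?S' i" "m \<le> i \<Longrightarrow> ?S i = ?S' (Suc i)" by (simp_all add: del_def)
  next
    fix s l assume "s + l < m" "s + l \<le> M"
    then show "?b s (Suc l) = ?b' s (Suc l)"
      unfolding blk_def sgd gp_del[symmetric] by (intro weave_cong[OF H(1)]) (auto simp: sh_def del_def)
  next
    fix s l assume "m < s" "s + l \<le> M"
    then show "?b s (Suc l) = ?b' (Suc s) (Suc l)"
      unfolding blk_def sgd gp_del[symmetric] by (intro weave_cong[OF H(1)]) (auto simp: sh_def del_def)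
  next
    fix s l assume sl: "s \<le> m" "m \<le> s + l" "s + l \<le> M" and u: "uncut ?S s l"
    \<comment> \<open>The gaps of an uncut block are stretched to less than 2 and the new gap is 0,
      so the block stays legal after the doubling.\<close>
    have le: "\<alpha> * y i \<le> 2" if "s \<le> i" "i < s + Suc l" for i
    proof -
      consider "i < m" | "i = m" | "m < i" by linarith
      then show ?thesis
      proof cases
        case 1
        then show ?thesis using u that sl by (auto simp: uncut_def del_def)
      next
        case 3
        then obtain j where j: "i = Suc j" "m \<le> j" by (cases i) auto
        then have "\<not> 2 \<le> \<alpha> * del m y j" using u that sl by (auto simp: uncut_def)
        then show ?thesis using j by (simp add: del_def)
      qed (use m in simp)
    qed
    have zz: "inZ (Suc (Suc l)) (sh s (gp \<alpha> y)) (sh s (sg \<alpha> \<beta> a (Suc n) y t))"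
      by (rule p.block_inZ) (use sl n le in auto)
    have d: "del (m - s) (sh s f) = sh s (del m f)" for f
      using sl by (auto simp: sh_def del_def fun_eq_iff)
    have "?b' s (Suc (Suc l)) = ract (dup (Suc l) (m - s)) (H (Suc l) (del (m - s) (sh s (gp \<alpha> y))) (del (m - s) (sh s (sg \<alpha> \<beta> a (Suc n) y t))))"
      unfolding blk_def by (rule weave_dup[OF H(1) zz]) (use sl m in \<open>auto simp: sh_def gp_def\<close>)
    then show "ract (dup (Suc l) (m - s)) (?b s (Suc l)) = ?b' s (Suc (Suc l))"
      unfolding blk_def sgd gp_del[symmetric] d by simp
  qed (use m n in auto)
  then show "pushed \<alpha> \<beta> a H (Suc n) y t = ract (dup n m) (pushed \<alpha> \<beta> a H n ?y ?t)"
    using n by (simp add: pushed_def)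
qed

text \<open>A gap of width 1 is stretched to 3. It is cut, and at width 3 \<open>push\<close>
  imposes no bound, so both sides are pushed independently of each other.\<close>

lemma strict_pushed:
  assumes ok: "push_ok 3 \<beta> a H"
  shows "strict (pushed 3 \<beta> a H)"
  unfolding strict_def
proof (intro allI impI)
  fix m n y t assume z: "inZ (Suc m + Suc n) y t" and ym: "y m = 1"
  define M where "M = m + Suc n"
  have z': "inZ (Suc M) y t" using z by (simp add: M_def)
  interpret push_params 3 \<beta> a "Suc M" y t using push_ok_params[OF ok z'] .
  have tmm: "tm (Suc M) (\<lambda>i. 3 * y i) t m = t m"
    by (rule tm_3) (use t_bounds ym in \<open>auto simp: M_def\<close>)
  have "pushed 3 \<beta> a H (Suc M) y t = a2 (Suc m) (Suc n) (pushed 3 \<beta> a H (Suc m) y t)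
      (pushed 3 \<beta> a H (Suc n) (sh (Suc m) y) (sh (Suc m) t))"
  proof (rule pushed_split[OF ok z'])
    show "pushed 3 \<beta> a H (Suc M) y t = bprod (blk H (gp 3 y) (sg 3 \<beta> a (Suc M) y t)) (\<lambda>i. 2 \<le> 3 * y i) 0 0 M"
      by (simp add: pushed_def)
    fix i assume "i \<le> m"
    then have "tm (Suc M) (\<lambda>i. 3 * y i) t i = tm (Suc m) (\<lambda>i. 3 * y i) t i"
      by (intro tm_cut_off) (use tmm t_bounds in \<open>auto simp: M_def\<close>)
    then show "sg 3 \<beta> a (Suc M) y t i = sg 3 \<beta> a (Suc m) y t i" by (simp add: sg_def)
  qed (use ym M_def in auto)
  then show "pushed 3 \<beta> a H (Suc m + Suc n) y t = a2 (Suc m) (Suc n) (pushed 3 \<beta> a H (Suc m) y t)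
      (pushed 3 \<beta> a H (Suc n) (sh (Suc m) y) (sh (Suc m) t))" by (simp add: M_def)
qed

text \<open>The stretched gaps stay at most 1, so nothing is cut, lowered or rescaled.\<close>

lemma pushed_trivial:
  assumes H: "weave H" "normal H" and z: "inZ n y t"
  shows "pushed 1 1 0 H n y t = H n y t"
proof (cases n)
  case 0
  then show ?thesis using H by (simp add: pushed_def normal_def)
next
  case (Suc M)
  have "pushed 1 1 0 H n y t = blk H (gp 1 y) (sg 1 1 0 n y t) 0 (Suc (0 + M))"
    unfolding pushed_def Suc nat.case by (rule bprod_uncut) (use z Suc in \<open>force simp: uncut_def inZ_def\<close>)
  also have "\<dots> = H n y t"
    unfolding blk_def Suc add_0
  proof (rule weave_cong[OF H(1)])
    fix i assume "i < Suc M"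
    then have "tm n y t i = t i" by (intro tm_id[OF z]) (use z Suc in \<open>auto simp: inZ_def\<close>)
    then show "sh 0 (sg 1 1 0 (Suc M) y t) i = t i"
      using z \<open>i < Suc M\<close> Suc by (auto simp: sh_def sg_def inZ_def)
  qed (use z Suc in \<open>auto simp: sh_def gp_def inZ_def\<close>)
  finally show ?thesis .
qed

text \<open>For \<open>a = 1\<close> the times are the given ones, and a strict weave factors at all
  the cut gaps. Every cut can be undone, and the stretching of the gaps is all that remains.\<close>

lemma pushed_end:
  assumes H: "weave H" "normal H" "strict H" and z: "inZ n y t"
  shows "pushed 3 2 1 H n y t = H n (gp 3 y) t"
proof (cases n)
  case 0
  then show ?thesis using H by (simp add: pushed_def normal_def)
next
  case (Suc M)
  have ok: "push_ok 3 2 1 H" using H by (simp add: push_ok_def)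
  have z': "inZ (Suc M) y t" using z Suc by simp
  let ?b = "blk H (gp 3 y) (sg 3 2 1 (Suc M) y t)"
  have "bprod ?b (\<lambda>_. False) 0 0 M = bprod ?b (\<lambda>i. 2 \<le> 3 * y i) 0 0 M"
    by (rule bprod_refine[OF blk_closed[OF ok z']]) (use H in \<open>auto intro!: blk_cut_gen[OF ok z']\<close>)
  moreover have "bprod ?b (\<lambda>_. False) 0 0 M = ?b 0 (Suc (0 + M))"
    by (rule bprod_uncut) (simp add: uncut_def)
  moreover have "?b 0 (Suc (0 + M)) = H n (gp 3 y) t"
    unfolding blk_def Suc by (simp add: sh_def sg_def)
  ultimately show ?thesis using Suc by (simp add: pushed_def)
qed

end

section \<open>Closed covers, and the distance of the times from 0 and 1\<close>

lemma closedin_le: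
  assumes "continuous_map X euclideanreal f" "continuous_map X euclideanreal g"
  shows "closedin X {z \<in> topspace X. f z \<le> g z}"
proof -
  have "closedin X {z \<in> topspace X. g z - f z \<in> {0..}}"
    by (rule closedin_continuous_map_preimage) (use assms in \<open>auto intro: continuous_intros\<close>)
  then show ?thesis by simp
qed

lemma closedin_all_less:
  fixes M :: nat
  assumes "\<And>i. i < M \<Longrightarrow> closedin X {z \<in> topspace X. P i z}"
  shows "closedin X {z \<in> topspace X. \<forall>i<M. P i z}"
  using assms
proof (induction M)
  case (Suc M)
  have "{z \<in> topspace X. \<forall>i<Suc M. P i z} = {z \<in> topspace X. \<forall>i<M. P i z} \<inter> {z \<in> topspace X. P M z}"
    by (auto simp: less_Suc_eq)
  then show ?case using Suc by auto
qed simp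

lemma continuous_map_closed_cover:
  assumes "finite I" "\<And>i. i \<in> I \<Longrightarrow> closedin X {z \<in> topspace X. P i z}"
    and "\<And>i. i \<in> I \<Longrightarrow> continuous_map (subtopology X {z \<in> topspace X. P i z}) Y g"
    and "\<And>z. z \<in> topspace X \<Longrightarrow> \<exists>i\<in>I. P i z"
  shows "continuous_map X Y g"
  by (rule pasting_lemma_closed[of I X "\<lambda>i. {z \<in> topspace X. P i z}" Y "\<lambda>_. g"]) (use assms in \<open>auto simp: Bex_def\<close>)

text \<open>For times in \<open>[0, 1]\<close> this is the sup distance from the configurations
  whose times are all 0 or 1.\<close>

primrec dd :: "(nat \<Rightarrow> real) \<Rightarrow> nat \<Rightarrow> real" where
  "dd t 0 = 0"
| "dd t (Suc n) = max (dd t n) (min (t n) (1 - t n))"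

lemma dd_le: "dd t n \<le> r \<longleftrightarrow> 0 \<le> r \<and> (\<forall>i<n. min (t i) (1 - t i) \<le> r)"
  by (induction n) (auto simp: less_Suc_eq)

lemma dd_nonneg: "0 \<le> dd t n"
  by (induction n) auto

lemma dd_ge: "i < n \<Longrightarrow> min (t i) (1 - t i) \<le> dd t n"
  using dd_le[of t n "dd t n"] by auto

text \<open>The maximum depends only on the set of times, apart from those contributing nothing
  positive. This treats the removal of a unit and of a doubled point alike.\<close>

lemma dd_eqI:
  assumes "\<And>i. i < n \<Longrightarrow> min (t i) (1 - t i) \<le> 0 \<or> (\<exists>j<m. t i = u j)"
    and "\<And>j. j < m \<Longrightarrow> \<exists>i<n. u j = t i"
  shows "dd t n = dd u m"
proof (rule antisym)
  show "dd t n \<le> dd u m"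
    unfolding dd_le[of t] using dd_nonneg[of u m] assms(1) dd_ge[of _ m u] by fastforce
  show "dd u m \<le> dd t n"
    unfolding dd_le[of u] using dd_nonneg[of t n] assms(2) dd_ge[of _ n t] by fastforce
qed

text \<open>The number of points on the side of time 0; by monotonicity these come first.
  \<open>renorm\<close> uses the count where every time is within 1/3 of 0 or 1, and there it is
  locally constant.\<close>

primrec pc :: "(nat \<Rightarrow> real) \<Rightarrow> nat \<Rightarrow> nat" where
  "pc t 0 = 0"
| "pc t (Suc n) = pc t n + (if t n < 1 / 2 then 1 else 0)"

lemma pc_unique: "(\<And>i. i < n \<Longrightarrow> t i < 1 / 2 \<longleftrightarrow> i < p) \<Longrightarrow> pc t n = min p n"
proof (induction n)
  case (Suc n)
  then have "pc t n = min p n" by simp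
  moreover have "t n < 1 / 2 \<longleftrightarrow> n < p" using Suc.prems by simp
  ultimately show ?case by auto
qed simp

lemma pc_le: "pc t n \<le> n"
  by (induction n) auto

lemma pc_iff: "inZ n y t \<Longrightarrow> i < n \<Longrightarrow> t i < 1 / 2 \<longleftrightarrow> i < pc t n"
proof (induction n)
  case (Suc n)
  show ?case
  proof (cases "t n < 1 / 2")
    case True
    then have "t j < 1 / 2" if "j < Suc n" for j using inZ_mono[OF Suc.prems(1), of j n] that by simp
    then have "pc t (Suc n) = min (Suc n) (Suc n)" by (intro pc_unique) simp
    then show ?thesis using \<open>\<And>j. j < Suc n \<Longrightarrow> t j < 1 / 2\<close>[of i] Suc.prems by simp
  next
    case False
    have z: "inZ n y t" using inZ_take[OF Suc.prems(1)] by simp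
    show ?thesis
    proof (cases "i = n")
      case True
      then show ?thesis using False pc_le[of t n] by simp
    next
      case i: False
      then show ?thesis using Suc.IH[OF z] Suc.prems False by simp
    qed
  qed
qed simp

lemma pc_sh: "pc t (Suc n) = (if t 0 < 1 / 2 then 1 else 0) + pc (sh 1 t) n"
  by (induction n) (auto simp: sh_def)

lemma pc_del: "m < n \<Longrightarrow> t m = t (Suc m) \<Longrightarrow> pc t (Suc n) = pc (del m t) n + (if t m < 1 / 2 then 1 else 0)"
proof (induction n)
  case (Suc n)
  show ?case
  proof (cases "m = n")
    case True
    have "pc (del m t) m = pc t m"
    proof -
      have "k \<le> m \<Longrightarrow> pc (del m t) k = pc t k" for k by (induction k) (auto simp: del_def)
      then show ?thesis by simp
    qed
    then show ?thesis using True Suc.prems by (simp add: del_def)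
  next
    case False
    then have "pc t (Suc n) = pc (del m t) n + (if t m < 1 / 2 then 1 else 0)" using Suc by simp
    then show ?thesis using False Suc.prems by (simp add: del_def)
  qed
qed simp

section \<open>Making a family normal\<close>

text \<open>Collapses \<open>[0, s / 3]\<close> to 0 and \<open>[1 - s / 3, 1]\<close> to 1 and is
  affine in between. For \<open>s \<le> 1\<close> the denominator is at least 1/3.\<close>

definition phi :: "real \<Rightarrow> real \<Rightarrow> real" where
  "phi s u = max 0 (min 1 ((u - s / 3) / (1 - 2 * s / 3)))"

lemma phi_bounds: "0 \<le> phi s u" "phi s u \<le> 1"
  by (auto simp: phi_def)

lemma phi_mono: "s \<le> 1 \<Longrightarrow> u \<le> v \<Longrightarrow> phi s u \<le> phi s v"
  unfolding phi_def by (intro max.mono min.mono divide_right_mono) auto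

lemma phi_id: "0 \<le> u \<Longrightarrow> u \<le> 1 \<Longrightarrow> phi 0 u = u"
  by (simp add: phi_def)

lemma phi_0: "s \<le> 1 \<Longrightarrow> u \<le> s / 3 \<Longrightarrow> phi s u = 0"
  unfolding phi_def by (intro max_absorb1 min.coboundedI2 divide_nonpos_nonneg) auto

lemma phi_1: "s \<le> 1 \<Longrightarrow> 1 - s / 3 \<le> u \<Longrightarrow> phi s u = 1"
proof -
  assume "s \<le> 1" "1 - s / 3 \<le> u"
  then have "1 \<le> (u - s / 3) / (1 - 2 * s / 3)" by (simp add: le_divide_eq)
  then show ?thesis by (simp add: phi_def)
qed

lemma inZ_phi: "inZ n y t \<Longrightarrow> s \<le> 1 \<Longrightarrow> inZ n y (\<lambda>i. phi s (t i))"
  unfolding inZ_def using phi_bounds phi_mono by auto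

context assoc_bimod begin

text \<open>If the first time is not 0 it is 1, and by monotonicity so is the last. A unit can thus
  always be split off at one end, until only the value for \<open>n = 0\<close> is left.\<close>

lemma weave_01:
  assumes H: "weave H"
  shows "inZ n y t \<Longrightarrow> (\<And>i. i < n \<Longrightarrow> t i = 0 \<or> t i = 1) \<Longrightarrow>
    H n y t = pad (pc t n) (n - pc t n) 0 (H 0 (\<lambda>_. 0) (\<lambda>_. 0))"
proof (induction n arbitrary: y t)
  case 0
  have "H 0 y t = H 0 (\<lambda>_. 0) (\<lambda>_. 0)" by (rule weave_cong[OF H]) auto
  moreover have "H 0 (\<lambda>_. 0) (\<lambda>_. 0) \<in> topspace (Op 0)" by (rule weave_closed[OF H]) (simp add: inZ_def)
  ultimately show ?case by (simp add: pad_0)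
next
  case (Suc n)
  have c: "H 0 (\<lambda>_. 0) (\<lambda>_. 0) \<in> topspace (Op 0)" by (rule weave_closed[OF H]) (simp add: inZ_def)
  show ?case
  proof (cases "t 0 = 0")
    case True
    have "H (Suc n) y t = a2 1 n (eta 1) (H n (sh 1 y) (sh 1 t))"
      by (rule weave_left[OF H]) (use Suc True in auto)
    also have "H n (sh 1 y) (sh 1 t) = pad (pc (sh 1 t) n) (n - pc (sh 1 t) n) 0 (H 0 (\<lambda>_. 0) (\<lambda>_. 0))"
      by (rule Suc.IH) (use inZ_sh[of 1 n] Suc.prems in \<open>auto simp: sh_def\<close>)
    finally show ?thesis
      using pad_left[OF c, of "pc (sh 1 t) n" "n - pc (sh 1 t) n"] pc_le[of "sh 1 t" n] True
      unfolding pc_sh by simp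
  next
    case False
    then have "t n = 1" using inZ_mono[OF Suc.prems(1), of 0 n] Suc.prems(2)[of 0] Suc.prems(2)[of n] by auto
    have "H (Suc n) y t = a2 n 1 (H n y t) (eta 1)"
      by (rule weave_right[OF H]) (use Suc \<open>t n = 1\<close> in auto)
    also have "H n y t = pad (pc t n) (n - pc t n) 0 (H 0 (\<lambda>_. 0) (\<lambda>_. 0))"
      by (rule Suc.IH) (use inZ_take[OF Suc.prems(1)] Suc.prems in auto)
    finally show ?thesis
      using pad_right[OF c, of "pc t n" "n - pc t n"] pc_le[of t n] \<open>t n = 1\<close> by (simp add: Suc_diff_le)
  qed
qed

text \<open>The collar \<open>3 * dd t n \<le> s\<close> around the configurations with all times 0
  or 1 carries the path \<open>c\<close>, from \<open>c 0\<close> on its boundary to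
  \<open>c s\<close> at its core; outside, \<open>H\<close> is read at squeezed times. The factor 3
  matches the thirds in \<open>phi\<close> and, for \<open>s \<le> 1\<close>, keeps the collar away
  from time 1/2.\<close>

definition renorm ::
  "real \<Rightarrow> (real \<Rightarrow> 'a) \<Rightarrow> (nat \<Rightarrow> (nat \<Rightarrow> real) \<Rightarrow> (nat \<Rightarrow> real) \<Rightarrow> 'a) \<Rightarrow> nat \<Rightarrow> (nat \<Rightarrow> real) \<Rightarrow> (nat \<Rightarrow> real) \<Rightarrow> 'a" where
  "renorm s c H n y t = (if 3 * dd t n \<le> s then pad (pc t n) (n - pc t n) 0 (c (s - 3 * dd t n))
     else H n y (\<lambda>i. phi s (t i)))"

text \<open>On the boundary of the collar \<open>phi s\<close> sends every time to 0 or 1, so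
  \<open>H\<close> is there its own value for \<open>n = 0\<close> padded by units, which is what
  \<open>c 0\<close> gives.\<close>

lemma renorm_glue:
  assumes H: "weave H" and s: "0 \<le> s" "s \<le> 1" and c: "c 0 = H 0 (\<lambda>_. 0) (\<lambda>_. 0)"
    and z: "inZ n y t" and eq: "3 * dd t n = s"
  shows "pad (pc t n) (n - pc t n) 0 (c (s - 3 * dd t n)) = H n y (\<lambda>i. phi s (t i))"
proof -
  let ?u = "\<lambda>i. phi s (t i)"
  have u: "?u i = (if t i < 1 / 2 then 0 else 1)" if "i < n" for i
  proof -
    have "min (t i) (1 - t i) \<le> s / 3" using dd_ge[OF that, of t] eq by simp
    then consider "t i \<le> s / 3" | "1 - s / 3 \<le> t i" by linarith
    then show ?thesis using phi_0[OF s(2)] phi_1[OF s(2)] s by cases auto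
  qed
  have "pc ?u n = min (pc t n) n"
    by (rule pc_unique) (use u pc_iff[OF z] in auto)
  then have "pc ?u n = pc t n" using pc_le[of t n] by simp
  then show ?thesis
    using weave_01[OF H inZ_phi[OF z s(2)]] u c eq by auto
qed

lemma renorm_0:
  assumes H: "weave H" and c: "c 0 = H 0 (\<lambda>_. 0) (\<lambda>_. 0)" and z: "inZ n y t"
  shows "renorm 0 c H n y t = H n y t"
proof -
  have "H n y (\<lambda>i. phi 0 (t i)) = H n y t"
    by (rule weave_cong[OF H]) (use z phi_id in \<open>auto simp: inZ_def\<close>)
  moreover have "renorm 0 c H n y t = H n y (\<lambda>i. phi 0 (t i))"
    using renorm_glue[of H 0 c n y t] H c z dd_nonneg[of t n] unfolding renorm_def by auto
  ultimately show ?thesis by simp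
qed

lemma normal_renorm: "0 \<le> s \<Longrightarrow> c s = eta 0 \<Longrightarrow> normal (renorm s c H)"
  by (simp add: normal_def renorm_def pad_0)

lemma weave_renorm:
  assumes H: "weave H" and s: "0 \<le> s" "s \<le> 1" and c: "\<And>r. 0 \<le> r \<Longrightarrow> r \<le> s \<Longrightarrow> c r \<in> topspace (Op 0)"
  shows "weave (renorm s c H)"
  unfolding weave_def
proof (intro conjI allI impI)
  fix n y t assume "inZ n y t"
  then show "renorm s c H n y t \<in> topspace (Op n)"
    using pad_closed[OF c[of "s - 3 * dd t n"], of "pc t n" "n - pc t n"] pc_le[of t n] dd_nonneg[of t n]
      weave_closed[OF H inZ_phi[OF _ s(2)]] by (auto simp: renorm_def)
next
  fix n y t y' t' assume e: "\<forall>i. Suc i < n \<longrightarrow> y i = (y' :: nat \<Rightarrow> real) i" "\<forall>i<n. t i = (t' :: nat \<Rightarrow> real) i"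
  have "dd t n = dd t' n" by (rule dd_eqI) (use e in auto)
  moreover have "k \<le> n \<Longrightarrow> pc t k = pc t' k" for k using e by (induction k) auto
  then have "pc t n = pc t' n" by simp
  moreover have "H n y (\<lambda>i. phi s (t i)) = H n y' (\<lambda>i. phi s (t' i))"
    by (rule weave_cong[OF H]) (use e in auto)
  ultimately show "renorm s c H n y t = renorm s c H n y' t'" by (simp add: renorm_def)
next
  fix n y t assume z: "inZ (Suc n) y t" and t0: "t 0 = 0"
  have d: "dd t (Suc n) = dd (sh 1 t) n"
  proof (rule dd_eqI)
    fix i assume "i < Suc n"
    then show "min (t i) (1 - t i) \<le> 0 \<or> (\<exists>j<n. t i = sh 1 t j)"
      using t0 by (cases i) (auto simp: sh_def)
  qed (auto simp: sh_def)
  have p: "pc t (Suc n) = Suc (pc (sh 1 t) n)" using t0 unfolding pc_sh by simp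
  have "H (Suc n) y (\<lambda>i. phi s (t i)) = a2 1 n (eta 1) (H n (sh 1 y) (sh 1 (\<lambda>i. phi s (t i))))"
    by (rule weave_left[OF H inZ_phi[OF z s(2)]]) (use t0 phi_0[OF s(2)] s in auto)
  moreover have "sh 1 (\<lambda>i. phi s (t i)) = (\<lambda>i. phi s (sh 1 t i))" by (simp add: sh_def)
  moreover have "pad (Suc (pc (sh 1 t) n)) (n - pc (sh 1 t) n) 0 (c (s - 3 * dd (sh 1 t) n)) =
      a2 1 n (eta 1) (pad (pc (sh 1 t) n) (n - pc (sh 1 t) n) 0 (c (s - 3 * dd (sh 1 t) n)))" if "3 * dd (sh 1 t) n \<le> s"
    using pad_left[OF c[of "s - 3 * dd (sh 1 t) n"], of "pc (sh 1 t) n" "n - pc (sh 1 t) n"] pc_le[of "sh 1 t" n]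
      dd_nonneg[of "sh 1 t" n] that by simp
  ultimately show "renorm s c H (Suc n) y t = a2 1 n (eta 1) (renorm s c H n (sh 1 y) (sh 1 t))"
    unfolding renorm_def d p by simp
next
  fix n y t assume z: "inZ (Suc n) y t" and t1: "t n = 1"
  have d: "dd t (Suc n) = dd t n" using dd_nonneg[of t n] t1 by simp
  have p: "pc t (Suc n) = pc t n" using t1 by simp
  have "H (Suc n) y (\<lambda>i. phi s (t i)) = a2 n 1 (H n y (\<lambda>i. phi s (t i))) (eta 1)"
    by (rule weave_right[OF H inZ_phi[OF z s(2)]]) (use t1 phi_1[OF s(2)] s in auto)
  moreover have "pad (pc t n) (Suc n - pc t n) 0 (c (s - 3 * dd t n)) =
      a2 n 1 (pad (pc t n) (n - pc t n) 0 (c (s - 3 * dd t n))) (eta 1)" if "3 * dd t n \<le> s"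
    using pad_right[OF c[of "s - 3 * dd t n"], of "pc t n" "n - pc t n"] pc_le[of t n] dd_nonneg[of t n] that
    by (simp add: Suc_diff_le)
  ultimately show "renorm s c H (Suc n) y t = a2 n 1 (renorm s c H n y t) (eta 1)"
    unfolding renorm_def d p by simp
next
  fix n y t m assume z: "inZ (Suc n) y t" and m: "m < n" "y m = 0"
  then have tm: "t m = t (Suc m)" by (auto simp: inZ_def)
  have z': "inZ n (del m y) (del m t)" by (rule inZ_del[OF z m])
  have d: "dd t (Suc n) = dd (del m t) n"
  proof (rule dd_eqI)
    fix i assume i: "i < Suc n"
    have "\<exists>j<n. t i = del m t j"
    proof (cases "i \<le> m")
      case True
      then show ?thesis using m tm by (intro exI[of _ i]) (auto simp: del_def)
    next
      case False
      then have "\<not> i - 1 < m" "Suc (i - 1) = i" by auto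
      then have "del m t (i - 1) = t i" by (simp only: del_def if_False)
      then show ?thesis using i False by (intro exI[of _ "i - 1"]) auto
    qed
    then show "min (t i) (1 - t i) \<le> 0 \<or> (\<exists>j<n. t i = del m t j)" by simp
  next
    fix j assume "j < n"
    then show "\<exists>i<Suc n. del m t j = t i"
      by (intro exI[of _ "if j < m then j else Suc j"]) (auto simp: del_def)
  qed
  have p: "pc t (Suc n) = pc (del m t) n + (if t m < 1 / 2 then 1 else 0)" by (rule pc_del[OF m(1) tm])
  \<comment> \<open>Decides the side of the new unit: a doubled point near time 0 adds one to the
    left of the entry in \<open>Op 0\<close>, a doubled point near time 1 adds one to its
    right.\<close>
  have pm: "t m < 1 / 2 \<longleftrightarrow> m < pc (del m t) n" using pc_iff[OF z' m(1)] tm by (simp add: del_def)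
  have "H (Suc n) y (\<lambda>i. phi s (t i)) = ract (dup n m) (H n (del m y) (del m (\<lambda>i. phi s (t i))))"
    by (rule weave_dup[OF H inZ_phi[OF z s(2)] m])
  moreover have "del m (\<lambda>i. phi s (t i)) = (\<lambda>i. phi s (del m t i))" by (auto simp: del_def)
  moreover have "pad (pc t (Suc n)) (Suc n - pc t (Suc n)) 0 (c (s - 3 * dd (del m t) n)) =
      ract (dup n m) (pad (pc (del m t) n) (n - pc (del m t) n) 0 (c (s - 3 * dd (del m t) n)))" if "3 * dd (del m t) n \<le> s"
    using pad_dup[OF c[of "s - 3 * dd (del m t) n"], of m "pc (del m t) n" "n - pc (del m t) n"] pc_le[of "del m t" n] m
      dd_nonneg[of "del m t" n] that pm unfolding p by (auto simp: Suc_diff_le)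
  ultimately show "renorm s c H (Suc n) y t = ract (dup n m) (renorm s c H n (del m y) (del m t))"
    unfolding renorm_def d by simp
qed

text \<open>The shape that \<open>pushed\<close> reaches on a strict weave in
  \<open>pushed_end\<close>. Letting \<open>\<alpha>\<close> run from 3 to 1 leads back to the weave
  through strict ones.\<close>

definition stretch ::
  "real \<Rightarrow> (nat \<Rightarrow> (nat \<Rightarrow> real) \<Rightarrow> (nat \<Rightarrow> real) \<Rightarrow> 'a) \<Rightarrow> nat \<Rightarrow> (nat \<Rightarrow> real) \<Rightarrow> (nat \<Rightarrow> real) \<Rightarrow> 'a" where
  "stretch \<alpha> H n y t = H n (gp \<alpha> y) t"

lemma inZ_gp: "1 \<le> \<alpha> \<Longrightarrow> inZ n y t \<Longrightarrow> inZ n (gp \<alpha> y) t"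
proof -
  assume a: "1 \<le> \<alpha>" and z: "inZ n y t"
  have "t i = t (Suc i)" if "Suc i < n" "gp \<alpha> y i < 1" for i
  proof -
    have "0 \<le> y i" using z that by (auto simp: inZ_def)
    then have "1 * y i \<le> \<alpha> * y i" using a by (intro mult_right_mono) auto
    then have "y i < 1" using that by (auto simp: gp_def min_def split: if_splits)
    then show ?thesis using z that by (auto simp: inZ_def)
  qed
  then show ?thesis using z a by (auto simp: inZ_def gp_def)
qed

lemma weave_stretch:
  assumes H: "weave H" and a: "1 \<le> \<alpha>"
  shows "weave (stretch \<alpha> H)"
  unfolding weave_def stretch_def
proof (intro conjI allI impI)
  fix n y t y' t' assume "\<forall>i. Suc i < n \<longrightarrow> y i = (y' :: nat \<Rightarrow> real) i" "\<forall>i<n. t i = (t' :: nat \<Rightarrow> real) i"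
  then show "H n (gp \<alpha> y) t = H n (gp \<alpha> y') t'" by (intro weave_cong[OF H]) (auto simp: gp_def)
next
  fix n y t m assume z: "inZ (Suc n) y t" and m: "m < n" "y m = 0"
  then show "H (Suc n) (gp \<alpha> y) t = ract (dup n m) (H n (gp \<alpha> (del m y)) (del m t))"
    using weave_dup[OF H inZ_gp[OF a z] m(1)] by (simp add: gp_del) (simp add: gp_def)
qed (use weave_closed[OF H inZ_gp[OF a]] weave_left[OF H inZ_gp[OF a]] weave_right[OF H inZ_gp[OF a]] in \<open>auto simp: gp_sh\<close>)

lemma strict_stretch: "strict H \<Longrightarrow> 1 \<le> \<alpha> \<Longrightarrow> strict (stretch \<alpha> H)"
  unfolding strict_def stretch_def using inZ_gp by (auto simp: gp_sh) (simp add: gp_def gp_sh)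

lemma normal_stretch: "normal H \<Longrightarrow> normal (stretch \<alpha> H)"
  by (simp add: normal_def stretch_def)

lemma stretch_1: "weave H \<Longrightarrow> inZ n y t \<Longrightarrow> stretch 1 H n y t = H n y t"
  unfolding stretch_def by (rule weave_cong) (auto simp: gp_def inZ_def)

end

section \<open>Continuity of families in all variables\<close>

abbreviation Zset :: "nat \<Rightarrow> ((nat \<Rightarrow> real) \<times> (nat \<Rightarrow> real)) set" where
  "Zset n \<equiv> {(y, t). inZ n y t}"

lemma continuous_map_into_Zset:
  assumes "\<And>i. continuous_map Y euclideanreal (\<lambda>z. y z i)" "\<And>i. continuous_map Y euclideanreal (\<lambda>z. t z i)"
    and "\<And>z. z \<in> topspace Y \<Longrightarrow> inZ n (y z) (t z)"
  shows "continuous_map Y (top_of_set (Zset n)) (\<lambda>z. (y z, t z))"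
proof -
  have "continuous_map Y euclidean y" "continuous_map Y euclidean t"
    unfolding euclidean_product_topology[symmetric] continuous_map_componentwise_UNIV using assms by auto
  then have "continuous_map Y (prod_topology euclidean euclidean) (\<lambda>z. (y z, t z))"
    by (rule continuous_map_pairedI)
  then show ?thesis using assms(3) by (simp add: continuous_map_in_subtopology image_subset_iff)
qed

lemma continuous_map_coord:
  shows "continuous_map (top_of_set (Zset n)) euclideanreal (\<lambda>p. fst p i)"
    and "continuous_map (top_of_set (Zset n)) euclideanreal (\<lambda>p. snd p i)"
proof -
  have c: "continuous_map euclidean euclideanreal (\<lambda>f::nat \<Rightarrow> real. f i)"
    using continuous_map_product_projection[of i UNIV "\<lambda>_. euclideanreal"] by (simp add: euclidean_product_topology)
  have "continuous_map (prod_topology euclidean euclidean) euclideanreal ((\<lambda>f. f i) \<circ> fst)"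
    "continuous_map (prod_topology euclidean euclidean) euclideanreal ((\<lambda>f. f i) \<circ> snd)"
    by (rule continuous_map_compose[OF continuous_map_fst c] continuous_map_compose[OF continuous_map_snd c])+
  from this[unfolded o_def prod_topology_euclidean, THEN continuous_map_from_subtopology]
  show "continuous_map (top_of_set (Zset n)) euclideanreal (\<lambda>p. fst p i)"
    "continuous_map (top_of_set (Zset n)) euclideanreal (\<lambda>p. snd p i)" .
qed

context assoc_bimod begin

text \<open>Homotopies are built as families over a product of the unit interval with a function
  space. Joint continuity in parameter and coordinates is the form in which they pass to the mapping
  spaces.\<close>

definition weave_family :: "'b topology \<Rightarrow> ('b \<Rightarrow> nat \<Rightarrow> (nat \<Rightarrow> real) \<Rightarrow> (nat \<Rightarrow> real) \<Rightarrow> 'a) \<Rightarrow> bool" where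
  "weave_family A H \<longleftrightarrow> (\<forall>a\<in>topspace A. weave (H a)) \<and>
    (\<forall>n. continuous_map (prod_topology A (top_of_set (Zset n))) (Op n) (\<lambda>z. H (fst z) n (fst (snd z)) (snd (snd z))))"

lemma weave_family_cont:
  assumes H: "weave_family A H" and f: "continuous_map Y A f"
    and "\<And>i. continuous_map Y euclideanreal (\<lambda>z. y z i)" "\<And>i. continuous_map Y euclideanreal (\<lambda>z. t z i)"
    and "\<And>z. z \<in> topspace Y \<Longrightarrow> inZ n (y z) (t z)"
  shows "continuous_map Y (Op n) (\<lambda>z. H (f z) n (y z) (t z))"
proof -
  have "continuous_map Y (prod_topology A (top_of_set (Zset n))) (\<lambda>z. (f z, (y z, t z)))"
    by (intro continuous_map_pairedI f continuous_map_into_Zset assms)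
  moreover have "continuous_map (prod_topology A (top_of_set (Zset n))) (Op n) (\<lambda>z. H (fst z) n (fst (snd z)) (snd (snd z)))"
    using H by (simp add: weave_family_def)
  ultimately have "continuous_map Y (Op n) ((\<lambda>z. H (fst z) n (fst (snd z)) (snd (snd z))) \<circ> (\<lambda>z. (f z, (y z, t z))))"
    by (rule continuous_map_compose)
  then show ?thesis by (simp add: o_def)
qed

lemma weave_family_weave: "weave_family A H \<Longrightarrow> a \<in> topspace A \<Longrightarrow> weave (H a)"
  by (simp add: weave_family_def)

lemma family_coord:
  shows "continuous_map (prod_topology A (top_of_set (Zset n))) euclideanreal (\<lambda>z. fst (snd z) i)"
    and "continuous_map (prod_topology A (top_of_set (Zset n))) euclideanreal (\<lambda>z. snd (snd z) i)"
  using continuous_map_compose[OF continuous_map_snd continuous_map_coord(1)]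
    continuous_map_compose[OF continuous_map_snd continuous_map_coord(2)] by (simp_all add: o_def)

lemma family_param:
  "continuous_map A B f \<Longrightarrow> continuous_map (prod_topology A C) B (\<lambda>z. f (fst z))"
  using continuous_map_compose[OF continuous_map_fst] by (simp add: o_def)

lemma weave_family_compose:
  assumes H: "weave_family A H" and f: "continuous_map B A f"
  shows "weave_family B (\<lambda>b. H (f b))"
  unfolding weave_family_def
proof (intro conjI ballI allI)
  fix b assume "b \<in> topspace B"
  then show "weave (H (f b))" using f H by (auto simp: weave_family_def continuous_map_def)
next
  fix n show "continuous_map (prod_topology B (top_of_set (Zset n))) (Op n) (\<lambda>z. H (f (fst z)) n (fst (snd z)) (snd (snd z)))"
    by (rule weave_family_cont[OF H family_param[OF f] family_coord]) auto
qed

lemma weave_family_stretch: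
  assumes H: "weave_family A H" and a: "continuous_map A euclideanreal \<alpha>" "\<And>c. c \<in> topspace A \<Longrightarrow> 1 \<le> \<alpha> c"
  shows "weave_family A (\<lambda>c. stretch (\<alpha> c) (H c))"
  unfolding weave_family_def
proof (intro conjI ballI allI)
  fix c assume "c \<in> topspace A"
  then show "weave (stretch (\<alpha> c) (H c))" using weave_stretch weave_family_weave[OF H] a by blast
next
  fix n show "continuous_map (prod_topology A (top_of_set (Zset n))) (Op n)
      (\<lambda>z. stretch (\<alpha> (fst z)) (H (fst z)) n (fst (snd z)) (snd (snd z)))"
    unfolding stretch_def
    by (rule weave_family_cont[OF H continuous_map_fst])
       (use a inZ_gp in \<open>auto simp: gp_def intro!: continuous_intros family_coord family_param\<close>)
qed

lemma tq_continuous: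
  assumes "\<And>i. continuous_map Y euclideanreal (\<lambda>z. e z i)" "\<And>i. continuous_map Y euclideanreal (\<lambda>z. t z i)"
  shows "continuous_map Y euclideanreal (\<lambda>z. tq (e z) (t z) i r)"
proof (induction r arbitrary: i)
  case (Suc r)
  show ?case unfolding tq.simps push_def
    by (intro continuous_intros assms Suc continuous_map_canonical_const)
qed simp

lemma weave_family_pushed:
  assumes H: "weave_family A H"
    and c: "continuous_map A euclideanreal \<alpha>" "continuous_map A euclideanreal \<beta>" "continuous_map A euclideanreal a"
    and ok: "\<And>c. c \<in> topspace A \<Longrightarrow> push_ok (\<alpha> c) (\<beta> c) (a c) (H c)"
  shows "weave_family A (\<lambda>c. pushed (\<alpha> c) (\<beta> c) (a c) (H c))"
  unfolding weave_family_def
proof (intro conjI ballI allI)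
  fix c assume "c \<in> topspace A"
  then show "weave (pushed (\<alpha> c) (\<beta> c) (a c) (H c))" using weave_pushed ok by blast
next
  fix n
  show "continuous_map (prod_topology A (top_of_set (Zset n))) (Op n)
      (\<lambda>z. pushed (\<alpha> (fst z)) (\<beta> (fst z)) (a (fst z)) (H (fst z)) n (fst (snd z)) (snd (snd z)))"
  proof (cases n)
    case 0
    then show ?thesis by (simp add: pushed_def)
  next
    case (Suc M)
    let ?X = "prod_topology A (top_of_set (Zset (Suc M)))"
    \<comment> \<open>\<open>S\<close> prescribes which gaps are cut. Both conditions are closed and
      overlap at stretched width 2, where \<open>pushed_refine\<close> permits either
      choice.\<close>
    let ?P = "\<lambda>S z. \<forall>i<M. (i \<in> S \<longrightarrow> 2 \<le> \<alpha> (fst z) * fst (snd z) i) \<and> (i \<notin> S \<longrightarrow> \<alpha> (fst z) * fst (snd z) i \<le> 2)"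
    let ?b = "\<lambda>z. blk (H (fst z)) (gp (\<alpha> (fst z)) (fst (snd z))) (sg (\<alpha> (fst z)) (\<beta> (fst z)) (a (fst z)) (Suc M) (fst (snd z)) (snd (snd z)))"
    note e = continuous_map_real_mult[OF family_param[OF c(1)] family_coord(1)]
    have "continuous_map ?X (Op (Suc M))
      (\<lambda>z. pushed (\<alpha> (fst z)) (\<beta> (fst z)) (a (fst z)) (H (fst z)) (Suc M) (fst (snd z)) (snd (snd z)))"
    proof (rule continuous_map_closed_cover[where I = "Pow {..<M}" and P = ?P])
      fix S assume S: "S \<in> Pow {..<M}"
      show "closedin ?X {z \<in> topspace ?X. ?P S z}"
      proof (rule closedin_all_less)
        fix i assume "i < M"
        have 1: "closedin ?X {z \<in> topspace ?X. 2 \<le> \<alpha> (fst z) * fst (snd z) i}"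
          by (rule closedin_le[OF _ e]) simp
        have 2: "closedin ?X {z \<in> topspace ?X. \<alpha> (fst z) * fst (snd z) i \<le> 2}"
          by (rule closedin_le[OF e]) simp
        show "closedin ?X {z \<in> topspace ?X. (i \<in> S \<longrightarrow> 2 \<le> \<alpha> (fst z) * fst (snd z) i) \<and> (i \<notin> S \<longrightarrow> \<alpha> (fst z) * fst (snd z) i \<le> 2)}"
          by (cases "i \<in> S") (use 1 2 in simp_all)
      qed
      let ?Y = "subtopology ?X {z \<in> topspace ?X. ?P S z}"
      have zz: "push_ok (\<alpha> (fst z)) (\<beta> (fst z)) (a (fst z)) (H (fst z))" "inZ (Suc M) (fst (snd z)) (snd (snd z))" "\<And>i. i < M \<Longrightarrow> i \<notin> S \<Longrightarrow> \<alpha> (fst z) * fst (snd z) i \<le> 2"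
          "\<And>i. i < M \<Longrightarrow> i \<in> S \<Longrightarrow> 2 \<le> \<alpha> (fst z) * fst (snd z) i"
        if "z \<in> topspace ?Y" for z
        using that ok by auto
      have "continuous_map ?Y (Op (Suc (0 + M))) (\<lambda>z. bprod (?b z) (\<lambda>i. i \<in> S) 0 0 M)"
      proof (rule bprod_continuous[where M = M])
        fix s l assume sl: "s + l \<le> M" "uncut (\<lambda>i. i \<in> S) s l"
        show "continuous_map ?Y (Op (Suc l)) (\<lambda>z. ?b z s (Suc l))"
          unfolding blk_def
        proof (rule weave_family_cont[OF H])
          show "continuous_map ?Y A fst" by (intro continuous_map_from_subtopology continuous_map_fst)
          fix i
          show "continuous_map ?Y euclideanreal (\<lambda>z. sh s (gp (\<alpha> (fst z)) (fst (snd z))) i)"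
            unfolding sh_def gp_def by (intro continuous_map_from_subtopology continuous_intros e) simp
          show "continuous_map ?Y euclideanreal (\<lambda>z. sh s (sg (\<alpha> (fst z)) (\<beta> (fst z)) (a (fst z)) (Suc M) (fst (snd z)) (snd (snd z))) i)"
            unfolding sh_def sg_def tm_def
            by (intro continuous_map_from_subtopology continuous_intros tq_continuous e family_param c family_coord) simp_all
        next
          fix z assume zY: "z \<in> topspace ?Y"
          interpret push_params "\<alpha> (fst z)" "\<beta> (fst z)" "a (fst z)" "Suc M" "fst (snd z)" "snd (snd z)"
            using push_ok_params zz(1,2)[OF zY] by blast
          show "inZ (Suc l) (sh s (gp (\<alpha> (fst z)) (fst (snd z))))
             (sh s (sg (\<alpha> (fst z)) (\<beta> (fst z)) (a (fst z)) (Suc M) (fst (snd z)) (snd (snd z))))"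
            by (rule block_inZ) (use zz(3)[OF zY] sl in \<open>auto simp: uncut_def\<close>)
        qed
      qed auto
      then have "continuous_map ?Y (Op (Suc M)) (\<lambda>z. bprod (?b z) (\<lambda>i. i \<in> S) 0 0 M)" by simp
      then show "continuous_map ?Y (Op (Suc M))
        (\<lambda>z. pushed (\<alpha> (fst z)) (\<beta> (fst z)) (a (fst z)) (H (fst z)) (Suc M) (fst (snd z)) (snd (snd z)))"
      proof (rule continuous_map_eq)
        fix z assume zY: "z \<in> topspace ?Y"
        show "bprod (?b z) (\<lambda>i. i \<in> S) 0 0 M = pushed (\<alpha> (fst z)) (\<beta> (fst z)) (a (fst z)) (H (fst z)) (Suc M) (fst (snd z)) (snd (snd z))"
          by (rule pushed_refine[symmetric, OF zz(1,2)[OF zY]]) (use zz(3,4)[OF zY] in auto)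
      qed
    next
      fix z assume "z \<in> topspace ?X"
      show "\<exists>S\<in>Pow {..<M}. ?P S z"
        by (rule bexI[of _ "{i. i < M \<and> 2 \<le> \<alpha> (fst z) * fst (snd z) i}"]) auto
    qed simp
    then show ?thesis using Suc by simp
  qed
qed

lemma weave_family_renorm:
  assumes H: "weave_family A H" and s: "continuous_map A (top_of_set {0..1}) s"
    and c: "continuous_map (prod_topology A (top_of_set {0..1})) (Op 0) (\<lambda>z. c (fst z) (snd z))"
    and c0: "\<And>a. a \<in> topspace A \<Longrightarrow> c a 0 = H a 0 (\<lambda>_. 0) (\<lambda>_. 0)"
  shows "weave_family A (\<lambda>a. renorm (s a) (c a) (H a))"
  unfolding weave_family_def
proof (intro conjI ballI allI)
  have s01: "0 \<le> s a \<and> s a \<le> 1" if "a \<in> topspace A" for a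
    using s that by (auto simp: continuous_map_in_subtopology)
  have sr: "continuous_map A euclideanreal s" using s by (simp add: continuous_map_in_subtopology)
  have cc: "c a r \<in> topspace (Op 0)" if "a \<in> topspace A" "0 \<le> r" "r \<le> 1" for a r
    using c that by (force simp: continuous_map_def)
  show "weave (renorm (s a) (c a) (H a))" if "a \<in> topspace A" for a
    using weave_renorm[OF weave_family_weave[OF H that]] s01[OF that] cc[OF that] by force
  fix n
  let ?X = "prod_topology A (top_of_set (Zset n))"
  have ddc: "continuous_map ?X euclideanreal (\<lambda>z. 3 * dd (snd (snd z)) n)"
  proof -
    have "continuous_map ?X euclideanreal (\<lambda>z. dd (snd (snd z)) k)" for k
      by (induction k) (auto intro!: continuous_intros family_coord)
    then show ?thesis by (intro continuous_intros) auto
  qed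
  show "continuous_map ?X (Op n) (\<lambda>z. renorm (s (fst z)) (c (fst z)) (H (fst z)) n (fst (snd z)) (snd (snd z)))"
    unfolding renorm_def
  proof (rule continuous_map_cases_le[OF ddc family_param[OF sr]])
    let ?Y = "subtopology ?X {z \<in> topspace ?X. 3 * dd (snd (snd z)) n \<le> s (fst z)}"
    let ?g = "\<lambda>z. c (fst z) (s (fst z) - 3 * dd (snd (snd z)) n)"
    \<comment> \<open>Pieces with the first \<open>p\<close> times on the side of 0. In the collar
      all times are within 1/3 of 0 or 1, so these closed conditions determine
      \<open>pc\<close>.\<close>
    let ?P = "\<lambda>p z. \<forall>i<n. (i < p \<longrightarrow> snd (snd z) i \<le> 1 / 2) \<and> (\<not> i < p \<longrightarrow> 1 / 2 \<le> snd (snd z) i)"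
    have zY: "fst z \<in> topspace A" "inZ n (fst (snd z)) (snd (snd z))" "3 * dd (snd (snd z)) n \<le> s (fst z)"
      if "z \<in> topspace ?Y" for z using that by auto
    have g: "continuous_map ?Y (Op 0) ?g"
    proof -
      have "continuous_map ?Y (prod_topology A (top_of_set {0..1})) (\<lambda>z. (fst z, s (fst z) - 3 * dd (snd (snd z)) n))"
      proof (intro continuous_map_pairedI)
        show "continuous_map ?Y A fst" by (intro continuous_map_from_subtopology continuous_map_fst)
        have "continuous_map ?Y euclideanreal (\<lambda>z. s (fst z) - 3 * dd (snd (snd z)) n)"
          by (intro continuous_map_from_subtopology continuous_map_diff ddc family_param[OF sr])
        moreover have "s (fst z) - 3 * dd (snd (snd z)) n \<in> {0..1}" if "z \<in> topspace ?Y" for z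
          using zY[OF that] s01 dd_nonneg[of "snd (snd z)" n] by force
        ultimately show "continuous_map ?Y (top_of_set {0..1}) (\<lambda>z. s (fst z) - 3 * dd (snd (snd z)) n)"
          unfolding continuous_map_in_subtopology by blast
      qed
      from continuous_map_compose[OF this c] show ?thesis by (simp add: o_def)
    qed
    have t: "continuous_map ?Y euclideanreal (\<lambda>z. snd (snd z) i)" for i
      by (intro continuous_map_from_subtopology family_coord)
    show "continuous_map ?Y (Op n) (\<lambda>z. pad (pc (snd (snd z)) n) (n - pc (snd (snd z)) n) 0 (?g z))"
    proof (rule continuous_map_closed_cover[where I = "{..n}" and P = ?P])
      fix p assume p: "p \<in> {..n}"
      show "closedin ?Y {z \<in> topspace ?Y. ?P p z}"
      proof (rule closedin_all_less)
        fix i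
        have 1: "closedin ?Y {z \<in> topspace ?Y. snd (snd z) i \<le> 1 / 2}" by (rule closedin_le[OF t]) simp
        have 2: "closedin ?Y {z \<in> topspace ?Y. 1 / 2 \<le> snd (snd z) i}" by (rule closedin_le[OF _ t]) simp
        show "closedin ?Y {z \<in> topspace ?Y. (i < p \<longrightarrow> snd (snd z) i \<le> 1 / 2) \<and> (\<not> i < p \<longrightarrow> 1 / 2 \<le> snd (snd z) i)}"
          by (cases "i < p") (simp_all only: 1 2 simp_thms)
      qed
      have "continuous_map (subtopology ?Y {z \<in> topspace ?Y. ?P p z}) (Op (p + 0 + (n - p))) (\<lambda>z. pad p (n - p) 0 (?g z))"
        by (intro pad_continuous continuous_map_from_subtopology g)
      then have "continuous_map (subtopology ?Y {z \<in> topspace ?Y. ?P p z}) (Op n) (\<lambda>z. pad p (n - p) 0 (?g z))"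
        using p by simp
      then show "continuous_map (subtopology ?Y {z \<in> topspace ?Y. ?P p z}) (Op n)
         (\<lambda>z. pad (pc (snd (snd z)) n) (n - pc (snd (snd z)) n) 0 (?g z))"
      proof (rule continuous_map_eq)
        fix z assume z: "z \<in> topspace (subtopology ?Y {z \<in> topspace ?Y. ?P p z})"
        then have zY': "z \<in> topspace ?Y" and P: "?P p z" by auto
        have "snd (snd z) i < 1 / 2 \<longleftrightarrow> i < p" if "i < n" for i
        proof -
          have "min (snd (snd z) i) (1 - snd (snd z) i) \<le> 1 / 3"
            using dd_ge[OF that, of "snd (snd z)"] zY(3)[OF zY'] s01[OF zY(1)[OF zY']] by simp
          then show ?thesis using P that by (fastforce simp: min_def split: if_splits)
        qed
        then have "pc (snd (snd z)) n = min p n" by (rule pc_unique)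
        then show "pad p (n - p) 0 (?g z) = pad (pc (snd (snd z)) n) (n - pc (snd (snd z)) n) 0 (?g z)" using p by simp
      qed
    next
      fix z assume z: "z \<in> topspace ?Y"
      show "\<exists>p\<in>{..n}. ?P p z"
      proof (rule bexI[of _ "pc (snd (snd z)) n"])
        have "snd (snd z) i < 1 / 2 \<longleftrightarrow> i < pc (snd (snd z)) n" if "i < n" for i
          using pc_iff[OF zY(2)[OF z] that] .
        then show "?P (pc (snd (snd z)) n) z" by (metis less_imp_le not_less)
      qed (simp add: pc_le)
    qed simp
  next
    have phic: "continuous_map ?X euclideanreal (\<lambda>z. phi (s (fst z)) (snd (snd z) i))" for i
      unfolding phi_def
      by (intro continuous_intros family_coord family_param[OF sr]) (use s01 in force)+
    show "continuous_map (subtopology ?X {z \<in> topspace ?X. s (fst z) \<le> 3 * dd (snd (snd z)) n}) (Op n)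
       (\<lambda>z. H (fst z) n (fst (snd z)) (\<lambda>i. phi (s (fst z)) (snd (snd z) i)))"
      by (intro continuous_map_from_subtopology weave_family_cont[OF H continuous_map_fst] family_coord phic)
         (use s01 in \<open>auto intro!: inZ_phi\<close>)
  next
    fix z assume z: "z \<in> topspace ?X" "3 * dd (snd (snd z)) n = s (fst z)"
    show "pad (pc (snd (snd z)) n) (n - pc (snd (snd z)) n) 0 (c (fst z) (s (fst z) - 3 * dd (snd (snd z)) n)) =
       H (fst z) n (fst (snd z)) (\<lambda>i. phi (s (fst z)) (snd (snd z) i))"
      by (rule renorm_glue) (use z s01 c0 weave_family_weave[OF H] in auto)
  qed
qed

end

section \<open>Flattening points of the coproduct\<close>

primrec flatY :: "nat list \<Rightarrow> (nat \<Rightarrow> nat \<Rightarrow> real) \<Rightarrow> nat \<Rightarrow> real" where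
  "flatY [] X = (\<lambda>_. 0)"
| "flatY (m # ns) X = (\<lambda>i. if Suc i < m then X 0 i else if Suc i = m then 1 else flatY ns (\<lambda>j. X (Suc j)) (i - m))"

primrec flatT :: "nat list \<Rightarrow> (nat \<Rightarrow> real) \<Rightarrow> nat \<Rightarrow> real" where
  "flatT [] T = (\<lambda>_. 0)"
| "flatT (m # ns) T = (\<lambda>i. if i < m then T 0 else flatT ns (\<lambda>j. T (Suc j)) (i - m))"

definition flY :: "wbpt \<Rightarrow> nat \<Rightarrow> real" where
  "flY p = (case p of (ns, X, T) \<Rightarrow> flatY ns X)"

definition flT :: "wbpt \<Rightarrow> nat \<Rightarrow> real" where
  "flT p = (case p of (ns, X, T) \<Rightarrow> flatT ns T)"

text \<open>Prepending a factor gives points a list-like structure: \<open>wcons_cases\<close> and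
  \<open>wcons_induct\<close> replace index calculations with the functions \<open>X\<close> and
  \<open>T\<close>.\<close>

definition wcons :: "nat \<Rightarrow> (nat \<Rightarrow> real) \<Rightarrow> real \<Rightarrow> wbpt \<Rightarrow> wbpt" where
  "wcons m x t p = (case p of (ns, X, T) \<Rightarrow> (m # ns, case_nat x X, case_nat t T))"

lemma flY_wcons: "flY (wcons m x t p) = (\<lambda>i. if Suc i < m then x i else if Suc i = m then 1 else flY p (i - m))"
  by (cases p) (simp add: flY_def wcons_def fun_eq_iff)

lemma flT_wcons: "flT (wcons m x t p) = (\<lambda>i. if i < m then t else flT p (i - m))"
  by (cases p) (simp add: flT_def wcons_def fun_eq_iff)

lemma wcons_cases:
  obtains X T where "p = ([], X, T)" | m x t p' where "p = wcons m x t p'"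
proof -
  obtain ns X T where p: "p = (ns, X, T)" by (cases p)
  show ?thesis
  proof (cases ns)
    case Nil
    then show ?thesis using p that(1) by simp
  next
    case (Cons m ns')
    have "case_nat (X 0) (\<lambda>j. X (Suc j)) = X" "case_nat (T 0) (\<lambda>j. T (Suc j)) = T"
      by (auto simp: fun_eq_iff split: nat.split)
    then have "p = wcons m (X 0) (T 0) (ns', (\<lambda>j. X (Suc j)), (\<lambda>j. T (Suc j)))"
      using p Cons by (simp add: wcons_def)
    then show ?thesis by (rule that(2))
  qed
qed

lemma wcons_induct:
  assumes "\<And>X T. P ([], X, T)" "\<And>m x t p. P p \<Longrightarrow> P (wcons m x t p)"
  shows "P p"
proof -
  obtain ns X T where "p = (ns, X, T)" by (cases p)
  moreover have "P (ns, X, T)" for X T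
  proof (induction ns arbitrary: X T)
    case (Cons m ns)
    have "case_nat (X 0) (\<lambda>j. X (Suc j)) = X" "case_nat (T 0) (\<lambda>j. T (Suc j)) = T"
      by (auto simp: fun_eq_iff split: nat.split)
    then have "(m # ns, X, T) = wcons m (X 0) (T 0) (ns, (\<lambda>j. X (Suc j)), (\<lambda>j. T (Suc j)))"
      by (simp add: wcons_def)
    then show ?case using assms(2)[OF Cons] by simp
  qed (rule assms(1))
  ultimately show ?thesis by simp
qed

lemma valid_Nil: "wb_valid n ([], X, T) \<longleftrightarrow> n = 0 \<and> X = (\<lambda>_ _. 0) \<and> T = (\<lambda>_. 0)"
  by (auto simp: wb_valid_def fun_eq_iff)

lemma all_gap_Suc: "(\<forall>i. Suc i < Suc k \<longrightarrow> P i) \<longleftrightarrow> (0 < k \<longrightarrow> P 0) \<and> (\<forall>i. Suc i < k \<longrightarrow> P (Suc i))"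
  by (metis Suc_less_eq not0_implies_Suc zero_less_Suc less_trans gr0I)

lemma all_ge_Suc: "(\<forall>i\<ge>Suc k. P i) \<longleftrightarrow> (\<forall>i\<ge>k. P (Suc i))"
  by (metis Suc_le_D Suc_le_mono)

lemma flT_0: "wb_valid n (ns, X, T) \<Longrightarrow> 0 < n \<Longrightarrow> flT (ns, X, T) 0 = T 0"
  by (cases ns) (auto simp: flT_def wb_valid_def)

lemma valid_wcons:
  "wb_valid n (wcons m x t p) \<longleftrightarrow> 1 \<le> m \<and> m \<le> n \<and> x \<in> cube m \<and> 0 \<le> t \<and> t \<le> 1 \<and> wb_valid (n - m) p \<and>
     (m < n \<longrightarrow> t \<le> flT p 0)"
proof (cases p)
  case (fields ns X T)
  have "wb_valid n (wcons m x t p) \<longleftrightarrow> 1 \<le> m \<and> m \<le> n \<and> x \<in> cube m \<and> 0 \<le> t \<and> t \<le> 1 \<and> wb_valid (n - m) (ns, X, T) \<and>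
     (ns \<noteq> [] \<longrightarrow> t \<le> T 0)"
    unfolding fields wcons_def wb_valid_def prod.case list.size add_0_right add_Suc_right All_less_Suc2 all_gap_Suc all_ge_Suc
      nth_Cons_0 nth_Cons_Suc nat.case sum_list.Cons list.set ball_simps length_greater_0_conv
    by (intro iffI conjI; elim conjE; (assumption | linarith | simp)?; (intro conjI allI impI)?; simp?)
  moreover have "wb_valid (n - m) (ns, X, T) \<Longrightarrow> m \<le> n \<Longrightarrow> ns \<noteq> [] \<longleftrightarrow> m < n"
    by (cases ns) (auto simp: wb_valid_def)
  ultimately show ?thesis using flT_0[of "n - m" ns X T] fields by auto
qed

lemma valid_pos_cases:
  assumes "wb_valid n p" "0 < n"
  obtains m x t p' where "p = wcons m x t p'"
  using assms by (cases p rule: wcons_cases) (auto simp: valid_Nil)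

lemma flat_inZ: "wb_valid n p \<Longrightarrow> inZ n (flY p) (flT p)"
proof (induction p arbitrary: n rule: wcons_induct)
  case (1 X T)
  then show ?case by (simp add: valid_Nil inZ_def)
next
  case (2 m x t p)
  note v = 2(2)[unfolded valid_wcons]
  have z: "inZ (n - m) (flY p) (flT p)" using 2 v by simp
  show ?case
    unfolding inZ_def
  proof (intro conjI allI impI)
    fix i assume i: "Suc i < n"
    have *: "0 \<le> flY (wcons m x t p) i \<and> flY (wcons m x t p) i \<le> 1 \<and> flT (wcons m x t p) i \<le> flT (wcons m x t p) (Suc i) \<and>
      (flY (wcons m x t p) i < 1 \<longrightarrow> flT (wcons m x t p) i = flT (wcons m x t p) (Suc i))"
    proof -
      consider "Suc i < m" | "Suc i = m" | "m \<le> i" by linarith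
      then show ?thesis
      proof cases
        case 1
        then show ?thesis using v by (auto simp: flY_wcons flT_wcons cube_def)
      next
        case 2
        then show ?thesis using v i by (auto simp: flY_wcons flT_wcons)
      next
        case 3
        then have "Suc (i - m) < n - m" "Suc i - m = Suc (i - m)" using i by auto
        then show ?thesis using 3 z by (auto simp: flY_wcons flT_wcons inZ_def)
      qed
    qed
    show "0 \<le> flY (wcons m x t p) i" "flY (wcons m x t p) i \<le> 1" "flT (wcons m x t p) i \<le> flT (wcons m x t p) (Suc i)"
      "flY (wcons m x t p) i < 1 \<Longrightarrow> flT (wcons m x t p) i = flT (wcons m x t p) (Suc i)"
      using * by blast+
  next
    fix i assume "i < n"
    then show "0 \<le> flT (wcons m x t p) i" "flT (wcons m x t p) i \<le> 1"
      using v z by (auto simp: flT_wcons inZ_def)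
  qed
qed

lemma nth_fromlist: "fromlist l i = (if i < length l then l ! i else 0)"
  by (simp add: fromlist_def)

lemma cube_lact_2:
  assumes "1 \<le> a" "1 \<le> b" "y \<in> cube b"
  shows "cube_lact [a, b] [x, y] = (\<lambda>i. if Suc i < a then x i else if Suc i = a then 1 else y (i - a))"
proof
  fix i
  have y0: "y j = 0" if "b \<le> Suc j" for j using assms that by (auto simp: cube_def split: if_splits)
  show "cube_lact [a, b] [x, y] i = (if Suc i < a then x i else if Suc i = a then 1 else y (i - a))"
    unfolding cube_lact_def nth_fromlist
    using assms y0[of "i - a"]
    by (cases "i < a") (auto simp: tolist_def nth_append nth_Cons' not_less)
qed

lemma cube_lact_2_cube:
  assumes "1 \<le> a" "1 \<le> b" "x \<in> cube a" "y \<in> cube b"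
  shows "cube_lact [a, b] [x, y] \<in> cube (a + b)"
  unfolding cube_lact_2[OF assms(1,2,4)] using assms
  by (auto simp: cube_def split: if_splits)

lemma wb_merge_0: "wb_merge 0 (wcons a x t (wcons b y u p)) = wcons (a + b) (cube_lact [a, b] [x, y]) t p"
  by (cases p) (auto simp: wb_merge_def wcons_def fun_eq_iff split: nat.split)

lemma wb_merge_Suc: "wb_merge (Suc i) (wcons m x t p) = wcons m x t (wb_merge i p)"
  by (cases p) (auto simp: wb_merge_def wcons_def fun_eq_iff split: nat.split)

text \<open>\<open>cube_lact\<close> separates its blocks by the coordinate 1, the same gap that
  flattening puts between two factors, and merged factors share their time.\<close>

lemma merge_props:
  "wb_valid n p \<Longrightarrow> Suc i < length (fst p) \<Longrightarrow> snd (snd p) i = snd (snd p) (Suc i) \<Longrightarrow>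
    wb_valid n (wb_merge i p) \<and> flY (wb_merge i p) = flY p \<and> flT (wb_merge i p) = flT p"
proof (induction i arbitrary: n p)
  case 0
  obtain a x t p1 where p1: "p = wcons a x t p1" using 0 by (cases p rule: wcons_cases) auto
  obtain b y u p2 where p2: "p1 = wcons b y u p2" using 0 p1 by (cases p1 rule: wcons_cases) (auto simp: wcons_def)
  have tu: "t = u" using 0(3) unfolding p1 p2 by (cases p2) (simp add: wcons_def)
  have v: "1 \<le> a" "a \<le> n" "x \<in> cube a" "0 \<le> t" "t \<le> 1" "1 \<le> b" "b \<le> n - a" "y \<in> cube b" "wb_valid (n - a - b) p2"
    "b < n - a \<Longrightarrow> u \<le> flT p2 0"
    using 0(1) unfolding p1 p2 valid_wcons by auto
  have "wb_valid n (wb_merge 0 p)"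
    unfolding p1 p2 wb_merge_0 valid_wcons
    using v tu cube_lact_2_cube[of a b x y] by auto
  moreover have "flY (wb_merge 0 p) = flY p"
    unfolding p1 p2 wb_merge_0 flY_wcons cube_lact_2[OF v(1,6,8)] using v(1,6) by (auto simp: fun_eq_iff)
  moreover have "flT (wb_merge 0 p) = flT p"
    unfolding p1 p2 wb_merge_0 flT_wcons tu by (auto simp: fun_eq_iff)
  ultimately show ?case by simp
next
  case (Suc i)
  obtain a x t p1 where p1: "p = wcons a x t p1" using Suc by (cases p rule: wcons_cases) auto
  have "wb_valid (n - a) p1" using Suc.prems p1 by (simp add: valid_wcons)
  moreover have "Suc i < length (fst p1)" "snd (snd p1) i = snd (snd p1) (Suc i)"
    using Suc.prems(2,3) unfolding p1 by (cases p1; simp add: wcons_def)+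
  ultimately have "wb_valid (n - a) (wb_merge i p1) \<and> flY (wb_merge i p1) = flY p1 \<and> flT (wb_merge i p1) = flT p1"
    by (rule Suc.IH)
  then show ?case using Suc.prems(1) unfolding p1 wb_merge_Suc valid_wcons flY_wcons flT_wcons by (auto simp: fun_eq_iff)
qed

section \<open>The equivalence relation in gap and time coordinates\<close>

text \<open>Relation (a) is invisible in flat coordinates. Relation (b) frees the gaps inside a
  factor at time 0 or 1 and, after a merge, also the gap between two factors at such a common
  time.\<close>

definition simZ :: "nat \<Rightarrow> (nat \<Rightarrow> real) \<Rightarrow> (nat \<Rightarrow> real) \<Rightarrow> (nat \<Rightarrow> real) \<Rightarrow> (nat \<Rightarrow> real) \<Rightarrow> bool" where
  "simZ n y t y' t' \<longleftrightarrow> (\<forall>i<n. t i = t' i) \<and>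
     (\<forall>i. Suc i < n \<longrightarrow> y i = y' i \<or> t i = t (Suc i) \<and> (t i = 0 \<or> t i = 1))"

lemma simZ_sym: "simZ n y t y' t' \<Longrightarrow> simZ n y' t' y t"
  by (auto simp: simZ_def)

lemma simZ_trans: "simZ n y t y' t' \<Longrightarrow> simZ n y' t' y'' t'' \<Longrightarrow> simZ n y t y'' t''"
proof -
  assume 1: "simZ n y t y' t'" and 2: "simZ n y' t' y'' t''"
  show ?thesis
    unfolding simZ_def
  proof (intro conjI allI impI)
    fix i assume "i < n"
    then show "t i = t'' i" using 1 2 by (simp add: simZ_def)
  next
    fix i assume i: "Suc i < n"
    then have "t i = t' i" "t (Suc i) = t' (Suc i)" using 1 by (auto simp: simZ_def)
    then show "y i = y'' i \<or> t i = t (Suc i) \<and> (t i = 0 \<or> t i = 1)"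
      using 1 2 i unfolding simZ_def by metis
  qed
qed

definition wupd :: "nat \<Rightarrow> (nat \<Rightarrow> real) \<Rightarrow> wbpt \<Rightarrow> wbpt" where
  "wupd i y p = (case p of (ns, X, T) \<Rightarrow> (ns, X(i := y), T))"

lemma wupd_0: "wupd 0 y (wcons m x t p) = wcons m y t p"
  by (cases p) (auto simp: wupd_def wcons_def fun_eq_iff split: nat.split)

lemma wupd_Suc: "wupd (Suc i) y (wcons m x t p) = wcons m x t (wupd i y p)"
  by (cases p) (auto simp: wupd_def wcons_def fun_eq_iff split: nat.split)

lemma collapse_props:
  "wb_valid n p \<Longrightarrow> i < length (fst p) \<Longrightarrow> snd (snd p) i = 0 \<or> snd (snd p) i = 1 \<Longrightarrow> y \<in> cube (fst p ! i) \<Longrightarrow>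
    wb_valid n (wupd i y p) \<and> simZ n (flY p) (flT p) (flY (wupd i y p)) (flT (wupd i y p)) \<and> flT (wupd i y p) = flT p"
proof (induction i arbitrary: n p)
  case 0
  obtain a x t p1 where p1: "p = wcons a x t p1" using 0 by (cases p rule: wcons_cases) auto
  have t: "t = 0 \<or> t = 1" "y \<in> cube a" using 0(3,4) unfolding p1 by (cases p1; simp add: wcons_def)+
  show ?case using 0(1) t unfolding p1 wupd_0 valid_wcons simZ_def flY_wcons flT_wcons by auto
next
  case (Suc i)
  obtain a x t p1 where p1: "p = wcons a x t p1" using Suc by (cases p rule: wcons_cases) auto
  have v: "wb_valid (n - a) p1" "1 \<le> a" using Suc.prems p1 by (auto simp: valid_wcons)
  have c: "i < length (fst p1)" "snd (snd p1) i = 0 \<or> snd (snd p1) i = 1" "y \<in> cube (fst p1 ! i)"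
    using Suc.prems(2-4) unfolding p1 by (cases p1; simp add: wcons_def)+
  have IH: "wb_valid (n - a) (wupd i y p1)"
    "simZ (n - a) (flY p1) (flT p1) (flY (wupd i y p1)) (flT (wupd i y p1))" "flT (wupd i y p1) = flT p1"
    using Suc.IH[OF v(1) c] by blast+
  have "simZ n (flY p) (flT p) (flY (wupd (Suc i) y p)) (flT (wupd (Suc i) y p))"
    unfolding simZ_def
  proof (intro conjI allI impI)
    fix j assume "j < n"
    then show "flT p j = flT (wupd (Suc i) y p) j" unfolding p1 wupd_Suc flT_wcons IH(3) by simp
  next
    fix j assume j: "Suc j < n"
    show "flY p j = flY (wupd (Suc i) y p) j \<or> flT p j = flT p (Suc j) \<and> (flT p j = 0 \<or> flT p j = 1)"
    proof (cases "j < a")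
      case True
      then show ?thesis unfolding p1 wupd_Suc flY_wcons by auto
    next
      case False
      then have "Suc (j - a) < n - a" "Suc j - a = Suc (j - a)" using j by auto
      then show ?thesis using IH(2) False unfolding p1 wupd_Suc flY_wcons flT_wcons simZ_def by auto
    qed
  qed
  then show ?case using Suc.prems(1) IH unfolding p1 wupd_Suc valid_wcons flT_wcons by (auto simp: fun_eq_iff)
qed

lemma wb_stepE [consumes 1, case_names merge collapse]:
  assumes "(p, p') \<in> wb_step"
  obtains n i where "p' = wb_merge i p" "wb_valid n p" "Suc i < length (fst p)" "snd (snd p) i = snd (snd p) (Suc i)"
  | n i y where "p' = wupd i y p" "wb_valid n p" "i < length (fst p)" "snd (snd p) i = 0 \<or> snd (snd p) i = 1"
      "y \<in> cube (fst p ! i)"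
proof -
  obtain ns X T where p: "p = (ns, X, T)" by (cases p)
  from assms[unfolded p wb_step.simps] show ?thesis
  proof (elim disjE exE conjE, goal_cases)
    case (1 n ns' X' T' i)
    then show ?thesis using that(1)[of i n] p by simp
  next
    case (2 n ns' X' T' i y)
    then show ?thesis using that(2)[of i y n] p by (simp add: wupd_def)
  next
    case (3 n ns' X' T' i y)
    then show ?thesis using that(2)[of i y n] p by (simp add: wupd_def)
  qed
qed

lemma wb_stepD:
  assumes "(p, p') \<in> wb_step"
  shows "\<exists>n. wb_valid n p" and "wb_valid n p \<longleftrightarrow> wb_valid n p'"
    and "wb_valid n p \<Longrightarrow> simZ n (flY p) (flT p) (flY p') (flT p')"
    and "flT p' = flT p"
proof -
  \<comment> \<open>A point is valid for one \<open>n\<close> only, the sum of its block sizes. This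
    carries the facts from the arity of the step to an arbitrary one.\<close>
  have valid_sum: "wb_valid n p \<Longrightarrow> n = sum_list (fst p)" for n p by (cases p) (auto simp: wb_valid_def)
  have "\<exists>n. wb_valid n p \<and> wb_valid n p' \<and> simZ n (flY p) (flT p) (flY p') (flT p') \<and> flT p' = flT p"
    using assms
  proof (cases rule: wb_stepE)
    case (merge n i)
    then show ?thesis using merge_props[of n p i] by (auto simp: simZ_def)
  next
    case (collapse n i y)
    then show ?thesis using collapse_props[of n p i y] by auto
  qed
  then obtain m where m: "wb_valid m p" "wb_valid m p'" "simZ m (flY p) (flT p) (flY p') (flT p')" "flT p' = flT p" by blast
  then show "\<exists>n. wb_valid n p" "flT p' = flT p" by auto
  have "wb_valid n p \<Longrightarrow> n = m" "wb_valid n p' \<Longrightarrow> n = m" using m(1,2) valid_sum by metis+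
  then show "wb_valid n p \<longleftrightarrow> wb_valid n p'" "wb_valid n p \<Longrightarrow> simZ n (flY p) (flT p) (flY p') (flT p')"
    using m by auto
qed

lemma wb_step_wupd:
  "wb_valid n p \<Longrightarrow> i < length (fst p) \<Longrightarrow> snd (snd p) i = 0 \<or> snd (snd p) i = 1 \<Longrightarrow> y \<in> cube (fst p ! i)
   \<Longrightarrow> (p, wupd i y p) \<in> wb_step"
  by (cases p) (auto simp: wupd_def intro: wb_step.collapse)

lemma wb_step_merge:
  "wb_valid n p \<Longrightarrow> Suc i < length (fst p) \<Longrightarrow> snd (snd p) i = snd (snd p) (Suc i) \<Longrightarrow> (p, wb_merge i p) \<in> wb_step"
  by (cases p) (auto intro: wb_step.merge)

lemma wb_step_wcons:
  assumes "(p, p') \<in> wb_step" "wb_valid n (wcons m x t p)"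
  shows "(wcons m x t p, wcons m x t p') \<in> wb_step"
  using assms(1)
proof (cases rule: wb_stepE)
  case (merge k i)
  have "(wcons m x t p, wb_merge (Suc i) (wcons m x t p)) \<in> wb_step"
    by (rule wb_step_merge[OF assms(2)]) (use merge in \<open>cases p; simp add: wcons_def\<close>)+
  then show ?thesis using merge by (simp add: wb_merge_Suc)
next
  case (collapse k i y)
  have "(wcons m x t p, wupd (Suc i) y (wcons m x t p)) \<in> wb_step"
    by (rule wb_step_wupd[OF assms(2)]) (use collapse in \<open>cases p; simp add: wcons_def\<close>)+
  then show ?thesis using collapse by (simp add: wupd_Suc)
qed

lemma equiv_wbR: "equiv UNIV wbR"
proof (rule equivI)
  show "sym wbR" unfolding wbR_def by (intro sym_rtrancl) (auto simp: sym_def)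
qed (auto simp: wbR_def refl_on_def trans_rtrancl)

lemma wbR_sym: "(p, p') \<in> wbR \<Longrightarrow> (p', p) \<in> wbR"
  using equiv_wbR by (meson equiv_def symE)

lemma wbR_trans: "(p, p') \<in> wbR \<Longrightarrow> (p', p'') \<in> wbR \<Longrightarrow> (p, p'') \<in> wbR"
  unfolding wbR_def by (rule rtrancl_trans)

lemma wb_step_wbR: "(p, p') \<in> wb_step \<Longrightarrow> (p, p') \<in> wbR"
  unfolding wbR_def by auto

lemma wbR_simZ:
  assumes "(p, p') \<in> wbR" "wb_valid n p"
  shows "wb_valid n p' \<and> simZ n (flY p) (flT p) (flY p') (flT p')"
  using assms(1) unfolding wbR_def
proof (induction rule: rtrancl_induct)
  case base
  then show ?case using assms(2) by (simp add: simZ_def)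
next
  case (step p1 p2)
  show ?case
  proof (cases "(p1, p2) \<in> wb_step")
    case True
    then show ?thesis using step.IH wb_stepD(2,3)[OF True, of n] simZ_trans by blast
  next
    case False
    then have s: "(p2, p1) \<in> wb_step" using step by simp
    then show ?thesis using step.IH wb_stepD(2,3)[OF s, of n] simZ_trans simZ_sym by blast
  qed
qed

text \<open>Steps leave the flat times unchanged, so the prepended time stays in order along the
  whole chain.\<close>

lemma wbR_wcons:
  assumes "(p, p') \<in> wbR" "wb_valid n (wcons m x t p)"
  shows "(wcons m x t p, wcons m x t p') \<in> wbR"
proof -
  have "(p, p') \<in> (wb_step \<union> wb_step\<inverse>)\<^sup>*" using assms(1) by (simp add: wbR_def)
  then have "wb_valid n (wcons m x t p') \<and> (wcons m x t p, wcons m x t p') \<in> wbR"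
  proof (induction rule: rtrancl_induct)
    case base
    then show ?case using assms(2) by (simp add: wbR_def)
  next
    case (step p1 p2)
    have v: "wb_valid n (wcons m x t p1)" using step.IH by simp
    show ?case
    proof (cases "(p1, p2) \<in> wb_step")
      case True
      then have "wb_valid n (wcons m x t p2)"
        using v wb_stepD(2,4)[OF True] unfolding valid_wcons by auto
      then show ?thesis using step.IH wb_step_wbR[OF wb_step_wcons[OF True v]] wbR_trans by blast
    next
      case False
      then have s: "(p2, p1) \<in> wb_step" using step by simp
      then have v2: "wb_valid n (wcons m x t p2)"
        using v wb_stepD(2,4)[OF s] unfolding valid_wcons by auto
      then show ?thesis using step.IH wbR_sym[OF wb_step_wbR[OF wb_step_wcons[OF s v2]]] wbR_trans by blast
    qed
  qed
  then show ?thesis by simp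
qed

definition eqZ :: "nat \<Rightarrow> wbpt \<Rightarrow> (nat \<Rightarrow> real) \<Rightarrow> (nat \<Rightarrow> real) \<Rightarrow> bool" where
  "eqZ n p y t \<longleftrightarrow> (\<forall>i. Suc i < n \<longrightarrow> flY p i = y i) \<and> (\<forall>i<n. flT p i = t i)"

lemma cube_eqI:
  "x \<in> cube m \<Longrightarrow> x' \<in> cube m \<Longrightarrow> (\<And>i. Suc i < m \<Longrightarrow> x i = x' i) \<Longrightarrow> x = x'"
  by (rule ext) (metis (mono_tags, lifting) cube_def empty_iff less_diff_conv mem_Collect_eq not_le Suc_eq_plus1)

lemma eqZ_wcons:
  assumes "eqZ n (wcons m x t p) (flY (wcons m x' t' p')) (flT (wcons m x' t' p'))" "1 \<le> m" "m \<le> n" "x \<in> cube m" "x' \<in> cube m"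
  shows "x = x'" "t = t'" "eqZ (n - m) p (flY p') (flT p')"
proof -
  have Y: "Suc i < n \<Longrightarrow> flY (wcons m x t p) i = flY (wcons m x' t' p') i"
    and T: "i < n \<Longrightarrow> flT (wcons m x t p) i = flT (wcons m x' t' p') i" for i
    using assms(1) by (auto simp: eqZ_def)
  show "t = t'" using T[of 0] assms(2,3) by (simp add: flT_wcons)
  show "x = x'"
  proof (rule cube_eqI[OF assms(4,5)])
    fix i assume "Suc i < m"
    then show "x i = x' i" using Y[of i] assms(3) by (simp add: flY_wcons)
  qed
  show "eqZ (n - m) p (flY p') (flT p')"
    unfolding eqZ_def
  proof (intro conjI allI impI)
    fix i assume "Suc i < n - m"
    then show "flY p i = flY p' i" using Y[of "m + i"] by (simp add: flY_wcons)
  next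
    fix i assume "i < n - m"
    then show "flT p i = flT p' i" using T[of "m + i"] by (simp add: flT_wcons)
  qed
qed

text \<open>Compare the first factors. If their sizes agree, remove them and use induction.
  Otherwise the longer one has coordinate 1 where the shorter one ends; it is then the merge of a
  factor of the shorter size with a remainder \<open>w\<close>, and the point split in this way
  falls under the first case.\<close>

lemma flat_eq_wbR:
  "wb_valid n p \<Longrightarrow> wb_valid n p' \<Longrightarrow> eqZ n p (flY p') (flT p') \<Longrightarrow> (p, p') \<in> wbR"
proof (induction n arbitrary: p p' rule: less_induct)
  case (less n)
  show ?case
  proof (cases "n = 0")
    case True
    have nil: "p = ([], \<lambda>_ _. 0, \<lambda>_. 0)" if "wb_valid 0 p" for p
      using that by (cases p rule: wcons_cases) (auto simp: valid_Nil valid_wcons)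
    have "p = p'" using nil[of p] nil[of p'] less.prems(1,2) unfolding True by metis
    then show ?thesis by (simp add: wbR_def)
  next
    case False
    have main: "(wcons m x t p, wcons m' x' t' p') \<in> wbR"
      if v: "wb_valid n (wcons m x t p)" "wb_valid n (wcons m' x' t' p')" and mm: "m \<le> m'"
        and e: "eqZ n (wcons m x t p) (flY (wcons m' x' t' p')) (flT (wcons m' x' t' p'))"
      for m x t p m' x' t' p'
    proof -
      have same: "(wcons m x t p, wcons m x2 t2 p2) \<in> wbR"
        if v2: "wb_valid n (wcons m x2 t2 p2)" and e2: "eqZ n (wcons m x t p) (flY (wcons m x2 t2 p2)) (flT (wcons m x2 t2 p2))"
        for x2 t2 p2
      proof -
        have "x = x2" "t = t2" "eqZ (n - m) p (flY p2) (flT p2)"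
          using eqZ_wcons[OF e2] v v2 by (auto simp: valid_wcons)
        moreover have "(p, p2) \<in> wbR"
          by (rule less.IH[of "n - m"]) (use v v2 calculation False in \<open>auto simp: valid_wcons\<close>)
        ultimately show ?thesis using wbR_wcons[OF _ v(1)] by simp
      qed
      show ?thesis
      proof (cases "m = m'")
        case True
        then show ?thesis using same v e by simp
      next
        case F: False
        then have lt: "m < m'" using mm by simp
        define w where "w = sh m x'"
        let ?p2 = "wcons m x t (wcons (m' - m) w t' p')"
        have x': "x' \<in> cube m'" and m1: "1 \<le> m" and mn: "m' \<le> n" and xc: "x \<in> cube m"
          using v by (auto simp: valid_wcons)
        have wc: "w \<in> cube (m' - m)" using x' lt by (auto simp: cube_def w_def sh_def)
        have tt: "t = t'" using e m1 lt mn unfolding eqZ_def flT_wcons by (auto dest: spec[of _ 0])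
        have v2: "wb_valid n ?p2"
          using v lt wc tt unfolding valid_wcons by (auto simp: flT_wcons)
        have x1: "x' i = (if Suc i < m then x i else 1)" if "Suc i \<le> m" for i
          using e that lt mn unfolding eqZ_def flY_wcons by (force dest: spec[of _ i])
        have "cube_lact [m, m' - m] [x, w] = x'"
        proof
          fix i show "cube_lact [m, m' - m] [x, w] i = x' i"
            unfolding cube_lact_2[OF m1 _ wc, of x] using lt wc x1[of i]
            by (subst cube_lact_2[OF m1 _ wc]) (auto simp: w_def sh_def)
        qed
        then have mer: "wb_merge 0 ?p2 = wcons m' x' t' p'" using lt tt by (simp add: wb_merge_0)
        have "snd (snd ?p2) 0 = snd (snd ?p2) (Suc 0)" "Suc 0 < length (fst ?p2)"
          using tt by (cases p'; simp add: wcons_def)+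
        then have st: "(?p2, wcons m' x' t' p') \<in> wb_step" using wb_step_merge[OF v2, of 0] mer by simp
        have "flY ?p2 = flY (wcons m' x' t' p')" "flT ?p2 = flT (wcons m' x' t' p')"
          using merge_props[OF v2, of 0] mer \<open>snd (snd ?p2) 0 = _\<close> \<open>Suc 0 < _\<close> by auto
        then have "(wcons m x t p, ?p2) \<in> wbR" using same[OF v2] e by simp
        then show ?thesis using wb_step_wbR[OF st] wbR_trans by blast
      qed
    qed
    obtain m x t q where p: "p = wcons m x t q" using valid_pos_cases[OF less.prems(1)] False by blast
    obtain m' x' t' q' where p': "p' = wcons m' x' t' q'" using valid_pos_cases[OF less.prems(2)] False by blast
    show ?thesis
    proof (cases "m \<le> m'")
      case True
      then show ?thesis using main[of m x t q m' x' t' q'] less.prems p p' by simp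
    next
      case False
      have "eqZ n p' (flY p) (flT p)" using less.prems(3) by (simp add: eqZ_def)
      then show ?thesis using main[of m' x' t' q' m x t q] less.prems p p' False wbR_sym by simp
    qed
  qed
qed

text \<open>Built from the right: a first gap equal to 1 starts a new factor, a smaller one is
  prepended to the first factor of the tail, whose time the new point shares by
  \<open>inZ\<close>.\<close>

lemma flat_surj: "inZ n y t \<Longrightarrow> \<exists>p. wb_valid n p \<and> eqZ n p y t"
proof (induction n arbitrary: y t)
  case 0
  show ?case by (rule exI[of _ "([], \<lambda>_ _. 0, \<lambda>_. 0)"]) (simp add: valid_Nil eqZ_def)
next
  case (Suc n)
  have z: "inZ n (sh 1 y) (sh 1 t)" using inZ_sh[of 1 n] Suc.prems by simp
  obtain p where p: "wb_valid n p" "eqZ n p (sh 1 y) (sh 1 t)" using Suc.IH[OF z] by blast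
  have t0: "0 \<le> t 0" "t 0 \<le> 1" using Suc.prems by (auto simp: inZ_def)
  show ?case
  proof (cases "n = 0 \<or> y 0 = 1")
    case True
    let ?p = "wcons 1 (\<lambda>_. 0) (t 0) p"
    have "t 0 \<le> flT p 0" if "0 < n" using p(2) Suc.prems that by (auto simp: eqZ_def inZ_def sh_def)
    then have "wb_valid (Suc n) ?p" using p t0 by (simp add: valid_wcons cube_def)
    moreover have "eqZ (Suc n) ?p y t"
      unfolding eqZ_def flY_wcons flT_wcons
    proof (intro conjI allI impI)
      fix i assume "Suc i < Suc n"
      then show "(if Suc i < 1 then 0 else if Suc i = 1 then 1 else flY p (i - 1)) = y i"
        using p(2) True by (cases i) (auto simp: eqZ_def sh_def)
    next
      fix i assume "i < Suc n"
      then show "(if i < 1 then t 0 else flT p (i - 1)) = t i"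
        using p(2) by (cases i) (auto simp: eqZ_def sh_def)
    qed
    ultimately show ?thesis by blast
  next
    case False
    then have n: "0 < n" by simp
    obtain m x u q where q: "p = wcons m x u q" using valid_pos_cases[OF p(1) n] by blast
    note v = p(1)[unfolded q valid_wcons]
    have y0: "0 \<le> y 0" "y 0 \<le> 1" "t 0 = t 1" using Suc.prems n False by (auto simp: inZ_def)
    have u: "u = t 1" using p(2) n v unfolding q eqZ_def flT_wcons sh_def by (auto dest: spec[of _ 0])
    let ?p = "wcons (Suc m) (case_nat (y 0) x) u q"
    have "case_nat (y 0) x \<in> cube (Suc m)"
      using v y0 unfolding cube_def by (auto split: nat.splits)
    then have "wb_valid (Suc n) ?p" using v by (simp add: valid_wcons)
    moreover have "eqZ (Suc n) ?p y t"
      unfolding eqZ_def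
    proof (intro conjI allI impI)
      fix i assume "Suc i < Suc n"
      then show "flY ?p i = y i"
        using p(2) v unfolding q eqZ_def flY_wcons sh_def by (cases i) auto
    next
      fix i assume "i < Suc n"
      then show "flT ?p i = t i"
        using p(2) u y0 unfolding q eqZ_def flT_wcons sh_def by (cases i) auto
    qed
    ultimately show ?thesis by blast
  qed
qed

text \<open>Flattening puts 1 between two factors, so a gap different from 1 is a coordinate inside
  a factor; it is free when that factor sits at time 0 or 1.\<close>

lemma change_gap:
  "wb_valid n p \<Longrightarrow> Suc m < n \<Longrightarrow> flY p m \<noteq> 1 \<Longrightarrow> flT p m = 0 \<or> flT p m = 1 \<Longrightarrow> 0 \<le> z \<Longrightarrow> z \<le> 1 \<Longrightarrow>
    \<exists>p'. (p, p') \<in> wb_step \<and> flY p' = (flY p)(m := z)"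
proof (induction p arbitrary: n m rule: wcons_induct)
  case (1 X T)
  then show ?case by (simp add: valid_Nil)
next
  case (2 a x t p)
  note v = 2(2)[unfolded valid_wcons]
  consider "Suc m < a" | "Suc m = a" | "a \<le> m" by linarith
  then show ?case
  proof cases
    case 1
    have t: "t = 0 \<or> t = 1" using 2 1 by (simp add: flT_wcons)
    have "(wcons a x t p, wupd 0 (x(m := z)) (wcons a x t p)) \<in> wb_step"
      by (rule wb_step_wupd[OF 2(2)]) (use t v 1 2(6,7) in \<open>cases p; auto simp: wcons_def cube_def\<close>)+
    moreover have "flY (wupd 0 (x(m := z)) (wcons a x t p)) = (flY (wcons a x t p))(m := z)"
      unfolding wupd_0 flY_wcons using 1 by (auto simp: fun_eq_iff)
    ultimately show ?thesis by blast
  next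
    case 2
    then show ?thesis using \<open>flY (wcons a x t p) m \<noteq> 1\<close> by (simp add: flY_wcons)
  next
    case 3
    have "\<exists>p'. (p, p') \<in> wb_step \<and> flY p' = (flY p)(m - a := z)"
      by (rule 2(1)[of "n - a"]) (use 2 3 v in \<open>auto simp: flY_wcons flT_wcons\<close>)
    then obtain p' where p': "(p, p') \<in> wb_step" "flY p' = (flY p)(m - a := z)" by blast
    have "flY (wcons a x t p') = (flY (wcons a x t p))(m := z)"
      unfolding flY_wcons p' using 3 by (auto simp: fun_eq_iff)
    then show ?thesis using wb_step_wcons[OF p'(1) 2(2)] by blast
  qed
qed

text \<open>Gaps are exchanged one at a time, \<open>y k\<close> having its first \<open>k\<close>
  entries from the target. Each exchange goes through the value 0: a gap equal to 1 might lie
  between two factors, while a gap 0 certainly lies inside one and can be moved by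
  \<open>change_gap\<close>.\<close>

lemma simZ_wbR:
  assumes p: "wb_valid n p" and p': "wb_valid n p'" and sim: "simZ n (flY p) (flT p) (flY p') (flT p')"
  shows "(p, p') \<in> wbR"
proof -
  define t where "t = flT p"
  define y where "y k i = (if i < k then flY p' i else flY p i)" for k i
  have z: "inZ n (flY p) t" "inZ n (flY p') (flT p')" using flat_inZ p p' by (auto simp: t_def)
  have t': "flT p' i = t i" if "i < n" for i using sim that by (auto simp: simZ_def t_def)
  have zk: "inZ n (y k) t" for k
    using z t' unfolding inZ_def y_def by auto
  have step: "(p, r) \<in> wbR" if "wb_valid n r" "eqZ n r (y k) t" for k r
    using that
  proof (induction k arbitrary: r)
    case 0
    then show ?case
      by (intro flat_eq_wbR[OF p, of r]) (auto simp: eqZ_def y_def t_def)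
  next
    case (Suc k)
    show ?case
    proof (cases "Suc k < n \<and> flY p k \<noteq> flY p' k")
      case False
      then have "eqZ n r (y k) t" using Suc.prems(2) by (auto simp: eqZ_def y_def less_Suc_eq)
      then show ?thesis using Suc by blast
    next
      case True
      then have tk: "t k = t (Suc k)" "t k = 0 \<or> t k = 1" using sim by (auto simp: simZ_def t_def)
      have ys: "y (Suc k) = (y k)(k := flY p' k)" by (auto simp: y_def fun_eq_iff)
      have z0: "inZ n ((y k)(k := 0)) t" using zk[of k] tk unfolding inZ_def by auto
      obtain p0 where p0: "wb_valid n p0" "eqZ n p0 ((y k)(k := 0)) t" using flat_surj[OF z0] by blast
      have chg: "\<exists>r. wb_valid n r \<and> (p0, r) \<in> wbR \<and> eqZ n r ((y k)(k := w)) t" if w: "0 \<le> w" "w \<le> 1" for w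
      proof -
        have "flY p0 k = 0" "flT p0 k = t k" using p0(2) True by (auto simp: eqZ_def)
        then obtain r where r: "(p0, r) \<in> wb_step" "flY r = (flY p0)(k := w)"
          using change_gap[OF p0(1), of k w] True tk w by auto
        moreover have "wb_valid n r" using wb_stepD(2)[OF r(1)] p0 by simp
        moreover have "eqZ n r ((y k)(k := w)) t"
          using p0(2) r wb_stepD(4)[OF r(1)] by (auto simp: eqZ_def)
        ultimately show ?thesis using wb_step_wbR by blast
      qed
      have yb: "0 \<le> y k k" "y k k \<le> 1" "0 \<le> flY p' k" "flY p' k \<le> 1"
        using zk[of k] z(2) True by (auto simp: inZ_def)
      obtain r1 where r1: "wb_valid n r1" "(p0, r1) \<in> wbR" "eqZ n r1 (y k) t" using chg[OF yb(1,2)] by auto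
      obtain r2 where r2: "wb_valid n r2" "(p0, r2) \<in> wbR" "eqZ n r2 (y (Suc k)) t" using chg[OF yb(3,4)] ys by auto
      have "(p, r1) \<in> wbR" using Suc.IH r1 by blast
      moreover have "(r2, r) \<in> wbR"
        by (rule flat_eq_wbR[OF r2(1) Suc.prems(1)]) (use r2(3) Suc.prems(2) in \<open>auto simp: eqZ_def\<close>)
      ultimately show ?thesis using r1 r2 wbR_sym wbR_trans by blast
    qed
  qed
  show ?thesis
    by (rule step[OF p', of n]) (use t' in \<open>auto simp: eqZ_def y_def\<close>)
qed

section \<open>The quotient as a compact set of coordinates modulo \<open>simZ\<close>\<close>

lemma wbR_class_eq: "(p, p') \<in> wbR \<Longrightarrow> wbR `` {p} = wbR `` {p'}"
  using equiv_class_eq[OF equiv_wbR] by simp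

lemma topspace_WbCoprod: "topspace (WbCoprod n) = {p. wb_valid n p}"
proof (rule set_eqI)
  fix p :: wbpt
  obtain ns X T where p: "p = (ns, X, T)" by (cases p)
  have "p \<in> topspace (WbCoprod n) \<longleftrightarrow> ((\<forall>m\<in>set ns. 1 \<le> m) \<and> sum_list ns = n) \<and> wb_valid (sum_list ns) (ns, X, T)"
    unfolding WbCoprod_def WbPiece_def p by simp
  also have "\<dots> \<longleftrightarrow> wb_valid n p"
    unfolding p wb_valid_def prod.case by blast
  finally show "p \<in> topspace (WbCoprod n) \<longleftrightarrow> p \<in> {p. wb_valid n p}" by simp
qed

lemma wbR_valid: "wbR `` topspace (WbCoprod n) \<subseteq> topspace (WbCoprod n)"
  unfolding topspace_WbCoprod using wbR_simZ by blast

lemma topspace_WbQ: "topspace (WbQ n) = {wbR `` {p} |p. wb_valid n p}"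
  unfolding WbQ_def topspace_quotient_top[OF equiv_wbR wbR_valid] quotient_def topspace_WbCoprod by auto

lemma quotient_map_WbQ: "quotient_map (WbCoprod n) (WbQ n) (\<lambda>p. wbR `` {p})"
  unfolding WbQ_def by (rule quotient_map_quotient_top[OF equiv_wbR wbR_valid])

text \<open>Truncation gives each configuration one canonical pair of sequences; these pairs form
  the compact set \<open>Zc n\<close>.\<close>

definition trY :: "nat \<Rightarrow> (nat \<Rightarrow> real) \<Rightarrow> nat \<Rightarrow> real" where
  "trY n y = (\<lambda>i. if Suc i < n then y i else 0)"

definition trT :: "nat \<Rightarrow> (nat \<Rightarrow> real) \<Rightarrow> nat \<Rightarrow> real" where
  "trT n t = (\<lambda>i. if i < n then t i else 0)"

abbreviation Zc :: "nat \<Rightarrow> ((nat \<Rightarrow> real) \<times> (nat \<Rightarrow> real)) set" where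
  "Zc n \<equiv> {(y, t). inZ n y t \<and> y = trY n y \<and> t = trT n t}"

lemma inZ_tr: "inZ n (trY n y) (trT n t) \<longleftrightarrow> inZ n y t"
  by (auto simp: inZ_def trY_def trT_def)

lemma tr_idem [simp]: "trY n (trY n y) = trY n y" "trT n (trT n t) = trT n t"
  by (auto simp: trY_def trT_def)

lemma tr_in_Zc: "inZ n y t \<Longrightarrow> (trY n y, trT n t) \<in> Zc n"
  by (simp add: inZ_tr)

lemma continuous_on_coords:
  shows "continuous_on UNIV (\<lambda>p::(nat \<Rightarrow> real) \<times> (nat \<Rightarrow> real). fst p i)"
    "continuous_on UNIV (\<lambda>p::(nat \<Rightarrow> real) \<times> (nat \<Rightarrow> real). snd p i)"
    "continuous_on UNIV (\<lambda>p::(nat \<Rightarrow> nat \<Rightarrow> real) \<times> (nat \<Rightarrow> real). fst p i j)"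
    "continuous_on UNIV (\<lambda>p::(nat \<Rightarrow> nat \<Rightarrow> real) \<times> (nat \<Rightarrow> real). snd p i)"
  by (intro continuous_on_product_then_coordinatewise[of _ "\<lambda>p. fst p"] continuous_on_product_then_coordinatewise[of _ "\<lambda>p. snd p"]
      continuous_on_product_then_coordinatewise[of _ "\<lambda>p. fst p i"] continuous_on_fst continuous_on_snd continuous_on_id)+

lemma compact_box:
  "compact {p::(nat \<Rightarrow> real) \<times> (nat \<Rightarrow> real). \<forall>i. 0 \<le> fst p i \<and> fst p i \<le> 1 \<and> 0 \<le> snd p i \<and> snd p i \<le> 1}"
  "compact {p::(nat \<Rightarrow> nat \<Rightarrow> real) \<times> (nat \<Rightarrow> real). \<forall>i j. 0 \<le> fst p i j \<and> fst p i j \<le> 1 \<and> 0 \<le> snd p i \<and> snd p i \<le> 1}"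
proof -
  have "compactin (product_topology (\<lambda>_::nat. euclideanreal) UNIV) (PiE UNIV (\<lambda>_. {0..1}))"
    by (subst compactin_PiE) simp
  then have 1: "compact (PiE UNIV (\<lambda>_::nat. {0..1::real}))"
    by (simp add: euclidean_product_topology)
  have "compactin (product_topology (\<lambda>_::nat. euclidean :: (nat \<Rightarrow> real) topology) UNIV) (PiE UNIV (\<lambda>_. PiE UNIV (\<lambda>_::nat. {0..1::real})))"
    by (subst compactin_PiE) (use 1 in simp)
  then have 2: "compact (PiE UNIV (\<lambda>_::nat. PiE UNIV (\<lambda>_::nat. {0..1::real})))"
    by (simp add: euclidean_product_topology)
  have "{p::(nat \<Rightarrow> real) \<times> (nat \<Rightarrow> real). \<forall>i. 0 \<le> fst p i \<and> fst p i \<le> 1 \<and> 0 \<le> snd p i \<and> snd p i \<le> 1} =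
     PiE UNIV (\<lambda>_. {0..1}) \<times> PiE UNIV (\<lambda>_. {0..1})"
    by (auto simp: PiE_iff)
  then show "compact {p::(nat \<Rightarrow> real) \<times> (nat \<Rightarrow> real). \<forall>i. 0 \<le> fst p i \<and> fst p i \<le> 1 \<and> 0 \<le> snd p i \<and> snd p i \<le> 1}"
    using compact_Times[OF 1 1] by simp
  have "{p::(nat \<Rightarrow> nat \<Rightarrow> real) \<times> (nat \<Rightarrow> real). \<forall>i j. 0 \<le> fst p i j \<and> fst p i j \<le> 1 \<and> 0 \<le> snd p i \<and> snd p i \<le> 1} =
     PiE UNIV (\<lambda>_. PiE UNIV (\<lambda>_. {0..1})) \<times> PiE UNIV (\<lambda>_. {0..1})"
    by (auto simp: PiE_iff)
  then show "compact {p::(nat \<Rightarrow> nat \<Rightarrow> real) \<times> (nat \<Rightarrow> real). \<forall>i j. 0 \<le> fst p i j \<and> fst p i j \<le> 1 \<and> 0 \<le> snd p i \<and> snd p i \<le> 1}"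
    using compact_Times[OF 2 1] by simp
qed

text \<open>The premise is an open condition, so the implication is a union of two closed
  ones.\<close>

lemma closed_Collect_le_imp_eq:
  fixes f g h :: "'b::topological_space \<Rightarrow> real"
  assumes "continuous_on UNIV f" "continuous_on UNIV g" "continuous_on UNIV h"
  shows "closed {p. f p < 1 \<longrightarrow> g p = h p}"
proof -
  have "{p. f p < 1 \<longrightarrow> g p = h p} = {p. 1 \<le> f p} \<union> {p. g p = h p}" by auto
  then show ?thesis using assms by (simp add: closed_Un closed_Collect_le closed_Collect_eq)
qed

lemma closed_all_imp: "(\<And>i. closed {x. Q i x}) \<Longrightarrow> closed {x. \<forall>i. P i \<longrightarrow> Q i x}"
proof -
  assume q: "\<And>i. closed {x. Q i x}"
  have "closed {x. P i \<longrightarrow> Q i x}" for i by (cases "P i") (use q in simp_all)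
  then show ?thesis by (rule closed_Collect_all)
qed

text \<open>A closed subset of a product of unit intervals.\<close>

lemma compact_Zc: "compact (Zc n)"
proof -
  note c = continuous_on_coords(1,2)
  define S where "S = {p :: (nat \<Rightarrow> real) \<times> (nat \<Rightarrow> real). (\<forall>i. Suc i < n \<longrightarrow> 0 \<le> fst p i \<and> fst p i \<le> 1 \<and> snd p i \<le> snd p (Suc i) \<and> (fst p i < 1 \<longrightarrow> snd p i = snd p (Suc i)))
     \<and> (\<forall>i. i < n \<longrightarrow> 0 \<le> snd p i \<and> snd p i \<le> 1) \<and> (\<forall>i. \<not> Suc i < n \<longrightarrow> fst p i = 0) \<and> (\<forall>i. \<not> i < n \<longrightarrow> snd p i = 0)}"
  have eq: "Zc n = S"
    by (auto simp: S_def inZ_def trY_def trT_def fun_eq_iff)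
  have 1: "closed {p::(nat \<Rightarrow> real) \<times> (nat \<Rightarrow> real). 0 \<le> fst p i \<and> fst p i \<le> 1 \<and> snd p i \<le> snd p (Suc i) \<and> (fst p i < 1 \<longrightarrow> snd p i = snd p (Suc i))}" for i
    by (intro closed_Collect_conj closed_Collect_le closed_Collect_le_imp_eq c continuous_on_const)
  have 2: "closed {p::(nat \<Rightarrow> real) \<times> (nat \<Rightarrow> real). 0 \<le> snd p i \<and> snd p i \<le> 1}" for i
    by (intro closed_Collect_conj closed_Collect_le c continuous_on_const)
  have 3: "closed {p::(nat \<Rightarrow> real) \<times> (nat \<Rightarrow> real). fst p i = 0}" "closed {p::(nat \<Rightarrow> real) \<times> (nat \<Rightarrow> real). snd p i = 0}" for i
    by (intro closed_Collect_eq c continuous_on_const)+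
  have "closed S"
    unfolding S_def
    apply (rule closed_Collect_conj, rule closed_all_imp, rule 1)
    apply (rule closed_Collect_conj, rule closed_all_imp, rule 2)
    apply (rule closed_Collect_conj, rule closed_all_imp, rule 3(1))
    apply (rule closed_all_imp, rule 3(2))
    done
  moreover have "0 \<le> fst p i \<and> fst p i \<le> 1 \<and> 0 \<le> snd p i \<and> snd p i \<le> 1" if "p \<in> S" for p i
  proof -
    have "Suc i < n \<Longrightarrow> 0 \<le> fst p i \<and> fst p i \<le> 1" "\<not> Suc i < n \<Longrightarrow> fst p i = 0"
      "i < n \<Longrightarrow> 0 \<le> snd p i \<and> snd p i \<le> 1" "\<not> i < n \<Longrightarrow> snd p i = 0"
      using that unfolding S_def mem_Collect_eq by blast+
    then show ?thesis by (cases "Suc i < n"; cases "i < n") simp_all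
  qed
  then have "S \<subseteq> {p. \<forall>i. 0 \<le> fst p i \<and> fst p i \<le> 1 \<and> 0 \<le> snd p i \<and> snd p i \<le> 1}" by blast
  ultimately have "compact S"
    using compact_Int_closed[OF compact_box(1), of S] by (simp add: Int_absorb1)
  then show ?thesis by (simp only: eq)
qed

lemma WbPiece_eq: "WbPiece ns = top_of_set {(X, T). wb_valid (sum_list ns) (ns, X, T)}"
  by (simp add: WbPiece_def euclidean_product_topology)

lemma compact_WbPiece:
  assumes "\<forall>m\<in>set ns. 1 \<le> m"
  shows "compact_space (WbPiece ns)"
proof -
  let ?S = "{(X, T). wb_valid (sum_list ns) (ns, X, T)}"
  note c = continuous_on_coords(3,4)
  have nz: "ns ! i \<noteq> 0" if "i < length ns" for i using assms that by (metis not_one_le_zero nth_mem)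
  have "wb_valid (sum_list ns) (ns, X, T) \<longleftrightarrow>
     (\<forall>i. i < length ns \<longrightarrow> ((\<forall>j. j < ns ! i - 1 \<longrightarrow> 0 \<le> X i j \<and> X i j \<le> 1) \<and> (\<forall>j. j \<ge> ns ! i - 1 \<longrightarrow> X i j = 0)) \<and> 0 \<le> T i \<and> T i \<le> 1) \<and>
     (\<forall>i. Suc i < length ns \<longrightarrow> T i \<le> T (Suc i)) \<and>
     (\<forall>i. i\<ge>length ns \<longrightarrow> (\<forall>j. X i j = 0) \<and> T i = 0)" for X T
  proof -
    have cu: "X i \<in> cube (ns ! i) \<longleftrightarrow> (\<forall>j. j < ns ! i - 1 \<longrightarrow> 0 \<le> X i j \<and> X i j \<le> 1) \<and> (\<forall>j. j \<ge> ns ! i - 1 \<longrightarrow> X i j = 0)"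
      if "i < length ns" for i using nz[OF that] by (simp add: cube_def)
    have "wb_valid (sum_list ns) (ns, X, T) \<longleftrightarrow> (\<forall>i. i < length ns \<longrightarrow> X i \<in> cube (ns ! i) \<and> 0 \<le> T i \<and> T i \<le> 1) \<and>
       (\<forall>i. Suc i < length ns \<longrightarrow> T i \<le> T (Suc i)) \<and> (\<forall>i. i\<ge>length ns \<longrightarrow> (\<forall>j. X i j = 0) \<and> T i = 0)"
      using assms by (simp add: wb_valid_def fun_eq_iff)
    also have "(\<forall>i. i < length ns \<longrightarrow> X i \<in> cube (ns ! i) \<and> 0 \<le> T i \<and> T i \<le> 1) \<longleftrightarrow>
      (\<forall>i. i < length ns \<longrightarrow> ((\<forall>j. j < ns ! i - 1 \<longrightarrow> 0 \<le> X i j \<and> X i j \<le> 1) \<and> (\<forall>j. j \<ge> ns ! i - 1 \<longrightarrow> X i j = 0)) \<and> 0 \<le> T i \<and> T i \<le> 1)"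
      by (intro all_cong1 imp_cong refl) (simp only: cu)
    finally show ?thesis .
  qed
  note valid_eq = this
  define S where "S = {p :: (nat \<Rightarrow> nat \<Rightarrow> real) \<times> (nat \<Rightarrow> real). (\<forall>i. i < length ns \<longrightarrow> ((\<forall>j. j < ns ! i - 1 \<longrightarrow> 0 \<le> fst p i j \<and> fst p i j \<le> 1) \<and> (\<forall>j. j \<ge> ns ! i - 1 \<longrightarrow> fst p i j = 0)) \<and> 0 \<le> snd p i \<and> snd p i \<le> 1) \<and>
     (\<forall>i. Suc i < length ns \<longrightarrow> snd p i \<le> snd p (Suc i)) \<and>
     (\<forall>i. i\<ge>length ns \<longrightarrow> (\<forall>j. fst p i j = 0) \<and> snd p i = 0)}"
  have eq: "?S = S"
    unfolding S_def case_prod_unfold valid_eq ..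
  have 1: "closed {p::(nat \<Rightarrow> nat \<Rightarrow> real) \<times> (nat \<Rightarrow> real). 0 \<le> fst p i j \<and> fst p i j \<le> 1}" for i j
    by (intro closed_Collect_conj closed_Collect_le c continuous_on_const)
  have 2: "closed {p::(nat \<Rightarrow> nat \<Rightarrow> real) \<times> (nat \<Rightarrow> real). fst p i j = 0}" for i j
    by (intro closed_Collect_eq c continuous_on_const)
  have 3: "closed {p::(nat \<Rightarrow> nat \<Rightarrow> real) \<times> (nat \<Rightarrow> real). 0 \<le> snd p i \<and> snd p i \<le> 1}" for i
    by (intro closed_Collect_conj closed_Collect_le c continuous_on_const)
  have 4: "closed {p::(nat \<Rightarrow> nat \<Rightarrow> real) \<times> (nat \<Rightarrow> real). snd p i \<le> snd p (Suc i)}" for i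
    by (intro closed_Collect_le c)
  have 5: "closed {p::(nat \<Rightarrow> nat \<Rightarrow> real) \<times> (nat \<Rightarrow> real). (\<forall>j. fst p i j = 0) \<and> snd p i = 0}" for i
    by (intro closed_Collect_conj closed_Collect_all closed_Collect_eq c continuous_on_const)
  have 6: "closed {p::(nat \<Rightarrow> nat \<Rightarrow> real) \<times> (nat \<Rightarrow> real). ((\<forall>j. j < ns ! i - 1 \<longrightarrow> 0 \<le> fst p i j \<and> fst p i j \<le> 1) \<and> (\<forall>j. j \<ge> ns ! i - 1 \<longrightarrow> fst p i j = 0)) \<and> 0 \<le> snd p i \<and> snd p i \<le> 1}" for i
    apply (rule closed_Collect_conj)
     apply (rule closed_Collect_conj, rule closed_all_imp, rule 1)
     apply (rule closed_all_imp, rule 2)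
    apply (rule 3)
    done
  have "closed S"
    unfolding S_def
    apply (rule closed_Collect_conj, rule closed_all_imp, rule 6)
    apply (rule closed_Collect_conj, rule closed_all_imp, rule 4)
    apply (rule closed_all_imp, rule 5)
    done
  moreover have "0 \<le> fst p i j \<and> fst p i j \<le> 1 \<and> 0 \<le> snd p i \<and> snd p i \<le> 1" if "p \<in> S" for p i j
  proof -
    have "i < length ns \<Longrightarrow> j < ns ! i - 1 \<Longrightarrow> 0 \<le> fst p i j \<and> fst p i j \<le> 1"
      "i < length ns \<Longrightarrow> j \<ge> ns ! i - 1 \<Longrightarrow> fst p i j = 0" "i < length ns \<Longrightarrow> 0 \<le> snd p i \<and> snd p i \<le> 1"
      "length ns \<le> i \<Longrightarrow> fst p i j = 0 \<and> snd p i = 0"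
      using that unfolding S_def mem_Collect_eq by blast+
    then show ?thesis by (cases "i < length ns"; cases "j < ns ! i - 1") (simp_all add: not_less)
  qed
  then have "S \<subseteq> {p. \<forall>i j. 0 \<le> fst p i j \<and> fst p i j \<le> 1 \<and> 0 \<le> snd p i \<and> snd p i \<le> 1}" by blast
  ultimately have "compact S"
    using compact_Int_closed[OF compact_box(2), of S] by (simp add: Int_absorb1)
  then show ?thesis unfolding WbPiece_eq eq by (simp add: compact_space_subtopology)
qed

lemma finite_compositions: "finite {ns. (\<forall>m\<in>set ns. 1 \<le> m) \<and> sum_list ns = (n::nat)}"
proof (rule finite_subset)
  have "length ns \<le> sum_list ns" if "\<forall>m\<in>set ns. 1 \<le> m" for ns :: "nat list" using that by (induction ns) auto
  moreover have "m \<le> sum_list ns" if "m \<in> set ns" for ns :: "nat list" and m using that by (auto intro: member_le_sum_list)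
  ultimately show "{ns. (\<forall>m\<in>set ns. 1 \<le> m) \<and> sum_list ns = n} \<subseteq> {ns. set ns \<subseteq> {..n} \<and> length ns \<le> n}"
    by fastforce
  show "finite {ns. set ns \<subseteq> {..n} \<and> length ns \<le> n}" by (rule finite_lists_length_le) simp
qed

lemma compact_WbCoprod: "compact_space (WbCoprod n)"
proof -
  let ?I = "{ns. (\<forall>m\<in>set ns. 1 \<le> m) \<and> sum_list ns = n}"
  have "compactin (WbCoprod n) (Pair ns ` topspace (WbPiece ns))" if "ns \<in> ?I" for ns
    unfolding WbCoprod_def
    by (rule image_compactin[OF _ continuous_map_component_injection[OF that]])
       (use compact_WbPiece that in \<open>auto simp: compact_space_def\<close>)
  then have "compactin (WbCoprod n) (\<Union>ns\<in>?I. Pair ns ` topspace (WbPiece ns))"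
    by (intro compactin_Union) (use finite_compositions in auto)
  moreover have "(\<Union>ns\<in>?I. Pair ns ` topspace (WbPiece ns)) = topspace (WbCoprod n)"
    by (auto simp: WbCoprod_def)
  ultimately show ?thesis by (simp add: compact_space_def)
qed

lemma flat_continuous:
  "continuous_map (WbPiece ns) euclideanreal (\<lambda>p. flatY ns (fst p) i)"
  "continuous_map (WbPiece ns) euclideanreal (\<lambda>p. flatT ns (snd p) i)"
proof -
  \<comment> \<open>The offset \<open>k\<close> makes room for the shifted functions that appear in
    the recursion of \<open>flatY\<close>.\<close>
  have "continuous_on UNIV (\<lambda>p::(nat \<Rightarrow> nat \<Rightarrow> real) \<times> (nat \<Rightarrow> real). flatY ns (\<lambda>j. fst p (k + j)) i)" for k
  proof (induction ns arbitrary: k i)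
    case (Cons m ns)
    have "continuous_on UNIV (\<lambda>p::(nat \<Rightarrow> nat \<Rightarrow> real) \<times> (nat \<Rightarrow> real). flatY ns (\<lambda>j. fst p (k + Suc j)) (i - m))"
      using Cons[of "Suc k" "i - m"] by simp
    then show ?case using continuous_on_coords(3)[of k i]
      by (cases "Suc i < m"; cases "Suc i = m") simp_all
  qed simp
  from this[of 0] show "continuous_map (WbPiece ns) euclideanreal (\<lambda>p. flatY ns (fst p) i)"
    unfolding WbPiece_eq by simp (erule continuous_on_subset, simp)
  have "continuous_on UNIV (\<lambda>p::(nat \<Rightarrow> nat \<Rightarrow> real) \<times> (nat \<Rightarrow> real). flatT ns (\<lambda>j. snd p (k + j)) i)" for k
  proof (induction ns arbitrary: k i)
    case (Cons m ns)
    have "continuous_on UNIV (\<lambda>p::(nat \<Rightarrow> nat \<Rightarrow> real) \<times> (nat \<Rightarrow> real). flatT ns (\<lambda>j. snd p (k + Suc j)) (i - m))"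
      using Cons[of "Suc k" "i - m"] by simp
    then show ?case using continuous_on_coords(4)[of k] by (cases "i < m") simp_all
  qed simp
  from this[of 0] show "continuous_map (WbPiece ns) euclideanreal (\<lambda>p. flatT ns (snd p) i)"
    unfolding WbPiece_eq by simp (erule continuous_on_subset, simp)
qed

lemma continuous_map_from_sum:
  assumes "\<And>i. i \<in> I \<Longrightarrow> continuous_map (X i) Y (\<lambda>x. f (i, x))"
  shows "continuous_map (sum_topology X I) Y f"
  unfolding continuous_map_def
proof (intro conjI allI impI)
  show "f \<in> topspace (sum_topology X I) \<rightarrow> topspace Y"
    using assms by (force simp: continuous_map_def Pi_iff)
  fix U assume U: "openin Y U"
  show "openin (sum_topology X I) {x \<in> topspace (sum_topology X I). f x \<in> U}"
    unfolding openin_sum_topology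
  proof (intro conjI ballI)
    fix i assume i: "i \<in> I"
    then have "openin (X i) {x \<in> topspace (X i). f (i, x) \<in> U}"
      using assms U by (auto simp: continuous_map_def)
    then show "openin (X i) {x. (i, x) \<in> {x \<in> topspace (sum_topology X I). f x \<in> U}}" using i by simp
  qed auto
qed

definition flc :: "nat \<Rightarrow> wbpt \<Rightarrow> (nat \<Rightarrow> real) \<times> (nat \<Rightarrow> real)" where
  "flc n p = (trY n (flY p), trT n (flT p))"

lemma continuous_map_flc: "continuous_map (WbCoprod n) (top_of_set (Zc n)) (flc n)"
proof -
  have "continuous_map (WbCoprod n) euclidean (\<lambda>p. trY n (flY p))"
    unfolding euclidean_product_topology[symmetric] continuous_map_componentwise_UNIV trY_def WbCoprod_def
    by (intro allI continuous_map_from_sum) (use flat_continuous(1) in \<open>simp add: flY_def case_prod_unfold\<close>)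
  moreover have "continuous_map (WbCoprod n) euclidean (\<lambda>p. trT n (flT p))"
    unfolding euclidean_product_topology[symmetric] continuous_map_componentwise_UNIV trT_def WbCoprod_def
    by (intro allI continuous_map_from_sum) (use flat_continuous(2) in \<open>simp add: flT_def case_prod_unfold\<close>)
  ultimately have "continuous_map (WbCoprod n) (prod_topology euclidean euclidean) (flc n)"
    unfolding flc_def by (rule continuous_map_pairedI)
  moreover have "flc n ` topspace (WbCoprod n) \<subseteq> Zc n"
  proof
    fix z assume "z \<in> flc n ` topspace (WbCoprod n)"
    then obtain p where "wb_valid n p" "z = flc n p" unfolding topspace_WbCoprod by blast
    then show "z \<in> Zc n" using tr_in_Zc[OF flat_inZ] by (simp add: flc_def)
  qed
  ultimately show ?thesis by (simp add: continuous_map_in_subtopology image_subset_iff_funcset)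
qed

text \<open>The class belonging to given flat coordinates. By \<open>simZ_wbR\<close> it does not
  depend on the chosen representative.\<close>

definition qq :: "nat \<Rightarrow> (nat \<Rightarrow> real) \<Rightarrow> (nat \<Rightarrow> real) \<Rightarrow> wbpt set" where
  "qq n y t = wbR `` {SOME p. wb_valid n p \<and> eqZ n p y t}"

lemma qq_eqI:
  assumes z: "inZ n y t" and r: "wb_valid n r" and sim: "simZ n y t (flY r) (flT r)"
  shows "qq n y t = wbR `` {r}"
proof -
  define p where "p = (SOME p. wb_valid n p \<and> eqZ n p y t)"
  have p: "wb_valid n p" "eqZ n p y t" using someI_ex[OF flat_surj[OF z]] by (auto simp: p_def)
  have "simZ n (flY p) (flT p) y t" using p(2) by (auto simp: simZ_def eqZ_def)
  then have "(p, r) \<in> wbR" using simZ_wbR[OF p(1) r] simZ_trans sim by blast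
  then show ?thesis using wbR_class_eq by (simp add: qq_def p_def)
qed

lemma qq_flat: "wb_valid n p \<Longrightarrow> qq n (flY p) (flT p) = wbR `` {p}"
  by (rule qq_eqI) (auto simp: flat_inZ simZ_def)

lemma qq_eq_iff:
  assumes z: "inZ n y t" and z': "inZ n y' t'"
  shows "qq n y t = qq n y' t' \<longleftrightarrow> simZ n y t y' t'"
proof -
  obtain p where p: "wb_valid n p" "eqZ n p y t" using flat_surj[OF z] by blast
  obtain p' where p': "wb_valid n p'" "eqZ n p' y' t'" using flat_surj[OF z'] by blast
  have s: "simZ n y t (flY p) (flT p)" "simZ n y' t' (flY p') (flT p')" using p p' by (auto simp: simZ_def eqZ_def)
  have q: "qq n y t = wbR `` {p}" "qq n y' t' = wbR `` {p'}" using qq_eqI z z' p p' s by auto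
  show ?thesis
  proof
    assume "qq n y t = qq n y' t'"
    then have "(p, p') \<in> wbR" using q eq_equiv_class[OF _ equiv_wbR] by auto
    then have "simZ n (flY p) (flT p) (flY p') (flT p')" using wbR_simZ[OF _ p(1)] by blast
    then show "simZ n y t y' t'" using simZ_trans[OF simZ_trans[OF s(1)] simZ_sym[OF s(2)]] by blast
  next
    assume "simZ n y t y' t'"
    then have "simZ n (flY p) (flT p) (flY p') (flT p')"
      using simZ_trans[OF simZ_trans[OF simZ_sym[OF s(1)]] s(2)] by blast
    then show "qq n y t = qq n y' t'" using simZ_wbR[OF p(1) p'(1)] q wbR_class_eq by simp
  qed
qed

lemma qq_in: "inZ n y t \<Longrightarrow> qq n y t \<in> topspace (WbQ n)"
proof -
  assume z: "inZ n y t"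
  obtain p where p: "wb_valid n p" "eqZ n p y t" using flat_surj[OF z] by blast
  have "qq n y t = wbR `` {p}" by (rule qq_eqI[OF z p(1)]) (use p(2) in \<open>auto simp: simZ_def eqZ_def\<close>)
  then show ?thesis using p(1) unfolding topspace_WbQ by blast
qed

lemma flc_surj: "flc n ` topspace (WbCoprod n) = Zc n"
proof
  show "flc n ` topspace (WbCoprod n) \<subseteq> Zc n"
    using continuous_map_image_subset_topspace[OF continuous_map_flc[of n]] by simp
  show "Zc n \<subseteq> flc n ` topspace (WbCoprod n)"
  proof clarify
    fix y t assume z: "inZ n y t" and e: "y = trY n y" "t = trT n t"
    obtain p where p: "wb_valid n p" "eqZ n p y t" using flat_surj[OF z] by blast
    then have "trY n (flY p) = trY n y" "trT n (flT p) = trT n t" by (auto simp: eqZ_def trY_def trT_def fun_eq_iff)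
    then have "(y, t) = flc n p" using e by (simp add: flc_def)
    then show "(y, t) \<in> flc n ` topspace (WbCoprod n)" using p by (auto simp: topspace_WbCoprod)
  qed
qed

text \<open>A continuous map from a compact space to a Hausdorff space is closed, and a closed
  continuous surjection is a quotient map.\<close>

lemma quotient_map_flc: "quotient_map (WbCoprod n) (top_of_set (Zc n)) (flc n)"
proof (rule continuous_closed_imp_quotient_map)
  show "continuous_map (WbCoprod n) (top_of_set (Zc n)) (flc n)" by (rule continuous_map_flc)
  show "closed_map (WbCoprod n) (top_of_set (Zc n)) (flc n)"
    by (rule continuous_imp_closed_map_gen[OF compact_WbCoprod _ continuous_map_flc])
       (simp add: Hausdorff_imp_kc_space Hausdorff_space_subtopology)
  show "flc n ` topspace (WbCoprod n) = topspace (top_of_set (Zc n))" using flc_surj by simp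
qed

text \<open>The defining quotient map is \<open>qq\<close> after \<open>flc\<close>, and
  \<open>flc\<close> is a quotient map itself; so \<open>WbQ n\<close> carries the quotient topology
  of the compact space \<open>Zc n\<close>.\<close>

lemma quotient_map_qq: "quotient_map (top_of_set (Zc n)) (WbQ n) (\<lambda>z. qq n (fst z) (snd z))"
proof (rule quotient_map_from_composition[OF continuous_map_flc])
  have eq: "qq n (fst (flc n p)) (snd (flc n p)) = wbR `` {p}" if "p \<in> topspace (WbCoprod n)" for p
  proof -
    have v: "wb_valid n p" using that by (simp add: topspace_WbCoprod)
    have "qq n (trY n (flY p)) (trT n (flT p)) = wbR `` {p}"
    proof (rule qq_eqI[OF _ v])
      show "inZ n (trY n (flY p)) (trT n (flT p))" using flat_inZ[OF v] by (simp add: inZ_tr)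
      show "simZ n (trY n (flY p)) (trT n (flT p)) (flY p) (flT p)" by (simp add: simZ_def trY_def trT_def)
    qed
    then show ?thesis by (simp add: flc_def)
  qed
  show qc: "quotient_map (WbCoprod n) (WbQ n) ((\<lambda>z. qq n (fst z) (snd z)) \<circ> flc n)"
    by (rule quotient_map_eq[OF quotient_map_WbQ]) (use eq in simp)
  show "continuous_map (top_of_set (Zc n)) (WbQ n) (\<lambda>z. qq n (fst z) (snd z))"
    by (rule continuous_compose_quotient_map[OF quotient_map_flc quotient_imp_continuous_map[OF qc]])
qed

lemma closed_simZ:
  "closed {w::((nat \<Rightarrow> real) \<times> (nat \<Rightarrow> real)) \<times> ((nat \<Rightarrow> real) \<times> (nat \<Rightarrow> real)).
     simZ n (fst (fst w)) (snd (fst w)) (fst (snd w)) (snd (snd w))}"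
proof -
  have c: "continuous_on UNIV (\<lambda>w::((nat \<Rightarrow> real) \<times> (nat \<Rightarrow> real)) \<times> ((nat \<Rightarrow> real) \<times> (nat \<Rightarrow> real)). fst (fst w) i)"
    "continuous_on UNIV (\<lambda>w::((nat \<Rightarrow> real) \<times> (nat \<Rightarrow> real)) \<times> ((nat \<Rightarrow> real) \<times> (nat \<Rightarrow> real)). snd (fst w) i)"
    "continuous_on UNIV (\<lambda>w::((nat \<Rightarrow> real) \<times> (nat \<Rightarrow> real)) \<times> ((nat \<Rightarrow> real) \<times> (nat \<Rightarrow> real)). fst (snd w) i)"
    "continuous_on UNIV (\<lambda>w::((nat \<Rightarrow> real) \<times> (nat \<Rightarrow> real)) \<times> ((nat \<Rightarrow> real) \<times> (nat \<Rightarrow> real)). snd (snd w) i)" for i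
    by (rule continuous_on_product_then_coordinatewise[of _ "\<lambda>w. fst (fst w)"]
        continuous_on_product_then_coordinatewise[of _ "\<lambda>w. snd (fst w)"]
        continuous_on_product_then_coordinatewise[of _ "\<lambda>w. fst (snd w)"]
        continuous_on_product_then_coordinatewise[of _ "\<lambda>w. snd (snd w)"]; intro continuous_on_fst continuous_on_snd continuous_on_id)+
  have 1: "closed {w::((nat \<Rightarrow> real) \<times> (nat \<Rightarrow> real)) \<times> ((nat \<Rightarrow> real) \<times> (nat \<Rightarrow> real)). snd (fst w) i = snd (snd w) i}" for i
    by (intro closed_Collect_eq c)
  have 2: "closed {w::((nat \<Rightarrow> real) \<times> (nat \<Rightarrow> real)) \<times> ((nat \<Rightarrow> real) \<times> (nat \<Rightarrow> real)). fst (fst w) i = fst (snd w) i \<or>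
      snd (fst w) i = snd (fst w) (Suc i) \<and> (snd (fst w) i = 0 \<or> snd (fst w) i = 1)}" for i
    by (intro closed_Collect_disj closed_Collect_conj closed_Collect_eq c continuous_on_const)
  show ?thesis
    unfolding simZ_def
    apply (rule closed_Collect_conj, rule closed_all_imp, rule 1)
    apply (rule closed_all_imp, rule 2)
    done
qed

text \<open>\<open>simZ\<close> is a closed relation on a compact space, so the saturation of a
  closed set is the projection of a compact set. Hence \<open>qq\<close> is closed, and its fibres,
  the saturations of points, are compact. Properness is what
  \<open>continuous_map_into_compact_open\<close> asks for.\<close>

lemma proper_map_qq: "proper_map (top_of_set (Zc n)) (WbQ n) (\<lambda>z. qq n (fst z) (snd z))"
proof -
  let ?q = "\<lambda>z. qq n (fst z) (snd z)" and ?Z = "top_of_set (Zc n)"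
  let ?R = "{w. simZ n (fst (fst w)) (snd (fst w)) (fst (snd w)) (snd (snd w))}"
  have sat: "closedin ?Z {z \<in> Zc n. ?q z \<in> ?q ` C}" if C: "closedin ?Z C" for C
  proof -
    have CZ: "C \<subseteq> Zc n" using closedin_subset[OF C] by simp
    have "compact C" using C compact_Zc closedin_compact by blast
    then have "compact (snd ` ((C \<times> Zc n) \<inter> ?R))"
      by (intro compact_continuous_image compact_Int_closed compact_Times compact_Zc closed_simZ) (auto intro: continuous_intros)
    moreover have "{z \<in> Zc n. ?q z \<in> ?q ` C} = snd ` ((C \<times> Zc n) \<inter> ?R)"
    proof (intro set_eqI iffI)
      fix z assume "z \<in> {z \<in> Zc n. ?q z \<in> ?q ` C}"
      then obtain c where c: "z \<in> Zc n" "c \<in> C" "?q z = ?q c" by blast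
      then have "simZ n (fst c) (snd c) (fst z) (snd z)"
        using qq_eq_iff[of n "fst c" "snd c" "fst z" "snd z"] CZ by auto
      then have "(c, z) \<in> (C \<times> Zc n) \<inter> ?R" using c by simp
      then show "z \<in> snd ` ((C \<times> Zc n) \<inter> ?R)" by force
    next
      fix z assume "z \<in> snd ` ((C \<times> Zc n) \<inter> ?R)"
      then obtain c where c: "z \<in> Zc n" "c \<in> C" "simZ n (fst c) (snd c) (fst z) (snd z)" by auto
      then have "?q c = ?q z" using qq_eq_iff[of n "fst c" "snd c" "fst z" "snd z"] CZ by auto
      then show "z \<in> {z \<in> Zc n. ?q z \<in> ?q ` C}" using c by auto
    qed
    moreover have "snd ` ((C \<times> Zc n) \<inter> ?R) \<subseteq> Zc n" by auto
    ultimately show ?thesis by (auto intro!: closed_subset compact_imp_closed)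
  qed
  show ?thesis
    unfolding proper_map_def
  proof
    show "closed_map ?Z (WbQ n) ?q"
      unfolding closed_map_def
    proof (intro allI impI)
      fix C assume C: "closedin ?Z C"
      have sub: "?q ` C \<subseteq> topspace (WbQ n)"
        using closedin_subset[OF C] qq_in by auto
      then show "closedin (WbQ n) (?q ` C)"
        using sat[OF C] quotient_map_qq[of n] unfolding quotient_map_closedin by auto
    qed
    show "\<forall>c\<in>topspace (WbQ n). compactin ?Z {z \<in> topspace ?Z. ?q z = c}"
    proof
      fix c assume "c \<in> topspace (WbQ n)"
      then have "c \<in> ?q ` topspace ?Z" using quotient_imp_surjective_map[OF quotient_map_qq[of n]] by simp
      then obtain z where z: "z \<in> Zc n" "c = ?q z" by auto
      have "closedin ?Z {z}" using z by (intro closed_subset) auto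
      from sat[OF this] have "closedin ?Z {z' \<in> topspace ?Z. ?q z' = c}" using z by simp
      then show "compactin ?Z {z \<in> topspace ?Z. ?q z = c}"
        using compact_Zc[of n] by (intro closedin_compact_space) (auto simp: compact_space_subtopology)
    qed
  qed
qed

section \<open>The weak bimodule operations in flat coordinates\<close>

definition wsnoc :: "wbpt \<Rightarrow> wbpt" where
  "wsnoc p = wb_lcomp_pt 2 1 p"

abbreviation lpt :: "nat \<Rightarrow> nat \<Rightarrow> wbpt \<Rightarrow> wbpt" where
  "lpt a b p \<equiv> wb_lcomp_pt (Suc (a + b)) (Suc a) p"

text \<open>Every left composition is iterated from two moves: prepending a one-point factor at time
  0, as here, and appending one at time 1 by \<open>wsnoc\<close>.\<close>

lemma lpt_Suc_left: "lpt (Suc a) b p = wcons 1 (\<lambda>_. 0) 0 (lpt a b p)"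
  by (cases p) (auto simp: wb_lcomp_pt_def wcons_def fun_eq_iff split: nat.split)

lemma lpt_Suc_right: "lpt 0 (Suc b) p = wsnoc (lpt 0 b p)"
  by (cases p) (auto simp: wsnoc_def wb_lcomp_pt_def fun_eq_iff simp flip: replicate_append_same)

lemma lpt_0: "wb_valid n p \<Longrightarrow> lpt 0 0 p = p"
  by (cases p) (auto simp: wb_lcomp_pt_def wb_valid_def fun_eq_iff)

lemma wsnoc_wcons: "wsnoc (wcons m x t p) = wcons m x t (wsnoc p)"
  by (cases p) (auto simp: wsnoc_def wb_lcomp_pt_def wcons_def fun_eq_iff split: nat.split)

lemma wsnoc_Nil: "wsnoc ([], X, T) = wcons 1 (\<lambda>_. 0) 1 ([], \<lambda>_ _. 0, \<lambda>_. 0)"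
  by (auto simp: wsnoc_def wb_lcomp_pt_def wcons_def fun_eq_iff split: nat.split)

lemma wsnoc_props:
  "wb_valid n p \<Longrightarrow> wb_valid (Suc n) (wsnoc p) \<and> (\<forall>i. Suc i < n \<longrightarrow> flY (wsnoc p) i = flY p i) \<and>
     (\<forall>i<n. flT (wsnoc p) i = flT p i) \<and> flT (wsnoc p) n = 1 \<and> (\<forall>i. Suc i = n \<longrightarrow> flY (wsnoc p) i = 1)"
proof (induction p arbitrary: n rule: wcons_induct)
  case (1 X T)
  then show ?case by (simp add: valid_Nil wsnoc_Nil valid_wcons cube_def flT_wcons)
next
  case (2 m x t p)
  note v = 2(2)[unfolded valid_wcons]
  have IH: "wb_valid (Suc (n - m)) (wsnoc p)" "\<And>i. Suc i < n - m \<Longrightarrow> flY (wsnoc p) i = flY p i"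
    "\<And>i. i < n - m \<Longrightarrow> flT (wsnoc p) i = flT p i" "flT (wsnoc p) (n - m) = 1" "\<And>i. Suc i = n - m \<Longrightarrow> flY (wsnoc p) i = 1"
    using 2(1)[of "n - m"] v by blast+
  have "t \<le> flT (wsnoc p) 0" using IH(3)[of 0] IH(4) v by (cases "m < n") auto
  then have "wb_valid (Suc n) (wcons m x t (wsnoc p))" using v IH(1) by (simp add: valid_wcons Suc_diff_le)
  moreover have "flY (wcons m x t (wsnoc p)) i = flY (wcons m x t p) i" if "Suc i < n" for i
  proof (cases "i < m")
    case False
    then have "Suc (i - m) < n - m" using that by linarith
    then show ?thesis using False IH(2)[of "i - m"] by (simp add: flY_wcons)
  qed (auto simp: flY_wcons)
  moreover have "flT (wcons m x t (wsnoc p)) i = flT (wcons m x t p) i" if "i < n" for i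
    using that IH(3)[of "i - m"] by (auto simp: flT_wcons)
  moreover have "flT (wcons m x t (wsnoc p)) n = 1" using IH(4) v by (simp add: flT_wcons)
  moreover have "flY (wcons m x t (wsnoc p)) i = 1" if "Suc i = n" for i
  proof (cases "Suc i = m")
    case False
    then have "m \<le> i" "Suc (i - m) = n - m" using that v by auto
    then show ?thesis using IH(5)[of "i - m"] by (simp add: flY_wcons)
  qed (simp add: flY_wcons)
  ultimately show ?case unfolding wsnoc_wcons by blast
qed

text \<open>Gaps after the right action of \<open>ks\<close>: each point becomes a cluster with gaps
  0 inside, and its old gap follows the last point of the cluster.\<close>

primrec expY :: "nat list \<Rightarrow> (nat \<Rightarrow> real) \<Rightarrow> nat \<Rightarrow> real" where
  "expY [] y = (\<lambda>_. 0)"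
| "expY (k # ks) y = (\<lambda>i. if Suc i < k then 0 else if Suc i = k then y 0 else expY ks (sh 1 y) (i - k))"

primrec expT :: "nat list \<Rightarrow> (nat \<Rightarrow> real) \<Rightarrow> nat \<Rightarrow> real" where
  "expT [] t = (\<lambda>_. 0)"
| "expT (k # ks) t = (\<lambda>i. if i < k then t 0 else expT ks (sh 1 t) (i - k))"

lemma fromlist_zeros: "fromlist (replicate a 0 @ s # l) i = (if i < a then 0 else if i = a then s else fromlist l (i - Suc a))"
  by (auto simp: fromlist_def nth_append nth_Cons')

lemma cube_ract_expY:
  assumes "ks \<noteq> []" "\<And>k. k \<in> set ks \<Longrightarrow> 1 \<le> k"
  shows "cube_ract ks x = trY (sum_list ks) (expY ks x)"
proof
  fix i
  have "fromlist (glue_sep (map x [0..<length ks - 1]) (map (\<lambda>k. replicate (k - 1) 0) ks)) i = trY (sum_list ks) (expY ks x) i"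
    using assms
  proof (induction ks arbitrary: x i)
    case (Cons k ks)
    show ?case
    proof (cases ks)
      case Nil
      then show ?thesis by (auto simp: fromlist_def trY_def)
    next
      case (Cons k2 ks2)
      have up: "map x [0..<length (k # ks) - 1] = x 0 # map (sh 1 x) [0..<length ks - 1]"
        using Cons by (simp add: sh_def map_upt_Suc del: upt_Suc)
      have k: "1 \<le> k" "0 < sum_list ks" using Cons.prems Cons by force+
      define g where "g = glue_sep (map (sh 1 x) [0..<length ks - 1]) (map (\<lambda>k. replicate (k - 1) 0) ks)"
      have IH: "fromlist g j = trY (sum_list ks) (expY ks (sh 1 x)) j" for j
        unfolding g_def by (rule Cons.IH) (use Cons.prems Cons in auto)
      have eq: "glue_sep (map x [0..<length (k # ks) - 1]) (map (\<lambda>k. replicate (k - 1) 0) (k # ks)) = replicate (k - 1) 0 @ x 0 # g"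
        unfolding up g_def using Cons by simp
      show ?thesis
        unfolding eq fromlist_zeros IH using k by (auto simp: trY_def)
    qed
  qed simp
  then show "cube_ract ks x i = trY (sum_list ks) (expY ks x) i"
    by (simp add: cube_ract_def tolist_def)
qed

lemma inZ_exp:
  "(\<And>k. k \<in> set ks \<Longrightarrow> 1 \<le> k) \<Longrightarrow> inZ (length ks) y t \<Longrightarrow> inZ (sum_list ks) (expY ks y) (expT ks t)"
proof (induction ks arbitrary: y t)
  case Nil
  then show ?case by (simp add: inZ_def)
next
  case (Cons k ks)
  have z: "inZ (sum_list ks) (expY ks (sh 1 y)) (expT ks (sh 1 t))"
    by (rule Cons.IH) (use Cons.prems inZ_sh[of 1 "length ks"] in auto)
  have k: "1 \<le> k" using Cons.prems by simp
  have t0: "0 \<le> t 0" "t 0 \<le> 1" using Cons.prems(2) by (auto simp: inZ_def)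
  show ?case
    unfolding inZ_def
  proof (intro conjI allI impI)
    fix i assume i: "Suc i < sum_list (k # ks)"
    let ?Y = "expY (k # ks) y" and ?T = "expT (k # ks) t"
    have *: "0 \<le> ?Y i \<and> ?Y i \<le> 1 \<and> ?T i \<le> ?T (Suc i) \<and> (?Y i < 1 \<longrightarrow> ?T i = ?T (Suc i))"
    proof -
      consider "Suc i < k" | "Suc i = k" | "k \<le> i" by linarith
      then show ?thesis
      proof cases
        case 1
        then show ?thesis by simp
      next
        case 2
        then obtain k2 ks2 where ks: "ks = k2 # ks2" using i by (cases ks) auto
        then have "1 \<le> k2" using Cons.prems by simp
        then have "?T (Suc i) = t 1" "?T i = t 0" "?Y i = y 0" using 2 ks by (auto simp: sh_def)
        then show ?thesis using Cons.prems(2) ks by (auto simp: inZ_def)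
      next
        case 3
        then have "Suc (i - k) < sum_list ks" "Suc i - k = Suc (i - k)" using i by auto
        then show ?thesis using 3 z by (auto simp: inZ_def)
      qed
    qed
    show "0 \<le> ?Y i" "?Y i \<le> 1" "?T i \<le> ?T (Suc i)" "?Y i < 1 \<Longrightarrow> ?T i = ?T (Suc i)" using * by blast+
  next
    fix i assume "i < sum_list (k # ks)"
    then show "0 \<le> expT (k # ks) t i" "expT (k # ks) t i \<le> 1" using z t0 by (auto simp: inZ_def)
  qed
qed

text \<open>Shrinking a cluster by one point deletes a gap of width 0; this makes
  \<open>weave_dup\<close> applicable to general right actions.\<close>

lemma exp_del:
  assumes "1 \<le> k"
  shows "del (sum_list ks1) (expY (ks1 @ Suc k # ks2) y) = expY (ks1 @ k # ks2) y"
    "del (sum_list ks1) (expT (ks1 @ Suc k # ks2) t) = expT (ks1 @ k # ks2) t"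
    "expY (ks1 @ Suc k # ks2) y (sum_list ks1) = 0"
proof -
  show "expY (ks1 @ Suc k # ks2) y (sum_list ks1) = 0" for y
    using assms by (induction ks1 arbitrary: y) auto
  show "del (sum_list ks1) (expY (ks1 @ Suc k # ks2) y) = expY (ks1 @ k # ks2) y"
  proof (induction ks1 arbitrary: y)
    case Nil
    show ?case using assms by (auto simp: del_def fun_eq_iff)
  next
    case (Cons a ks1)
    show ?case
    proof
      fix i
      show "del (sum_list (a # ks1)) (expY ((a # ks1) @ Suc k # ks2) y) i = expY ((a # ks1) @ k # ks2) y i"
        using fun_cong[OF Cons, of "sh 1 y" "i - a"]
        by (cases "i < a"; cases "i - a < sum_list ks1") (auto simp: del_def Suc_diff_le)
    qed
  qed
  show "del (sum_list ks1) (expT (ks1 @ Suc k # ks2) t) = expT (ks1 @ k # ks2) t"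
  proof (induction ks1 arbitrary: t)
    case Nil
    show ?case using assms by (auto simp: del_def fun_eq_iff)
  next
    case (Cons a ks1)
    show ?case
    proof
      fix i
      show "del (sum_list (a # ks1)) (expT ((a # ks1) @ Suc k # ks2) t) i = expT ((a # ks1) @ k # ks2) t i"
        using fun_cong[OF Cons, of "sh 1 t" "i - a"]
        by (cases "i < a"; cases "i - a < sum_list ks1") (auto simp: del_def Suc_diff_le)
    qed
  qed
qed

lemma exp_ones: "Suc i \<le> n \<Longrightarrow> expY (replicate n 1) y i = y i" "i < n \<Longrightarrow> expT (replicate n 1) y i = y i"
proof -
  show "Suc i \<le> n \<Longrightarrow> expY (replicate n 1) y i = y i"
    by (induction n arbitrary: i y) (auto simp: sh_def)
  show "i < n \<Longrightarrow> expT (replicate n 1) y i = y i"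
    by (induction n arbitrary: i y) (auto simp: sh_def)
qed

text \<open>Closed form of \<open>expY\<close> when one entry is \<open>k\<close> and the others are
  1. The comparison with \<open>Suc i\<close> leaves \<open>k - 1\<close> zero gaps, after which the
  old gap \<open>P\<close> reappears.\<close>

definition insY :: "nat \<Rightarrow> nat \<Rightarrow> (nat \<Rightarrow> real) \<Rightarrow> nat \<Rightarrow> real" where
  "insY P k y i = (if i < P then y i else if Suc i < P + k then 0 else y (Suc i - k))"

definition insT :: "nat \<Rightarrow> nat \<Rightarrow> (nat \<Rightarrow> real) \<Rightarrow> nat \<Rightarrow> real" where
  "insT P k t i = (if i < P then t i else if i < P + k then t P else t (Suc i - k))"

lemma exp_ins:
  assumes "1 \<le> k"
  shows "Suc i < P + k + r \<Longrightarrow> expY (replicate P 1 @ k # replicate r 1) y i = insY P k y i"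
    "i < P + k + r \<Longrightarrow> expT (replicate P 1 @ k # replicate r 1) t i = insT P k t i"
proof -
  show "Suc i < P + k + r \<Longrightarrow> expY (replicate P 1 @ k # replicate r 1) y i = insY P k y i"
  proof (induction P arbitrary: i y)
    case 0
    show ?case
    proof (cases "i < k")
      case False
      then show ?thesis using 0 exp_ones(1)[of "i - k" r "sh 1 y"] by (simp add: insY_def sh_def Suc_diff_le)
    qed (use assms in \<open>auto simp: insY_def\<close>)
  next
    case (Suc P)
    then show ?case using assms by (cases i) (auto simp: insY_def sh_def Suc_diff_le)
  qed
  show "i < P + k + r \<Longrightarrow> expT (replicate P 1 @ k # replicate r 1) t i = insT P k t i"
  proof (induction P arbitrary: i t)
    case 0
    show ?case
    proof (cases "i < k")
      case False
      then show ?thesis using 0 exp_ones(2)[of "i - k" r "sh 1 t"] by (simp add: insT_def sh_def Suc_diff_le)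
    qed (use assms in \<open>auto simp: insT_def\<close>)
  next
    case (Suc P)
    then show ?case using assms by (cases i) (auto simp: insT_def sh_def Suc_diff_le)
  qed
qed

text \<open>Writing \<open>i\<close> as \<open>i' + K\<close> past the insertion removes the
  truncated subtractions of \<open>insY\<close> and \<open>insT\<close>.\<close>

lemma insertion_cases:
  fixes i P K :: nat
  obtains "i < P" | "P \<le> i" "i < P + K" | i' where "i = i' + K" "P \<le> i'"
proof (cases "i < P + K")
  case True
  then show ?thesis using that(1,2) by linarith
next
  case False
  then have "i = (i - K) + K" "P \<le> i - K" by auto
  then show ?thesis by (rule that(3))
qed

lemma insertion_cases':
  fixes i P K :: nat
  obtains "i < P" | "P \<le> i" "i < P + Suc K" | i' where "i = i' + K" "P < i'"
proof (cases "i < P + Suc K")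
  case True
  then show ?thesis using that(1,2) by linarith
next
  case False
  then have "i = (i - K) + K" "P < i - K" by auto
  then show ?thesis by (rule that(3))
qed

lemma replicate_update: "1 \<le> j \<Longrightarrow> j \<le> n \<Longrightarrow> (replicate n 1)[j - 1 := k] = replicate (j - 1) 1 @ k # replicate (n - j) (1::nat)"
  by (rule nth_equalityI) (auto simp: nth_append nth_list_update nth_Cons')

lemma cube_rcomp_ins:
  assumes "1 \<le> j" "j \<le> m" "1 \<le> k"
  shows "cube_rcomp m x j k = trY (m + k - 1) (insY (j - 1) k x)"
proof -
  let ?ks = "replicate (j - 1) 1 @ k # replicate (m - j) (1::nat)"
  have "cube_rcomp m x j k = trY (sum_list ?ks) (expY ?ks x)"
    unfolding cube_rcomp_def replicate_update[OF assms(1,2)]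
    by (rule cube_ract_expY) (use assms in auto)
  also have "sum_list ?ks = m + k - 1" using assms by (simp add: sum_list_replicate)
  also have "trY (m + k - 1) (expY ?ks x) = trY (m + k - 1) (insY (j - 1) k x)"
    using exp_ins(1)[OF assms(3), of _ "j - 1" "m - j" x] assms by (auto simp: trY_def fun_eq_iff)
  finally show ?thesis .
qed

lemma insY_cube:
  assumes "x \<in> cube m" "1 \<le> j" "j \<le> m" "1 \<le> k"
  shows "trY (m + k - 1) (insY (j - 1) k x) \<in> cube (m + k - 1)"
  using assms by (auto simp: cube_def trY_def insY_def)

text \<open>\<open>wb_rcomp_pt\<close> locates the factor containing input \<open>j\<close> by a
  \<open>LEAST\<close>; this rule and the next turn that search into a recursion along the
  factors.\<close>

lemma rpt_wcons_le:
  assumes "1 \<le> j" "j \<le> m"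
  shows "wb_rcomp_pt j k (wcons m x t p) = wcons (m + k - 1) (cube_rcomp m x j k) t p"
proof (cases p)
  case (fields ns X T)
  have "(LEAST i. j \<le> sum_list (take (Suc i) (m # ns))) = 0"
    by (rule Least_eq_0) (use assms in simp)
  then show ?thesis
    unfolding fields wcons_def wb_rcomp_pt_def prod.case Let_def
    by (auto simp: fun_eq_iff split: nat.split)
qed

lemma rpt_wcons_gt:
  assumes "m < j" "j \<le> m + sum_list (fst p)"
  shows "wb_rcomp_pt j k (wcons m x t p) = wcons m x t (wb_rcomp_pt (j - m) k p)"
proof (cases p)
  case (fields ns X T)
  have "(LEAST i. j \<le> sum_list (take (Suc i) (m # ns))) = Suc (LEAST i. j \<le> sum_list (take (Suc (Suc i)) (m # ns)))"
    by (rule Least_Suc[where n = "length ns"]) (use assms fields in auto)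
  moreover have "(\<lambda>i. j \<le> sum_list (take (Suc (Suc i)) (m # ns))) = (\<lambda>i. j - m \<le> sum_list (take (Suc i) ns))"
    by (auto simp: fun_eq_iff)
  ultimately have L: "(LEAST i. j \<le> sum_list (take (Suc i) (m # ns))) = Suc (LEAST i. j - m \<le> sum_list (take (Suc i) ns))"
    by simp
  show ?thesis
    unfolding fields wcons_def wb_rcomp_pt_def prod.case Let_def L
    by (auto simp: fun_eq_iff split: nat.split)
qed

lemma rpt_props:
  "wb_valid n p \<Longrightarrow> 1 \<le> j \<Longrightarrow> j \<le> n \<Longrightarrow> 1 \<le> k \<Longrightarrow> wb_valid (n + k - 1) (wb_rcomp_pt j k p) \<and>
     flY (wb_rcomp_pt j k p) = insY (j - 1) k (flY p) \<and> flT (wb_rcomp_pt j k p) = insT (j - 1) k (flT p)"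
proof (induction p arbitrary: n j rule: wcons_induct)
  case (1 X T)
  then show ?case by (simp add: valid_Nil)
next
  case (2 m x t p)
  note v = 2(2)[unfolded valid_wcons]
  show ?case
  proof (cases "j \<le> m")
    case True
    have e: "wb_rcomp_pt j k (wcons m x t p) = wcons (m + k - 1) (trY (m + k - 1) (insY (j - 1) k x)) t p"
      using rpt_wcons_le[of j m] cube_rcomp_ins[of j m k x] True 2 by simp
    have "wb_valid (n + k - 1) (wb_rcomp_pt j k (wcons m x t p))"
      unfolding e valid_wcons using v 2(3-5) True insY_cube[of x m j k] by auto
    moreover obtain P K where jk: "j = Suc P" "k = Suc K" using 2(3,5) by (cases j; cases k) auto
    have Pm: "P < m" using True jk by simp
    have "flY (wb_rcomp_pt j k (wcons m x t p)) i = insY (j - 1) k (flY (wcons m x t p)) i" for i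
    proof -
      consider "i < P" | "P \<le> i" "i < P + K" | i' where "i = i' + K" "P \<le> i'"
        by (rule insertion_cases)
      then show ?thesis
        unfolding jk e[unfolded jk] flY_wcons using Pm by cases (auto simp: insY_def trY_def)
    qed
    moreover have "flT (wb_rcomp_pt j k (wcons m x t p)) i = insT (j - 1) k (flT (wcons m x t p)) i" for i
    proof -
      consider "i < P" | "P \<le> i" "i < P + Suc K" | i' where "i = i' + K" "P < i'"
        by (rule insertion_cases')
      then show ?thesis
        unfolding jk e[unfolded jk] flT_wcons using Pm by cases (auto simp: insT_def)
    qed
    ultimately show ?thesis by blast
  next
    case False
    have "sum_list (fst p) = n - m" using v by (cases p) (auto simp: wb_valid_def)
    then have e: "wb_rcomp_pt j k (wcons m x t p) = wcons m x t (wb_rcomp_pt (j - m) k p)"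
      using rpt_wcons_gt[of m j p] False 2 v by simp
    have IH: "wb_valid (n - m + k - 1) (wb_rcomp_pt (j - m) k p)" "flY (wb_rcomp_pt (j - m) k p) = insY (j - m - 1) k (flY p)"
      "flT (wb_rcomp_pt (j - m) k p) = insT (j - m - 1) k (flT p)"
      using 2(1)[of "n - m" "j - m"] v 2(3-5) False by auto
    have "wb_valid (n + k - 1) (wb_rcomp_pt j k (wcons m x t p))"
      unfolding e valid_wcons using v 2(3-5) False IH by (auto simp: insT_def)
    moreover obtain Q K where jk: "j = Suc (m + Q)" "k = Suc K"
      using 2(3,5) False by (cases k) (auto simp: not_le less_iff_Suc_add)
    have "flY (wb_rcomp_pt j k (wcons m x t p)) i = insY (j - 1) k (flY (wcons m x t p)) i" for i
    proof (cases "i < m")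
      case True
      then show ?thesis unfolding jk e[unfolded jk] flY_wcons by (auto simp: insY_def)
    next
      case im: False
      then obtain d where d: "i = m + d" using le_Suc_ex not_less by blast
      consider "d < Q" | "Q \<le> d" "d < Q + K" | d' where "d = d' + K" "Q \<le> d'"
        by (rule insertion_cases)
      then show ?thesis
        unfolding jk e[unfolded jk] flY_wcons IH(2)[unfolded jk] d using v by cases (auto simp: insY_def)
    qed
    moreover have "flT (wb_rcomp_pt j k (wcons m x t p)) i = insT (j - 1) k (flT (wcons m x t p)) i" for i
    proof (cases "i < m")
      case True
      then show ?thesis unfolding jk e[unfolded jk] flT_wcons by (auto simp: insT_def)
    next
      case im: False
      then obtain d where d: "i = m + d" using le_Suc_ex not_less by blast
      consider "d < Q" | "Q \<le> d" "d < Q + Suc K" | d' where "d = d' + K" "Q < d'"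
        by (rule insertion_cases')
      then show ?thesis
        unfolding jk e[unfolded jk] flT_wcons IH(3)[unfolded jk] d using v by cases (auto simp: insT_def)
    qed
    ultimately show ?thesis by blast
  qed
qed

section \<open>Weaves and weak bimodule maps\<close>

context assoc_bimod begin

lemma weave_left_pt:
  assumes H: "weave H" and p: "wb_valid n p"
  shows "wb_valid (Suc n) (wcons 1 (\<lambda>_. 0) 0 p)"
    and "H (Suc n) (flY (wcons 1 (\<lambda>_. 0) 0 p)) (flT (wcons 1 (\<lambda>_. 0) 0 p)) = a2 1 n (eta 1) (H n (flY p) (flT p))"
proof -
  show v: "wb_valid (Suc n) (wcons 1 (\<lambda>_. 0) 0 p)"
    using p flat_inZ[OF p] by (auto simp: valid_wcons cube_def inZ_def)
  have "sh 1 (flY (wcons 1 (\<lambda>_. 0) 0 p)) = flY p" "sh 1 (flT (wcons 1 (\<lambda>_. 0) 0 p)) = flT p"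
    by (auto simp: sh_def flY_wcons flT_wcons)
  then show "H (Suc n) (flY (wcons 1 (\<lambda>_. 0) 0 p)) (flT (wcons 1 (\<lambda>_. 0) 0 p)) = a2 1 n (eta 1) (H n (flY p) (flT p))"
    using weave_left[OF H flat_inZ[OF v]] by (simp add: flT_wcons)
qed

lemma weave_right_pt:
  assumes H: "weave H" and p: "wb_valid n p"
  shows "H (Suc n) (flY (wsnoc p)) (flT (wsnoc p)) = a2 n 1 (H n (flY p) (flT p)) (eta 1)"
proof -
  have s: "wb_valid (Suc n) (wsnoc p)" "\<And>i. Suc i < n \<Longrightarrow> flY (wsnoc p) i = flY p i"
    "\<And>i. i < n \<Longrightarrow> flT (wsnoc p) i = flT p i" "flT (wsnoc p) n = 1" using wsnoc_props[OF p] by auto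
  have "H n (flY (wsnoc p)) (flT (wsnoc p)) = H n (flY p) (flT p)"
    by (rule weave_cong[OF H]) (use s in auto)
  then show ?thesis using weave_right[OF H flat_inZ[OF s(1)] s(4)] by simp
qed

lemma weave_lpt:
  assumes H: "weave H" and p: "wb_valid n p"
  shows "wb_valid (a + n + b) (lpt a b p) \<and> H (a + n + b) (flY (lpt a b p)) (flT (lpt a b p)) = pad a b n (H n (flY p) (flT p))"
proof -
  have c: "H n (flY p) (flT p) \<in> topspace (Op n)" by (rule weave_closed[OF H flat_inZ[OF p]])
  have base: "wb_valid (n + b) (lpt 0 b p) \<and> H (n + b) (flY (lpt 0 b p)) (flT (lpt 0 b p)) = pad 0 b n (H n (flY p) (flT p))"
  proof (induction b)
    case 0
    then show ?case using lpt_0[OF p] p pad_0[OF c] by simp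
  next
    case (Suc b)
    then have v: "wb_valid (n + b) (lpt 0 b p)" by simp
    show ?case
      unfolding lpt_Suc_right using Suc weave_right_pt[OF H v] wsnoc_props[OF v] pad_right[OF c, of 0 b] by simp
  qed
  show ?thesis
  proof (induction a)
    case 0
    then show ?case using base by simp
  next
    case (Suc a)
    then have v: "wb_valid (a + n + b) (lpt a b p)" by simp
    show ?case
      unfolding lpt_Suc_left using Suc weave_left_pt[OF H v] pad_left[OF c, of a b] by simp
  qed
qed

text \<open>Induction on the number of resulting points: a cluster of size at least 2 arises from a
  smaller one by doubling its first point. If all clusters have size 1, both sides are the original
  value.\<close>

lemma weave_ract:
  assumes H: "weave H"
  shows "(\<And>k. k \<in> set ks \<Longrightarrow> 1 \<le> k) \<Longrightarrow> inZ (length ks) y t \<Longrightarrow>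
    H (sum_list ks) (expY ks y) (expT ks t) = ract ks (H (length ks) y t)"
proof (induction "sum_list ks" arbitrary: ks)
  case 0
  then have "ks = []" by (cases ks) force+
  then show ?case using ract_ones[of "H 0 y t" 0] weave_closed[OF H 0(3)] weave_cong[OF H, of 0 "\<lambda>_. 0" y "\<lambda>_. 0" t] by simp
next
  case (Suc N)
  note c = weave_closed[OF H Suc.prems(2)]
  show ?case
  proof (cases "\<forall>k\<in>set ks. k = 1")
    case True
    then have ks: "ks = replicate (length ks) 1" by (simp add: replicate_eqI)
    define n where "n = length ks"
    have "H n (expY (replicate n 1) y) (expT (replicate n 1) t) = H n y t"
      by (rule weave_cong[OF H]) (use exp_ones in auto)
    then show ?thesis using ks c ract_ones[of "H n y t" n] unfolding n_def[symmetric] by (simp add: sum_list_replicate)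
  next
    case False
    then obtain k' where k': "k' \<in> set ks" "k' \<noteq> 1" by blast
    then obtain ks1 ks2 where "ks = ks1 @ k' # ks2" by (meson split_list)
    moreover have "1 \<le> k'" using Suc.prems k' by simp
    then obtain k where k: "k' = Suc k" "1 \<le> k" using k' by (cases k') auto
    ultimately have ks: "ks = ks1 @ Suc k # ks2" by simp
    define ks' where "ks' = ks1 @ k # ks2"
    define P where "P = sum_list ks1"
    have len: "length ks' = length ks" and sum: "sum_list ks = Suc (sum_list ks')" "N = sum_list ks'"
      using Suc.hyps(2) ks by (auto simp: ks'_def)
    have pos: "\<And>k. k \<in> set ks' \<Longrightarrow> 1 \<le> k" using Suc.prems(1) ks k by (auto simp: ks'_def)
    have P: "P < sum_list ks'" using k by (simp add: P_def ks'_def)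
    have IH: "H (sum_list ks') (expY ks' y) (expT ks' t) = ract ks' (H (length ks') y t)"
      by (rule Suc.hyps(1)[OF sum(2) pos]) (use Suc.prems len in auto)
    have "H (Suc (sum_list ks')) (expY ks y) (expT ks t) =
      ract (dup (sum_list ks') P) (H (sum_list ks') (del P (expY ks y)) (del P (expT ks t)))"
      by (rule weave_dup[OF H _ P])
         (use inZ_exp[OF Suc.prems] sum exp_del(3)[OF k(2)] in \<open>auto simp: ks P_def\<close>)
    also have "del P (expY ks y) = expY ks' y" unfolding ks P_def ks'_def by (rule exp_del(1)[OF k(2)])
    also have "del P (expT ks t) = expT ks' t" unfolding ks P_def ks'_def by (rule exp_del(2)[OF k(2)])
    also have "ract (dup (sum_list ks') P) (H (sum_list ks') (expY ks' y) (expT ks' t)) = ract ks (H (length ks) y t)"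
      unfolding IH unfolding ks'_def P_def ks
      using ract_dup_ract[where ?ks1.0 = ks1 and k = k and ?ks2.0 = ks2 and x = "H (length ks) y t"] pos c unfolding ks ks'_def by simp
    finally show ?thesis using sum by simp
  qed
qed

text \<open>A first time 0 or a last time 1 lets a unit be split off together with the gap next to
  it. Otherwise all times lie strictly between 0 and 1, where \<open>simZ\<close> is equality of
  coordinates.\<close>

lemma weave_sim:
  assumes H: "weave H"
  shows "inZ n y t \<Longrightarrow> inZ n y' t' \<Longrightarrow> simZ n y t y' t' \<Longrightarrow> H n y t = H n y' t'"
proof (induction n arbitrary: y t y' t')
  case 0
  show ?case by (rule weave_cong[OF H]) auto
next
  case (Suc n)
  have tt: "t i = t' i" if "i < Suc n" for i using Suc.prems(3) that by (simp add: simZ_def)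
  consider "t 0 = 0" | "t n = 1" | "t 0 \<noteq> 0" "t n \<noteq> 1" by blast
  then show ?case
  proof cases
    case 1
    have "H n (sh 1 y) (sh 1 t) = H n (sh 1 y') (sh 1 t')"
      by (rule Suc.IH) (use Suc.prems inZ_sh[of 1 n] in \<open>auto simp: simZ_def sh_def\<close>)
    then show ?thesis
      using weave_left[OF H Suc.prems(1) 1] weave_left[OF H Suc.prems(2)] 1 tt[of 0] by simp
  next
    case 2
    have "H n y t = H n y' t'"
    proof (rule Suc.IH)
      show "inZ n y t" "inZ n y' t'" using inZ_take Suc.prems(1,2) by force+
      show "simZ n y t y' t'" using Suc.prems(3) unfolding simZ_def by (meson less_SucI)
    qed
    then show ?thesis
      using weave_right[OF H Suc.prems(1) 2] weave_right[OF H Suc.prems(2)] 2 tt[of n] by simp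
  next
    case 3
    have "t i \<noteq> 0 \<and> t i \<noteq> 1" if "i < Suc n" for i
      using inZ_mono[OF Suc.prems(1), of 0 i] inZ_mono[OF Suc.prems(1), of i n] that 3 Suc.prems(1)
      by (force simp: inZ_def)
    then show ?thesis
      by (intro weave_cong[OF H]) (use Suc.prems(3) in \<open>auto simp: simZ_def\<close>)
  qed
qed

text \<open>\<open>realize\<close> and \<open>unreal\<close> translate between weaves and weak
  bimodule maps and are mutually inverse, weaves being compared on legal configurations.\<close>

definition realize :: "(nat \<Rightarrow> (nat \<Rightarrow> real) \<Rightarrow> (nat \<Rightarrow> real) \<Rightarrow> 'a) \<Rightarrow> nat \<Rightarrow> wbpt set \<Rightarrow> 'a" where
  "realize H n c = (if c \<in> topspace (WbQ n) then H n (flY (SOME p. p \<in> c)) (flT (SOME p. p \<in> c)) else undefined)"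

definition unreal :: "(nat \<Rightarrow> wbpt set \<Rightarrow> 'a) \<Rightarrow> nat \<Rightarrow> (nat \<Rightarrow> real) \<Rightarrow> (nat \<Rightarrow> real) \<Rightarrow> 'a" where
  "unreal h n y t = h n (qq n (trY n y) (trT n t))"

lemma class_rep:
  assumes "c \<in> topspace (WbQ n)"
  shows "wb_valid n (SOME p. p \<in> c)" "c = wbR `` {SOME p. p \<in> c}"
proof -
  obtain p where p: "wb_valid n p" "c = wbR `` {p}" using assms unfolding topspace_WbQ by blast
  then have "p \<in> c" by (simp add: wbR_def)
  then have r: "(SOME p. p \<in> c) \<in> c" by (rule someI)
  then have pr: "(p, SOME p. p \<in> c) \<in> wbR" using p by simp
  then show "wb_valid n (SOME p. p \<in> c)" using wbR_simZ[OF _ p(1)] by blast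
  show "c = wbR `` {SOME p. p \<in> c}" using wbR_class_eq[OF pr] p(2) by metis
qed

lemma realize_class:
  assumes H: "weave H" and p: "wb_valid n p"
  shows "realize H n (wbR `` {p}) = H n (flY p) (flT p)"
proof -
  let ?c = "wbR `` {p}"
  have c: "?c \<in> topspace (WbQ n)" using p unfolding topspace_WbQ by blast
  note r = class_rep[OF c]
  have "(SOME p. p \<in> ?c) \<in> ?c" by (rule someI[of _ p]) (simp add: wbR_def)
  then have "simZ n (flY p) (flT p) (flY (SOME p. p \<in> ?c)) (flT (SOME p. p \<in> ?c))"
    using wbR_simZ[OF _ p] by blast
  then have "H n (flY p) (flT p) = H n (flY (SOME p. p \<in> ?c)) (flT (SOME p. p \<in> ?c))"
    by (rule weave_sim[OF H flat_inZ[OF p] flat_inZ[OF r(1)]])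
  then show ?thesis using c by (simp add: realize_def)
qed

lemma realize_qq:
  assumes H: "weave H" and z: "inZ n y t"
  shows "realize H n (qq n y t) = H n y t"
proof -
  obtain p where p: "wb_valid n p" "eqZ n p y t" using flat_surj[OF z] by blast
  have "qq n y t = wbR `` {p}" by (rule qq_eqI[OF z p(1)]) (use p(2) in \<open>auto simp: simZ_def eqZ_def\<close>)
  moreover have "H n (flY p) (flT p) = H n y t" by (rule weave_cong[OF H]) (use p(2) in \<open>auto simp: eqZ_def\<close>)
  ultimately show ?thesis using realize_class[OF H p(1)] by simp
qed

lemma qq_tr: "inZ n y t \<Longrightarrow> qq n (trY n y) (trT n t) = qq n y t"
proof -
  assume z: "inZ n y t"
  have "simZ n (trY n y) (trT n t) y t" by (simp add: simZ_def trY_def trT_def)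
  then show ?thesis using qq_eq_iff[of n "trY n y" "trT n t" y t] z by (simp add: inZ_tr)
qed

lemma unreal_realize: "weave H \<Longrightarrow> inZ n y t \<Longrightarrow> unreal (realize H) n y t = H n y t"
  by (simp add: unreal_def qq_tr realize_qq)

text \<open>The compositions on \<open>WbQ\<close> are computed on the chosen representative of a
  class, and \<open>realize\<close> evaluates at the same one; so the identities for single points
  transfer.\<close>

lemma realize_wbimod:
  assumes H: "weave H" and cont: "\<And>n. continuous_map (top_of_set (Zset n)) (Op n) (\<lambda>z. H n (fst z) (snd z))"
  shows "wbimod_map Op lact ract eta (realize H)"
  unfolding wbimod_map_def
proof (intro conjI allI impI)
  fix n
  have sub: "Zc n \<subseteq> Zset n" by auto
  have "continuous_map (top_of_set (Zc n)) (Op n) (\<lambda>z. H n (fst z) (snd z))"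
    by (rule continuous_map_from_subtopology_mono[OF cont sub])
  then have "continuous_map (top_of_set (Zc n)) (Op n) (realize H n \<circ> (\<lambda>z. qq n (fst z) (snd z)))"
    by (rule continuous_map_eq) (use realize_qq[OF H] in auto)
  then have "continuous_map (WbQ n) (Op n) (realize H n)"
    by (rule continuous_compose_quotient_map[OF quotient_map_qq])
  then show "realize H n \<in> cmaps (WbQ n) (Op n)" by (simp add: cmaps_def realize_def)
next
  fix n c and k j :: nat assume a: "c \<in> topspace (WbQ n) \<and> 1 \<le> k \<and> 1 \<le> j \<and> j \<le> k"
  let ?p = "SOME p. p \<in> c"
  have p: "wb_valid n ?p" using class_rep[of c n] a by simp
  have jk: "Suc (j - 1 + (k - j)) = k" "Suc (j - 1) = j" "j - 1 + n + (k - j) = n + k - 1" using a by auto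
  have w: "wb_valid (n + k - 1) (wb_lcomp_pt k j ?p)"
    "H (n + k - 1) (flY (wb_lcomp_pt k j ?p)) (flT (wb_lcomp_pt k j ?p)) = pad (j - 1) (k - j) n (H n (flY ?p) (flT ?p))"
    using weave_lpt[OF H p, of "j - 1" "k - j"] unfolding jk by auto
  have "realize H (n + k - 1) (wb_lcomp k j c) = pad (j - 1) (k - j) n (H n (flY ?p) (flT ?p))"
    unfolding wb_lcomp_def using realize_class[OF H w(1)] w(2) by simp
  also have "H n (flY ?p) (flT ?p) = realize H n c" using a by (simp add: realize_def)
  finally show "realize H (n + k - 1) (wb_lcomp k j c) = O_lcomp lact eta k j n (realize H n c)"
    by (simp add: O_lcomp_def pad_def)
next
  fix n c and j k :: nat assume a: "c \<in> topspace (WbQ n) \<and> 1 \<le> j \<and> j \<le> n \<and> 1 \<le> k"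
  let ?p = "SOME p. p \<in> c" and ?ks = "(replicate n 1)[j - 1 := k]"
  have p: "wb_valid n ?p" using class_rep[of c n] a by simp
  have r: "wb_valid (n + k - 1) (wb_rcomp_pt j k ?p)" "flY (wb_rcomp_pt j k ?p) = insY (j - 1) k (flY ?p)"
    "flT (wb_rcomp_pt j k ?p) = insT (j - 1) k (flT ?p)"
    using rpt_props[OF p] a by auto
  have ks: "?ks = replicate (j - 1) 1 @ k # replicate (n - j) 1" using replicate_update[of j n k] a by simp
  have s: "sum_list ?ks = n + k - 1" "length ?ks = n" "\<And>i. i \<in> set ?ks \<Longrightarrow> 1 \<le> i"
    unfolding ks using a by (auto simp: sum_list_replicate)
  have "realize H (n + k - 1) (wb_rcomp j k c) = H (n + k - 1) (insY (j - 1) k (flY ?p)) (insT (j - 1) k (flT ?p))"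
    unfolding wb_rcomp_def using realize_class[OF H r(1)] r(2,3) by simp
  also have "\<dots> = H (n + k - 1) (expY ?ks (flY ?p)) (expT ?ks (flT ?p))"
  proof (rule weave_cong[OF H])
    fix i assume "Suc i < n + k - 1"
    then show "insY (j - 1) k (flY ?p) i = expY ?ks (flY ?p) i"
      unfolding ks using exp_ins(1)[of k i "j - 1" "n - j" "flY ?p"] a by simp
  next
    fix i assume "i < n + k - 1"
    then show "insT (j - 1) k (flT ?p) i = expT ?ks (flT ?p) i"
      unfolding ks using exp_ins(2)[of k i "j - 1" "n - j" "flT ?p"] a by simp
  qed
  also have "\<dots> = ract ?ks (H n (flY ?p) (flT ?p))"
  proof -
    have "H (sum_list ?ks) (expY ?ks (flY ?p)) (expT ?ks (flT ?p)) = ract ?ks (H (length ?ks) (flY ?p) (flT ?p))"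
      by (rule weave_ract[OF H s(3)]) (use s(2) flat_inZ[OF p] in simp_all)
    then show ?thesis using s by simp
  qed
  also have "H n (flY ?p) (flT ?p) = realize H n c" using a by (simp add: realize_def)
  finally show "realize H (n + k - 1) (wb_rcomp j k c) = O_rcomp ract n j k (realize H n c)"
    by (simp add: O_rcomp_def)
qed

text \<open>The clauses of \<open>weave\<close> are the compositions with \<open>a_2\<close> on
  either side and on the right. The composed representative has the given flat coordinates only up
  to \<open>simZ\<close>, because it starts from a chosen point of the class.\<close>

lemma weave_unreal:
  assumes h: "wbimod_map Op lact ract eta h"
  shows "weave (unreal h)"
proof -
  have hc: "c \<in> topspace (WbQ n) \<Longrightarrow> h n c \<in> topspace (Op n)" for n c
    using h by (auto simp: wbimod_map_def cmaps_def continuous_map_def)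
  have hl: "c \<in> topspace (WbQ n) \<Longrightarrow> 1 \<le> k \<Longrightarrow> 1 \<le> j \<Longrightarrow> j \<le> k \<Longrightarrow>
      h (n + k - 1) (wb_lcomp k j c) = O_lcomp lact eta k j n (h n c)" for n c k j
    using h unfolding wbimod_map_def by blast
  have hr: "c \<in> topspace (WbQ n) \<Longrightarrow> 1 \<le> j \<Longrightarrow> j \<le> n \<Longrightarrow> 1 \<le> k \<Longrightarrow>
      h (n + k - 1) (wb_rcomp j k c) = O_rcomp ract n j k (h n c)" for n c k j
    using h unfolding wbimod_map_def by blast
  have rep: "\<exists>p. wb_valid n p \<and> p = (SOME p. p \<in> qq n y t) \<and> simZ n y t (flY p) (flT p)" if z: "inZ n y t" for n y t
  proof -
    let ?p = "SOME p. p \<in> qq n y t"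
    have v: "wb_valid n ?p" "qq n y t = wbR `` {?p}" using class_rep[OF qq_in[OF z]] by auto
    then have "qq n y t = qq n (flY ?p) (flT ?p)" using qq_flat by simp
    then have "simZ n y t (flY ?p) (flT ?p)" using qq_eq_iff[OF z flat_inZ[OF v(1)]] by simp
    then show ?thesis using v(1) by blast
  qed
  show ?thesis
    unfolding weave_def
  proof (intro conjI allI impI)
    fix n y t assume z: "inZ n y t"
    then show "unreal h n y t \<in> topspace (Op n)" by (simp add: unreal_def qq_tr hc qq_in)
  next
    fix n y t y' t' assume "\<forall>i. Suc i < n \<longrightarrow> y i = (y' :: nat \<Rightarrow> real) i" "\<forall>i<n. t i = (t' :: nat \<Rightarrow> real) i"
    then have "trY n y = trY n y'" "trT n t = trT n t'" by (auto simp: trY_def trT_def)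
    then show "unreal h n y t = unreal h n y' t'" by (simp add: unreal_def)
  next
    fix n y t assume z: "inZ (Suc n) y t" and t0: "t 0 = 0"
    have z1: "inZ n (sh 1 y) (sh 1 t)" using inZ_sh[of 1 n] z by simp
    obtain p where p: "wb_valid n p" "p = (SOME p. p \<in> qq n (sh 1 y) (sh 1 t))" "simZ n (sh 1 y) (sh 1 t) (flY p) (flT p)"
      using rep[OF z1] by blast
    have l: "wb_lcomp_pt 2 2 p = wcons 1 (\<lambda>_. 0) 0 p"
      using lpt_Suc_left[of 0 0 p] lpt_0[OF p(1)] by (simp add: numeral_2_eq_2)
    have v: "wb_valid (Suc n) (wcons 1 (\<lambda>_. 0) 0 p)"
      using p flat_inZ[OF p(1)] by (auto simp: valid_wcons cube_def inZ_def)
    have "simZ (Suc n) y t (flY (wcons 1 (\<lambda>_. 0) 0 p)) (flT (wcons 1 (\<lambda>_. 0) 0 p))"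
      unfolding simZ_def
    proof (intro conjI allI impI)
      fix i assume "i < Suc n"
      then show "t i = flT (wcons 1 (\<lambda>_. 0) 0 p) i"
        using p(3) t0 by (cases i) (auto simp: flT_wcons simZ_def sh_def)
    next
      fix i assume i: "Suc i < Suc n"
      show "y i = flY (wcons 1 (\<lambda>_. 0) 0 p) i \<or> t i = t (Suc i) \<and> (t i = 0 \<or> t i = 1)"
      proof (cases i)
        case 0
        \<comment> \<open>The composed point has gap 1 after the new unit. A smaller
          \<open>y 0\<close> forces both times to be 0, and there the gap is free.\<close>
        have "y 0 \<le> 1" "y 0 < 1 \<longrightarrow> t 0 = t 1" using z i 0 by (auto simp: inZ_def)
        then show ?thesis using 0 t0 by (auto simp: flY_wcons)
      next
        case (Suc j)
        then show ?thesis using p(3) i by (auto simp: flY_wcons simZ_def sh_def)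
      qed
    qed
    then have "qq (Suc n) y t = wb_lcomp 2 2 (qq n (sh 1 y) (sh 1 t))"
      unfolding wb_lcomp_def p(2)[symmetric] l by (rule qq_eqI[OF z v])
    moreover have "h (n + 2 - 1) (wb_lcomp 2 2 (qq n (sh 1 y) (sh 1 t))) = O_lcomp lact eta 2 2 n (h n (qq n (sh 1 y) (sh 1 t)))"
      by (rule hl[OF qq_in[OF z1]]) auto
    ultimately show "unreal h (Suc n) y t = a2 1 n (eta 1) (unreal h n (sh 1 y) (sh 1 t))"
      by (simp add: unreal_def qq_tr[OF z] qq_tr[OF z1, simplified] O_lcomp_def a2_def)
  next
    fix n y t assume z: "inZ (Suc n) y t" and tn: "t n = 1"
    have z1: "inZ n y t" using inZ_take[OF z] by simp
    obtain p where p: "wb_valid n p" "p = (SOME p. p \<in> qq n y t)" "simZ n y t (flY p) (flT p)"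
      using rep[OF z1] by blast
    note w = wsnoc_props[OF p(1)]
    have "simZ (Suc n) y t (flY (wsnoc p)) (flT (wsnoc p))"
      unfolding simZ_def
    proof (intro conjI allI impI)
      fix i assume "i < Suc n"
      then show "t i = flT (wsnoc p) i" using p(3) tn w by (cases "i = n") (auto simp: simZ_def)
    next
      fix i assume i: "Suc i < Suc n"
      show "y i = flY (wsnoc p) i \<or> t i = t (Suc i) \<and> (t i = 0 \<or> t i = 1)"
      proof (cases "Suc i = n")
        case True
        have "y i \<le> 1" "y i < 1 \<longrightarrow> t i = t (Suc i)" using z i by (auto simp: inZ_def)
        then show ?thesis using True tn w by auto
      next
        case False
        then have "Suc i < n" using i by simp
        then have "y i = flY p i \<or> t i = t (Suc i) \<and> (t i = 0 \<or> t i = 1)" "flY (wsnoc p) i = flY p i"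
          using p(3) w unfolding simZ_def by blast+
        then show ?thesis by metis
      qed
    qed
    then have "qq (Suc n) y t = wb_lcomp 2 1 (qq n y t)"
      unfolding wb_lcomp_def p(2)[symmetric] wsnoc_def[symmetric] using w by (intro qq_eqI[OF z]) auto
    moreover have "h (n + 2 - 1) (wb_lcomp 2 1 (qq n y t)) = O_lcomp lact eta 2 1 n (h n (qq n y t))"
      by (rule hl[OF qq_in[OF z1]]) auto
    ultimately show "unreal h (Suc n) y t = a2 n 1 (unreal h n y t) (eta 1)"
      by (simp add: unreal_def qq_tr[OF z] qq_tr[OF z1] O_lcomp_def a2_def)
  next
    fix n y t m assume z: "inZ (Suc n) y t" and m: "m < n" "y m = 0"
    have tm: "t m = t (Suc m)" using z m by (auto simp: inZ_def)
    have z1: "inZ n (del m y) (del m t)" by (rule inZ_del[OF z m])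
    obtain p where p: "wb_valid n p" "p = (SOME p. p \<in> qq n (del m y) (del m t))" "simZ n (del m y) (del m t) (flY p) (flT p)"
      using rep[OF z1] by blast
    let ?r = "wb_rcomp_pt (Suc m) 2 p"
    have r: "wb_valid (Suc n) ?r" "flY ?r = insY m 2 (flY p)" "flT ?r = insT m 2 (flT p)"
      using rpt_props[OF p(1), of "Suc m" 2] m by auto
    have pt: "flT p i = del m t i" if "i < n" for i using p(3) that by (auto simp: simZ_def)
    have py: "del m y i = flY p i \<or> del m t i = del m t (Suc i) \<and> (del m t i = 0 \<or> del m t i = 1)" if "Suc i < n" for i
      using p(3) that by (auto simp: simZ_def)
    have "simZ (Suc n) y t (flY ?r) (flT ?r)"
      unfolding simZ_def r
    proof (intro conjI allI impI)
      fix i assume i: "i < Suc n"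
      consider "i < m" | "i = m" | "i = Suc m" | j where "i = Suc (Suc j)" "m \<le> j"
        using that by (metis Suc_lessI not_less_eq less_imp_Suc_add le_add1 linorder_neqE_nat add_Suc_right)
      then show "t i = insT m 2 (flT p) i"
        using i m tm pt by cases (auto simp: insT_def del_def)
    next
      fix i assume i: "Suc i < Suc n"
      consider "i < m" | "i = m" | j where "i = Suc j" "m \<le> j"
        by (metis less_imp_Suc_add le_add1 linorder_neqE_nat)
      then show "y i = insY m 2 (flY p) i \<or> t i = t (Suc i) \<and> (t i = 0 \<or> t i = 1)"
      proof cases
        case 1
        have "Suc i < n" using 1 m by simp
        from py[OF this] show ?thesis using 1 tm by (cases "Suc i = m") (auto simp: insY_def del_def)
      next
        case 2
        then show ?thesis using m by (simp add: insY_def)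
      next
        case 3
        have "Suc j < n" using 3 i by simp
        from py[OF this] show ?thesis using 3 by (auto simp: insY_def del_def)
      qed
    qed
    then have "qq (Suc n) y t = wb_rcomp (Suc m) 2 (qq n (del m y) (del m t))"
      unfolding wb_rcomp_def p(2)[symmetric] by (rule qq_eqI[OF z r(1)])
    moreover have "h (n + 2 - 1) (wb_rcomp (Suc m) 2 (qq n (del m y) (del m t))) =
        O_rcomp ract n (Suc m) 2 (h n (qq n (del m y) (del m t)))"
      by (rule hr[OF qq_in[OF z1]]) (use m in auto)
    ultimately show "unreal h (Suc n) y t = ract (dup n m) (unreal h n (del m y) (del m t))"
      using m by (simp add: unreal_def qq_tr[OF z] qq_tr[OF z1] O_rcomp_def dup_eq_update)
  qed
qed

lemma realize_unreal:
  assumes h: "wbimod_map Op lact ract eta h"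
  shows "realize (unreal h) = h"
proof (intro ext)
  fix n c
  show "realize (unreal h) n c = h n c"
  proof (cases "c \<in> topspace (WbQ n)")
    case True
    note r = class_rep[OF True]
    have "qq n (flY (SOME p. p \<in> c)) (flT (SOME p. p \<in> c)) = c" using qq_flat[OF r(1)] r(2) by simp
    then show ?thesis using True by (simp add: realize_def unreal_def qq_tr[OF flat_inZ[OF r(1)]])
  next
    case False
    then show ?thesis using h by (simp add: realize_def wbimod_map_def cmaps_def)
  qed
qed

lemma topspace_WbimodSp: "topspace (WbimodSp Op lact ract eta) = {h. wbimod_map Op lact ract eta h}"
  by (auto simp: WbimodSp_def PiE_iff wbimod_map_def)

text \<open>Continuity into the compact-open topology is tested on \<open>Zc n\<close> through the
  proper map \<open>qq\<close>, where \<open>realize\<close> becomes the weave itself.\<close>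

lemma continuous_map_realize:
  assumes H: "weave_family A H"
  shows "continuous_map A (WbimodSp Op lact ract eta) (\<lambda>a. realize (H a))"
  unfolding WbimodSp_def continuous_map_in_subtopology continuous_map_componentwise_UNIV
proof (intro conjI allI)
  have w: "wbimod_map Op lact ract eta (realize (H a))" if a: "a \<in> topspace A" for a
  proof (rule realize_wbimod[OF weave_family_weave[OF H a]])
    show "continuous_map (top_of_set (Zset n)) (Op n) (\<lambda>z. H a n (fst z) (snd z))" for n
      by (rule weave_family_cont[OF H _ continuous_map_coord]) (use a in auto)
  qed
  then show "(\<lambda>a. realize (H a)) \<in> topspace A \<rightarrow> {h. wbimod_map Op lact ract eta h}" by simp
  fix n
  show "continuous_map A (compact_open (WbQ n) (Op n)) (\<lambda>a. realize (H a) n)"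
  proof (rule continuous_map_into_compact_open[OF proper_map_qq quotient_imp_continuous_map[OF quotient_map_qq]
        quotient_imp_surjective_map[OF quotient_map_qq]])
    show "realize (H a) n \<in> cmaps (WbQ n) (Op n)" if "a \<in> topspace A" for a
      using w[OF that] by (simp add: wbimod_map_def)
    have c1: "continuous_map (top_of_set (Zc n)) euclideanreal (\<lambda>p. fst p i)"
      "continuous_map (top_of_set (Zc n)) euclideanreal (\<lambda>p. snd p i)" for i
      using continuous_map_from_subtopology_mono[OF continuous_map_coord(1)[of n i], of "Zc n"]
        continuous_map_from_subtopology_mono[OF continuous_map_coord(2)[of n i], of "Zc n"] by blast+
    have c2: "continuous_map (prod_topology A (top_of_set (Zc n))) euclideanreal (\<lambda>z. fst (snd z) i)"
      "continuous_map (prod_topology A (top_of_set (Zc n))) euclideanreal (\<lambda>z. snd (snd z) i)" for i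
      using continuous_map_compose[OF continuous_map_snd c1(1)] continuous_map_compose[OF continuous_map_snd c1(2)]
      by (simp_all add: o_def)
    have "continuous_map (prod_topology A (top_of_set (Zc n))) (Op n) (\<lambda>z. H (fst z) n (fst (snd z)) (snd (snd z)))"
      by (rule weave_family_cont[OF H continuous_map_fst c2]) auto
    then show "continuous_map (prod_topology A (top_of_set (Zc n))) (Op n) (\<lambda>(a, z). realize (H a) n (qq n (fst z) (snd z)))"
      by (rule continuous_map_eq) (use realize_qq weave_family_weave[OF H] in auto)
  qed
qed

text \<open>Evaluation through \<open>qq\<close> on the compact Hausdorff space \<open>Zc n\<close>,
  preceded by the continuous truncation of the coordinates.\<close>

lemma weave_family_unreal: "weave_family (WbimodSp Op lact ract eta) unreal"
  unfolding weave_family_def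
proof (intro conjI ballI allI)
  fix h assume "h \<in> topspace (WbimodSp Op lact ract eta)"
  then show "weave (unreal h)" using weave_unreal by (simp add: topspace_WbimodSp)
next
  fix n
  let ?W = "WbimodSp Op lact ract eta" and ?X = "prod_topology (WbimodSp Op lact ract eta) (top_of_set (Zset n))"
  have ev: "continuous_map (prod_topology (compact_open (WbQ n) (Op n)) (top_of_set (Zc n))) (Op n)
      (\<lambda>(f, z). f (qq n (fst z) (snd z)))"
    by (rule compact_open_eval_continuous[OF _ _ quotient_imp_continuous_map[OF quotient_map_qq]])
       (use compact_Zc in \<open>auto simp: compact_space_subtopology Hausdorff_space_subtopology\<close>)
  have "continuous_map ?W (compact_open (WbQ n) (Op n)) (\<lambda>h. h n)"
    unfolding WbimodSp_def by (intro continuous_map_from_subtopology continuous_map_product_projection) simp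
  then have 1: "continuous_map ?X (compact_open (WbQ n) (Op n)) (\<lambda>z. fst z n)" by (rule family_param)
  have 2: "continuous_map ?X (top_of_set (Zc n)) (\<lambda>z. (trY n (fst (snd z)), trT n (snd (snd z))))"
  proof -
    have y: "continuous_map ?X euclideanreal (\<lambda>z. trY n (fst (snd z)) i)" for i
      unfolding trY_def using family_coord(1) by (cases "Suc i < n") auto
    have t: "continuous_map ?X euclideanreal (\<lambda>z. trT n (snd (snd z)) i)" for i
      unfolding trT_def using family_coord(2) by (cases "i < n") auto
    have "continuous_map ?X (top_of_set (Zset n)) (\<lambda>z. (trY n (fst (snd z)), trT n (snd (snd z))))"
      by (rule continuous_map_into_Zset[OF y t]) (auto simp: inZ_tr)
    then show ?thesis by (auto simp: continuous_map_in_subtopology inZ_tr)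
  qed
  have "continuous_map ?X (Op n) ((\<lambda>(f, z). f (qq n (fst z) (snd z))) \<circ> (\<lambda>z. (fst z n, (trY n (fst (snd z)), trT n (snd (snd z))))))"
    by (rule continuous_map_compose[OF continuous_map_pairedI[OF 1 2] ev])
  then show "continuous_map ?X (Op n) (\<lambda>z. unreal (fst z) n (fst (snd z)) (snd (snd z)))"
    by (simp add: o_def unreal_def)
qed

end

section \<open>Cubes and their operations\<close>

lemma CubeTop_eq: "CubeTop n = top_of_set (cube n)"
  by (simp add: CubeTop_def euclidean_product_topology)

lemma compact_cube: "compact (cube n)"
proof (cases "n = 0")
  case False
  have "cube n = PiE UNIV (\<lambda>i. if i < n - 1 then {0..1} else {0})"
    using False by (auto simp: cube_def PiE_iff split: if_splits)
  moreover have "compactin (product_topology (\<lambda>_::nat. euclideanreal) UNIV) (PiE UNIV (\<lambda>i. if i < n - 1 then {0..1} else {0}))"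
    by (subst compactin_PiE) auto
  ultimately show ?thesis by (simp add: euclidean_product_topology)
qed (simp add: cube_def)

lemma compact_CubeTop: "compact_space (CubeTop n)" and Hausdorff_CubeTop: "Hausdorff_space (CubeTop n)"
  using compact_cube by (simp_all add: CubeTop_eq compact_space_subtopology Hausdorff_space_subtopology)

lemma topspace_CubeTop: "topspace (CubeTop n) = cube n"
  by (simp add: CubeTop_eq)

lemma continuous_map_into_CubeTop:
  assumes "\<And>i. continuous_map Y euclideanreal (\<lambda>z. f z i)" "\<And>z. z \<in> topspace Y \<Longrightarrow> f z \<in> cube n"
  shows "continuous_map Y (CubeTop n) f"
  using assms unfolding CubeTop_def continuous_map_in_subtopology continuous_map_componentwise_UNIV by auto

lemma trY_cube: "inZ n y t \<Longrightarrow> s + l < n \<Longrightarrow> trY (Suc l) (sh s y) \<in> cube (Suc l)"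
  by (auto simp: inZ_def cube_def trY_def sh_def)

lemma cube_trY: "x \<in> cube n \<Longrightarrow> trY n x = x"
  by (rule ext) (auto simp: cube_def trY_def split: if_splits)

lemma cube_pos: "x \<in> cube n \<Longrightarrow> 1 \<le> n"
  by (cases n) (auto simp: cube_def)

lemma cube_inZ: "x \<in> cube n \<Longrightarrow> 0 \<le> r \<Longrightarrow> r \<le> 1 \<Longrightarrow> inZ n x (\<lambda>_. r)"
  by (auto simp: cube_def inZ_def split: if_splits)

lemma cube_lact_1: "x \<in> cube n \<Longrightarrow> cube_lact [n] [x] = x"
  using cube_pos[of x n] by (auto simp: cube_lact_def fromlist_def tolist_def cube_def fun_eq_iff)

lemma fromlist_tolist:
  "1 \<le> n \<Longrightarrow> fromlist (tolist n x @ s # g) i = (if Suc i < n then x i else if Suc i = n then s else fromlist g (i - n))"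
  by (auto simp: fromlist_def nth_append nth_Cons' tolist_def)

lemma cube_lact_Cons:
  assumes "ns \<noteq> []" "length xs = length ns" "1 \<le> n" "\<And>m. m \<in> set ns \<Longrightarrow> 1 \<le> m"
  shows "cube_lact (n # ns) (x # xs) = (\<lambda>i. if Suc i < n then x i else if Suc i = n then 1 else cube_lact ns xs (i - n))"
proof
  fix i
  obtain m ns' where ns: "ns = m # ns'" using assms by (cases ns) auto
  obtain y xs' where xs: "xs = y # xs'" using assms ns by (cases xs) auto
  have "cube_lact (n # ns) (x # xs) = fromlist (tolist n x @ 1 # glue_sep (replicate (length ns - 1) 1) (map2 tolist ns xs))"
    unfolding cube_lact_def ns xs by simp
  from fun_cong[OF this, of i] show "cube_lact (n # ns) (x # xs) i = (if Suc i < n then x i else if Suc i = n then 1 else cube_lact ns xs (i - n))"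
    unfolding fromlist_tolist[OF assms(3)] cube_lact_def .
qed

text \<open>The two halves need each other: folding a concatenation into binary ones uses that the
  tail vanishes beyond its last coordinate, which is part of membership in the cube.\<close>

lemma cube_lact_cube:
  "ns \<noteq> [] \<Longrightarrow> length xs = length ns \<Longrightarrow> (\<And>i. i < length ns \<Longrightarrow> 1 \<le> ns ! i \<and> xs ! i \<in> cube (ns ! i)) \<Longrightarrow>
    cube_lact ns xs \<in> cube (sum_list ns) \<and>
    (\<forall>n x. 1 \<le> n \<longrightarrow> cube_lact (n # ns) (x # xs) = cube_lact [n, sum_list ns] [x, cube_lact ns xs])"
proof (induction ns arbitrary: xs)
  case (Cons m ns)
  obtain y ys where xs: "xs = y # ys" using Cons.prems by (cases xs) auto
  have m: "1 \<le> m" "y \<in> cube m" using Cons.prems(3)[of 0] xs by auto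
  have pos: "1 \<le> k" if "k \<in> set (m # ns)" for k
    using that Cons.prems(3) by (metis in_set_conv_nth)
  have c: "cube_lact (m # ns) (y # ys) \<in> cube (sum_list (m # ns))"
  proof (cases "ns = []")
    case True
    then show ?thesis using m Cons.prems xs cube_lact_1 by simp
  next
    case False
    have I: "cube_lact ns ys \<in> cube (sum_list ns)"
      "\<And>n x. 1 \<le> n \<Longrightarrow> cube_lact (n # ns) (x # ys) = cube_lact [n, sum_list ns] [x, cube_lact ns ys]"
    proof -
      have a: "length ys = length ns" "1 \<le> ns ! i \<and> ys ! i \<in> cube (ns ! i)" if "i < length ns" for i
        using Cons.prems(2) Cons.prems(3)[of "Suc i"] xs that by simp_all
      have l: "length ys = length ns" using Cons.prems(2) xs by simp
      note I = Cons.IH[OF False l a(2)]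
      show "cube_lact ns ys \<in> cube (sum_list ns)" using I by blast
      show "\<And>n x. 1 \<le> n \<Longrightarrow> cube_lact (n # ns) (x # ys) = cube_lact [n, sum_list ns] [x, cube_lact ns ys]"
        using I by blast
    qed
    have "1 \<le> sum_list ns" using I(1) cube_pos by blast
    then show ?thesis unfolding I(2)[OF m(1)] using cube_lact_2_cube[OF m(1) _ m(2) I(1)] by simp
  qed
  moreover have "cube_lact (n # m # ns) (x # y # ys) = cube_lact [n, sum_list (m # ns)] [x, cube_lact (m # ns) (y # ys)]"
    if "1 \<le> n" for n x
  proof -
    have "1 \<le> sum_list (m # ns)" using m by simp
    show ?thesis
      using cube_lact_Cons[of "m # ns" "y # ys" n x] Cons.prems xs that pos
        cube_lact_2[OF that \<open>1 \<le> sum_list (m # ns)\<close> c, of x] by simp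
  qed
  ultimately show ?case unfolding xs by blast
qed simp

lemma cube_ract_dup:
  assumes "m < n" "x \<in> cube n"
  shows "cube_ract (dup n m) x = trY (Suc n) (insY m 2 x)"
proof -
  obtain r where n: "n = Suc (m + r)" using assms less_iff_Suc_add by auto
  have d: "dup n m = replicate m 1 @ 2 # replicate r 1" by (simp add: dup_def n)
  have "cube_ract (dup n m) x = trY (Suc n) (expY (dup n m) x)"
    using cube_ract_expY[of "dup n m" x] assms dup_props[of m n] by (auto simp: dup_def)
  also have "\<dots> = trY (Suc n) (insY m 2 x)"
    unfolding d using exp_ins(1)[of 2 _ m r x] n by (auto simp: trY_def fun_eq_iff)
  finally show ?thesis .
qed

lemma expT_const: "i < sum_list ks \<Longrightarrow> expT ks (\<lambda>_. r) i = r"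
  by (induction ks arbitrary: i) (auto simp: sh_def)

section \<open>Loops of bimodule maps\<close>

context assoc_bimod begin

text \<open>The algebraic content of being a based loop; continuity in the parameter enters only
  through \<open>loop_eval\<close>.\<close>

definition is_loop :: "(real \<Rightarrow> nat \<Rightarrow> (nat \<Rightarrow> real) \<Rightarrow> 'a) \<Rightarrow> bool" where
  "is_loop \<gamma> \<longleftrightarrow> (\<forall>r. 0 \<le> r \<and> r \<le> 1 \<longrightarrow> bimod_map Op lact ract (\<gamma> r)) \<and> \<gamma> 0 = base_map eta \<and> \<gamma> 1 = base_map eta"

lemma topspace_BimodSp: "topspace (BimodSp Op lact ract) = {f. bimod_map Op lact ract f}"
  by (auto simp: BimodSp_def PiE_iff bimod_map_def)

lemma loop_is_loop: "\<gamma> \<in> topspace (LoopSp Op lact ract eta) \<Longrightarrow> is_loop \<gamma>"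
  using topspace_BimodSp by (auto simp: LoopSp_def cmaps_def continuous_map_def Pi_iff is_loop_def)

lemma loop_closed:
  assumes "is_loop \<gamma>" "0 \<le> r" "r \<le> 1" "x \<in> cube n"
  shows "\<gamma> r n x \<in> topspace (Op n)"
proof -
  have "\<gamma> r n \<in> cmaps (CubeTop n) (Op n)" using assms by (auto simp: is_loop_def bimod_map_def)
  then show ?thesis using assms by (auto simp: cmaps_def continuous_map_def topspace_CubeTop)
qed

lemma loop_lact2:
  assumes "is_loop \<gamma>" "0 \<le> r" "r \<le> 1" "x \<in> cube m" "y \<in> cube n"
  shows "\<gamma> r (m + n) (cube_lact [m, n] [x, y]) = a2 m n (\<gamma> r m x) (\<gamma> r n y)"
proof -
  have "\<forall>ns xs. ns \<noteq> [] \<and> length xs = length ns \<and> (\<forall>i<length ns. 1 \<le> ns ! i \<and> xs ! i \<in> cube (ns ! i))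
        \<longrightarrow> \<gamma> r (sum_list ns) (cube_lact ns xs) = lact ns (map2 (\<gamma> r) ns xs)"
    using assms(1-3) unfolding is_loop_def bimod_map_def by blast
  from this[rule_format, of "[m, n]" "[x, y]"] show ?thesis
    using assms cube_pos by (auto simp: a2_def less_Suc_eq)
qed

lemma loop_ract_dup:
  assumes "is_loop \<gamma>" "0 \<le> r" "r \<le> 1" "x \<in> cube n" "m < n"
  shows "\<gamma> r (Suc n) (trY (Suc n) (insY m 2 x)) = ract (dup n m) (\<gamma> r n x)"
proof -
  have all: "\<forall>ks x. ks \<noteq> [] \<and> (\<forall>k\<in>set ks. 1 \<le> k) \<and> x \<in> cube (length ks)
        \<longrightarrow> \<gamma> r (sum_list ks) (cube_ract ks x) = ract ks (\<gamma> r (length ks) x)"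
    using assms(1-3) unfolding is_loop_def bimod_map_def by blast
  have "dup n m \<noteq> []" by (simp add: dup_def)
  then have "\<gamma> r (sum_list (dup n m)) (cube_ract (dup n m) x) = ract (dup n m) (\<gamma> r (length (dup n m)) x)"
    by (intro all[rule_format]) (use assms(4,5) in simp)
  then show ?thesis using assms(5) cube_ract_dup[OF assms(5,4)] by simp
qed

lemma loop_end: "is_loop \<gamma> \<Longrightarrow> r = 0 \<or> r = 1 \<Longrightarrow> x \<in> cube n \<Longrightarrow> \<gamma> r n x = eta n"
  by (auto simp: is_loop_def base_map_def)

text \<open>The points of an uncut block share one time, which is read at the first point
  \<open>s\<close>.\<close>

definition gb :: "(real \<Rightarrow> nat \<Rightarrow> (nat \<Rightarrow> real) \<Rightarrow> 'a) \<Rightarrow> (nat \<Rightarrow> real) \<Rightarrow> (nat \<Rightarrow> real) \<Rightarrow> nat \<Rightarrow> nat \<Rightarrow> 'a" where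
  "gb \<gamma> y t s l = \<gamma> (t s) l (trY l (sh s y))"

text \<open>This is \<open>xi\<close> in flat coordinates. Gaps equal to 1 separate the factors but
  may also occur inside one; cutting there as well changes nothing, since a loop consists of
  bimodule maps.\<close>

definition HG :: "(real \<Rightarrow> nat \<Rightarrow> (nat \<Rightarrow> real) \<Rightarrow> 'a) \<Rightarrow> nat \<Rightarrow> (nat \<Rightarrow> real) \<Rightarrow> (nat \<Rightarrow> real) \<Rightarrow> 'a" where
  "HG \<gamma> n y t = (case n of 0 \<Rightarrow> eta 0 | Suc m \<Rightarrow> bprod (gb \<gamma> y t) (\<lambda>i. 1 \<le> y i) 0 0 m)"

lemma gb_closed:
  assumes "is_loop \<gamma>" "inZ (Suc M) y t"
  shows "block_closed (gb \<gamma> y t) S M"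
  unfolding block_closed_def gb_def
proof (intro allI impI)
  fix s l assume "s + l \<le> M"
  then show "\<gamma> (t s) (Suc l) (trY (Suc l) (sh s y)) \<in> topspace (Op (Suc l))"
    by (intro loop_closed[OF assms(1)] trY_cube[OF assms(2)]) (use assms(2) in \<open>auto simp: inZ_def\<close>)
qed

lemma uncut_const:
  assumes "\<And>i. i < M \<Longrightarrow> \<not> S i \<Longrightarrow> t i = (t (Suc i) :: real)" "uncut S s l" "s + l \<le> M"
  shows "i \<le> l \<Longrightarrow> t (s + i) = t s"
proof (induction i)
  case (Suc i)
  then have "\<not> S (s + i)" using assms(2) by (simp add: uncut_def)
  then show ?case using Suc assms(1)[of "s + i"] assms(3) by simp
qed simp

text \<open>Time is constant on the block, so at \<open>y m = 1\<close> a single bimodule map is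
  applied to a concatenation. At times 0 and 1 all values are units, and these factor at every
  gap.\<close>

lemma gb_cut:
  assumes \<gamma>: "is_loop \<gamma>" and z: "inZ (Suc M) y t"
    and S: "\<And>i. i < M \<Longrightarrow> \<not> S i \<Longrightarrow> t i = t (Suc i)"
    and cut: "y m = 1 \<or> t m = 0 \<or> t m = 1"
  shows "block_cut (gb \<gamma> y t) S M m"
  unfolding block_cut_def
proof (intro allI impI)
  fix s l l' assume sl: "s + l = m" "Suc (m + l') \<le> M" "uncut S s (Suc (l + l'))"
  have tc: "t m = t s" "t (Suc m) = t s"
    using uncut_const[of M S t s "Suc (l + l')" l] uncut_const[of M S t s "Suc (l + l')" "Suc l"] S sl by auto
  have tb: "0 \<le> t s" "t s \<le> 1" using z sl by (auto simp: inZ_def)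
  let ?x = "trY (Suc l) (sh s y)" and ?w = "trY (Suc l') (sh (Suc m) y)"
  have c: "?x \<in> cube (Suc l)" "?w \<in> cube (Suc l')" "trY (Suc (Suc (l + l'))) (sh s y) \<in> cube (Suc (Suc (l + l')))"
    using trY_cube[OF z] sl by auto
  show "gb \<gamma> y t s (Suc (Suc (l + l'))) = a2 (Suc l) (Suc l') (gb \<gamma> y t s (Suc l)) (gb \<gamma> y t (Suc m) (Suc l'))"
  proof (cases "y m = 1")
    case True
    have "cube_lact [Suc l, Suc l'] [?x, ?w] = trY (Suc (Suc (l + l'))) (sh s y)"
      unfolding cube_lact_2[OF _ _ c(2), of "Suc l", simplified] using sl True
      by (auto simp: trY_def sh_def fun_eq_iff)
    then show ?thesis
      using loop_lact2[OF \<gamma> tb c(1,2)] tc by (simp add: gb_def)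
  next
    case False
    then have "t s = 0 \<or> t s = 1" using cut tc by simp
    then show ?thesis
      using loop_end[OF \<gamma> _ c(1)] loop_end[OF \<gamma> _ c(2)] loop_end[OF \<gamma> _ c(3)] tc a2_eta[of "Suc l" "Suc l'"] by (simp add: gb_def)
  qed
qed

text \<open>Cuts are compulsory only where the time jumps; at the other gaps equal to 1 they are
  optional.\<close>

lemma HG_refine:
  assumes \<gamma>: "is_loop \<gamma>" and z: "inZ (Suc M) y t"
    and S: "\<And>i. i < M \<Longrightarrow> S i \<Longrightarrow> 1 \<le> y i" "\<And>i. i < M \<Longrightarrow> \<not> S i \<Longrightarrow> t i = t (Suc i)"
  shows "HG \<gamma> (Suc M) y t = bprod (gb \<gamma> y t) S 0 0 M"
proof -
  have y1: "y i = 1" if "1 \<le> y i" "i < M" for i using z that by (force simp: inZ_def)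
  have "bprod (gb \<gamma> y t) S 0 0 M = bprod (gb \<gamma> y t) (\<lambda>i. 1 \<le> y i) 0 0 M"
    by (rule bprod_refine[OF gb_closed[OF \<gamma> z]]) (use S y1 in \<open>auto intro!: gb_cut[OF \<gamma> z]\<close>)
  then show ?thesis by (simp add: HG_def)
qed

lemma inZ_gap_const: "inZ (Suc M) y t \<Longrightarrow> i < M \<Longrightarrow> \<not> 1 \<le> y i \<Longrightarrow> t i = t (Suc i)"
  by (auto simp: inZ_def)

lemma HG_const:
  assumes \<gamma>: "is_loop \<gamma>" and z: "inZ (Suc M) y t" and c: "\<And>i. i \<le> M \<Longrightarrow> t i = r"
  shows "HG \<gamma> (Suc M) y t = \<gamma> r (Suc M) (trY (Suc M) y)"
proof -
  have "HG \<gamma> (Suc M) y t = bprod (gb \<gamma> y t) (\<lambda>_. False) 0 0 M"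
    by (rule HG_refine[OF \<gamma> z]) (use c in auto)
  also have "\<dots> = gb \<gamma> y t 0 (Suc (0 + M))" by (rule bprod_uncut) (simp add: uncut_def)
  finally show ?thesis using c[of 0] by (simp add: gb_def sh_def)
qed

text \<open>The last alternative of \<open>cut\<close> concerns a final point at time 1: if the gap
  before it is below 1, the preceding point has time 1 as well, and the middle alternative
  applies.\<close>

lemma HG_split:
  assumes \<gamma>: "is_loop \<gamma>" and z: "inZ (Suc M) y t" and M: "M = m + Suc k"
    and cut: "y m = 1 \<or> (t m = 0 \<or> t m = 1) \<or> t (Suc m) = 1 \<and> k = 0"
  shows "HG \<gamma> (Suc M) y t = a2 (Suc m) (Suc k) (HG \<gamma> (Suc m) y t) (HG \<gamma> (Suc k) (sh (Suc m) y) (sh (Suc m) t))"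
proof -
  let ?b = "gb \<gamma> y t" and ?S = "\<lambda>i. 1 \<le> y i \<or> i = m"
  have "bprod ?b (\<lambda>i. 1 \<le> y i) 0 0 M = bprod ?b ?S 0 0 M"
  proof (rule bprod_refine[OF gb_closed[OF \<gamma> z]])
    fix i assume "1 \<le> y i \<or> i = m" "\<not> 1 \<le> y i" "i < M"
    then have i: "i = m" "\<not> 1 \<le> y m" "t m = t (Suc m)" using inZ_gap_const[OF z] by auto
    show "block_cut ?b (\<lambda>i. 1 \<le> y i) M i"
      unfolding i(1) by (rule gb_cut[OF \<gamma> z]) (use inZ_gap_const[OF z] cut i in auto)
  qed auto
  then have "HG \<gamma> (Suc M) y t = bprod ?b ?S 0 0 (m + Suc k)" by (simp add: HG_def M)
  also have "\<dots> = a2 (Suc (0 + m)) (Suc k) (bprod ?b ?S 0 0 m) (bprod ?b ?S (Suc (0 + 0 + m)) 0 k)"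
    by (rule bprod_split[OF gb_closed[OF \<gamma> z]]) (use M in auto)
  also have "bprod ?b ?S 0 0 m = HG \<gamma> (Suc m) y t"
    unfolding HG_def nat.case by (rule bprod_cong[where M = m]) auto
  also have "bprod ?b ?S (Suc (0 + 0 + m)) 0 k = bprod (\<lambda>s. ?b (Suc m + s)) (\<lambda>i. ?S (Suc m + i)) 0 0 k"
    using bprod_shift[of ?b "Suc m" ?S 0 0 k] by simp
  also have "\<dots> = HG \<gamma> (Suc k) (sh (Suc m) y) (sh (Suc m) t)"
    unfolding HG_def nat.case
  proof (rule bprod_cong[where M = k])
    fix s l show "?b (Suc m + s) (Suc l) = gb \<gamma> (sh (Suc m) y) (sh (Suc m) t) s (Suc l)"
      by (simp add: gb_def sh_def add.assoc)
  qed (auto simp: sh_def)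
  finally show ?thesis by simp
qed

lemma weave_HG:
  assumes \<gamma>: "is_loop \<gamma>"
  shows "weave (HG \<gamma>)"
  unfolding weave_def
proof (intro conjI allI impI)
  fix n y t assume z: "inZ n y t"
  show "HG \<gamma> n y t \<in> topspace (Op n)"
  proof (cases n)
    case (Suc M)
    then show ?thesis
      using bprod_closed[OF gb_closed[OF \<gamma>, of M y t], of 0 0 M] z by (simp add: HG_def)
  qed (simp add: HG_def)
next
  fix n y t y' t' assume e: "\<forall>i. Suc i < n \<longrightarrow> y i = (y' :: nat \<Rightarrow> real) i" "\<forall>i<n. t i = (t' :: nat \<Rightarrow> real) i"
  show "HG \<gamma> n y t = HG \<gamma> n y' t'"
  proof (cases n)
    case (Suc M)
    have "bprod (gb \<gamma> y t) (\<lambda>i. 1 \<le> y i) 0 0 M = bprod (gb \<gamma> y' t') (\<lambda>i. 1 \<le> y' i) 0 0 M"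
    proof (rule bprod_cong[where M = M])
      fix s l assume "s + l \<le> M"
      then have "trY (Suc l) (sh s y) = trY (Suc l) (sh s y')" "t s = t' s"
        using e Suc by (auto simp: trY_def sh_def)
      then show "gb \<gamma> y t s (Suc l) = gb \<gamma> y' t' s (Suc l)" by (simp add: gb_def)
    qed (use e Suc in auto)
    then show ?thesis using Suc by (simp add: HG_def)
  qed (simp add: HG_def)
next
  fix n y t assume z: "inZ (Suc n) y t" and t0: "t 0 = 0"
  have z1: "inZ (Suc 0) y t" using inZ_take[OF z] by simp
  have one: "HG \<gamma> (Suc 0) y t = eta (Suc 0)"
    using HG_const[OF \<gamma> z1, of 0] loop_end[OF \<gamma> _ trY_cube[OF z1, of 0 0]] t0 by (simp add: sh_def)
  show "HG \<gamma> (Suc n) y t = a2 1 n (eta 1) (HG \<gamma> n (sh 1 y) (sh 1 t))"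
  proof (cases n)
    case 0
    then show ?thesis using one a2_eta[of 1 0] by (simp add: HG_def[of _ 0])
  next
    case (Suc k)
    then show ?thesis using HG_split[OF \<gamma> z, of 0 k] t0 one by simp
  qed
next
  fix n y t assume z: "inZ (Suc n) y t" and tn: "t n = 1"
  have z1: "inZ (Suc 0) (sh n y) (sh n t)" using inZ_sh[of n 1] z by simp
  have one: "HG \<gamma> (Suc 0) (sh n y) (sh n t) = eta (Suc 0)"
    using HG_const[OF \<gamma> z1, of 1] loop_end[OF \<gamma> _ trY_cube[OF z1, of 0 0]] tn by (simp add: sh_def)
  show "HG \<gamma> (Suc n) y t = a2 n 1 (HG \<gamma> n y t) (eta 1)"
  proof (cases n)
    case 0
    then show ?thesis using one a2_eta[of 0 1] by (simp add: HG_def[of _ 0] sh_def)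
  next
    case (Suc k)
    then show ?thesis using HG_split[OF \<gamma> z, of k 0] tn one by simp
  qed
next
  fix n y t m assume z: "inZ (Suc n) y t" and m: "m < n" "y m = 0"
  obtain M where n: "n = Suc M" using m by (cases n) auto
  have tm: "t m = t (Suc m)" using z m by (auto simp: inZ_def)
  let ?y = "del m y" and ?t = "del m t"
  have z': "inZ (Suc M) ?y ?t" using inZ_del[OF z m] n by simp
  have "ract (dup (Suc M) m) (bprod (gb \<gamma> ?y ?t) (\<lambda>i. 1 \<le> ?y i) 0 0 M) = bprod (gb \<gamma> y t) (\<lambda>i. 1 \<le> y i) 0 0 (Suc M)"
  proof (rule bprod_dup[OF gb_closed[OF \<gamma> z']])
    show "\<not> 1 \<le> y m" using m by simp
    fix i show "i < m \<Longrightarrow> (1 \<le> ?y i) = (1 \<le> y i)" "m \<le> i \<Longrightarrow> (1 \<le> ?y i) = (1 \<le> y (Suc i))" by (simp_all add: del_def)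
  next
    fix s l assume sl: "s + l < m"
    then have "trY (Suc l) (sh s ?y) = trY (Suc l) (sh s y)" "?t s = t s" by (auto simp: trY_def sh_def del_def)
    then show "gb \<gamma> ?y ?t s (Suc l) = gb \<gamma> y t s (Suc l)" by (simp add: gb_def)
  next
    fix s l assume sl: "m < s"
    then have "sh s ?y = sh (Suc s) y" "?t s = t (Suc s)" by (auto simp: sh_def del_def)
    then show "gb \<gamma> ?y ?t s (Suc l) = gb \<gamma> y t (Suc s) (Suc l)" by (simp add: gb_def)
  next
    fix s l assume sl: "s \<le> m" "m \<le> s + l" "s + l \<le> M"
    \<comment> \<open>A block starting at \<open>m\<close> reads the time of point
      \<open>m + 1\<close> after the deletion, which is the same.\<close>
    have ts: "?t s = t s" using sl tm by (auto simp: del_def dest: le_antisym)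
    have tb: "0 \<le> t s" "t s \<le> 1" using z sl m by (auto simp: inZ_def)
    have c: "trY (Suc l) (sh s ?y) \<in> cube (Suc l)" using trY_cube[OF z'] sl by simp
    have "trY (Suc (Suc l)) (insY (m - s) 2 (trY (Suc l) (sh s ?y))) i = trY (Suc (Suc l)) (sh s y) i" for i
    proof -
      consider "s + i < m" | "s + i = m" | "m < s + i" by linarith
      then show ?thesis
      proof cases
        case 3
        then obtain j where "i = Suc j" using sl by (cases i) auto
        then show ?thesis using 3 sl by (auto simp: trY_def insY_def sh_def del_def)
      qed (use sl m in \<open>auto simp: trY_def insY_def sh_def del_def\<close>)
    qed
    then have "trY (Suc (Suc l)) (insY (m - s) 2 (trY (Suc l) (sh s ?y))) = trY (Suc (Suc l)) (sh s y)" by blast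
    then show "ract (dup (Suc l) (m - s)) (gb \<gamma> ?y ?t s (Suc l)) = gb \<gamma> y t s (Suc (Suc l))"
      using loop_ract_dup[OF \<gamma> tb c, of "m - s"] sl ts by (simp add: gb_def)
  qed (use m n in auto)
  then show "HG \<gamma> (Suc n) y t = ract (dup n m) (HG \<gamma> n (del m y) (del m t))"
    using n by (simp add: HG_def)
qed

lemma strict_HG: "is_loop \<gamma> \<Longrightarrow> strict (HG \<gamma>)"
  unfolding strict_def
proof (intro allI impI)
  fix m n y t assume \<gamma>: "is_loop \<gamma>" and z: "inZ (Suc m + Suc n) y t" and ym: "y m = 1"
  have z': "inZ (Suc (m + Suc n)) y t" using z by simp
  show "HG \<gamma> (Suc m + Suc n) y t = a2 (Suc m) (Suc n) (HG \<gamma> (Suc m) y t) (HG \<gamma> (Suc n) (sh (Suc m) y) (sh (Suc m) t))"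
    using HG_split[OF \<gamma> z' refl] ym by simp
qed

text \<open>Two nested evaluations, first in the loop parameter and then in the cube, both over
  compact Hausdorff spaces.\<close>

lemma loop_eval:
  "continuous_map (prod_topology (LoopSp Op lact ract eta) (prod_topology (top_of_set {0..1}) (CubeTop l))) (Op l)
     (\<lambda>z. (fst z) (fst (snd z)) l (snd (snd z)))"
proof -
  let ?L = "LoopSp Op lact ract eta" and ?B = "BimodSp Op lact ract" and ?I = "top_of_set {0..1::real}"
  let ?X = "prod_topology ?L (prod_topology ?I (CubeTop l))"
  have e1: "continuous_map (prod_topology (compact_open ?I ?B) ?I) ?B (\<lambda>(f, x). f (id x))"
    by (rule compact_open_eval_continuous) (auto simp: compact_space_subtopology Hausdorff_space_subtopology)
  have "continuous_map ?L (compact_open ?I ?B) (\<lambda>\<gamma>. \<gamma>)" unfolding LoopSp_def by (rule continuous_map_from_subtopology) simp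
  then have "continuous_map ?X (compact_open ?I ?B) fst" by (rule family_param)
  moreover have sf: "continuous_map ?X ?I (\<lambda>z. fst (snd z))" "continuous_map ?X (CubeTop l) (\<lambda>z. snd (snd z))"
    using continuous_map_compose[OF continuous_map_snd continuous_map_fst] continuous_map_compose[OF continuous_map_snd continuous_map_snd]
    by (auto simp: o_def)
  ultimately have "continuous_map ?X ?B ((\<lambda>(f, x). f (id x)) \<circ> (\<lambda>z. (fst z, fst (snd z))))"
    by (intro continuous_map_compose[OF _ e1] continuous_map_pairedI)
  then have 1: "continuous_map ?X ?B (\<lambda>z. fst z (fst (snd z)))" by (simp add: o_def)
  have "continuous_map ?B (compact_open (CubeTop l) (Op l)) (\<lambda>f. f l)"
    unfolding BimodSp_def by (intro continuous_map_from_subtopology continuous_map_product_projection) simp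
  from continuous_map_compose[OF 1 this]
  have 2: "continuous_map ?X (compact_open (CubeTop l) (Op l)) (\<lambda>z. fst z (fst (snd z)) l)" by (simp add: o_def)
  have e2: "continuous_map (prod_topology (compact_open (CubeTop l) (Op l)) (CubeTop l)) (Op l) (\<lambda>(f, x). f (id x))"
    by (rule compact_open_eval_continuous[OF compact_CubeTop Hausdorff_CubeTop]) simp
  have "continuous_map ?X (Op l) ((\<lambda>(f, x). f (id x)) \<circ> (\<lambda>z. (fst z (fst (snd z)) l, snd (snd z))))"
    by (intro continuous_map_compose[OF _ e2] continuous_map_pairedI 2 sf)
  then show ?thesis by (simp add: o_def)
qed

lemma weave_family_HG: "weave_family (LoopSp Op lact ract eta) HG"
  unfolding weave_family_def
proof (intro conjI ballI allI)
  fix \<gamma> assume "\<gamma> \<in> topspace (LoopSp Op lact ract eta)"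
  then show "weave (HG \<gamma>)" using weave_HG loop_is_loop by blast
next
  fix n
  let ?L = "LoopSp Op lact ract eta"
  show "continuous_map (prod_topology ?L (top_of_set (Zset n))) (Op n) (\<lambda>z. HG (fst z) n (fst (snd z)) (snd (snd z)))"
  proof (cases n)
    case 0
    then show ?thesis by (simp add: HG_def)
  next
    case (Suc M)
    let ?X = "prod_topology ?L (top_of_set (Zset (Suc M)))"
    \<comment> \<open>Outside \<open>S\<close> the inequality is the closed condition that, times
      being increasing, says that the times agree. The gap may still be 1 there; on such overlaps
      \<open>HG_refine\<close> identifies the products.\<close>
    let ?P = "\<lambda>S z. \<forall>i<M. (i \<in> S \<longrightarrow> 1 \<le> fst (snd z) i) \<and> (i \<notin> S \<longrightarrow> snd (snd z) (Suc i) \<le> snd (snd z) i)"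
    let ?b = "\<lambda>z. gb (fst z) (fst (snd z)) (snd (snd z))"
    have "continuous_map ?X (Op (Suc M)) (\<lambda>z. HG (fst z) (Suc M) (fst (snd z)) (snd (snd z)))"
    proof (rule continuous_map_closed_cover[where I = "Pow {..<M}" and P = ?P])
      fix S assume S: "S \<in> Pow {..<M}"
      show "closedin ?X {z \<in> topspace ?X. ?P S z}"
      proof (rule closedin_all_less)
        fix i
        have 1: "closedin ?X {z \<in> topspace ?X. 1 \<le> fst (snd z) i}"
          by (rule closedin_le[OF _ family_coord(1)]) simp
        have 2: "closedin ?X {z \<in> topspace ?X. snd (snd z) (Suc i) \<le> snd (snd z) i}"
          by (rule closedin_le[OF family_coord(2) family_coord(2)])
        show "closedin ?X {z \<in> topspace ?X. (i \<in> S \<longrightarrow> 1 \<le> fst (snd z) i) \<and> (i \<notin> S \<longrightarrow> snd (snd z) (Suc i) \<le> snd (snd z) i)}"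
          by (cases "i \<in> S") (use 1 2 in simp_all)
      qed
      let ?Y = "subtopology ?X {z \<in> topspace ?X. ?P S z}"
      have zz: "is_loop (fst z)" "inZ (Suc M) (fst (snd z)) (snd (snd z))"
        "\<And>i. i < M \<Longrightarrow> i \<notin> S \<Longrightarrow> snd (snd z) i = snd (snd z) (Suc i)"
        "\<And>i. i < M \<Longrightarrow> i \<in> S \<Longrightarrow> 1 \<le> fst (snd z) i" if "z \<in> topspace ?Y" for z
      proof -
        show "is_loop (fst z)" using that loop_is_loop by auto
        show zi: "inZ (Suc M) (fst (snd z)) (snd (snd z))" using that by auto
        show "\<And>i. i < M \<Longrightarrow> i \<in> S \<Longrightarrow> 1 \<le> fst (snd z) i" using that by auto
        fix i assume "i < M" "i \<notin> S"
        then have "snd (snd z) (Suc i) \<le> snd (snd z) i" "snd (snd z) i \<le> snd (snd z) (Suc i)"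
          using that zi by (auto simp: inZ_def)
        then show "snd (snd z) i = snd (snd z) (Suc i)" by simp
      qed
      have "continuous_map ?Y (Op (Suc (0 + M))) (\<lambda>z. bprod (?b z) (\<lambda>i. i \<in> S) 0 0 M)"
      proof (rule bprod_continuous[where M = M])
        fix s l assume sl: "s + l \<le> M"
        have "continuous_map ?Y (prod_topology ?L (prod_topology (top_of_set {0..1}) (CubeTop (Suc l))))
           (\<lambda>z. (fst z, (snd (snd z) s, trY (Suc l) (sh s (fst (snd z))))))"
        proof (intro continuous_map_pairedI)
          show "continuous_map ?Y ?L fst" by (intro continuous_map_from_subtopology continuous_map_fst)
          have "continuous_map ?Y euclideanreal (\<lambda>z. snd (snd z) s)"
            by (intro continuous_map_from_subtopology family_coord)
          moreover have "snd (snd z) s \<in> {0..1}" if "z \<in> topspace ?Y" for z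
            using zz(2)[OF that] sl by (auto simp: inZ_def)
          ultimately show "continuous_map ?Y (top_of_set {0..1}) (\<lambda>z. snd (snd z) s)"
            unfolding continuous_map_in_subtopology by blast
          show "continuous_map ?Y (CubeTop (Suc l)) (\<lambda>z. trY (Suc l) (sh s (fst (snd z))))"
          proof (rule continuous_map_into_CubeTop)
            fix i show "continuous_map ?Y euclideanreal (\<lambda>z. trY (Suc l) (sh s (fst (snd z))) i)"
              unfolding trY_def sh_def
              by (cases "Suc i < Suc l") (auto intro: continuous_map_from_subtopology family_coord)
          next
            fix z assume "z \<in> topspace ?Y"
            from trY_cube[OF zz(2)[OF this]] show "trY (Suc l) (sh s (fst (snd z))) \<in> cube (Suc l)" using sl by simp
          qed
        qed
        from continuous_map_compose[OF this loop_eval]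
        show "continuous_map ?Y (Op (Suc l)) (\<lambda>z. ?b z s (Suc l))" by (simp add: o_def gb_def)
      qed auto
      then have "continuous_map ?Y (Op (Suc M)) (\<lambda>z. bprod (?b z) (\<lambda>i. i \<in> S) 0 0 M)" by simp
      then show "continuous_map ?Y (Op (Suc M)) (\<lambda>z. HG (fst z) (Suc M) (fst (snd z)) (snd (snd z)))"
      proof (rule continuous_map_eq)
        fix z assume zY: "z \<in> topspace ?Y"
        show "bprod (?b z) (\<lambda>i. i \<in> S) 0 0 M = HG (fst z) (Suc M) (fst (snd z)) (snd (snd z))"
          by (rule HG_refine[symmetric, OF zz(1,2)[OF zY]]) (use zz(3,4)[OF zY] in auto)
      qed
    next
      fix z assume z: "z \<in> topspace ?X"
      then have "inZ (Suc M) (fst (snd z)) (snd (snd z))" by auto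
      then show "\<exists>S\<in>Pow {..<M}. ?P S z"
        by (intro bexI[of _ "{i. i < M \<and> 1 \<le> fst (snd z) i}"]) (auto simp: inZ_def)
    qed simp
    then show ?thesis using Suc by simp
  qed
qed

section \<open>From normal strict weaves back to loops\<close>

definition LP :: "(nat \<Rightarrow> (nat \<Rightarrow> real) \<Rightarrow> (nat \<Rightarrow> real) \<Rightarrow> 'a) \<Rightarrow> real \<Rightarrow> nat \<Rightarrow> (nat \<Rightarrow> real) \<Rightarrow> 'a" where
  "LP H r = (if 0 \<le> r \<and> r \<le> 1 then (\<lambda>n x. if x \<in> cube n then H n x (\<lambda>_. r) else undefined) else undefined)"

text \<open>At constant time the gaps are the coordinates of a point of a single cube. Concatenation
  inserts a gap 1, where a strict weave factors, and the right action is
  \<open>weave_ract\<close>.\<close>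

lemma LP_bimod:
  assumes H: "weave H" "strict H" and cont: "\<And>n. continuous_map (top_of_set (Zset n)) (Op n) (\<lambda>z. H n (fst z) (snd z))"
    and r: "0 \<le> r" "r \<le> 1"
  shows "bimod_map Op lact ract (LP H r)"
  unfolding bimod_map_def
proof (intro conjI allI impI)
  have f: "LP H r n x = H n x (\<lambda>_. r)" if "x \<in> cube n" for n x using r that by (simp add: LP_def)
  fix n
  have "continuous_map (CubeTop n) (top_of_set (Zset n)) (\<lambda>x. (x, \<lambda>_. r))"
    by (rule continuous_map_into_Zset)
       (use cube_inZ r in \<open>auto simp: topspace_CubeTop CubeTop_def intro!: continuous_map_from_subtopology continuous_map_product_projection\<close>)
  from continuous_map_compose[OF this cont] have "continuous_map (CubeTop n) (Op n) (\<lambda>x. H n x (\<lambda>_. r))" by (simp add: o_def)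
  then have "continuous_map (CubeTop n) (Op n) (LP H r n)"
    by (rule continuous_map_eq) (simp add: f topspace_CubeTop)
  then show "LP H r n \<in> cmaps (CubeTop n) (Op n)" using r by (simp add: cmaps_def topspace_CubeTop LP_def)
next
  have f: "LP H r n x = H n x (\<lambda>_. r)" if "x \<in> cube n" for n x using r that by (simp add: LP_def)
  have two: "LP H r (m + n) (cube_lact [m, n] [x, y]) = a2 m n (LP H r m x) (LP H r n y)" if xy: "x \<in> cube m" "y \<in> cube n" for m n x y
  proof -
    obtain m' n' where mn: "m = Suc m'" "n = Suc n'" using cube_pos xy by (metis One_nat_def Suc_le_D)
    have c: "cube_lact [m, n] [x, y] \<in> cube (m + n)" using cube_lact_2_cube xy cube_pos by blast
    let ?y = "cube_lact [Suc m', Suc n'] [x, y]"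
    have y: "?y = (\<lambda>i. if Suc i < Suc m' then x i else if Suc i = Suc m' then 1 else y (i - Suc m'))"
      by (rule cube_lact_2) (use xy mn in auto)
    have "H (Suc m' + Suc n') ?y (\<lambda>_. r) = a2 (Suc m') (Suc n') (H (Suc m') ?y (\<lambda>_. r)) (H (Suc n') (sh (Suc m') ?y) (sh (Suc m') (\<lambda>_. r)))"
      using H(2)[unfolded strict_def, rule_format, of m' n' ?y "\<lambda>_. r"] cube_inZ[OF c r] mn y by simp
    also have "H (Suc m') ?y (\<lambda>_. r) = H (Suc m') x (\<lambda>_. r)" by (rule weave_cong[OF H(1)]) (auto simp: y)
    also have "H (Suc n') (sh (Suc m') ?y) (sh (Suc m') (\<lambda>_. r)) = H (Suc n') y (\<lambda>_. r)"
      by (rule weave_cong[OF H(1)]) (auto simp: y sh_def)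
    finally show ?thesis using f[OF c] f[OF xy(1)] f[OF xy(2)] mn by simp
  qed
  have fc: "LP H r n x \<in> topspace (Op n)" if "x \<in> cube n" for n x
    using weave_closed[OF H(1) cube_inZ[OF that r]] f[OF that] by simp
  fix ns xs
  assume a: "ns \<noteq> [] \<and> length xs = length ns \<and> (\<forall>i<length ns. 1 \<le> ns ! i \<and> xs ! i \<in> cube (ns ! i))"
  then show "LP H r (sum_list ns) (cube_lact ns xs) = lact ns (map2 (LP H r) ns xs)"
  proof (induction ns arbitrary: xs)
    case (Cons m ns)
    obtain y ys where xs: "xs = y # ys" using Cons.prems by (cases xs) auto
    have m: "1 \<le> m" "y \<in> cube m"
      using Cons.prems[THEN conjunct2, THEN conjunct2, rule_format, of 0] xs by simp_all
    show ?case
    proof (cases "ns = []")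
      case True
      then show ?thesis using Cons.prems xs m cube_lact_1 lact_single fc by simp
    next
      case False
      have a': "length ys = length ns" "\<And>i. i < length ns \<Longrightarrow> 1 \<le> ns ! i \<and> ys ! i \<in> cube (ns ! i)"
        using Cons.prems[THEN conjunct2, THEN conjunct2, rule_format, of "Suc _"] Cons.prems xs by simp_all
      note c = cube_lact_cube[OF False a']
      have IH: "LP H r (sum_list ns) (cube_lact ns ys) = lact ns (map2 (LP H r) ns ys)"
        by (rule Cons.IH) (use False a' in blast)
      have "LP H r (m + sum_list ns) (cube_lact (m # ns) (y # ys)) = a2 m (sum_list ns) (LP H r m y) (lact ns (map2 (LP H r) ns ys))"
        using c m two[OF m(2), of "cube_lact ns ys" "sum_list ns"] IH by simp
      also have "\<dots> = lact (m # ns) (LP H r m y # map2 (LP H r) ns ys)"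
        by (rule lact_Cons[symmetric]) (use False a' fc m in auto)
      finally show ?thesis using xs by simp
    qed
  qed simp
next
  have f: "LP H r n x = H n x (\<lambda>_. r)" if "x \<in> cube n" for n x using r that by (simp add: LP_def)
  fix ks :: "nat list" and x assume a: "ks \<noteq> [] \<and> (\<forall>k\<in>set ks. 1 \<le> k) \<and> x \<in> cube (length ks)"
  then have pos: "\<And>k. k \<in> set ks \<Longrightarrow> 1 \<le> k" and x: "x \<in> cube (length ks)" by auto
  have e: "cube_ract ks x = trY (sum_list ks) (expY ks x)" by (rule cube_ract_expY) (use a in auto)
  have z: "inZ (sum_list ks) (expY ks x) (expT ks (\<lambda>_. r))" by (rule inZ_exp[OF pos cube_inZ[OF x r]])
  have "0 < sum_list ks" using a by (cases ks) force+
  then obtain N where N: "sum_list ks = Suc N" by (cases "sum_list ks") auto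
  have c: "cube_ract ks x \<in> cube (sum_list ks)"
    using trY_cube[of "Suc N" "expY ks x" "expT ks (\<lambda>_. r)" 0 N] z N e by (simp add: sh_def)
  have "H (sum_list ks) (cube_ract ks x) (\<lambda>_. r) = H (sum_list ks) (expY ks x) (expT ks (\<lambda>_. r))"
    by (rule weave_cong[OF H(1)]) (auto simp: e trY_def expT_const)
  also have "\<dots> = ract ks (H (length ks) x (\<lambda>_. r))"
    by (rule weave_ract[OF H(1) pos cube_inZ[OF x r]])
  finally show "LP H r (sum_list ks) (cube_ract ks x) = ract ks (LP H r (length ks) x)"
    using f[OF c] f[OF x] by simp
qed

text \<open>Strictness yields a bimodule map at every time, normality makes both ends of the loop
  the base point. Continuity is obtained by currying twice.\<close>

lemma continuous_map_LP:
  assumes H: "weave_family A H" and s: "\<And>a. a \<in> topspace A \<Longrightarrow> strict (H a)" and n: "\<And>a. a \<in> topspace A \<Longrightarrow> normal (H a)"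
  shows "continuous_map A (LoopSp Op lact ract eta) (\<lambda>a. LP (H a))"
proof -
  let ?I = "top_of_set {0..1::real}" and ?B = "BimodSp Op lact ract"
  have bm: "bimod_map Op lact ract (LP (H a) r)" if a: "a \<in> topspace A" and r: "0 \<le> r" "r \<le> 1" for a r
  proof (rule LP_bimod[OF weave_family_weave[OF H a] s[OF a] _ r])
    show "continuous_map (top_of_set (Zset n)) (Op n) (\<lambda>z. H a n (fst z) (snd z))" for n
      by (rule weave_family_cont[OF H _ continuous_map_coord]) (use a in auto)
  qed
  have c1: "continuous_map (prod_topology A ?I) ?B (\<lambda>(a, r). LP (H a) r)"
    unfolding BimodSp_def continuous_map_in_subtopology continuous_map_componentwise_UNIV
  proof (intro conjI allI)
    show "(\<lambda>(a, r). LP (H a) r) \<in> topspace (prod_topology A ?I) \<rightarrow> {f. bimod_map Op lact ract f}" using bm by auto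
    fix k
    have "continuous_map (prod_topology A ?I) (compact_open (CubeTop k) (Op k)) (\<lambda>z. LP (H (fst z)) (snd z) k)"
    proof (rule continuous_map_into_compact_open_id)
      fix z assume "z \<in> topspace (prod_topology A ?I)"
      then show "LP (H (fst z)) (snd z) k \<in> cmaps (CubeTop k) (Op k)" using bm by (auto simp: bimod_map_def)
    next
      let ?Y = "prod_topology (prod_topology A ?I) (CubeTop k)"
      have "continuous_map ?Y (Op k) (\<lambda>w. H (fst (fst w)) k (snd w) (\<lambda>_. snd (fst w)))"
      proof (rule weave_family_cont[OF H])
        show "continuous_map ?Y A (\<lambda>w. fst (fst w))" by (rule family_param[OF continuous_map_fst])
        have "continuous_map ?Y (powertop_real UNIV) snd"
          using continuous_map_snd[of "prod_topology A ?I" "CubeTop k"] unfolding CubeTop_def continuous_map_in_subtopology by blast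
        then show "continuous_map ?Y euclideanreal (\<lambda>w. snd w i)" for i
          by (simp add: continuous_map_componentwise_UNIV)
        have "continuous_map (prod_topology A ?I) euclideanreal snd"
          using continuous_map_snd[of A ?I] unfolding continuous_map_in_subtopology by blast
        then show "continuous_map ?Y euclideanreal (\<lambda>w. snd (fst w))" by (rule family_param)
        show "inZ k (snd w) (\<lambda>_. snd (fst w))" if "w \<in> topspace ?Y" for w
          using that cube_inZ by (auto simp: topspace_CubeTop)
      qed
      then show "continuous_map ?Y (Op k) (\<lambda>(z, x). LP (H (fst z)) (snd z) k x)"
        by (rule continuous_map_eq) (auto simp: LP_def topspace_CubeTop)
    qed
    then show "continuous_map (prod_topology A ?I) (compact_open (CubeTop k) (Op k)) (\<lambda>x. (case x of (a, r) \<Rightarrow> LP (H a) r) k)"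
      by (simp add: case_prod_unfold)
  qed
  have "continuous_map A (compact_open ?I ?B) (\<lambda>a. LP (H a))"
  proof (rule continuous_map_into_compact_open_id[OF c1])
    fix a assume a: "a \<in> topspace A"
    have "continuous_map ?I (prod_topology A ?I) (\<lambda>r. (a, r))" by (intro continuous_map_pairedI) (use a in auto)
    from continuous_map_compose[OF this c1] have "continuous_map ?I ?B (LP (H a))" by (simp add: o_def)
    then show "LP (H a) \<in> cmaps ?I ?B" by (auto simp: cmaps_def LP_def)
  qed
  moreover have "LP (H a) 0 = base_map eta \<and> LP (H a) 1 = base_map eta" if a: "a \<in> topspace A" for a
  proof -
    have "H a k x (\<lambda>_. r) = eta k" if "x \<in> cube k" "r = 0 \<or> r = 1" for k x r
    proof -
      have "1 \<le> k" by (rule cube_pos[OF that(1)])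
      then obtain l where k: "k = Suc l" by (cases k) auto
      have z: "inZ (Suc l) x (\<lambda>_. r)" using cube_inZ[OF that(1)] that(2) k by auto
      show ?thesis
        using weave_zeros[OF weave_family_weave[OF H a] n[OF a] z] weave_ones[OF weave_family_weave[OF H a] n[OF a] z] that(2) k by auto
    qed
    then show ?thesis by (auto simp: LP_def base_map_def fun_eq_iff)
  qed
  ultimately show ?thesis unfolding LoopSp_def continuous_map_in_subtopology by auto
qed

lemma LP_HG:
  assumes L: "\<gamma> \<in> topspace (LoopSp Op lact ract eta)"
  shows "LP (HG \<gamma>) = \<gamma>"
proof
  fix r
  have \<gamma>: "is_loop \<gamma>" by (rule loop_is_loop[OF L])
  show "LP (HG \<gamma>) r = \<gamma> r"
  proof (cases "0 \<le> r \<and> r \<le> 1")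
    case True
    have "LP (HG \<gamma>) r n x = \<gamma> r n x" for n x
    proof (cases "x \<in> cube n")
      case x: True
      obtain M where n: "n = Suc M" using cube_pos[OF x] by (cases n) auto
      have "HG \<gamma> (Suc M) x (\<lambda>_. r) = \<gamma> r (Suc M) (trY (Suc M) x)"
        by (rule HG_const[OF \<gamma>]) (use cube_inZ[OF x] True n in auto)
      then show ?thesis using x True n cube_trY[OF x] by (simp add: LP_def)
    next
      case x: False
      have "\<gamma> r n \<in> cmaps (CubeTop n) (Op n)" using \<gamma> True by (auto simp: is_loop_def bimod_map_def)
      then show ?thesis using x True by (simp add: LP_def cmaps_def topspace_CubeTop)
    qed
    then show ?thesis by blast
  next
    case False
    then show ?thesis using L by (auto simp: LP_def LoopSp_def cmaps_def)
  qed
qed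

text \<open>A strict weave factors at all gaps equal to 1, so its product over blocks collapses to
  the uncut value, while inside a block the time is constant, which is all that \<open>LP\<close>
  sees. With \<open>LP_HG\<close> this matches loops and normal strict weaves.\<close>

lemma HG_LP:
  assumes H: "weave H" "normal H" "strict H" and z: "inZ n y t"
  shows "HG (LP H) n y t = H n y t"
proof (cases n)
  case 0
  then show ?thesis using H by (simp add: HG_def normal_def)
next
  case (Suc M)
  have z': "inZ (Suc M) y t" using z Suc by simp
  have tb: "0 \<le> t i \<and> t i \<le> 1" if "i \<le> M" for i using z' that by (auto simp: inZ_def)
  let ?S = "\<lambda>i. 1 \<le> y i"
  have cl: "block_closed (blk H y t) (\<lambda>_. False) M"
    unfolding block_closed_def blk_def
  proof (intro allI impI)
    fix s l assume "s + l \<le> M"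
    then show "H (Suc l) (sh s y) (sh s t) \<in> topspace (Op (Suc l))"
      by (intro weave_closed[OF H(1)] inZ_sh inZ_take[OF z']) auto
  qed
  have cut: "block_cut (blk H y t) (\<lambda>_. False) M m" if m: "1 \<le> y m" "m < M" for m
    unfolding block_cut_def blk_def
  proof (intro allI impI)
    fix s l l' assume sl: "s + l = m" "Suc (m + l') \<le> M"
    have "y m = 1" using z' m by (force simp: inZ_def)
    moreover have "inZ (Suc l + Suc l') (sh s y) (sh s t)"
      by (intro inZ_sh inZ_take[OF z']) (use sl in auto)
    moreover have "sh (Suc l) (sh s f) = sh (Suc m) f" for f using sl by (simp add: sh_def add.assoc[symmetric])
    moreover have "sh s y l = 1" using \<open>y m = 1\<close> sl by (simp add: sh_def)
    ultimately show "H (Suc (Suc (l + l'))) (sh s y) (sh s t) =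
       a2 (Suc l) (Suc l') (H (Suc l) (sh s y) (sh s t)) (H (Suc l') (sh (Suc m) y) (sh (Suc m) t))"
      using H(3)[unfolded strict_def, rule_format, of l l' "sh s y" "sh s t"] by simp
  qed
  have "HG (LP H) (Suc M) y t = bprod (blk H y t) ?S 0 0 M"
    unfolding HG_def nat.case
  proof (rule bprod_cong[where M = M])
    fix s l assume sl: "s + l \<le> M" "uncut ?S s l"
    have c: "trY (Suc l) (sh s y) \<in> cube (Suc l)" using trY_cube[OF z'] sl by simp
    have "gb (LP H) y t s (Suc l) = H (Suc l) (trY (Suc l) (sh s y)) (\<lambda>_. t s)"
      using c tb[of s] sl by (simp add: gb_def LP_def)
    also have "\<dots> = blk H y t s (Suc l)"
      unfolding blk_def
    proof (rule weave_cong[OF H(1)])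
      fix i assume "i < Suc l"
      then show "t s = sh s t i"
        using uncut_const[of M ?S t s l i] inZ_gap_const[OF z'] sl by (simp add: sh_def)
    qed (simp add: trY_def)
    finally show "gb (LP H) y t s (Suc l) = blk H y t s (Suc l)" .
  qed auto
  also have "\<dots> = bprod (blk H y t) (\<lambda>_. False) 0 0 M"
    by (rule bprod_refine[symmetric, OF cl]) (use cut in auto)
  also have "\<dots> = blk H y t 0 (Suc (0 + M))" by (rule bprod_uncut) (simp add: uncut_def)
  finally show ?thesis using Suc by (simp add: blk_def sh_def)
qed

section \<open>The map xi in flat coordinates\<close>

lemma xi_flat:
  assumes \<gamma>: "is_loop \<gamma>"
  shows "wb_valid n (ns, X, T) \<Longrightarrow> ns \<noteq> [] \<Longrightarrow>
    lact ns (map (\<lambda>i. \<gamma> (T i) (ns ! i) (X i)) [0..<length ns]) = HG \<gamma> n (flY (ns, X, T)) (flT (ns, X, T))"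
proof (induction ns arbitrary: n X T)
  case (Cons m ns)
  define X' where "X' = (\<lambda>j. X (Suc j))"
  define T' where "T' = (\<lambda>j. T (Suc j))"
  let ?p = "(ns, X', T')"
  have "case_nat (X 0) X' = X" "case_nat (T 0) T' = T"
    by (auto simp: fun_eq_iff X'_def T'_def split: nat.split)
  then have p: "(m # ns, X, T) = wcons m (X 0) (T 0) ?p" by (simp add: wcons_def)
  note v = Cons.prems(1)[unfolded p valid_wcons]
  have mp: "map (\<lambda>i. \<gamma> (T i) ((m # ns) ! i) (X i)) [0..<length (m # ns)] =
      \<gamma> (T 0) m (X 0) # map (\<lambda>i. \<gamma> (T' i) (ns ! i) (X' i)) [0..<length ns]"
    by (simp add: map_upt_Suc X'_def T'_def del: upt_Suc)
  have z: "inZ n (flY (wcons m (X 0) (T 0) ?p)) (flT (wcons m (X 0) (T 0) ?p))"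
    using flat_inZ Cons.prems(1) p by metis
  obtain M where m: "m = Suc M" using v by (cases m) auto
  have zm: "inZ (Suc M) (flY (wcons m (X 0) (T 0) ?p)) (flT (wcons m (X 0) (T 0) ?p))"
    using inZ_take[OF z] v m by simp
  \<comment> \<open>The first factor has a single time, so its share of \<open>HG\<close> is the
    loop at that time on the coordinates of its cube.\<close>
  have hd: "HG \<gamma> m (flY (wcons m (X 0) (T 0) ?p)) (flT (wcons m (X 0) (T 0) ?p)) = \<gamma> (T 0) m (X 0)"
  proof -
    have "trY m (flY (wcons m (X 0) (T 0) ?p)) = trY m (X 0)"
      by (auto simp: trY_def flY_wcons)
    also have "\<dots> = X 0" using cube_trY v by blast
    finally have tr: "trY m (flY (wcons m (X 0) (T 0) ?p)) = X 0" .
    have "HG \<gamma> (Suc M) (flY (wcons m (X 0) (T 0) ?p)) (flT (wcons m (X 0) (T 0) ?p)) =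
        \<gamma> (T 0) (Suc M) (trY (Suc M) (flY (wcons m (X 0) (T 0) ?p)))"
      by (rule HG_const[OF \<gamma> zm]) (simp add: flT_wcons m)
    then show ?thesis using tr unfolding m[symmetric] by simp
  qed
  have hdc: "\<gamma> (T 0) m (X 0) \<in> topspace (Op m)" using loop_closed[OF \<gamma>] v by blast
  show ?case
  proof (cases "ns = []")
    case True
    then have "n = m" using v by (simp add: valid_Nil)
    then show ?thesis unfolding mp p using True hd hdc lact_single by simp
  next
    case False
    have IH: "lact ns (map (\<lambda>i. \<gamma> (T' i) (ns ! i) (X' i)) [0..<length ns]) = HG \<gamma> (n - m) (flY ?p) (flT ?p)"
      by (rule Cons.IH) (use v False in auto)
    have vp: "wb_valid (n - m) ?p" using v by simp
    have sum: "sum_list ns = n - m" "\<And>i. i < length ns \<Longrightarrow> X' i \<in> cube (ns ! i) \<and> 0 \<le> T' i \<and> T' i \<le> 1"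
      using vp by (auto simp: wb_valid_def)
    have "lact (m # ns) (\<gamma> (T 0) m (X 0) # map (\<lambda>i. \<gamma> (T' i) (ns ! i) (X' i)) [0..<length ns]) =
        a2 m (n - m) (\<gamma> (T 0) m (X 0)) (HG \<gamma> (n - m) (flY ?p) (flT ?p))"
    proof -
      have "lact (m # ns) (\<gamma> (T 0) m (X 0) # map (\<lambda>i. \<gamma> (T' i) (ns ! i) (X' i)) [0..<length ns]) =
          a2 m (sum_list ns) (\<gamma> (T 0) m (X 0)) (lact ns (map (\<lambda>i. \<gamma> (T' i) (ns ! i) (X' i)) [0..<length ns]))"
        by (rule lact_Cons) (use False hdc sum(2) loop_closed[OF \<gamma>] in auto)
      then show ?thesis unfolding IH sum(1) .
    qed
    moreover have "0 < n - m" using False vp by (cases ns) (auto simp: wb_valid_def)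
    then obtain k where k: "n - m = Suc k" by (cases "n - m") auto
    have zn: "inZ (Suc (M + Suc k)) (flY (wcons m (X 0) (T 0) ?p)) (flT (wcons m (X 0) (T 0) ?p))"
      using z m k v by (metis add_Suc add_Suc_right le_add_diff_inverse)
    \<comment> \<open>Flattening places gap 1 after the first factor, which permits the split
      there.\<close>
    have "HG \<gamma> (Suc (M + Suc k)) (flY (wcons m (X 0) (T 0) ?p)) (flT (wcons m (X 0) (T 0) ?p)) =
      a2 (Suc M) (Suc k) (HG \<gamma> (Suc M) (flY (wcons m (X 0) (T 0) ?p)) (flT (wcons m (X 0) (T 0) ?p)))
        (HG \<gamma> (Suc k) (sh (Suc M) (flY (wcons m (X 0) (T 0) ?p))) (sh (Suc M) (flT (wcons m (X 0) (T 0) ?p))))"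
      by (rule HG_split[OF \<gamma> zn refl]) (simp add: flY_wcons m)
    moreover have "sh (Suc M) (flY (wcons m (X 0) (T 0) ?p)) = flY ?p" "sh (Suc M) (flT (wcons m (X 0) (T 0) ?p)) = flT ?p"
      by (auto simp: sh_def flY_wcons flT_wcons m)
    moreover have "Suc (M + Suc k) = n" using m k v by linarith
    ultimately show ?thesis unfolding mp p using hd m k by simp
  qed
qed simp

text \<open>Both sides evaluate at the same chosen representative of a class, so the comparison
  reduces to \<open>xi_flat\<close>.\<close>

lemma xi_map_eq:
  assumes L: "\<gamma> \<in> topspace (LoopSp Op lact ract eta)"
  shows "xi_map lact eta \<gamma> = realize (HG \<gamma>)"
proof (intro ext)
  fix n c
  have \<gamma>: "is_loop \<gamma>" by (rule loop_is_loop[OF L])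
  show "xi_map lact eta \<gamma> n c = realize (HG \<gamma>) n c"
  proof (cases "c \<in> topspace (WbQ n)")
    case True
    obtain ns X T where p: "(SOME p. p \<in> c) = (ns, X, T)" by (cases "SOME p. p \<in> c")
    have v: "wb_valid n (ns, X, T)" using class_rep(1)[OF True] p by simp
    show ?thesis
    proof (cases "ns = []")
      case ns: True
      then have "n = 0" using v by (simp add: valid_Nil)
      then show ?thesis using True p ns by (simp add: xi_map_def realize_def HG_def)
    next
      case False
      then show ?thesis using True p xi_flat[OF \<gamma> v] by (simp add: xi_map_def realize_def)
    qed
  qed (simp add: xi_map_def realize_def)
qed

lemma realize_cong:
  assumes "\<And>n y t. inZ n y t \<Longrightarrow> H n y t = H' n y t"
  shows "realize H = realize H'"
proof (intro ext)
  fix n c show "realize H n c = realize H' n c"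
    using assms[OF flat_inZ[OF class_rep(1)[of c n]]] by (simp add: realize_def)
qed

lemma LP_cong:
  assumes "\<And>n y t. inZ n y t \<Longrightarrow> H n y t = H' n y t"
  shows "LP H = LP H'"
  using assms cube_inZ by (auto simp: LP_def fun_eq_iff)

text \<open>Lets the path that contracts to the units be exchanged for one that agrees with it only
  on \<open>[0, 1]\<close>.\<close>

lemma renorm_cong: "(\<And>r. 0 \<le> r \<Longrightarrow> r \<le> s \<Longrightarrow> c r = c' r) \<Longrightarrow> renorm s c H = renorm s c' H"
  using dd_nonneg by (auto simp: renorm_def fun_eq_iff)

text \<open>\<open>renorm\<close> at \<open>s = 0\<close> returns the weave only on legal
  configurations; by \<open>block_inZ\<close> \<open>pushed\<close> evaluates no others.\<close>

lemma pushed_cong_weave: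
  assumes ok: "push_ok \<alpha> \<beta> a H" and eq: "\<And>n y t. inZ n y t \<Longrightarrow> H n y t = H' n y t" and z: "inZ n x t"
  shows "pushed \<alpha> \<beta> a H n x t = pushed \<alpha> \<beta> a H' n x t"
proof (cases n)
  case (Suc M)
  interpret push_params \<alpha> \<beta> a n x t using push_ok_params[OF ok z] .
  have "bprod (blk H (gp \<alpha> x) (sg \<alpha> \<beta> a n x t)) (\<lambda>i. 2 \<le> \<alpha> * x i) 0 0 M =
      bprod (blk H' (gp \<alpha> x) (sg \<alpha> \<beta> a n x t)) (\<lambda>i. 2 \<le> \<alpha> * x i) 0 0 M"
  proof (rule bprod_cong[where M = M])
    fix s l assume sl: "s + l \<le> M" "uncut (\<lambda>i. 2 \<le> \<alpha> * x i) s l"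
    show "blk H (gp \<alpha> x) (sg \<alpha> \<beta> a n x t) s (Suc l) = blk H' (gp \<alpha> x) (sg \<alpha> \<beta> a n x t) s (Suc l)"
      unfolding blk_def by (rule eq[OF block_inZ]) (use sl Suc in \<open>auto simp: uncut_def\<close>)
  qed auto
  then show ?thesis using Suc by (simp add: pushed_def)
qed (simp add: pushed_def)

section \<open>The map xi and its homotopy inverse\<close>

lemma xi_continuous: "continuous_map (LoopSp Op lact ract eta) (WbimodSp Op lact ract eta) (xi_map lact eta)"
  by (rule continuous_map_eq[OF continuous_map_realize[OF weave_family_HG]]) (simp add: xi_map_eq)

lemma unreal_xi:
  assumes "\<gamma> \<in> topspace (LoopSp Op lact ract eta)" "inZ n y t"
  shows "unreal (xi_map lact eta \<gamma>) n y t = HG \<gamma> n y t"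
  using assms xi_map_eq unreal_realize[OF weave_HG[OF loop_is_loop]] by simp

lemma normal_unreal_xi:
  assumes "\<gamma> \<in> topspace (LoopSp Op lact ract eta)"
  shows "normal (unreal (xi_map lact eta \<gamma>))"
  using unreal_xi[OF assms, of 0] by (simp add: normal_def inZ_def HG_def)

lemma strict_unreal_xi:
  assumes \<gamma>: "\<gamma> \<in> topspace (LoopSp Op lact ract eta)"
  shows "strict (unreal (xi_map lact eta \<gamma>))"
  unfolding strict_def
proof (intro allI impI)
  fix m n y t assume z: "inZ (Suc m + Suc n) y t" and y: "y m = 1"
  have "inZ (Suc m) y t" "inZ (Suc n) (sh (Suc m) y) (sh (Suc m) t)" using inZ_take[OF z] inZ_sh[OF z] by auto
  then show "unreal (xi_map lact eta \<gamma>) (Suc m + Suc n) y t = a2 (Suc m) (Suc n) (unreal (xi_map lact eta \<gamma>) (Suc m) y t)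
      (unreal (xi_map lact eta \<gamma>) (Suc n) (sh (Suc m) y) (sh (Suc m) t))"
    using unreal_xi[OF \<gamma>] z y strict_HG[OF loop_is_loop[OF \<gamma>], unfolded strict_def] by simp
qed

lemma LP_unreal_xi:
  assumes "\<gamma> \<in> topspace (LoopSp Op lact ract eta)"
  shows "LP (unreal (xi_map lact eta \<gamma>)) = \<gamma>"
  using LP_cong[of "unreal (xi_map lact eta \<gamma>)" "HG \<gamma>"] unreal_xi[OF assms] LP_HG[OF assms] by simp

text \<open>The inverse \<open>g\<close> normalises by \<open>N 1\<close>, makes the result strict
  by \<open>pushed 3 2 0\<close> and restricts it to constant times. On weak bimodule maps
  \<open>W1\<close> and \<open>W2\<close> follow these stages. On loops every intermediate family
  must be normal and strict, as \<open>LP\<close> gives loops only for these; hence the different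
  route through \<open>L1\<close>, \<open>L2\<close> and \<open>L3\<close>.\<close>

theorem xi_homotopy_equivalence:
  assumes "contractible_space (Op 0)"
  shows "homotopy_equivalence_map (LoopSp Op lact ract eta) (WbimodSp Op lact ract eta) (xi_map lact eta)"
proof -
  let ?L = "LoopSp Op lact ract eta" and ?W = "WbimodSp Op lact ract eta" and ?I = "top_of_set {0..1::real}"
  let ?xi = "xi_map lact eta"
  obtain a0 where "homotopic_with (\<lambda>_. True) (Op 0) (Op 0) id (\<lambda>_. a0)"
    using assms unfolding contractible_space_def by blast
  then obtain C where Cc: "continuous_map (prod_topology ?I (Op 0)) (Op 0) C"
    and C0: "\<And>x. C (0, x) = x" and C1: "\<And>x. C (1, x) = a0"
    unfolding homotopic_with_def by auto
  have CC: "continuous_map Y (Op 0) (\<lambda>z. C (r z, f z))"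
    if "continuous_map Y ?I r" "continuous_map Y (Op 0) f" for Y :: "'c topology" and r f
    using continuous_map_compose[OF continuous_map_pairedI[OF that] Cc] by (simp add: o_def)
  \<comment> \<open>Out to \<open>a0\<close> along the contraction and back along the track of
    \<open>eta 0\<close>: a path from \<open>x\<close> to \<open>eta 0\<close> that depends
    continuously on \<open>x\<close>.\<close>
  define P where "P x r = (if r \<le> 1 / 2 then C (2 * r, x) else C (2 - 2 * r, eta 0))" for x r
  have P0: "P x 0 = x" "P x 1 = eta 0" for x by (auto simp: P_def C0)
  have Pc: "continuous_map (prod_topology (Op 0) ?I) (Op 0) (\<lambda>z. P (fst z) (snd z))"
    unfolding P_def
  proof (rule continuous_map_cases_le)
    let ?X = "prod_topology (Op 0) ?I"
    have s: "continuous_map ?X euclideanreal snd"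
      using continuous_map_snd[of "Op 0" ?I] unfolding continuous_map_in_subtopology by blast
    then show "continuous_map ?X euclideanreal (\<lambda>z. snd z)" .
    show "continuous_map ?X euclideanreal (\<lambda>z. 1 / 2)" by simp
    have "continuous_map (subtopology ?X {z \<in> topspace ?X. snd z \<le> 1 / 2}) euclideanreal (\<lambda>z. 2 * snd z)"
      by (intro continuous_map_from_subtopology continuous_intros s) simp
    then have r1: "continuous_map (subtopology ?X {z \<in> topspace ?X. snd z \<le> 1 / 2}) ?I (\<lambda>z. 2 * snd z)"
      by (auto simp: continuous_map_in_subtopology)
    show "continuous_map (subtopology ?X {z \<in> topspace ?X. snd z \<le> 1 / 2}) (Op 0) (\<lambda>z. C (2 * snd z, fst z))"
      by (intro CC r1 continuous_map_from_subtopology continuous_map_fst)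
    have "continuous_map (subtopology ?X {z \<in> topspace ?X. 1 / 2 \<le> snd z}) euclideanreal (\<lambda>z. 2 - 2 * snd z)"
      by (intro continuous_map_from_subtopology continuous_intros s) simp_all
    then have r2: "continuous_map (subtopology ?X {z \<in> topspace ?X. 1 / 2 \<le> snd z}) ?I (\<lambda>z. 2 - 2 * snd z)"
      by (auto simp: continuous_map_in_subtopology)
    show "continuous_map (subtopology ?X {z \<in> topspace ?X. 1 / 2 \<le> snd z}) (Op 0) (\<lambda>z. C (2 - 2 * snd z, eta 0))"
      by (intro CC r2) simp
    show "C (2 * snd z, fst z) = C (2 - 2 * snd z, eta 0)" if "snd z = 1 / 2" for z :: "'a \<times> real"
    proof -
      have "2 * snd z = 1" "2 - 2 * snd z = 1"
        using that by auto
      then show ?thesis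
        by (simp only: C1)
    qed
  qed
  define h0 where "h0 h = unreal h 0 (\<lambda>_. 0) (\<lambda>_. 0)" for h
  have h0c: "continuous_map ?W (Op 0) h0"
    unfolding h0_def
    using weave_family_cont[OF weave_family_unreal continuous_map_id[unfolded id_def], of "\<lambda>_ _. 0" "\<lambda>_ _. 0" 0]
    by (simp add: inZ_def)
  define N where "N s h = renorm s (P (h0 h)) (unreal h)" for s h
  have Nfam: "weave_family (prod_topology ?I ?W) (\<lambda>z. N (fst z) (snd z))"
    unfolding N_def
  proof (rule weave_family_renorm[OF weave_family_compose[OF weave_family_unreal continuous_map_snd] continuous_map_fst])
    have "continuous_map (prod_topology (prod_topology ?I ?W) ?I) (prod_topology (Op 0) ?I) (\<lambda>z. (h0 (snd (fst z)), snd z))"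
      using continuous_map_compose[OF continuous_map_snd h0c]
      by (intro continuous_map_pairedI continuous_map_snd family_param) (simp add: o_def)
    from continuous_map_compose[OF this Pc]
    show "continuous_map (prod_topology (prod_topology ?I ?W) ?I) (Op 0) (\<lambda>z. P (h0 (snd (fst z))) (snd z))"
      by (simp add: o_def)
  qed (simp add: P0 h0_def)
  have N1fam: "weave_family ?W (N 1)"
    using weave_family_compose[OF Nfam, of ?W "\<lambda>h. (1, h)"] by (simp add: continuous_map_pairedI)
  have Nn: "normal (N 1 h)" for h
    unfolding N_def by (rule normal_renorm) (simp_all add: P0)
  have ok: "push_ok \<alpha> \<beta> 0 (N 1 h)"
    if "h \<in> topspace ?W" "1 \<le> \<alpha>" "\<alpha> \<le> 3" "1 \<le> \<beta>" "\<beta> \<le> 2" "2 \<le> \<alpha> \<longrightarrow> \<beta> = 2" for h \<alpha> \<beta>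
    using that weave_family_weave[OF N1fam] Nn by (simp add: push_ok_def)
  have vc: "continuous_map (prod_topology ?I Y) euclideanreal fst" for Y :: "'c topology"
    using continuous_map_fst[of ?I Y] unfolding continuous_map_in_subtopology by blast
  define g where "g h = LP (pushed 3 2 0 (N 1 h))" for h
  have K1fam: "weave_family ?W (\<lambda>h. pushed 3 2 0 (N 1 h))"
    by (rule weave_family_pushed[OF N1fam]) (use ok in auto)
  have gc: "continuous_map ?W ?L g"
    unfolding g_def
    by (rule continuous_map_LP[OF K1fam]) (use strict_pushed ok normal_pushed in auto)
  have xig: "?xi (g h) = realize (pushed 3 2 0 (N 1 h))" if h: "h \<in> topspace ?W" for h
  proof -
    have gh: "g h \<in> topspace ?L" using gc h by (auto simp: continuous_map_def)
    have w: "weave (pushed 3 2 0 (N 1 h))" "strict (pushed 3 2 0 (N 1 h))"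
      using weave_family_weave[OF K1fam h] strict_pushed ok[OF h] by auto
    have "realize (HG (g h)) = realize (pushed 3 2 0 (N 1 h))"
      by (rule realize_cong) (simp add: g_def HG_LP[OF w(1) normal_pushed w(2)])
    then show ?thesis using xi_map_eq[OF gh] by simp
  qed
  have W1: "homotopic_with (\<lambda>_. True) ?W ?W id (\<lambda>h. realize (N 1 h))"
  proof (rule homotopic_withI_True[where h = "\<lambda>s h. realize (N s h)"])
    show "continuous_map (prod_topology ?I ?W) ?W (\<lambda>(s, h). realize (N s h))"
      using continuous_map_realize[OF Nfam] by (simp add: case_prod_unfold)
    fix h assume h: "h \<in> topspace ?W"
    have w: "wbimod_map Op lact ract eta h" using h by (simp add: topspace_WbimodSp)
    have "realize (N 0 h) = realize (unreal h)"
      by (rule realize_cong) (simp add: N_def renorm_0[OF weave_unreal[OF w]] P0 h0_def)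
    then show "realize (N 0 h) = id h" using realize_unreal[OF w] by simp
  qed simp
  \<comment> \<open>As \<open>v\<close> grows, \<open>\<alpha>\<close> runs from 1 to 3. At
    \<open>v = 1 / 2\<close> it reaches 2 and cuts become possible; \<open>\<beta>\<close> has
    reached 2 at that very moment.\<close>
  have W2: "homotopic_with (\<lambda>_. True) ?W ?W (\<lambda>h. realize (N 1 h)) (?xi \<circ> g)"
  proof (rule homotopic_withI_True[where h = "\<lambda>v h. realize (pushed (1 + 2 * v) (1 + min 1 (2 * v)) 0 (N 1 h))"])
    have "weave_family (prod_topology ?I ?W) (\<lambda>z. pushed (1 + 2 * fst z) (1 + min 1 (2 * fst z)) 0 (N 1 (snd z)))"
    proof (rule weave_family_pushed[OF weave_family_compose[OF N1fam continuous_map_snd]])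
      show "continuous_map (prod_topology ?I ?W) euclideanreal (\<lambda>z. 1 + 2 * fst z)"
        "continuous_map (prod_topology ?I ?W) euclideanreal (\<lambda>z. 1 + min 1 (2 * fst z))"
        by (intro continuous_intros vc; simp)+
      fix z assume "z \<in> topspace (prod_topology ?I ?W)"
      then show "push_ok (1 + 2 * fst z) (1 + min 1 (2 * fst z)) 0 (N 1 (snd z))"
        by (intro ok) (auto simp: min_def)
    qed simp
    from continuous_map_realize[OF this]
    show "continuous_map (prod_topology ?I ?W) ?W (\<lambda>(v, h). realize (pushed (1 + 2 * v) (1 + min 1 (2 * v)) 0 (N 1 h)))"
      by (simp add: case_prod_unfold)
    fix h assume h: "h \<in> topspace ?W"
    show "realize (pushed (1 + 2 * 0) (1 + min 1 (2 * 0)) 0 (N 1 h)) = realize (N 1 h)"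
      by (rule realize_cong) (simp add: pushed_trivial[OF weave_family_weave[OF N1fam h] Nn])
    show "realize (pushed (1 + 2 * 1) (1 + min 1 (2 * 1)) 0 (N 1 h)) = (?xi \<circ> g) h"
      using xig[OF h] by simp
  qed
  \<comment> \<open>For a weave that is normal already, \<open>P\<close> follows the track of
    \<open>eta 0\<close> to \<open>a0\<close> and returns. \<open>Q s\<close> goes only as far as
    parameter \<open>s\<close> of that track and is back at \<open>eta 0\<close> at time
    \<open>s\<close>, so every stage is normal; \<open>Q 1\<close> is the path
    \<open>P\<close>.\<close>
  define Q where "Q s r = C (max 0 (min (2 * r) (2 * s - 2 * r)), eta 0)" for s r
  define H where "H \<gamma> = unreal (?xi \<gamma>)" for \<gamma>
  have Hfam: "weave_family ?L H"
    unfolding H_def by (rule weave_family_compose[OF weave_family_unreal xi_continuous])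
  have Hn: "normal (H \<gamma>)" "strict (H \<gamma>)" "weave (H \<gamma>)" if "\<gamma> \<in> topspace ?L" for \<gamma>
    using normal_unreal_xi[OF that] strict_unreal_xi[OF that] weave_family_weave[OF Hfam that] by (auto simp: H_def)
  have Q0: "Q s 0 = eta 0" "Q s s = eta 0" if "0 \<le> s" for s using that by (auto simp: Q_def C0)
  have Qfam: "weave_family (prod_topology ?I ?L) (\<lambda>z. renorm (fst z) (Q (fst z)) (H (snd z)))"
  proof (rule weave_family_renorm[OF weave_family_compose[OF Hfam continuous_map_snd] continuous_map_fst])
    let ?X = "prod_topology (prod_topology ?I ?L) ?I"
    have s: "continuous_map ?X euclideanreal (\<lambda>z. fst (fst z))" by (rule family_param[OF vc])
    have r: "continuous_map ?X euclideanreal snd"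
      using continuous_map_snd[of "prod_topology ?I ?L" ?I] unfolding continuous_map_in_subtopology by blast
    have "continuous_map ?X euclideanreal (\<lambda>z. max 0 (min (2 * snd z) (2 * fst (fst z) - 2 * snd z)))"
      by (intro continuous_intros s r) simp_all
    then have "continuous_map ?X ?I (\<lambda>z. max 0 (min (2 * snd z) (2 * fst (fst z) - 2 * snd z)))"
      by (auto simp: continuous_map_in_subtopology min_def max_def)
    then show "continuous_map ?X (Op 0) (\<lambda>z. Q (fst (fst z)) (snd z))"
      unfolding Q_def by (rule CC) simp
  next
    fix z assume "z \<in> topspace (prod_topology ?I ?L)"
    then show "Q (fst z) 0 = H (snd z) 0 (\<lambda>_. 0) (\<lambda>_. 0)" using Hn(1)[of "snd z"] Q0 by (auto simp: normal_def)
  qed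
  have Qok: "push_ok 3 2 0 (renorm s (Q s) (H \<gamma>))" if "0 \<le> s" "s \<le> 1" "\<gamma> \<in> topspace ?L" for s \<gamma>
    using weave_family_weave[OF Qfam, of "(s, \<gamma>)"] that normal_renorm[of s "Q s" "H \<gamma>"] Q0 by (simp add: push_ok_def)
  \<comment> \<open>\<open>renorm\<close> need not preserve strictness, so
    \<open>pushed 3 2 0\<close> is applied at every stage to restore it.\<close>
  have L1: "homotopic_with (\<lambda>_. True) ?L ?L (\<lambda>\<gamma>. LP (pushed 3 2 0 (H \<gamma>))) (g \<circ> ?xi)"
  proof (rule homotopic_withI_True[where h = "\<lambda>s \<gamma>. LP (pushed 3 2 0 (renorm s (Q s) (H \<gamma>)))"])
    have "weave_family (prod_topology ?I ?L) (\<lambda>z. pushed 3 2 0 (renorm (fst z) (Q (fst z)) (H (snd z))))"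
      by (rule weave_family_pushed[OF Qfam]) (use Qok in auto)
    from continuous_map_LP[OF this]
    show "continuous_map (prod_topology ?I ?L) ?L (\<lambda>(s, \<gamma>). LP (pushed 3 2 0 (renorm s (Q s) (H \<gamma>))))"
      by (simp add: case_prod_unfold strict_pushed[OF Qok] normal_pushed mem_Times_iff)
    fix \<gamma> assume \<gamma>: "\<gamma> \<in> topspace ?L"
    have eq: "renorm 0 (Q 0) (H \<gamma>) n y t = H \<gamma> n y t" if "inZ n y t" for n y t
      by (rule renorm_0[OF Hn(3)[OF \<gamma>] _ that]) (use Hn(1)[OF \<gamma>] Q0 in \<open>simp add: normal_def\<close>)
    show "LP (pushed 3 2 0 (renorm 0 (Q 0) (H \<gamma>))) = LP (pushed 3 2 0 (H \<gamma>))"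
      by (rule LP_cong, rule pushed_cong_weave[OF Qok eq]) (use \<gamma> in auto)
    have "renorm 1 (Q 1) (H \<gamma>) = N 1 (?xi \<gamma>)"
      unfolding N_def H_def[symmetric]
    proof (rule renorm_cong)
      fix r :: real assume r: "0 \<le> r" "r \<le> 1"
      have "h0 (?xi \<gamma>) = eta 0" using Hn(1)[OF \<gamma>] by (simp add: h0_def H_def normal_def)
      then show "Q 1 r = P (h0 (?xi \<gamma>)) r" using r by (auto simp: Q_def P_def min_def max_def)
    qed
    then show "LP (pushed 3 2 0 (renorm 1 (Q 1) (H \<gamma>))) = (g \<circ> ?xi) \<gamma>" by (simp add: g_def)
  qed
  have aok: "push_ok 3 2 a (H \<gamma>)" if "0 \<le> a" "a \<le> 1" "\<gamma> \<in> topspace ?L" for a \<gamma>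
    using that Hn[OF that(3)] by (simp add: push_ok_def)
  \<comment> \<open>The weave is strict here, so cuts are legitimate for every \<open>a\<close>. The
    pushed times return to the given ones, and at \<open>a = 1\<close> only the stretching by 3 is
    left.\<close>
  have L2: "homotopic_with (\<lambda>_. True) ?L ?L (\<lambda>\<gamma>. LP (pushed 3 2 0 (H \<gamma>))) (\<lambda>\<gamma>. LP (stretch 3 (H \<gamma>)))"
  proof (rule homotopic_withI_True[where h = "\<lambda>a \<gamma>. LP (pushed 3 2 a (H \<gamma>))"])
    have "weave_family (prod_topology ?I ?L) (\<lambda>z. pushed 3 2 (fst z) (H (snd z)))"
      by (rule weave_family_pushed[OF weave_family_compose[OF Hfam continuous_map_snd] _ _ vc]) (use aok in auto)
    from continuous_map_LP[OF this]
    show "continuous_map (prod_topology ?I ?L) ?L (\<lambda>(a, \<gamma>). LP (pushed 3 2 a (H \<gamma>)))"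
      by (simp add: case_prod_unfold strict_pushed[OF aok] normal_pushed mem_Times_iff)
    fix \<gamma> assume \<gamma>: "\<gamma> \<in> topspace ?L"
    show "LP (pushed 3 2 1 (H \<gamma>)) = LP (stretch 3 (H \<gamma>))"
      by (rule LP_cong) (simp add: pushed_end[OF Hn(3,1,2)[OF \<gamma>]] stretch_def)
  qed simp
  have L3: "homotopic_with (\<lambda>_. True) ?L ?L id (\<lambda>\<gamma>. LP (stretch 3 (H \<gamma>)))"
  proof (rule homotopic_withI_True[where h = "\<lambda>v \<gamma>. LP (stretch (1 + 2 * v) (H \<gamma>))"])
    have "weave_family (prod_topology ?I ?L) (\<lambda>z. stretch (1 + 2 * fst z) (H (snd z)))"
    proof (rule weave_family_stretch[OF weave_family_compose[OF Hfam continuous_map_snd]])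
      show "continuous_map (prod_topology ?I ?L) euclideanreal (\<lambda>z. 1 + 2 * fst z)" by (intro continuous_intros vc; simp)
    qed auto
    from continuous_map_LP[OF this]
    show "continuous_map (prod_topology ?I ?L) ?L (\<lambda>(v, \<gamma>). LP (stretch (1 + 2 * v) (H \<gamma>)))"
      by (simp add: case_prod_unfold strict_stretch normal_stretch Hn mem_Times_iff)
    fix \<gamma> assume \<gamma>: "\<gamma> \<in> topspace ?L"
    have "LP (stretch 1 (H \<gamma>)) = LP (H \<gamma>)" by (rule LP_cong) (rule stretch_1[OF Hn(3)[OF \<gamma>]])
    then show "LP (stretch (1 + 2 * 0) (H \<gamma>)) = id \<gamma>" using LP_unreal_xi[OF \<gamma>] by (simp add: H_def)
  qed simp
  have "homotopic_with (\<lambda>_. True) ?L ?L (g \<circ> ?xi) id"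
    using L1 L2 L3 homotopic_with_symD homotopic_with_trans by blast
  moreover have "homotopic_with (\<lambda>_. True) ?W ?W (?xi \<circ> g) id"
    using W1 W2 homotopic_with_symD homotopic_with_trans by blast
  ultimately show ?thesis
    unfolding homotopy_equivalence_map_def using xi_continuous gc by blast
qed

end

theorem theorem6p2:
  fixes Op :: "nat \<Rightarrow> 'a topology"
    and lact :: "nat list \<Rightarrow> 'a list \<Rightarrow> 'a"
    and ract :: "nat list \<Rightarrow> 'a \<Rightarrow> 'a"
    and eta :: "nat \<Rightarrow> 'a"
  assumes "assoc_bimodule Op lact ract"
    and "contractible_space (Op 0)"
    and "assoc_bimodule_map_from_Assoc Op lact ract eta"
  shows "homotopy_equivalence_map (LoopSp Op lact ract eta) (WbimodSp Op lact ract eta) (xi_map lact eta)"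
proof -
  interpret assoc_bimod Op lact ract eta
    by unfold_locales (use assms in auto)
  show ?thesis by (rule xi_homotopy_equivalence[OF assms(2)])
qed

end
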